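(* Let $A=\mathbb{C}Q/\mathcal{I}$ be a finite-dimensional complex bound quiver algebra with fixed basis $\{a_1,\dots,a_d\}$, $d=\dim_{\mathbb{C}} A$, and let $M$ be a finite-dimensional left $A$-module with a fixed $\mathbb{C}$-basis. (1) $M$ is projective if and only if there are non-negative integers $m_v$ ($v\in Q_0$) with $\sum_{v\in Q_0}m_v\dim_{\mathbb{C}}P(v)=\dim_{\mathbb{C}}M$ such that \[ \int_{I_A(t)}M\ \sim\ \frac{\prod_{i=1}^dt_i}{2}\cdot\bigoplus_{v\in Q_0}\Big(\sum_{i=1}^{d}t_iL_i^{(v)}\Big)^{\oplus m_v}. \] (2) $M$ is injective if and only if there are non-negative integers $n_v$ ($v\in Q_0$) with $\sum_{v\in Q_0}n_v\dim_{\mathbb{C}}I(v)=\dim_{\mathbb{C}}M$ such that \[ \int_{I_A(t)}M\ \sim\ \frac{\prod_{i=1}^dt_i}{2}\cdot\bigoplus_{v\in Q_0}\Big(\sum_{i=1}^{d}t_iR_i^{(v)}\Big)^{\oplus n_v}. \] Here both sides are matrices depending on $t=(t_1,\dots,t_d)\in(\mathbb{R}_{\ge0})^d$, and $X(t)\sim Y(t)$ means that there is an invertible complex matrix $H$, independent of $t$, with $X(t)H=HY(t)$ for all $t$.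
   Context: $Q$ is a finite quiver with vertex set $Q_0$, $\mathcal{I}$ is an admissible ideal, and $e_v$ is the trivial path (primitive idempotent) at $v\in Q_0$. For a finite-dimensional left $A$-module $M$, $\rho_M:A\to\mathrm{End}_{\mathbb{C}}(M)$, $a\mapsto(m\mapsto a.m)$. For $t\in(\mathbb{R}_{\ge0})^d$, $I_A(t)=\{\sum_i\lambda_ia_i:0\le\lambda_i\le t_i\}$ is identified with $\prod_i[0,t_i]$ and carries the transported $d$-dimensional Lebesgue measure $\mu_t$ (total mass $\prod_it_i$). The integral profile of $M$ is the map $t\mapsto\int_{I_A(t)}M:=\int_{I_A(t)}\rho_M(x)\,d\mu_t(x)\in\mathrm{End}_{\mathbb{C}}(M)$ (Bochner integral), viewed as a matrix in the fixed basis of $M$. $P(v)=Ae_v$ is the indecomposable projective left module at $v$; fixing a basis of $Ae_v$, $L_i^{(v)}$ is the matrix of $x\mapsto a_ix$ on $Ae_v$. $I(v)=D(e_vA)$, $D=\mathrm{Hom}_{\mathbb{C}}(-,\mathbb{C})$, is the indecomposable injective left module at $v$ with action $(a\cdot\varphi)(x)=\varphi(xa)$; fixing a basis of $e_vA$, $R_i^{(v)}$ is the matrix of the action of $a_i$ on $D(e_vA)$ with respect to the dual basis. (Columns of matrices are coordinates of images of basis vectors.) *)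

theory Defs
  imports
    "HOL-Algebra.QuotRing"
    "HOL-Algebra.Ideal_Product"
    "HOL-Analysis.Analysis"
    "HOL-Library.Poly_Mapping"
    "Graph_Theory.Arc_Walk"
    "Jordan_Normal_Form.VS_Connect"
begin

hide_const (open) Multiset.mult Polynomial.smult Modules.module Modules.module_hom

section \<open>Ordered bases, coordinates, matrices of linear maps\<close>

definition ordered_basis :: "(complex, 'v, 'z) module_scheme \<Rightarrow> 'v list \<Rightarrow> bool" where
  "ordered_basis V bs \<longleftrightarrow>
     vectorspace class_ring V \<and> distinct bs \<and> vectorspace.basis class_ring V (set bs)"

definition coords :: "(complex, 'v, 'z) module_scheme \<Rightarrow> 'v list \<Rightarrow> 'v \<Rightarrow> complex vec" where
  "coords V bs x = (THE c. c \<in> carrier_vec (length bs) \<and>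
     x = (\<Oplus>\<^bsub>V\<^esub> i \<in> {..<length bs}. vec_index c i \<odot>\<^bsub>V\<^esub> (bs ! i)))"

definition matrix_of ::
    "(complex, 'v, 'z) module_scheme \<Rightarrow> 'v list \<Rightarrow> ('v \<Rightarrow> 'v) \<Rightarrow> complex mat" where
  "matrix_of V bs T =
     Matrix.mat (length bs) (length bs) (\<lambda>(i, j). vec_index (coords V bs (T (bs ! j))) i)"

definition endo_space :: "(complex, 'v, 'z) module_scheme \<Rightarrow> (complex, 'v \<Rightarrow> 'v) module" where
  "endo_space V = \<lparr>
     carrier = module_hom class_ring V V \<inter> extensional (carrier V),
     mult = (\<lambda>S T. compose (carrier V) S T),
     one = (\<lambda>x\<in>carrier V. x),
     zero = (\<lambda>x\<in>carrier V. \<zero>\<^bsub>V\<^esub>),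
     add = (\<lambda>S T. \<lambda>x\<in>carrier V. S x \<oplus>\<^bsub>V\<^esub> T x),
     smult = (\<lambda>c T. \<lambda>x\<in>carrier V. c \<odot>\<^bsub>V\<^esub> T x) \<rparr>"

text \<open>All norms on the endomorphism space of a finite-dimensional space are equivalent and yield
  the same Bochner integral; this one is chosen for definiteness.\<close>

definition endo_norm :: "(complex, 'v, 'z) module_scheme \<Rightarrow> 'v list \<Rightarrow> ('v \<Rightarrow> 'v) \<Rightarrow> real" where
  "endo_norm V bs T =
     (\<Sum>i<length bs. \<Sum>j<length bs. norm (matrix_of V bs T $$ (i, j)))"


section \<open>The Bochner integral on a finite-dimensional space with a carrier\<close>

text \<open>The library's Bochner integral is tied to Banach-space types. This is its definition
  (convergence of integrals of simple functions), with the carrier of \<open>V\<close> in place of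
  the type and \<open>N\<close> in place of the norm.\<close>

definition simple_integrable_in ::
    "(complex, 'v, 'z) module_scheme \<Rightarrow> 'x measure \<Rightarrow> ('x \<Rightarrow> 'v) \<Rightarrow> bool" where
  "simple_integrable_in V \<mu> s \<longleftrightarrow>
     s \<in> space \<mu> \<rightarrow> carrier V \<and> simple_function \<mu> s \<and>
     emeasure \<mu> {x \<in> space \<mu>. s x \<noteq> \<zero>\<^bsub>V\<^esub>} \<noteq> \<infinity>"

definition simple_integral_in ::
    "(complex, 'v, 'z) module_scheme \<Rightarrow> 'x measure \<Rightarrow> ('x \<Rightarrow> 'v) \<Rightarrow> 'v" where
  "simple_integral_in V \<mu> s =
     (\<Oplus>\<^bsub>V\<^esub> y \<in> s ` space \<mu>.
        complex_of_real (measure \<mu> {x \<in> space \<mu>. s x = y}) \<odot>\<^bsub>V\<^esub> y)"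

definition has_bochner_integral_in ::
    "(complex, 'v, 'z) module_scheme \<Rightarrow> ('v \<Rightarrow> real) \<Rightarrow> 'x measure \<Rightarrow> ('x \<Rightarrow> 'v) \<Rightarrow> 'v \<Rightarrow> bool" where
  "has_bochner_integral_in V N \<mu> f y \<longleftrightarrow>
     f \<in> space \<mu> \<rightarrow> carrier V \<and> y \<in> carrier V \<and>
     (\<exists>s. (\<forall>k. simple_integrable_in V \<mu> (s k)) \<and>
          (\<forall>k. (\<lambda>x. N (f x \<ominus>\<^bsub>V\<^esub> s k x)) \<in> borel_measurable \<mu>) \<and>
          ((\<lambda>k. \<integral>\<^sup>+ x. ennreal (N (f x \<ominus>\<^bsub>V\<^esub> s k x)) \<partial>\<mu>) \<longlonglongrightarrow> 0) \<and>
          ((\<lambda>k. N (simple_integral_in V \<mu> (s k) \<ominus>\<^bsub>V\<^esub> y)) \<longlonglongrightarrow> 0))"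

definition bochner_integral_in ::
    "(complex, 'v, 'z) module_scheme \<Rightarrow> ('v \<Rightarrow> real) \<Rightarrow> 'x measure \<Rightarrow> ('x \<Rightarrow> 'v) \<Rightarrow> 'v" where
  "bochner_integral_in V N \<mu> f = (THE y. has_bochner_integral_in V N \<mu> f y)"


section \<open>Left modules over a noncommutative ring\<close>

text \<open>The axioms are those of the locale \<open>module\<close> of \<open>HOL-Algebra\<close>,
  which however requires the ring to be commutative. As there, the fields \<open>mult\<close> and
  \<open>one\<close> of the module record play no role.\<close>

locale left_module = R?: ring R + M?: abelian_group M
    for R :: "('r, 'y) ring_scheme" and M :: "('r, 'm, 'z) module_scheme" +
  assumes smult_closed: "\<lbrakk>a \<in> carrier R; x \<in> carrier M\<rbrakk> \<Longrightarrow> a \<odot>\<^bsub>M\<^esub> x \<in> carrier M"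
    and smult_l_distr: "\<lbrakk>a \<in> carrier R; b \<in> carrier R; x \<in> carrier M\<rbrakk> \<Longrightarrow>
      (a \<oplus>\<^bsub>R\<^esub> b) \<odot>\<^bsub>M\<^esub> x = a \<odot>\<^bsub>M\<^esub> x \<oplus>\<^bsub>M\<^esub> b \<odot>\<^bsub>M\<^esub> x"
    and smult_r_distr: "\<lbrakk>a \<in> carrier R; x \<in> carrier M; y \<in> carrier M\<rbrakk> \<Longrightarrow>
      a \<odot>\<^bsub>M\<^esub> (x \<oplus>\<^bsub>M\<^esub> y) = a \<odot>\<^bsub>M\<^esub> x \<oplus>\<^bsub>M\<^esub> a \<odot>\<^bsub>M\<^esub> y"
    and smult_assoc1: "\<lbrakk>a \<in> carrier R; b \<in> carrier R; x \<in> carrier M\<rbrakk> \<Longrightarrow>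
      (a \<otimes>\<^bsub>R\<^esub> b) \<odot>\<^bsub>M\<^esub> x = a \<odot>\<^bsub>M\<^esub> (b \<odot>\<^bsub>M\<^esub> x)"
    and smult_one: "x \<in> carrier M \<Longrightarrow> \<one>\<^bsub>R\<^esub> \<odot>\<^bsub>M\<^esub> x = x"

text \<open>HOL cannot quantify over all modules, so the lifting and extension properties range over
  the modules whose carrier is a subset of a type \<open>'u\<close>. This is the usual notion for
  finite-dimensional \<open>M\<close> over a finite-dimensional complex algebra only if \<open>'u\<close>
  is large enough to carry the finite-dimensional modules, for instance if
  \<open>nat \<Rightarrow> complex\<close> injects into it.\<close>

definition projective_module ::
    "'u itself \<Rightarrow> ('r, 'y) ring_scheme \<Rightarrow> ('r, 'm, 'z) module_scheme \<Rightarrow> bool" where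
  "projective_module (_ :: 'u itself) R M \<longleftrightarrow> left_module R M \<and>
     (\<forall>(X :: ('r, 'u) module) (Y :: ('r, 'u) module) p g.
        left_module R X \<and> left_module R Y \<and>
        p \<in> module_hom R X Y \<and> p ` carrier X = carrier Y \<and>
        g \<in> module_hom R M Y \<longrightarrow>
        (\<exists>h \<in> module_hom R M X. \<forall>x\<in>carrier M. p (h x) = g x))"

definition injective_module ::
    "'u itself \<Rightarrow> ('r, 'y) ring_scheme \<Rightarrow> ('r, 'm, 'z) module_scheme \<Rightarrow> bool" where
  "injective_module (_ :: 'u itself) R M \<longleftrightarrow> left_module R M \<and>
     (\<forall>(X :: ('r, 'u) module) (Y :: ('r, 'u) module) j g.
        left_module R X \<and> left_module R Y \<and>
        j \<in> module_hom R X Y \<and> inj_on j (carrier X) \<and>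
        g \<in> module_hom R X M \<longrightarrow>
        (\<exists>h \<in> module_hom R Y M. \<forall>x\<in>carrier X. h (j x) = g x))"


section \<open>Modules over a complex algebra\<close>

text \<open>A complex algebra is a record of type \<open>(complex, 'r) module\<close>: a ring together
  with a scalar multiplication by complex numbers. A left module over it is a complex vector space
  through \<open>c \<mapsto> c \<cdot> 1\<close>.\<close>

definition complex_space ::
    "(complex, 'r, 'y) module_scheme \<Rightarrow> ('r, 'm, 'z) module_scheme \<Rightarrow> (complex, 'm) module" where
  "complex_space A M = \<lparr> carrier = carrier M, mult = mult M, one = one M, zero = zero M,
     add = add M, smult = (\<lambda>c x. (c \<odot>\<^bsub>A\<^esub> \<one>\<^bsub>A\<^esub>) \<odot>\<^bsub>M\<^esub> x) \<rparr>"

definition representation :: "('r, 'm, 'z) module_scheme \<Rightarrow> 'r \<Rightarrow> ('m \<Rightarrow> 'm)" where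
  "representation M a = (\<lambda>x\<in>carrier M. a \<odot>\<^bsub>M\<^esub> x)"

definition projective_at ::
    "(complex, 'r, 'y) module_scheme \<Rightarrow> 'r \<Rightarrow> ('r, 'r) module" where
  "projective_at A e = \<lparr> carrier = (\<lambda>x. x \<otimes>\<^bsub>A\<^esub> e) ` carrier A, mult = mult A, one = one A,
     zero = zero A, add = add A, smult = mult A \<rparr>"

definition right_space ::
    "(complex, 'r, 'y) module_scheme \<Rightarrow> 'r \<Rightarrow> (complex, 'r, 'y) module_scheme" where
  "right_space A e = A \<lparr> carrier := (\<lambda>x. e \<otimes>\<^bsub>A\<^esub> x) ` carrier A \<rparr>"

definition dual_carrier :: "(complex, 'v, 'z) module_scheme \<Rightarrow> ('v \<Rightarrow> complex) set" where
  "dual_carrier V = {\<phi> \<in> extensional (carrier V).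
     (\<forall>x\<in>carrier V. \<forall>y\<in>carrier V. \<phi> (x \<oplus>\<^bsub>V\<^esub> y) = \<phi> x + \<phi> y) \<and>
     (\<forall>c. \<forall>x\<in>carrier V. \<phi> (c \<odot>\<^bsub>V\<^esub> x) = c * \<phi> x)}"

definition dual_basis :: "(complex, 'v, 'z) module_scheme \<Rightarrow> 'v list \<Rightarrow> ('v \<Rightarrow> complex) list" where
  "dual_basis V bs = map (\<lambda>i. \<lambda>x\<in>carrier V. vec_index (coords V bs x) i) [0..<length bs]"

text \<open>\<open>D(eA)\<close>: functionals on \<open>eA\<close>, extensional outside it, with
  \<open>(a \<cdot> \<phi>)(x) = \<phi>(xa)\<close>.\<close>

definition injective_at ::
    "(complex, 'r, 'y) module_scheme \<Rightarrow> 'r \<Rightarrow> ('r, 'r \<Rightarrow> complex) module" where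
  "injective_at A e = (let E = carrier (right_space A e) in
     \<lparr> carrier = dual_carrier (right_space A e),
       mult = (\<lambda>\<phi> \<psi>. \<lambda>x\<in>E. 0),
       one = (\<lambda>x\<in>E. 0),
       zero = (\<lambda>x\<in>E. 0),
       add = (\<lambda>\<phi> \<psi>. \<lambda>x\<in>E. \<phi> x + \<psi> x),
       smult = (\<lambda>a \<phi>. \<lambda>x\<in>E. \<phi> (x \<otimes>\<^bsub>A\<^esub> a)) \<rparr>)"


section \<open>The integral profile\<close>

text \<open>The set \<open>I\<^sub>A(t)\<close> with the Lebesgue measure of the box transported along
  \<open>\<lambda> \<mapsto> \<Sum> \<lambda>\<^sub>i a\<^sub>i\<close>; its \<open>space\<close> is \<open>I\<^sub>A(t)\<close>.\<close>

definition box_measure ::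
    "(complex, 'r, 'y) module_scheme \<Rightarrow> 'r list \<Rightarrow> (nat \<Rightarrow> real) \<Rightarrow> 'r measure" where
  "box_measure A as t = embed_measure
     (restrict_space (\<Pi>\<^sub>M i\<in>{..<length as}. lborel) (\<Pi>\<^sub>E i\<in>{..<length as}. {0..t i}))
     (\<lambda>l. \<Oplus>\<^bsub>A\<^esub> i \<in> {..<length as}. complex_of_real (l i) \<odot>\<^bsub>A\<^esub> (as ! i))"

definition integral_profile ::
    "(complex, 'r, 'y) module_scheme \<Rightarrow> 'r list \<Rightarrow> ('r, 'm, 'z) module_scheme \<Rightarrow> 'm list \<Rightarrow>
     (nat \<Rightarrow> real) \<Rightarrow> complex mat" where
  "integral_profile A as M bs t = (let V = complex_space A M in
     matrix_of V bs
       (bochner_integral_in (endo_space V) (endo_norm V bs) (box_measure A as t) (representation M)))"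

definition matrix_combination :: "nat \<Rightarrow> (nat \<Rightarrow> complex mat) \<Rightarrow> nat \<Rightarrow> (nat \<Rightarrow> real) \<Rightarrow> complex mat"
  where "matrix_combination n B d t =
    (\<Oplus>\<^bsub>module_mat TYPE(complex) n n\<^esub> i \<in> {..<d}. complex_of_real (t i) \<cdot>\<^sub>m B i)"

definition block_sum :: "'a list \<Rightarrow> ('a \<Rightarrow> nat) \<Rightarrow> ('a \<Rightarrow> complex mat) \<Rightarrow> complex mat" where
  "block_sum vs m B = diag_block_mat (concat (map (\<lambda>v. replicate (m v) (B v)) vs))"

definition similar_on :: "'t set \<Rightarrow> ('t \<Rightarrow> complex mat) \<Rightarrow> ('t \<Rightarrow> complex mat) \<Rightarrow> bool" where
  "similar_on T X Y \<longleftrightarrow> (\<exists>n. \<exists>H \<in> carrier_mat n n. invertible_mat H \<and>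
     (\<forall>t\<in>T. X t \<in> carrier_mat n n \<and> Y t \<in> carrier_mat n n \<and> X t * H = H * Y t))"


section \<open>Bound quiver algebras\<close>

text \<open>A finite quiver is a finite directed multigraph (loops allowed), and a path is a pair of
  its source and its list of arcs; \<open>(v, [])\<close> is the trivial path at \<open>v\<close>.
  Paths are composed from left to right: \<open>p q\<close> is \<open>p\<close> followed by
  \<open>q\<close>.\<close>

definition quiver_paths :: "('a, 'b) pre_digraph \<Rightarrow> ('a \<times> 'b list) set" where
  "quiver_paths Q = {(u, es). \<exists>v. pre_digraph.awalk Q u es v}"

definition path_mult :: "('a, 'b) pre_digraph \<Rightarrow> 'a \<times> 'b list \<Rightarrow> 'a \<times> 'b list \<Rightarrow>
    ('a \<times> 'b list) \<Rightarrow>\<^sub>0 complex" where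
  "path_mult Q p q =
     (if last (pre_digraph.awalk_verts Q (fst p) (snd p)) = fst q
      then Poly_Mapping.single (fst p, snd p @ snd q) 1 else 0)"

definition scale_map :: "complex \<Rightarrow> ('k \<Rightarrow>\<^sub>0 complex) \<Rightarrow> ('k \<Rightarrow>\<^sub>0 complex)" where
  "scale_map c x = Poly_Mapping.map (\<lambda>y. c * y) x"

definition path_algebra ::
    "('a, 'b) pre_digraph \<Rightarrow> (complex, ('a \<times> 'b list) \<Rightarrow>\<^sub>0 complex) module" where
  "path_algebra Q = \<lparr>
     carrier = {x. Poly_Mapping.keys x \<subseteq> quiver_paths Q},
     mult = (\<lambda>x y. \<Sum>p\<in>Poly_Mapping.keys x. \<Sum>q\<in>Poly_Mapping.keys y.
               scale_map (Poly_Mapping.lookup x p * Poly_Mapping.lookup y q) (path_mult Q p q)),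
     one = (\<Sum>v\<in>verts Q. Poly_Mapping.single (v, []) 1),
     zero = 0,
     add = (+),
     smult = scale_map \<rparr>"

definition arrow_ideal :: "('a, 'b) pre_digraph \<Rightarrow> (('a \<times> 'b list) \<Rightarrow>\<^sub>0 complex) set" where
  "arrow_ideal Q =
     genideal (path_algebra Q) ((\<lambda>e. Poly_Mapping.single (tail Q e, [e]) 1) ` arcs Q)"

definition ideal_power :: "('r, 'y) ring_scheme \<Rightarrow> 'r set \<Rightarrow> nat \<Rightarrow> 'r set" where
  "ideal_power R I n = (ideal_prod R I ^^ n) (carrier R)"

definition admissible_ideal ::
    "('a, 'b) pre_digraph \<Rightarrow> (('a \<times> 'b list) \<Rightarrow>\<^sub>0 complex) set \<Rightarrow> bool" where
  "admissible_ideal Q J \<longleftrightarrow> ideal J (path_algebra Q) \<and>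
     (\<exists>m\<ge>2. ideal_power (path_algebra Q) (arrow_ideal Q) m \<subseteq> J) \<and>
     J \<subseteq> ideal_power (path_algebra Q) (arrow_ideal Q) 2"

text \<open>The scalar multiplication on cosets follows the pattern of \<^const>\<open>rcoset_mult\<close>.\<close>

definition bound_quiver_algebra ::
    "('a, 'b) pre_digraph \<Rightarrow> (('a \<times> 'b list) \<Rightarrow>\<^sub>0 complex) set \<Rightarrow>
     (complex, (('a \<times> 'b list) \<Rightarrow>\<^sub>0 complex) set) module" where
  "bound_quiver_algebra Q J = ring.extend (path_algebra Q Quot J)
     (module.fields (\<lambda>c X. \<Union>x\<in>X. J +>\<^bsub>path_algebra Q\<^esub> (c \<odot>\<^bsub>path_algebra Q\<^esub> x)))"

definition trivial_path ::
    "('a, 'b) pre_digraph \<Rightarrow> (('a \<times> 'b list) \<Rightarrow>\<^sub>0 complex) set \<Rightarrow> 'a \<Rightarrow>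
     (('a \<times> 'b list) \<Rightarrow>\<^sub>0 complex) set" where
  "trivial_path Q J v = J +>\<^bsub>path_algebra Q\<^esub> Poly_Mapping.single (v, []) 1"

end

theory Submission
  imports Defs "HOL-Library.Nat_Bijection"
begin

text \<open>Write \<open>B\<^sub>k\<close> for the matrix of the \<open>k\<close>-th basis element \<open>a\<^sub>k\<close> of the algebra acting on \<open>M\<close>. Taking a
matrix entry commutes with the Bochner integral, so the integral profile at \<open>t\<close> is
\<open>(\<Prod>t\<^sub>i) / 2 \<cdot> \<Sum> t\<^sub>k B\<^sub>k\<close> (\<open>integral_profile_matrix\<close>). Because \<open>t\<close> varies, two such profiles are
similar by a matrix independent of \<open>t\<close> exactly if their coefficient matrices are simultaneously
conjugate (\<open>similar_on_iff_conjugates\<close>), that is, if the two modules are isomorphic. The claim is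
therefore that the projective modules are the direct sums of the \<open>P(v)\<close>, and dually for injectives.

The two sides meet in a finite condition on the matrices, \<open>splits\<close>: there are endomorphisms \<open>T\<^sub>k\<close>
of the vector space \<open>M\<close> such that \<open>x \<mapsto> \<Sum> a\<^sub>k \<otimes> T\<^sub>k x\<close> is an \<open>A\<close>-linear section of the action map from
\<open>A \<otimes>\<^sub>\<complex> M\<close> onto \<open>M\<close>. A projective module has such a section, since \<open>A \<otimes>\<^sub>\<complex> M\<close> embeds into the universe of
test modules; conversely \<open>h x = \<Sum> a\<^sub>k h\<^sub>0 (T\<^sub>k x)\<close> turns a \<open>\<complex>\<close>-linear lift \<open>h\<^sub>0\<close> into an \<open>A\<close>-linear one
(\<open>projective_iff_splits\<close>).

The condition is invariant under conjugation, passes to block sums and holds for \<open>P(v)\<close>, which is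
the direction from the decomposition to projectivity. For the other one, take a smallest generating family
of elements \<open>x\<^sub>t\<close>, each attached to a vertex. The section yields \<open>A\<close>-linear maps \<open>f\<^sub>t\<close> with
\<open>x = \<Sum> f\<^sub>t(x) x\<^sub>t\<close> (\<open>dual_family\<close>); by minimality every relation between the \<open>x\<^sub>t\<close> has coefficients
in the radical (\<open>minimal_relation\<close>), and combining the two pushes these coefficients into all powers
of the radical, so that they vanish (\<open>minimal_family_free\<close>). Hence \<open>M\<close> is the direct sum of the
\<open>P(v)\<close> generated by the \<open>x\<^sub>t\<close> (\<open>splits_iff_block_sum\<close>).

For injectivity, \<open>A \<otimes>\<^sub>\<complex> M\<close> is replaced by \<open>Hom\<^sub>\<complex>(A, M)\<close> and sections by retractions. The resulting
condition is \<open>splits\<close> for the transposed matrices and the structure constants of the opposite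
algebra (\<open>injective_iff_splits\<close>): it says that the dual of \<open>M\<close> decomposes into modules \<open>e\<^sub>vA\<close>, and
transposing back gives the \<open>I(v) = D(e\<^sub>vA)\<close> (\<open>injective_iff_profile\<close>).\<close>

section \<open>Coordinates with respect to an ordered basis\<close>

lemma additive_finsum:
  assumes "abelian_monoid V" "abelian_monoid W"
    and closed: "\<And>x. x \<in> carrier V \<Longrightarrow> h x \<in> carrier W"
    and zero: "h \<zero>\<^bsub>V\<^esub> = \<zero>\<^bsub>W\<^esub>"
    and add: "\<And>x y. x \<in> carrier V \<Longrightarrow> y \<in> carrier V \<Longrightarrow> h (x \<oplus>\<^bsub>V\<^esub> y) = h x \<oplus>\<^bsub>W\<^esub> h y"
    and f: "f \<in> S \<rightarrow> carrier V"
  shows "h (finsum V f S) = finsum W (\<lambda>s. h (f s)) S"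
proof -
  interpret V: abelian_monoid V by fact
  interpret W: abelian_monoid W by fact
  show ?thesis using f
  proof (induction S rule: infinite_finite_induct)
    case (insert s S)
    have "finsum V f S \<in> carrier V" using insert by (intro V.finsum_closed) auto
    then show ?case using insert closed by (simp add: Pi_def add)
  qed (auto simp: zero)
qed

lemma additive_finsum_sum:
  fixes h :: "'v \<Rightarrow> 'c::comm_monoid_add"
  assumes "abelian_monoid V"
    and zero: "h \<zero>\<^bsub>V\<^esub> = 0"
    and add: "\<And>x y. x \<in> carrier V \<Longrightarrow> y \<in> carrier V \<Longrightarrow> h (x \<oplus>\<^bsub>V\<^esub> y) = h x + h y"
    and f: "f \<in> S \<rightarrow> carrier V"
  shows "h (finsum V f S) = (\<Sum>s\<in>S. h (f s))"
proof -
  interpret V: abelian_monoid V by fact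
  show ?thesis using f
  proof (induction S rule: infinite_finite_induct)
    case (insert s S)
    have "finsum V f S \<in> carrier V" using insert by (intro V.finsum_closed) auto
    then show ?case using insert by (simp add: Pi_def add)
  qed (auto simp: zero)
qed

lemma finsum_transfer:
  assumes "abelian_monoid V" "abelian_monoid W"
    and "carrier V = carrier W" and "\<zero>\<^bsub>V\<^esub> = \<zero>\<^bsub>W\<^esub>"
    and "\<And>x y. x \<in> carrier W \<Longrightarrow> y \<in> carrier W \<Longrightarrow> x \<oplus>\<^bsub>V\<^esub> y = x \<oplus>\<^bsub>W\<^esub> y"
    and "f \<in> S \<rightarrow> carrier W"
  shows "finsum V f S = finsum W f S"
  using additive_finsum[of V W "\<lambda>x. x" f S] assms by auto

lemma abelian_group_transfer:
  assumes "abelian_group V"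
    and "carrier W = carrier V" and "\<zero>\<^bsub>W\<^esub> = \<zero>\<^bsub>V\<^esub>"
    and "\<And>x y. x \<in> carrier V \<Longrightarrow> y \<in> carrier V \<Longrightarrow> x \<oplus>\<^bsub>W\<^esub> y = x \<oplus>\<^bsub>V\<^esub> y"
  shows "abelian_group W"
proof -
  interpret V: abelian_group V by fact
  show ?thesis
  proof (rule abelian_groupI)
    show "\<exists>y\<in>carrier W. y \<oplus>\<^bsub>W\<^esub> x = \<zero>\<^bsub>W\<^esub>" if "x \<in> carrier W" for x
      using that assms by (intro bexI[of _ "\<ominus>\<^bsub>V\<^esub> x"]) (auto simp: V.l_neg)
  qed (auto simp: assms V.a_ac)
qed

lemma module_transfer:
  assumes "module K V"
    and "carrier W = carrier V" and "\<zero>\<^bsub>W\<^esub> = \<zero>\<^bsub>V\<^esub>"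
    and "\<And>x y. x \<in> carrier V \<Longrightarrow> y \<in> carrier V \<Longrightarrow> x \<oplus>\<^bsub>W\<^esub> y = x \<oplus>\<^bsub>V\<^esub> y"
    and "\<And>c x. c \<in> carrier K \<Longrightarrow> x \<in> carrier V \<Longrightarrow> c \<odot>\<^bsub>W\<^esub> x = c \<odot>\<^bsub>V\<^esub> x"
  shows "module K W"
proof -
  interpret V: module K V by fact
  show ?thesis
    by (rule moduleI) (auto simp: assms V.smult_l_distr V.smult_r_distr V.smult_assoc1 V.is_cring
        intro: abelian_group_transfer[OF V.M.abelian_group_axioms])
qed

lemma complex_module_ops:
  fixes V :: "(complex, 'v, 'z) module_scheme"
  assumes "module class_ring V" "x \<in> carrier V"
  shows "a \<odot>\<^bsub>V\<^esub> x \<in> carrier V" and "(a * b) \<odot>\<^bsub>V\<^esub> x = a \<odot>\<^bsub>V\<^esub> (b \<odot>\<^bsub>V\<^esub> x)"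
    and "(a + b) \<odot>\<^bsub>V\<^esub> x = a \<odot>\<^bsub>V\<^esub> x \<oplus>\<^bsub>V\<^esub> b \<odot>\<^bsub>V\<^esub> x"
    and "y \<in> carrier V \<Longrightarrow> a \<odot>\<^bsub>V\<^esub> (x \<oplus>\<^bsub>V\<^esub> y) = a \<odot>\<^bsub>V\<^esub> x \<oplus>\<^bsub>V\<^esub> a \<odot>\<^bsub>V\<^esub> y"
    and "1 \<odot>\<^bsub>V\<^esub> x = x" and "0 \<odot>\<^bsub>V\<^esub> x = \<zero>\<^bsub>V\<^esub>" and "a \<odot>\<^bsub>V\<^esub> \<zero>\<^bsub>V\<^esub> = \<zero>\<^bsub>V\<^esub>"
proof -
  interpret V: module class_ring V by fact
  note x = \<open>x \<in> carrier V\<close>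
  show "a \<odot>\<^bsub>V\<^esub> x \<in> carrier V" using V.smult_closed[of a x] x by simp
  show "(a * b) \<odot>\<^bsub>V\<^esub> x = a \<odot>\<^bsub>V\<^esub> (b \<odot>\<^bsub>V\<^esub> x)" using V.smult_assoc1[of a b x] x by simp
  show "(a + b) \<odot>\<^bsub>V\<^esub> x = a \<odot>\<^bsub>V\<^esub> x \<oplus>\<^bsub>V\<^esub> b \<odot>\<^bsub>V\<^esub> x" using V.smult_l_distr[of a b x] x by simp
  show "y \<in> carrier V \<Longrightarrow> a \<odot>\<^bsub>V\<^esub> (x \<oplus>\<^bsub>V\<^esub> y) = a \<odot>\<^bsub>V\<^esub> x \<oplus>\<^bsub>V\<^esub> a \<odot>\<^bsub>V\<^esub> y"
    using V.smult_r_distr[of a x y] x by simp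
  show "1 \<odot>\<^bsub>V\<^esub> x = x" using V.smult_one[of x] x by simp
  show "0 \<odot>\<^bsub>V\<^esub> x = \<zero>\<^bsub>V\<^esub>" using V.smult_l_null[of x] x by simp
  show "a \<odot>\<^bsub>V\<^esub> \<zero>\<^bsub>V\<^esub> = \<zero>\<^bsub>V\<^esub>" using V.smult_r_null[of a] by simp
qed

text \<open>Unique coordinate vectors, rather than linear independence and spanning, are what every computation
with a basis uses below.\<close>

locale based_space = module class_ring V
  for V :: "(complex, 'v, 'z) module_scheme" (structure) +
  fixes bs :: "'v list"
  assumes bs_subset: "set bs \<subseteq> carrier V"
    and coords_ex1: "x \<in> carrier V \<Longrightarrow> \<exists>!c. c \<in> carrier_vec (length bs) \<and>
        x = (\<Oplus>\<^bsub>V\<^esub> i \<in> {..<length bs}. vec_index c i \<odot>\<^bsub>V\<^esub> (bs ! i))"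
begin

abbreviation "lc c \<equiv> (\<Oplus>\<^bsub>V\<^esub> i \<in> {..<length bs}. c i \<odot>\<^bsub>V\<^esub> (bs ! i))"

lemma bs_closed [simp]: "i < length bs \<Longrightarrow> bs ! i \<in> carrier V"
  using bs_subset by auto

lemma smult_c [simp]: "x \<in> carrier V \<Longrightarrow> c \<odot> x \<in> carrier V"
  using smult_closed by simp

lemmas complex_module = complex_module_ops[OF module_axioms]

lemma lc_closed [simp]: "lc c \<in> carrier V"
  by (intro M.finsum_closed) auto

lemma coords_props: "x \<in> carrier V \<Longrightarrow> coords V bs x \<in> carrier_vec (length bs) \<and>
    x = lc (vec_index (coords V bs x))"
  unfolding coords_def by (rule theI'[OF coords_ex1])

lemma coords_carrier [simp]: "x \<in> carrier V \<Longrightarrow> coords V bs x \<in> carrier_vec (length bs)"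
  and lc_coords: "x \<in> carrier V \<Longrightarrow> lc (vec_index (coords V bs x)) = x"
  using coords_props by auto

lemma dim_coords [simp]: "x \<in> carrier V \<Longrightarrow> dim_vec (coords V bs x) = length bs"
  using coords_carrier by auto

lemma coords_lc: "coords V bs (lc c) = Matrix.vec (length bs) c"
proof -
  have "lc c = lc (vec_index (Matrix.vec (length bs) c))" by (intro M.finsum_cong') auto
  then show ?thesis using coords_ex1[of "lc c"] coords_props[of "lc c"] by auto
qed

lemma coords_eqI:
  "c \<in> carrier_vec (length bs) \<Longrightarrow> lc (vec_index c) = x \<Longrightarrow> coords V bs x = c"
  using coords_lc[of "vec_index c"] by (auto intro!: eq_vecI)

lemma coords_inj: "x \<in> carrier V \<Longrightarrow> y \<in> carrier V \<Longrightarrow> coords V bs x = coords V bs y \<Longrightarrow> x = y"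
  using lc_coords by metis

lemma coords_add: "x \<in> carrier V \<Longrightarrow> y \<in> carrier V \<Longrightarrow>
    coords V bs (x \<oplus> y) = coords V bs x + coords V bs y"
proof (rule coords_eqI)
  assume x: "x \<in> carrier V" and y: "y \<in> carrier V"
  have "lc (vec_index (coords V bs x + coords V bs y)) =
    (\<Oplus>\<^bsub>V\<^esub> i \<in> {..<length bs}. vec_index (coords V bs x) i \<odot>\<^bsub>V\<^esub> (bs ! i) \<oplus> vec_index (coords V bs y) i \<odot>\<^bsub>V\<^esub> (bs ! i))"
    using x y smult_l_distr by (intro M.finsum_cong') auto
  also have "\<dots> = x \<oplus> y" using x y by (subst M.finsum_addf) (auto simp: lc_coords)
  finally show "lc (vec_index (coords V bs x + coords V bs y)) = x \<oplus> y" .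
qed auto

lemma coords_smult: "x \<in> carrier V \<Longrightarrow> coords V bs (c \<odot> x) = c \<cdot>\<^sub>v coords V bs x"
proof (rule coords_eqI)
  assume x: "x \<in> carrier V"
  have "lc (vec_index (c \<cdot>\<^sub>v coords V bs x)) =
    (\<Oplus>\<^bsub>V\<^esub> i \<in> {..<length bs}. c \<odot> (vec_index (coords V bs x) i \<odot>\<^bsub>V\<^esub> (bs ! i)))"
    using x by (intro M.finsum_cong') (auto simp: complex_module)
  also have "\<dots> = c \<odot> lc (vec_index (coords V bs x))"
    by (rule finsum_smult[symmetric]) auto
  finally show "lc (vec_index (c \<cdot>\<^sub>v coords V bs x)) = c \<odot> x" using x by (simp add: lc_coords)
qed auto

lemma coords_zero: "coords V bs \<zero> = 0\<^sub>v (length bs)"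
  using coords_lc[of "\<lambda>_. 0"] by (intro coords_eqI) (auto intro!: M.add.finprod_one_eqI simp: complex_module)

definition coord :: "nat \<Rightarrow> 'v \<Rightarrow> complex" where "coord i x = vec_index (coords V bs x) i"

lemma coord_add: "i < length bs \<Longrightarrow> x \<in> carrier V \<Longrightarrow> y \<in> carrier V \<Longrightarrow>
    coord i (x \<oplus> y) = coord i x + coord i y"
  by (simp add: coord_def coords_add)

lemma coord_smult: "i < length bs \<Longrightarrow> x \<in> carrier V \<Longrightarrow> coord i (c \<odot> x) = c * coord i x"
  by (simp add: coord_def coords_smult)

lemma coord_zero: "i < length bs \<Longrightarrow> coord i \<zero> = 0"
  by (simp add: coord_def coords_zero)

lemma coord_finsum: "i < length bs \<Longrightarrow> f \<in> S \<rightarrow> carrier V \<Longrightarrow>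
    coord i (finsum V f S) = (\<Sum>s\<in>S. coord i (f s))"
  by (intro additive_finsum_sum) (auto simp: coord_add coord_zero M.abelian_monoid_axioms)

lemma lc_coord: "x \<in> carrier V \<Longrightarrow> lc (\<lambda>i. coord i x) = x"
  unfolding coord_def using lc_coords by simp

lemma coord_lc: "i < length bs \<Longrightarrow> coord i (lc c) = c i"
  by (simp add: coord_def coords_lc)

lemma coord_eqI: "x \<in> carrier V \<Longrightarrow> y \<in> carrier V \<Longrightarrow>
    (\<And>i. i < length bs \<Longrightarrow> coord i x = coord i y) \<Longrightarrow> x = y"
  by (intro coords_inj eq_vecI) (auto simp: coord_def)

lemma coord_bs: "i < length bs \<Longrightarrow> j < length bs \<Longrightarrow> coord i (bs ! j) = (if i = j then 1 else 0)"
proof -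
  assume i: "i < length bs" and j: "j < length bs"
  have "lc (\<lambda>k. if j = k then 1 else 0) = (\<Oplus>\<^bsub>V\<^esub>k\<in>{..<length bs}. if j = k then bs ! k else \<zero>)"
    by (intro M.finsum_cong') (auto simp: complex_module)
  also have "\<dots> = bs ! j" using j by (intro M.finsum_singleton) auto
  finally show ?thesis using coord_lc[OF i, of "\<lambda>k. if j = k then 1 else 0"] by auto
qed

lemma distinct_bs: "distinct bs"
  by (auto simp: distinct_conv_nth) (metis coord_bs zero_neq_one)

lemma linear_lc:
  assumes "T \<in> module_hom class_ring V W" "module class_ring W"
  shows "T (lc c) = (\<Oplus>\<^bsub>W\<^esub> i \<in> {..<length bs}. c i \<odot>\<^bsub>W\<^esub> T (bs ! i))"
proof -
  interpret W: module class_ring W by fact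
  interpret T: mod_hom class_ring V W T
    by unfold_locales fact
  have "T (lc c) = finsum W (\<lambda>i. T (c i \<odot>\<^bsub>V\<^esub> bs ! i)) {..<length bs}"
    by (rule additive_finsum) (auto simp: M.abelian_monoid_axioms W.M.abelian_monoid_axioms)
  also have "\<dots> = (\<Oplus>\<^bsub>W\<^esub> i \<in> {..<length bs}. c i \<odot>\<^bsub>W\<^esub> T (bs ! i))"
    by (intro W.M.finsum_cong') auto
  finally show ?thesis .
qed

lemma linear_eqI:
  assumes "T \<in> module_hom class_ring V W" "S \<in> module_hom class_ring V W" "module class_ring W"
    and "\<And>i. i < length bs \<Longrightarrow> T (bs ! i) = S (bs ! i)" and x: "x \<in> carrier V"
  shows "T x = S x"
proof -
  interpret W: module class_ring W by fact
  have "S (bs ! i) \<in> carrier W" if "i < length bs" for i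
    using assms(2) that by (auto simp: module_hom_def)
  then have "T (lc (\<lambda>i. coord i x)) = S (lc (\<lambda>i. coord i x))"
    unfolding linear_lc[OF assms(1,3)] linear_lc[OF assms(2,3)]
    using assms(4) by (intro W.M.finsum_cong') auto
  then show ?thesis using lc_coord[OF x] by simp
qed

lemma linear_extend:
  fixes W :: "(complex, 'w, 'y) module_scheme"
  assumes "module class_ring W" and w: "\<And>i. i < length bs \<Longrightarrow> w i \<in> carrier W"
  shows "(\<lambda>x. \<Oplus>\<^bsub>W\<^esub> i \<in> {..<length bs}. coord i x \<odot>\<^bsub>W\<^esub> w i) \<in> module_hom class_ring V W"
    and "j < length bs \<Longrightarrow> (\<Oplus>\<^bsub>W\<^esub> i \<in> {..<length bs}. coord i (bs ! j) \<odot>\<^bsub>W\<^esub> w i) = w j"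
proof -
  interpret W: module class_ring W by fact
  have sm: "c \<odot>\<^bsub>W\<^esub> w i \<in> carrier W" if "i < length bs" for c :: complex and i
    using W.smult_closed w that by simp
  show "(\<lambda>x. \<Oplus>\<^bsub>W\<^esub> i \<in> {..<length bs}. coord i x \<odot>\<^bsub>W\<^esub> w i) \<in> module_hom class_ring V W"
    unfolding module_hom_def
  proof (intro CollectI conjI allI impI funcsetI)
    fix x assume "x \<in> carrier V"
    then show "(\<Oplus>\<^bsub>W\<^esub>i\<in>{..<length bs}. coord i x \<odot>\<^bsub>W\<^esub> w i) \<in> carrier W"
      using sm by (intro W.M.finsum_closed) auto
  next
    fix x y assume xy: "x \<in> carrier V \<and> y \<in> carrier V"
    have "(\<Oplus>\<^bsub>W\<^esub>i\<in>{..<length bs}. coord i (x \<oplus> y) \<odot>\<^bsub>W\<^esub> w i)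
      = (\<Oplus>\<^bsub>W\<^esub>i\<in>{..<length bs}. coord i x \<odot>\<^bsub>W\<^esub> w i \<oplus>\<^bsub>W\<^esub> coord i y \<odot>\<^bsub>W\<^esub> w i)"
      using xy sm w by (intro W.M.finsum_cong') (auto simp: coord_add complex_module_ops[OF assms(1)])
    then show "(\<Oplus>\<^bsub>W\<^esub>i\<in>{..<length bs}. coord i (x \<oplus> y) \<odot>\<^bsub>W\<^esub> w i)
      = (\<Oplus>\<^bsub>W\<^esub>i\<in>{..<length bs}. coord i x \<odot>\<^bsub>W\<^esub> w i) \<oplus>\<^bsub>W\<^esub> (\<Oplus>\<^bsub>W\<^esub>i\<in>{..<length bs}. coord i y \<odot>\<^bsub>W\<^esub> w i)"
      using sm by (subst (asm) W.M.finsum_addf) auto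
  next
    fix c :: complex and x assume cx: "c \<in> carrier class_ring \<and> x \<in> carrier V"
    have "(\<Oplus>\<^bsub>W\<^esub>i\<in>{..<length bs}. coord i (c \<odot> x) \<odot>\<^bsub>W\<^esub> w i)
      = (\<Oplus>\<^bsub>W\<^esub>i\<in>{..<length bs}. c \<odot>\<^bsub>W\<^esub> (coord i x \<odot>\<^bsub>W\<^esub> w i))"
      using cx sm w by (intro W.M.finsum_cong') (auto simp: coord_smult complex_module_ops[OF assms(1)])
    also have "\<dots> = c \<odot>\<^bsub>W\<^esub> (\<Oplus>\<^bsub>W\<^esub>i\<in>{..<length bs}. coord i x \<odot>\<^bsub>W\<^esub> w i)"
      using sm by (intro W.finsum_smult[symmetric]) auto
    finally show "(\<Oplus>\<^bsub>W\<^esub>i\<in>{..<length bs}. coord i (c \<odot> x) \<odot>\<^bsub>W\<^esub> w i)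
      = c \<odot>\<^bsub>W\<^esub> (\<Oplus>\<^bsub>W\<^esub>i\<in>{..<length bs}. coord i x \<odot>\<^bsub>W\<^esub> w i)" .
  qed
  assume j: "j < length bs"
  have "(\<Oplus>\<^bsub>W\<^esub>i\<in>{..<length bs}. coord i (bs ! j) \<odot>\<^bsub>W\<^esub> w i)
      = (\<Oplus>\<^bsub>W\<^esub>i\<in>{..<length bs}. if j = i then w i else \<zero>\<^bsub>W\<^esub>)"
    using j w by (intro W.M.finsum_cong') (auto simp: coord_bs complex_module_ops[OF assms(1)])
  also have "\<dots> = w j" using j w by (intro W.M.finsum_singleton) auto
  finally show "(\<Oplus>\<^bsub>W\<^esub> i \<in> {..<length bs}. coord i (bs ! j) \<odot>\<^bsub>W\<^esub> w i) = w j" .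
qed

lemma linear_id: "(\<lambda>x. x) \<in> module_hom class_ring V V"
  by (auto simp: module_hom_def)

subsection \<open>The matrix of an endomorphism\<close>

lemma dim_matrix_of [simp]: "matrix_of V bs T \<in> carrier_mat (length bs) (length bs)"
  by (simp add: matrix_of_def)

lemma matrix_of_index: "i < length bs \<Longrightarrow> j < length bs \<Longrightarrow>
    matrix_of V bs T $$ (i, j) = coord i (T (bs ! j))"
  by (simp add: matrix_of_def coord_def)

lemma coord_linear:
  assumes T: "T \<in> module_hom class_ring V V" and x: "x \<in> carrier V" and i: "i < length bs"
  shows "coord i (T x) = (\<Sum>j<length bs. coord i (T (bs ! j)) * coord j x)"
proof -
  have Tb: "T (bs ! j) \<in> carrier V" if "j < length bs" for j
    using T that by (auto simp: module_hom_def)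
  have "coord i (T x) = coord i (T (lc (\<lambda>i. coord i x)))" using lc_coord[OF x] by simp
  also have "\<dots> = coord i (\<Oplus>\<^bsub>V\<^esub> j \<in> {..<length bs}. coord j x \<odot>\<^bsub>V\<^esub> T (bs ! j))"
    by (subst linear_lc[OF T module_axioms]) simp
  also have "\<dots> = (\<Sum>j<length bs. coord i (coord j x \<odot>\<^bsub>V\<^esub> T (bs ! j)))"
    using i Tb by (intro coord_finsum) auto
  also have "\<dots> = (\<Sum>j<length bs. coord i (T (bs ! j)) * coord j x)"
    using Tb i by (intro sum.cong) (auto simp: coord_smult)
  finally show ?thesis .
qed

lemma coords_linear:
  assumes T: "T \<in> module_hom class_ring V V" and x: "x \<in> carrier V"
  shows "coords V bs (T x) = matrix_of V bs T *\<^sub>v coords V bs x"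
proof (rule eq_vecI)
  have Tx: "T x \<in> carrier V" using T x by (auto simp: module_hom_def)
  show "dim_vec (coords V bs (T x)) = dim_vec (matrix_of V bs T *\<^sub>v coords V bs x)"
    using Tx by (simp add: matrix_of_def)
  fix i assume "i < dim_vec (matrix_of V bs T *\<^sub>v coords V bs x)"
  then have i: "i < length bs" by (simp add: matrix_of_def)
  show "coords V bs (T x) $ i = (matrix_of V bs T *\<^sub>v coords V bs x) $ i"
    using i coord_linear[OF T x i] x
    by (simp add: matrix_of_def scalar_prod_def coord_def atLeast0LessThan)
qed

lemma matrix_of_comp:
  assumes T: "T \<in> module_hom class_ring V V" and S: "\<And>i. i < length bs \<Longrightarrow> S (bs ! i) \<in> carrier V"
  shows "matrix_of V bs (\<lambda>x. T (S x)) = matrix_of V bs T * matrix_of V bs S"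
proof (rule eq_matI)
  fix i j assume "i < dim_row (matrix_of V bs T * matrix_of V bs S)"
    "j < dim_col (matrix_of V bs T * matrix_of V bs S)"
  then have ij: "i < length bs" "j < length bs" by (auto simp: matrix_of_def)
  then show "matrix_of V bs (\<lambda>x. T (S x)) $$ (i, j) = (matrix_of V bs T * matrix_of V bs S) $$ (i, j)"
    using coord_linear[OF T S[OF ij(2)] ij(1)]
    by (auto simp: matrix_of_def scalar_prod_def coord_def atLeast0LessThan)
qed (auto simp: matrix_of_def)

lemma matrix_of_cong: "(\<And>i. i < length bs \<Longrightarrow> T (bs ! i) = S (bs ! i)) \<Longrightarrow>
    matrix_of V bs T = matrix_of V bs S"
  by (auto simp: matrix_of_def)

lemma matrix_of_eqD:
  assumes "matrix_of V bs T = matrix_of V bs S"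
    and T: "T \<in> module_hom class_ring V V" and S: "S \<in> module_hom class_ring V V" and "x \<in> carrier V"
  shows "T x = S x"
  using T S module_axioms
proof (rule linear_eqI)
  fix i assume i: "i < length bs"
  show "T (bs ! i) = S (bs ! i)"
  proof (rule coord_eqI)
    show "coord j (T (bs ! i)) = coord j (S (bs ! i))" if "j < length bs" for j
      using arg_cong[OF assms(1), of "\<lambda>M. M $$ (j, i)"] that i by (simp add: matrix_of_index)
  qed (use T S i in \<open>auto simp: module_hom_def\<close>)
qed fact

definition endo_of :: "complex mat \<Rightarrow> 'v \<Rightarrow> 'v" where
  "endo_of B x = (\<Oplus>\<^bsub>V\<^esub> j \<in> {..<length bs}. coord j x \<odot> lc (\<lambda>i. B $$ (i, j)))"

lemma endo_of_linear: "endo_of B \<in> module_hom class_ring V V"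
  unfolding endo_of_def by (rule linear_extend) (auto intro: module_axioms)

lemma matrix_of_endo_of: "B \<in> carrier_mat (length bs) (length bs) \<Longrightarrow> matrix_of V bs (endo_of B) = B"
proof (rule eq_matI)
  assume B: "B \<in> carrier_mat (length bs) (length bs)"
  fix i j assume "i < dim_row B" "j < dim_col B"
  then have ij: "i < length bs" "j < length bs" using B by auto
  have "endo_of B (bs ! j) = lc (\<lambda>i. B $$ (i, j))"
    unfolding endo_of_def by (rule linear_extend) (auto intro: module_axioms ij)
  then show "matrix_of V bs (endo_of B) $$ (i, j) = B $$ (i, j)"
    using ij by (simp add: matrix_of_index coord_lc)
qed (auto simp: matrix_of_def)

lemma matrix_of_id: "matrix_of V bs (\<lambda>x. x) = 1\<^sub>m (length bs)"
  by (rule eq_matI) (auto simp: matrix_of_def coord_bs[unfolded coord_def])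

end

text \<open>Several module records here have the same carrier and the same operations on it but differ
outside of it; coordinates and matrices do not see the difference.\<close>

lemma based_space_transfer:
  fixes V :: "(complex, 'v, 'z) module_scheme" and W :: "(complex, 'v, 'y) module_scheme"
  assumes "based_space V bs"
    and agree: "carrier W = carrier V" "\<zero>\<^bsub>W\<^esub> = \<zero>\<^bsub>V\<^esub>"
    "\<And>x y. x \<in> carrier V \<Longrightarrow> y \<in> carrier V \<Longrightarrow> x \<oplus>\<^bsub>W\<^esub> y = x \<oplus>\<^bsub>V\<^esub> y"
    "\<And>c x. x \<in> carrier V \<Longrightarrow> c \<odot>\<^bsub>W\<^esub> x = c \<odot>\<^bsub>V\<^esub> x"
  shows "based_space W bs" and "coords W bs = coords V bs"
    and "matrix_of W bs = matrix_of V bs"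
proof -
  interpret V: based_space V bs by fact
  have mod: "module class_ring W" by (rule module_transfer[OF V.module_axioms]) (auto simp: agree)
  interpret W: module class_ring W by fact
  have sums: "(\<Oplus>\<^bsub>W\<^esub> i \<in> {..<length bs}. c i \<odot>\<^bsub>W\<^esub> (bs ! i)) = V.lc c" for c
  proof -
    have "(\<Oplus>\<^bsub>W\<^esub> i \<in> {..<length bs}. c i \<odot>\<^bsub>W\<^esub> (bs ! i)) = (\<Oplus>\<^bsub>W\<^esub> i \<in> {..<length bs}. c i \<odot>\<^bsub>V\<^esub> (bs ! i))"
      by (intro W.M.finsum_cong') (auto simp: agree)
    also have "\<dots> = V.lc c"
      using agree by (intro finsum_transfer) (auto simp: V.M.abelian_monoid_axioms W.M.abelian_monoid_axioms)
    finally show ?thesis .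
  qed
  show "based_space W bs"
    by (intro based_space.intro mod based_space_axioms.intro) (use V.bs_subset V.coords_ex1 in \<open>auto simp: agree sums\<close>)
  show *: "coords W bs = coords V bs"
    by (rule ext) (simp add: coords_def sums)
  show "matrix_of W bs = matrix_of V bs"
    by (rule ext) (simp add: matrix_of_def *)
qed

lemma bij_betw_ex1:
  assumes "bij_betw F A B"
  shows "(\<exists>!a. a \<in> A \<and> P (F a)) \<longleftrightarrow> (\<exists>!b. b \<in> B \<and> P b)"
proof -
  have ex1: "(\<exists>!x. x \<in> S) \<longleftrightarrow> card S = 1" for S :: "'x set"
    unfolding is_singleton_altdef[symmetric] is_singleton_def by auto
  have "bij_betw F {a \<in> A. P (F a)} {b \<in> B. P b}"
    using assms by (auto simp: bij_betw_def inj_on_def)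
  then show ?thesis
    using bij_betw_same_card[of F "{a \<in> A. P (F a)}" "{b \<in> B. P b}"]
      ex1[of "{a \<in> A. P (F a)}"] ex1[of "{b \<in> B. P b}"] by simp
qed

text \<open>A function on the finite set of basis vectors is the same as a coordinate vector, so unique
coordinates are unique linear combinations.\<close>

lemma based_space_iff: "ordered_basis V bs \<longleftrightarrow> based_space V bs"
  and based_space_dim: "based_space V bs \<Longrightarrow> vectorspace.dim class_ring V = length bs"
proof -
  have char: "vectorspace.basis class_ring V (set bs) \<longleftrightarrow>
      (\<forall>x\<in>carrier V. \<exists>!c. c \<in> carrier_vec (length bs) \<and>
        x = (\<Oplus>\<^bsub>V\<^esub> i \<in> {..<length bs}. vec_index c i \<odot>\<^bsub>V\<^esub> (bs ! i)))"
    if V: "vectorspace class_ring V" and d: "distinct bs" and sub: "set bs \<subseteq> carrier V"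
    for V :: "(complex, 'v, 'z) module_scheme" and bs
  proof -
    interpret V: vectorspace class_ring V by fact
    have img: "(!) bs ` {..<length bs} = set bs" by (auto simp: set_conv_nth)
    have lin: "V.lincomb a (set bs) = (\<Oplus>\<^bsub>V\<^esub> i \<in> {..<length bs}. a (bs ! i) \<odot>\<^bsub>V\<^esub> (bs ! i))" for a
    proof -
      have "V.lincomb a ((!) bs ` {..<length bs}) = (\<Oplus>\<^bsub>V\<^esub> i \<in> {..<length bs}. a (bs ! i) \<odot>\<^bsub>V\<^esub> (bs ! i))"
        unfolding V.lincomb_def
        by (rule V.module.M.finsum_reindex) (use sub d in \<open>auto simp: img inj_on_nth intro!: V.module.smult_closed\<close>)
      then show ?thesis by (simp add: img)
    qed
    define F where "F a = Matrix.vec (length bs) (\<lambda>i. a (bs ! i))" for a :: "'v \<Rightarrow> complex"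
    define G where "G c = (\<lambda>x\<in>set bs. vec_index c (THE i. i < length bs \<and> bs ! i = x))" for c :: "complex vec"
    have the: "(THE i. i < length bs \<and> bs ! i = bs ! j) = j" if "j < length bs" for j
      using that d by (auto simp: nth_eq_iff_index_eq)
    have sub': "bs ! i \<in> carrier V" if "i < length bs" for i using sub that by auto
    have bij: "bij_betw F (set bs \<rightarrow>\<^sub>E UNIV) (carrier_vec (length bs))"
    proof (rule bij_betwI[where g = G])
      show "G (F a) = a" if "a \<in> set bs \<rightarrow>\<^sub>E UNIV" for a
        using that by (intro ext) (auto simp: F_def G_def set_conv_nth the PiE_def extensional_def)
      show "F (G c) = c" if "c \<in> carrier_vec (length bs)" for c
        using that by (intro eq_vecI) (auto simp: F_def G_def the)
    qed (auto simp: F_def G_def)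
    have linF: "V.lincomb a (set bs) = (\<Oplus>\<^bsub>V\<^esub> i \<in> {..<length bs}. vec_index (F a) i \<odot>\<^bsub>V\<^esub> (bs ! i))" for a
      unfolding lin by (rule V.module.M.finsum_cong') (auto simp: F_def sub')
    have "(\<exists>!a. a \<in> set bs \<rightarrow>\<^sub>E UNIV \<and> V.lincomb a (set bs) = x) \<longleftrightarrow>
        (\<exists>!c. c \<in> carrier_vec (length bs) \<and> x = (\<Oplus>\<^bsub>V\<^esub> i \<in> {..<length bs}. vec_index c i \<odot>\<^bsub>V\<^esub> (bs ! i)))" for x
      unfolding linF eq_commute[of x]
      by (rule bij_betw_ex1[OF bij, where P = "\<lambda>c. (\<Oplus>\<^bsub>V\<^esub> i \<in> {..<length bs}. vec_index c i \<odot>\<^bsub>V\<^esub> (bs ! i)) = x"])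
    then show ?thesis using V.basis_criterion[of "set bs"] sub by auto
  qed
  have vs: "vectorspace class_ring V \<longleftrightarrow> module class_ring V" for V :: "(complex, 'v, 'z) module_scheme"
    using class_field[where 'a = complex] by (auto simp: vectorspace_def)
  show iff: "ordered_basis V bs \<longleftrightarrow> based_space V bs"
  proof
    assume a: "ordered_basis V bs"
    then interpret V: vectorspace class_ring V by (simp add: ordered_basis_def)
    have sub: "set bs \<subseteq> carrier V" using a by (auto simp: ordered_basis_def V.basis_def)
    then show "based_space V bs"
      using a char[of V bs] by (intro based_space.intro based_space_axioms.intro) (auto simp: ordered_basis_def vs)
  next
    assume a: "based_space V bs"
    then interpret V: based_space V bs .
    show "ordered_basis V bs"
      using char[of V bs] V.distinct_bs V.bs_subset V.coords_ex1 V.module_axioms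
      by (auto simp: ordered_basis_def vs)
  qed
  assume a: "based_space V bs"
  with iff have o: "ordered_basis V bs" by simp
  then interpret V: vectorspace class_ring V by (simp add: ordered_basis_def)
  have "V.dim = card (set bs)" using o by (intro V.dim_basis) (auto simp: ordered_basis_def)
  then show "vectorspace.dim class_ring V = length bs"
    using o by (simp add: ordered_basis_def distinct_card)
qed

section \<open>Modules over an algebra with an ordered basis\<close>

locale based_algebra = ring A + alg: based_space A as
  for A :: "(complex, 'r, 'y) module_scheme" (structure) and as :: "'r list" +
  assumes smult_mult: "x \<in> carrier A \<Longrightarrow> y \<in> carrier A \<Longrightarrow> c \<odot> (x \<otimes> y) = (c \<odot> x) \<otimes> y"
    and mult_smult: "x \<in> carrier A \<Longrightarrow> y \<in> carrier A \<Longrightarrow> c \<odot> (x \<otimes> y) = x \<otimes> (c \<odot> y)"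
begin

lemma scalar_mult: "x \<in> carrier A \<Longrightarrow> (c \<odot> \<one>) \<otimes> x = c \<odot> x"
  and mult_scalar: "x \<in> carrier A \<Longrightarrow> x \<otimes> (c \<odot> \<one>) = c \<odot> x"
  using smult_mult[of \<one> x c] mult_smult[of x \<one> c] by simp_all

text \<open>The structure constants of the algebra.\<close>

definition str :: "nat \<Rightarrow> nat \<Rightarrow> nat \<Rightarrow> complex" where
  "str k l j = alg.coord j ((as ! k) \<otimes> (as ! l))"

end

lemma complex_space_simps [simp]:
  "carrier (complex_space A M) = carrier M" "add (complex_space A M) = add M" "zero (complex_space A M) = zero M"
  "c \<odot>\<^bsub>complex_space A M\<^esub> x = (c \<odot>\<^bsub>A\<^esub> \<one>\<^bsub>A\<^esub>) \<odot>\<^bsub>M\<^esub> x"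
  by (simp_all add: complex_space_def)

lemma left_module_complex:
  assumes "based_algebra A as" "left_module A M"
  shows "module class_ring (complex_space A M)"
proof -
  interpret A: based_algebra A as by fact
  interpret M: left_module A M by fact
  have [simp]: "c \<odot>\<^bsub>A\<^esub> \<one>\<^bsub>A\<^esub> \<in> carrier A" for c by simp
  show ?thesis
  proof (rule moduleI)
    show "abelian_group (complex_space A M)"
      by (rule abelian_group_transfer[OF M.M.abelian_group_axioms]) simp_all
    fix a b x y assume x: "x \<in> carrier (complex_space A M)"
    show "(a \<oplus>\<^bsub>class_ring\<^esub> b) \<odot>\<^bsub>complex_space A M\<^esub> x =
        a \<odot>\<^bsub>complex_space A M\<^esub> x \<oplus>\<^bsub>complex_space A M\<^esub> b \<odot>\<^bsub>complex_space A M\<^esub> x"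
      using x by (simp add: A.alg.complex_module(3) M.smult_l_distr)
    show "(a \<otimes>\<^bsub>class_ring\<^esub> b) \<odot>\<^bsub>complex_space A M\<^esub> x =
        a \<odot>\<^bsub>complex_space A M\<^esub> (b \<odot>\<^bsub>complex_space A M\<^esub> x)"
      using x by (simp add: A.alg.complex_module(2) M.smult_assoc1[symmetric] A.scalar_mult)
    show "\<one>\<^bsub>class_ring\<^esub> \<odot>\<^bsub>complex_space A M\<^esub> x = x"
      using x by (simp add: A.alg.complex_module(5) M.smult_one)
  qed (use class_cring.is_cring in \<open>simp_all add: M.smult_closed M.smult_r_distr\<close>)
qed

locale algebra_module = alg: based_algebra A as + mod: left_module A M
  for A :: "(complex, 'r, 'y) module_scheme" and as :: "'r list"
    and M :: "('r, 'm, 'z) module_scheme" (structure)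
begin

abbreviation "V \<equiv> complex_space A M"

lemma V_module: "module class_ring V"
  by (rule left_module_complex[OF alg.based_algebra_axioms mod.left_module_axioms])

lemmas V_ops = complex_module_ops[OF V_module]

lemma act_scalar:
  "a \<in> carrier A \<Longrightarrow> x \<in> carrier M \<Longrightarrow> (c \<odot>\<^bsub>A\<^esub> a) \<odot> x = c \<odot>\<^bsub>V\<^esub> (a \<odot> x)"
  "a \<in> carrier A \<Longrightarrow> x \<in> carrier M \<Longrightarrow> a \<odot> (c \<odot>\<^bsub>V\<^esub> x) = c \<odot>\<^bsub>V\<^esub> (a \<odot> x)"
  by (simp_all add: mod.smult_assoc1[symmetric] alg.scalar_mult alg.mult_scalar)

lemma act_linear: "a \<in> carrier A \<Longrightarrow> (\<lambda>x. a \<odot> x) \<in> module_hom class_ring V V"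
  using act_scalar(2) by (auto simp: module_hom_def mod.smult_closed mod.smult_r_distr)

lemma finsum_V: "f \<in> S \<rightarrow> carrier M \<Longrightarrow> finsum V f S = finsum M f S"
proof (rule finsum_transfer[OF _ mod.M.abelian_monoid_axioms])
  interpret V: module class_ring V by (rule V_module)
  show "abelian_monoid V" by (rule V.M.abelian_monoid_axioms)
qed simp_all

lemma act_zero: "x \<in> carrier M \<Longrightarrow> \<zero>\<^bsub>A\<^esub> \<odot> x = \<zero>"
  and act_r_zero: "a \<in> carrier A \<Longrightarrow> a \<odot> \<zero> = \<zero>"
proof -
  assume x: "x \<in> carrier M"
  have "\<zero>\<^bsub>A\<^esub> = 0 \<odot>\<^bsub>A\<^esub> \<one>\<^bsub>A\<^esub>" by (simp add: alg.alg.complex_module(6))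
  then show "\<zero>\<^bsub>A\<^esub> \<odot> x = \<zero>" using x V_ops(6)[of x] by simp
next
  assume a: "a \<in> carrier A"
  have "a \<odot> (0 \<odot>\<^bsub>V\<^esub> \<zero>) = 0 \<odot>\<^bsub>V\<^esub> (a \<odot> \<zero>)"
    by (rule act_scalar(2)[OF a]) simp
  then show "a \<odot> \<zero> = \<zero>"
    using V_ops(6)[of "\<zero>"] V_ops(6)[of "a \<odot> \<zero>"] a by (simp add: mod.smult_closed)
qed

lemma act_finsum:
  assumes "f \<in> S \<rightarrow> carrier A" "x \<in> carrier M"
  shows "(finsum A f S) \<odot> x = (\<Oplus>s\<in>S. f s \<odot> x)"
  by (rule additive_finsum[OF alg.abelian_monoid_axioms mod.M.abelian_monoid_axioms])
    (use assms in \<open>auto simp: mod.smult_closed mod.smult_l_distr act_zero\<close>)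

lemma act_finsum_right:
  assumes "f \<in> S \<rightarrow> carrier M" "a \<in> carrier A"
  shows "a \<odot> (finsum M f S) = (\<Oplus>s\<in>S. a \<odot> f s)"
  by (rule additive_finsum[OF mod.M.abelian_monoid_axioms mod.M.abelian_monoid_axioms])
    (use assms in \<open>auto simp: mod.smult_closed mod.smult_r_distr act_r_zero\<close>)

end

locale based_module = algebra_module A as M + V: based_space "complex_space A M" bs
  for A :: "(complex, 'r, 'y) module_scheme" and as :: "'r list"
    and M :: "('r, 'm, 'z) module_scheme" (structure) and bs :: "'m list"
begin

lemma coord_finsum_M:
  assumes "i < length bs" "f \<in> S \<rightarrow> carrier M"
  shows "V.coord i (finsum M f S) = (\<Sum>s\<in>S. V.coord i (f s))"
  unfolding finsum_V[OF assms(2), symmetric] by (rule V.coord_finsum) (use assms in simp_all)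

definition action_matrix :: "'r \<Rightarrow> complex mat" where
  "action_matrix a = matrix_of V bs (\<lambda>x. a \<odot> x)"

lemma action_matrix_representation: "matrix_of V bs (representation M a) = action_matrix a"
  unfolding action_matrix_def by (rule V.matrix_of_cong) (use V.bs_closed in \<open>simp add: representation_def\<close>)

lemma action_matrix_carrier [simp]: "action_matrix a \<in> carrier_mat (length bs) (length bs)"
  by (simp add: action_matrix_def)

lemma coords_act: "a \<in> carrier A \<Longrightarrow> x \<in> carrier M \<Longrightarrow> coords V bs (a \<odot> x) = action_matrix a *\<^sub>v coords V bs x"
  unfolding action_matrix_def using V.coords_linear[OF act_linear] by simp

lemma action_matrix_index: "i < length bs \<Longrightarrow> j < length bs \<Longrightarrow> action_matrix a $$ (i, j) = V.coord i (a \<odot> (bs ! j))"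
  by (simp add: action_matrix_def V.matrix_of_index)

lemma bs_in_M [simp]: "i < length bs \<Longrightarrow> bs ! i \<in> carrier M"
  using V.bs_closed by simp

lemma action_matrix_lc:
  assumes ij: "i < length bs" "j < length bs" and f: "\<And>k. k \<in> S \<Longrightarrow> f k \<in> carrier A"
  shows "action_matrix (\<Oplus>\<^bsub>A\<^esub>k\<in>S. c k \<odot>\<^bsub>A\<^esub> f k) $$ (i, j) = (\<Sum>k\<in>S. c k * action_matrix (f k) $$ (i, j))"
proof -
  have m: "(\<lambda>k. (c k \<odot>\<^bsub>A\<^esub> f k) \<odot> bs ! j) \<in> S \<rightarrow> carrier M"
    using f ij by (auto intro!: mod.smult_closed)
  have "(\<Oplus>\<^bsub>A\<^esub>k\<in>S. c k \<odot>\<^bsub>A\<^esub> f k) \<odot> bs ! j = (\<Oplus>k\<in>S. (c k \<odot>\<^bsub>A\<^esub> f k) \<odot> bs ! j)"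
    by (rule act_finsum) (use f ij in auto)
  also have "\<dots> = (\<Oplus>\<^bsub>V\<^esub>k\<in>S. (c k \<odot>\<^bsub>A\<^esub> f k) \<odot> bs ! j)" using finsum_V[OF m] by simp
  finally have "V.coord i ((\<Oplus>\<^bsub>A\<^esub>k\<in>S. c k \<odot>\<^bsub>A\<^esub> f k) \<odot> bs ! j) = (\<Sum>k\<in>S. V.coord i ((c k \<odot>\<^bsub>A\<^esub> f k) \<odot> bs ! j))"
    using V.coord_finsum[OF ij(1), of "\<lambda>k. (c k \<odot>\<^bsub>A\<^esub> f k) \<odot> bs ! j" S] m by simp
  also have "\<dots> = (\<Sum>k\<in>S. c k * V.coord i (f k \<odot> bs ! j))"
  proof (intro sum.cong refl)
    fix k assume "k \<in> S"
    then have "f k \<odot> bs ! j \<in> carrier V" using f ij by (simp add: mod.smult_closed)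
    then show "V.coord i ((c k \<odot>\<^bsub>A\<^esub> f k) \<odot> bs ! j) = c k * V.coord i (f k \<odot> bs ! j)"
      using act_scalar(1)[of "f k" "bs ! j" "c k"] V.coord_smult[OF ij(1)] f[OF \<open>k \<in> S\<close>] ij by simp
  qed
  finally show ?thesis using ij by (simp add: action_matrix_index)
qed

end

section \<open>The integral profile\<close>

context based_space
begin

abbreviation "E \<equiv> endo_space V"
abbreviation "nrm \<equiv> endo_norm V bs"

definition entry :: "nat \<Rightarrow> nat \<Rightarrow> ('v \<Rightarrow> 'v) \<Rightarrow> complex" where
  "entry i j T = matrix_of V bs T $$ (i, j)"

lemma entry_eq: "i < length bs \<Longrightarrow> j < length bs \<Longrightarrow> entry i j T = coord i (T (bs ! j))"
  by (simp add: entry_def matrix_of_index)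

lemma E_simps:
  "T \<in> carrier E \<longleftrightarrow> T \<in> module_hom class_ring V V \<and> T \<in> extensional (carrier V)"
  "S \<oplus>\<^bsub>E\<^esub> T = (\<lambda>x\<in>carrier V. S x \<oplus> T x)"
  "\<zero>\<^bsub>E\<^esub> = (\<lambda>x\<in>carrier V. \<zero>)"
  "c \<odot>\<^bsub>E\<^esub> T = (\<lambda>x\<in>carrier V. c \<odot> T x)"
  by (auto simp: endo_space_def)

lemma E_value: "T \<in> carrier E \<Longrightarrow> x \<in> carrier V \<Longrightarrow> T x \<in> carrier V"
  by (auto simp: E_simps module_hom_def)

lemma restrict_linear:
  "T \<in> module_hom class_ring V V \<Longrightarrow> restrict T (carrier V) \<in> carrier E"
  by (auto simp: E_simps module_hom_def)

lemma E_hom: "T \<in> carrier E \<Longrightarrow> x \<in> carrier V \<Longrightarrow> y \<in> carrier V \<Longrightarrow> T (x \<oplus> y) = T x \<oplus> T y"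
  "T \<in> carrier E \<Longrightarrow> x \<in> carrier V \<Longrightarrow> T (c \<odot> x) = c \<odot> T x"
  by (simp_all add: E_simps module_hom_def)

lemma E_add_closed:
  assumes S: "S \<in> carrier E" and T: "T \<in> carrier E"
  shows "S \<oplus>\<^bsub>E\<^esub> T \<in> carrier E"
  unfolding E_simps(2)
proof (rule restrict_linear, unfold module_hom_def, intro CollectI conjI allI impI funcsetI; (elim conjE)?)
  fix x y assume x: "x \<in> carrier V" and y: "y \<in> carrier V"
  note c = E_value[OF S x] E_value[OF T x] E_value[OF S y] E_value[OF T y]
  show "S x \<oplus> T x \<in> carrier V" using c by simp
  show "S (x \<oplus> y) \<oplus> T (x \<oplus> y) = S x \<oplus> T x \<oplus> (S y \<oplus> T y)"
    unfolding E_hom(1)[OF S x y] E_hom(1)[OF T x y] using c by (simp add: M.a_ac)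
  fix c :: complex
  show "S (c \<odot> x) \<oplus> T (c \<odot> x) = c \<odot> (S x \<oplus> T x)"
    unfolding E_hom(2)[OF S x] E_hom(2)[OF T x] by (rule complex_module(4)[OF E_value[OF S x] E_value[OF T x], symmetric])
qed

lemma E_smult_closed:
  assumes T: "T \<in> carrier E"
  shows "c \<odot>\<^bsub>E\<^esub> T \<in> carrier E"
  unfolding E_simps(4)
proof (rule restrict_linear, unfold module_hom_def, intro CollectI conjI allI impI funcsetI; (elim conjE)?)
  fix x y assume x: "x \<in> carrier V" and y: "y \<in> carrier V"
  note cl = E_value[OF T x] E_value[OF T y]
  show "c \<odot> T x \<in> carrier V" using cl by simp
  show "c \<odot> T (x \<oplus> y) = c \<odot> T x \<oplus> c \<odot> T y"
    unfolding E_hom(1)[OF T x y] by (rule complex_module(4)[OF cl])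
  fix b :: complex
  show "c \<odot> T (b \<odot> x) = b \<odot> (c \<odot> T x)"
    unfolding E_hom(2)[OF T x] complex_module(2)[OF cl(1), symmetric] by (simp add: mult.commute)
qed

lemma E_zero_closed: "\<zero>\<^bsub>E\<^esub> \<in> carrier E"
  unfolding E_simps(3) by (rule restrict_linear) (simp add: module_hom_def complex_module(7))

lemma entry_add: "i < length bs \<Longrightarrow> j < length bs \<Longrightarrow> S \<in> carrier E \<Longrightarrow> T \<in> carrier E \<Longrightarrow>
    entry i j (S \<oplus>\<^bsub>E\<^esub> T) = entry i j S + entry i j T"
  by (simp add: entry_eq E_simps(2) coord_add E_value)

lemma entry_smult: "i < length bs \<Longrightarrow> j < length bs \<Longrightarrow> T \<in> carrier E \<Longrightarrow>
    entry i j (c \<odot>\<^bsub>E\<^esub> T) = c * entry i j T"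
  by (simp add: entry_eq E_simps(4) coord_smult E_value)

lemma entry_zero: "i < length bs \<Longrightarrow> j < length bs \<Longrightarrow> entry i j \<zero>\<^bsub>E\<^esub> = 0"
  by (simp add: entry_eq E_simps(3) coord_zero)

lemma entry_eqI:
  assumes "S \<in> carrier E" "T \<in> carrier E"
    and "\<And>i j. i < length bs \<Longrightarrow> j < length bs \<Longrightarrow> entry i j S = entry i j T"
  shows "S = T"
proof (rule extensionalityI[of _ "carrier V"])
  show "S x = T x" if "x \<in> carrier V" for x
  proof (rule matrix_of_eqD[of S T])
    show "matrix_of V bs S = matrix_of V bs T"
      using assms(3) by (intro eq_matI) (auto simp: entry_def matrix_of_def)
  qed (use assms that in \<open>auto simp: E_simps\<close>)
qed (use assms in \<open>auto simp: E_simps\<close>)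

lemma E_abelian_group: "abelian_group E"
proof (rule abelian_groupI)
  fix S T U assume STU: "S \<in> carrier E" "T \<in> carrier E" "U \<in> carrier E"
  show "S \<oplus>\<^bsub>E\<^esub> T \<oplus>\<^bsub>E\<^esub> U = S \<oplus>\<^bsub>E\<^esub> (T \<oplus>\<^bsub>E\<^esub> U)"
    by (rule entry_eqI) (simp_all add: STU entry_add E_add_closed)
  show "S \<oplus>\<^bsub>E\<^esub> T = T \<oplus>\<^bsub>E\<^esub> S"
    by (rule entry_eqI) (simp_all add: STU entry_add E_add_closed)
  show "S \<oplus>\<^bsub>E\<^esub> T \<in> carrier E" using STU by (intro E_add_closed)
next
  fix S assume S: "S \<in> carrier E"
  have "(-1) \<odot>\<^bsub>E\<^esub> S \<oplus>\<^bsub>E\<^esub> S = \<zero>\<^bsub>E\<^esub>"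
    by (rule entry_eqI) (simp_all add: S entry_add entry_smult entry_zero E_add_closed E_smult_closed E_zero_closed)
  then show "\<exists>T\<in>carrier E. T \<oplus>\<^bsub>E\<^esub> S = \<zero>\<^bsub>E\<^esub>" using E_smult_closed[OF S] by blast
  show "\<zero>\<^bsub>E\<^esub> \<oplus>\<^bsub>E\<^esub> S = S"
    by (rule entry_eqI) (simp_all add: S entry_add entry_zero E_add_closed E_zero_closed)
qed (rule E_zero_closed)

sublocale E: abelian_group E by (rule E_abelian_group)

lemma entry_minus:
  assumes "i < length bs" "j < length bs" "S \<in> carrier E" "T \<in> carrier E"
  shows "entry i j (S \<ominus>\<^bsub>E\<^esub> T) = entry i j S - entry i j T"
proof -
  have "entry i j (T \<oplus>\<^bsub>E\<^esub> \<ominus>\<^bsub>E\<^esub> T) = 0"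
    using assms by (simp add: E.r_neg entry_zero)
  then have "entry i j (\<ominus>\<^bsub>E\<^esub> T) = - entry i j T"
    using assms by (simp add: entry_add eq_neg_iff_add_eq_0 add.commute)
  then show ?thesis using assms by (simp add: a_minus_def entry_add)
qed

lemma nrm_eq: "nrm T = (\<Sum>i<length bs. \<Sum>j<length bs. norm (entry i j T))"
  by (simp add: endo_norm_def entry_def)

lemma entry_le_nrm:
  assumes "i < length bs" "j < length bs"
  shows "norm (entry i j T) \<le> nrm T"
proof -
  have "norm (entry i j T) \<le> (\<Sum>j<length bs. norm (entry i j T))"
    using assms by (intro member_le_sum) auto
  also have "\<dots> \<le> nrm T"
    unfolding nrm_eq using assms
    by (intro member_le_sum[of i "{..<length bs}" "\<lambda>i. \<Sum>j<length bs. norm (entry i j T)"]) (auto intro!: sum_nonneg)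
  finally show ?thesis .
qed

lemma nrm_nonneg: "0 \<le> nrm T"
  unfolding nrm_eq by (intro sum_nonneg) auto

lemma nrm_minus:
  "S \<in> carrier E \<Longrightarrow> T \<in> carrier E \<Longrightarrow>
    nrm (S \<ominus>\<^bsub>E\<^esub> T) = (\<Sum>i<length bs. \<Sum>j<length bs. norm (entry i j S - entry i j T))"
  unfolding nrm_eq by (intro sum.cong refl) (simp add: entry_minus)

text \<open>An entry is additive on endomorphisms, so it passes through the finite sum over the values.\<close>

lemma entry_simple_integral:
  assumes "finite_measure \<mu>" and s: "s \<in> space \<mu> \<rightarrow> carrier E" "simple_function \<mu> s"
    and ij: "i < length bs" "j < length bs"
  shows "integrable \<mu> (\<lambda>x. entry i j (s x))"
    and "entry i j (simple_integral_in E \<mu> s) = (\<integral>x. entry i j (s x) \<partial>\<mu>)"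
    and "simple_integral_in E \<mu> s \<in> carrier E"
proof -
  interpret finite_measure \<mu> by fact
  let ?A = "\<lambda>y. {x \<in> space \<mu>. s x = y}"
  have fin: "finite (s ` space \<mu>)" using s(2) by (rule simple_functionD(1))
  have A: "?A y \<in> sets \<mu>" for y
  proof -
    have "?A y = s -` {y} \<inter> space \<mu>" by auto
    then show ?thesis using simple_functionD(2)[OF s(2)] by simp
  qed
  have rep: "entry i j (s x) = (\<Sum>y\<in>s ` space \<mu>. indicat_real (?A y) x *\<^sub>R entry i j y)" if "x \<in> space \<mu>" for x
  proof -
    have "(\<Sum>y\<in>s ` space \<mu>. indicat_real (?A y) x *\<^sub>R entry i j y) =
        (\<Sum>y\<in>s ` space \<mu>. if y = s x then entry i j y else 0)"
      using that by (intro sum.cong) (auto simp: indicator_def)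
    then show ?thesis using that fin by (simp add: sum.delta)
  qed
  have int: "integrable \<mu> (\<lambda>x. indicat_real (?A y) x *\<^sub>R entry i j y)" if "y \<in> s ` space \<mu>" for y
    using A by (intro integrable_scaleR_left) (auto simp: emeasure_finite less_top[symmetric])
  show "integrable \<mu> (\<lambda>x. entry i j (s x))"
    by (subst Bochner_Integration.integrable_cong[OF refl rep]) (auto intro!: Bochner_Integration.integrable_sum int)
  have "(\<integral>x. entry i j (s x) \<partial>\<mu>) = (\<integral>x. (\<Sum>y\<in>s ` space \<mu>. indicat_real (?A y) x *\<^sub>R entry i j y) \<partial>\<mu>)"
    by (intro Bochner_Integration.integral_cong refl rep)
  also have "\<dots> = (\<Sum>y\<in>s ` space \<mu>. \<integral>x. indicat_real (?A y) x *\<^sub>R entry i j y \<partial>\<mu>)"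
    by (rule Bochner_Integration.integral_sum) (rule int)
  also have "\<dots> = (\<Sum>y\<in>s ` space \<mu>. measure \<mu> (?A y) *\<^sub>R entry i j y)"
  proof (intro sum.cong refl)
    fix y
    have "integrable \<mu> (indicat_real (?A y))" using A by (intro integrable_real_indicator) (auto simp: emeasure_finite less_top[symmetric])
    then have "(\<integral>x. indicat_real (?A y) x *\<^sub>R entry i j y \<partial>\<mu>) = (\<integral>x. indicat_real (?A y) x \<partial>\<mu>) *\<^sub>R entry i j y"
      by (intro integral_scaleR_left)
    also have "(\<integral>x. indicat_real (?A y) x \<partial>\<mu>) = measure \<mu> (?A y)"
      by (subst Bochner_Integration.integral_indicator) (simp only: Int_absorb2[OF sets.sets_into_space[OF A]])
    finally show "(\<integral>x. indicat_real (?A y) x *\<^sub>R entry i j y \<partial>\<mu>) = measure \<mu> (?A y) *\<^sub>R entry i j y" .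
  qed
  finally have int_eq: "(\<integral>x. entry i j (s x) \<partial>\<mu>) = (\<Sum>y\<in>s ` space \<mu>. measure \<mu> (?A y) *\<^sub>R entry i j y)" .
  have cl: "(\<lambda>y. complex_of_real (measure \<mu> (?A y)) \<odot>\<^bsub>E\<^esub> y) \<in> s ` space \<mu> \<rightarrow> carrier E"
  proof (rule funcsetI)
    fix y assume "y \<in> s ` space \<mu>"
    then obtain x where "x \<in> space \<mu>" "y = s x" by (rule imageE)
    then have "y \<in> carrier E" using funcset_mem[OF s(1)] by simp
    then show "complex_of_real (measure \<mu> (?A y)) \<odot>\<^bsub>E\<^esub> y \<in> carrier E" by (rule E_smult_closed)
  qed
  then show "simple_integral_in E \<mu> s \<in> carrier E"
    unfolding simple_integral_in_def by (rule E.finsum_closed)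
  have "entry i j (simple_integral_in E \<mu> s) = (\<Sum>y\<in>s ` space \<mu>. entry i j (complex_of_real (measure \<mu> (?A y)) \<odot>\<^bsub>E\<^esub> y))"
    unfolding simple_integral_in_def
    by (rule additive_finsum_sum[OF E.abelian_monoid_axioms entry_zero[OF ij] entry_add[OF ij] cl])
  also have "\<dots> = (\<Sum>y\<in>s ` space \<mu>. measure \<mu> (?A y) *\<^sub>R entry i j y)"
  proof (intro sum.cong refl)
    fix y assume "y \<in> s ` space \<mu>"
    then obtain x where "x \<in> space \<mu>" "y = s x" by (rule imageE)
    then have "y \<in> carrier E" using funcset_mem[OF s(1)] by simp
    then show "entry i j (complex_of_real (measure \<mu> (?A y)) \<odot>\<^bsub>E\<^esub> y) = measure \<mu> (?A y) *\<^sub>R entry i j y"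
      by (simp add: entry_smult ij scaleR_conv_of_real)
  qed
  finally show "entry i j (simple_integral_in E \<mu> s) = (\<integral>x. entry i j (s x) \<partial>\<mu>)" using int_eq by simp
qed

text \<open>Each entry is bounded by the norm. Convergence in norm of the approximating simple functions and of
their integrals therefore gives the convergence of every entry, whose limit is known from the
ordinary integral.\<close>

lemma bochner_integral_entry_unique:
  assumes fm: "finite_measure \<mu>" and B: "has_bochner_integral_in E nrm \<mu> f y"
    and ij: "i < length bs" "j < length bs" and int: "integrable \<mu> (\<lambda>x. entry i j (f x))"
  shows "entry i j y = (\<integral>x. entry i j (f x) \<partial>\<mu>)"
proof -
  interpret finite_measure \<mu> by fact
  from B obtain s where f: "f \<in> space \<mu> \<rightarrow> carrier E" and y: "y \<in> carrier E"
    and s: "\<And>k. simple_integrable_in E \<mu> (s k)"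
    and meas: "\<And>k. (\<lambda>x. nrm (f x \<ominus>\<^bsub>E\<^esub> s k x)) \<in> borel_measurable \<mu>"
    and lim1: "(\<lambda>k. \<integral>\<^sup>+ x. ennreal (nrm (f x \<ominus>\<^bsub>E\<^esub> s k x)) \<partial>\<mu>) \<longlonglongrightarrow> 0"
    and lim2: "(\<lambda>k. nrm (simple_integral_in E \<mu> (s k) \<ominus>\<^bsub>E\<^esub> y)) \<longlonglongrightarrow> 0"
    unfolding has_bochner_integral_in_def by auto
  have sc: "s k \<in> space \<mu> \<rightarrow> carrier E" and sf: "simple_function \<mu> (s k)" for k
    using s[of k] by (auto simp: simple_integrable_in_def)
  note si = entry_simple_integral[OF fm sc sf ij]
  let ?I = "\<lambda>k. simple_integral_in E \<mu> (s k)"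
  have "(\<lambda>k. entry i j (?I k) - entry i j y) \<longlonglongrightarrow> 0"
  proof (rule Lim_null_comparison[OF _ lim2])
    show "\<forall>\<^sub>F k in sequentially. norm (entry i j (?I k) - entry i j y) \<le> nrm (?I k \<ominus>\<^bsub>E\<^esub> y)"
      using entry_le_nrm[OF ij] by (simp add: entry_minus[OF ij si(3) y, symmetric])
  qed
  moreover have "(\<lambda>k. entry i j (?I k)) \<longlonglongrightarrow> (\<integral>x. entry i j (f x) \<partial>\<mu>)"
    unfolding si(2)
  proof (rule tendsto_L1_int)
    show "(\<lambda>k. \<integral>\<^sup>+ x. ennreal (norm (entry i j (s k x) - entry i j (f x))) \<partial>\<mu>) \<longlonglongrightarrow> 0"
    proof (rule tendsto_sandwich[OF _ _ tendsto_const lim1])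
      show "\<forall>\<^sub>F k in sequentially. (\<integral>\<^sup>+ x. ennreal (norm (entry i j (s k x) - entry i j (f x))) \<partial>\<mu>)
          \<le> (\<integral>\<^sup>+ x. ennreal (nrm (f x \<ominus>\<^bsub>E\<^esub> s k x)) \<partial>\<mu>)"
      proof (intro always_eventually allI nn_integral_mono ennreal_leI)
        fix k x assume "x \<in> space \<mu>"
        then have "f x \<in> carrier E" "s k x \<in> carrier E" using funcset_mem[OF f] funcset_mem[OF sc] by simp_all
        then show "norm (entry i j (s k x) - entry i j (f x)) \<le> nrm (f x \<ominus>\<^bsub>E\<^esub> s k x)"
          using entry_le_nrm[OF ij, of "f x \<ominus>\<^bsub>E\<^esub> s k x"] by (simp add: entry_minus[OF ij] norm_minus_commute)
      qed
    qed auto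
  qed (use int si(1) in auto)
  ultimately have "(\<lambda>k. entry i j (?I k) - (entry i j (?I k) - entry i j y)) \<longlonglongrightarrow> (\<integral>x. entry i j (f x) \<partial>\<mu>) - 0"
    by (intro tendsto_diff)
  then show ?thesis by (simp add: LIMSEQ_const_iff)
qed

text \<open>Uniform approximation by simple functions suffices for existence because the measure is finite; by
\<open>bochner_integral_entry_unique\<close> every candidate has the entrywise integrals as its matrix.\<close>

lemma bochner_integral_entry:
  assumes fm: "finite_measure \<mu>" and f: "f \<in> space \<mu> \<rightarrow> carrier E"
    and int: "\<And>i j. i < length bs \<Longrightarrow> j < length bs \<Longrightarrow> integrable \<mu> (\<lambda>x. entry i j (f x))"
    and s: "\<And>k. s k \<in> space \<mu> \<rightarrow> carrier E" "\<And>k. simple_function \<mu> (s k)"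
    and approx: "\<And>i j k x. i < length bs \<Longrightarrow> j < length bs \<Longrightarrow> x \<in> space \<mu> \<Longrightarrow>
      norm (entry i j (f x) - entry i j (s k x)) \<le> C / real (Suc k)"
    and ij: "i < length bs" "j < length bs"
  shows "matrix_of V bs (bochner_integral_in E nrm \<mu> f) $$ (i, j) = (\<integral>x. entry i j (f x) \<partial>\<mu>)"
proof -
  interpret finite_measure \<mu> by fact
  define n where "n = length bs"
  define y where "y = restrict (endo_of (Matrix.mat n n (\<lambda>(i, j). \<integral>x. entry i j (f x) \<partial>\<mu>))) (carrier V)"
  have yE: "y \<in> carrier E" unfolding y_def by (intro restrict_linear endo_of_linear)
  have y_entry: "entry i j y = (\<integral>x. entry i j (f x) \<partial>\<mu>)" if "i < length bs" "j < length bs" for i j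
  proof -
    have "matrix_of V bs y = matrix_of V bs (endo_of (Matrix.mat n n (\<lambda>(i, j). \<integral>x. entry i j (f x) \<partial>\<mu>)))"
      unfolding y_def by (rule matrix_of_cong) auto
    also have "\<dots> = Matrix.mat n n (\<lambda>(i, j). \<integral>x. entry i j (f x) \<partial>\<mu>)"
      by (rule matrix_of_endo_of) (simp add: n_def)
    finally show ?thesis using that by (simp add: entry_def n_def)
  qed
  have lim0: "(\<lambda>k. K / real (Suc k)) \<longlonglongrightarrow> 0" for K
    by (rule LIMSEQ_Suc[of "\<lambda>k. K / real k"]) (rule lim_const_over_n)
  have bound: "nrm (f x \<ominus>\<^bsub>E\<^esub> s k x) \<le> (real n * real n * C) / real (Suc k)" if "x \<in> space \<mu>" for x k
  proof -
    have "f x \<in> carrier E" "s k x \<in> carrier E" using funcset_mem[OF f that] funcset_mem[OF s(1) that] by simp_all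
    then have "nrm (f x \<ominus>\<^bsub>E\<^esub> s k x) = (\<Sum>i<n. \<Sum>j<n. norm (entry i j (f x) - entry i j (s k x)))"
      unfolding n_def by (rule nrm_minus)
    also have "\<dots> \<le> (\<Sum>i<n. \<Sum>j<n. C / real (Suc k))"
      using that by (intro sum_mono approx) (auto simp: n_def)
    finally have "nrm (f x \<ominus>\<^bsub>E\<^esub> s k x) \<le> (\<Sum>i<n. \<Sum>j<n. C / real (Suc k))" .
    then show ?thesis by (simp add: mult.assoc)
  qed
  note si = entry_simple_integral[OF fm s]
  have B: "has_bochner_integral_in E nrm \<mu> f y"
    unfolding has_bochner_integral_in_def
  proof (intro conjI f yE exI[of _ s] allI)
    show "simple_integrable_in E \<mu> (s k)" for k
      using s[of k] by (auto simp: simple_integrable_in_def emeasure_finite)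
    show "(\<lambda>x. nrm (f x \<ominus>\<^bsub>E\<^esub> s k x)) \<in> borel_measurable \<mu>" for k
    proof -
      have "(\<lambda>x. \<Sum>i<length bs. \<Sum>j<length bs. norm (entry i j (f x) - entry i j (s k x))) \<in> borel_measurable \<mu>"
        using int si(1) by (intro borel_measurable_sum borel_measurable_norm borel_measurable_diff
            borel_measurable_integrable) auto
      moreover have "nrm (f x \<ominus>\<^bsub>E\<^esub> s k x) = (\<Sum>i<length bs. \<Sum>j<length bs. norm (entry i j (f x) - entry i j (s k x)))"
        if "x \<in> space \<mu>" for x
        using funcset_mem[OF f that] funcset_mem[OF s(1) that] by (intro nrm_minus)
      ultimately show ?thesis by (simp cong: measurable_cong)
    qed
    show "(\<lambda>k. \<integral>\<^sup>+ x. ennreal (nrm (f x \<ominus>\<^bsub>E\<^esub> s k x)) \<partial>\<mu>) \<longlonglongrightarrow> 0"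
    proof (rule tendsto_sandwich[OF _ _ tendsto_const])
      show "\<forall>\<^sub>F k in sequentially. (\<integral>\<^sup>+ x. ennreal (nrm (f x \<ominus>\<^bsub>E\<^esub> s k x)) \<partial>\<mu>)
          \<le> ennreal ((real n * real n * \<bar>C\<bar> * measure \<mu> (space \<mu>)) / real (Suc k))"
      proof (intro always_eventually allI)
        fix k
        have "(\<integral>\<^sup>+ x. ennreal (nrm (f x \<ominus>\<^bsub>E\<^esub> s k x)) \<partial>\<mu>) \<le> (\<integral>\<^sup>+ x. ennreal ((real n * real n * \<bar>C\<bar>) / real (Suc k)) \<partial>\<mu>)"
        proof (intro nn_integral_mono ennreal_leI)
          fix x assume "x \<in> space \<mu>"
          note bound[OF this, of k]
          also have "(real n * real n * C) / real (Suc k) \<le> (real n * real n * \<bar>C\<bar>) / real (Suc k)"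
            by (intro divide_right_mono mult_left_mono) auto
          finally show "nrm (f x \<ominus>\<^bsub>E\<^esub> s k x) \<le> (real n * real n * \<bar>C\<bar>) / real (Suc k)" .
        qed
        also have "\<dots> = ennreal ((real n * real n * \<bar>C\<bar>) / real (Suc k) * measure \<mu> (space \<mu>))"
          by (simp add: emeasure_eq_measure ennreal_mult''[symmetric])
        finally show "(\<integral>\<^sup>+ x. ennreal (nrm (f x \<ominus>\<^bsub>E\<^esub> s k x)) \<partial>\<mu>)
          \<le> ennreal ((real n * real n * \<bar>C\<bar> * measure \<mu> (space \<mu>)) / real (Suc k))" by simp
      qed
      show "(\<lambda>k. ennreal ((real n * real n * \<bar>C\<bar> * measure \<mu> (space \<mu>)) / real (Suc k))) \<longlonglongrightarrow> 0"
        using tendsto_ennrealI[OF lim0[of "real n * real n * \<bar>C\<bar> * measure \<mu> (space \<mu>)"]] unfolding ennreal_0 .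
    qed auto
    show "(\<lambda>k. nrm (simple_integral_in E \<mu> (s k) \<ominus>\<^bsub>E\<^esub> y)) \<longlonglongrightarrow> 0"
    proof (rule Lim_null_comparison[OF _ lim0])
      show "\<forall>\<^sub>F k in sequentially. norm (nrm (simple_integral_in E \<mu> (s k) \<ominus>\<^bsub>E\<^esub> y))
          \<le> (real n * real n * (C * measure \<mu> (space \<mu>))) / real (Suc k)"
      proof (intro always_eventually allI)
        fix k
        have "norm (entry i j (simple_integral_in E \<mu> (s k)) - entry i j y) \<le> C / real (Suc k) * measure \<mu> (space \<mu>)"
          if ij: "i < length bs" "j < length bs" for i j
        proof -
          have "entry i j (simple_integral_in E \<mu> (s k)) - entry i j y = (\<integral>x. entry i j (s k x) - entry i j (f x) \<partial>\<mu>)"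
            using si(1,2)[OF ij] int[OF ij] by (simp add: y_entry[OF ij])
          also have "norm \<dots> \<le> (\<integral>x. norm (entry i j (s k x) - entry i j (f x)) \<partial>\<mu>)"
            by (rule integral_norm_bound)
          also have "\<dots> \<le> (\<integral>x. C / real (Suc k) \<partial>\<mu>)"
          proof (rule integral_mono)
            show "integrable \<mu> (\<lambda>x. norm (entry i j (s k x) - entry i j (f x)))"
              using si(1)[OF ij] int[OF ij] by auto
            fix x assume "x \<in> space \<mu>"
            then show "norm (entry i j (s k x) - entry i j (f x)) \<le> C / real (Suc k)"
              using approx[OF ij, of x k] by (simp add: norm_minus_commute)
          qed auto
          finally show ?thesis by (simp add: mult.commute)
        qed
        note single = this
        have "nrm (simple_integral_in E \<mu> (s k) \<ominus>\<^bsub>E\<^esub> y) \<le> (\<Sum>i<n. \<Sum>j<n. C / real (Suc k) * measure \<mu> (space \<mu>))"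
          if "n > 0"
        proof -
          have "nrm (simple_integral_in E \<mu> (s k) \<ominus>\<^bsub>E\<^esub> y) =
              (\<Sum>i<n. \<Sum>j<n. norm (entry i j (simple_integral_in E \<mu> (s k)) - entry i j y))"
            using si(3)[of 0 0 k] that yE unfolding n_def by (intro nrm_minus)
          also have "\<dots> \<le> (\<Sum>i<n. \<Sum>j<n. C / real (Suc k) * measure \<mu> (space \<mu>))"
            by (intro sum_mono single) (auto simp: n_def)
          finally show ?thesis .
        qed
        moreover have "nrm (simple_integral_in E \<mu> (s k) \<ominus>\<^bsub>E\<^esub> y) = 0" if "n = 0"
          using that unfolding n_def nrm_eq by simp
        ultimately show "norm (nrm (simple_integral_in E \<mu> (s k) \<ominus>\<^bsub>E\<^esub> y))
          \<le> (real n * real n * (C * measure \<mu> (space \<mu>))) / real (Suc k)"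
          by (cases "n = 0") (auto simp: nrm_nonneg mult.assoc)
      qed
    qed
  qed
  have "bochner_integral_in E nrm \<mu> f = y"
    unfolding bochner_integral_in_def
  proof (rule the_equality)
    fix z assume z: "has_bochner_integral_in E nrm \<mu> f z"
    then have "z \<in> carrier E" by (simp add: has_bochner_integral_in_def)
    then show "z = y" using yE bochner_integral_entry_unique[OF fm z _ _ int] y_entry
      by (intro entry_eqI) auto
  qed (rule B)
  then show ?thesis using y_entry[OF ij] by (simp add: entry_def)
qed

end

definition box_lebesgue :: "nat \<Rightarrow> (nat \<Rightarrow> real) \<Rightarrow> (nat \<Rightarrow> real) measure" where
  "box_lebesgue d t = restrict_space (\<Pi>\<^sub>M i\<in>{..<d}. lborel) (\<Pi>\<^sub>E i\<in>{..<d}. {0..t i})"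

lemma box_sets:
  fixes d :: nat
  shows "(\<Pi>\<^sub>E i\<in>{..<d}. {0..t i}) \<in> sets (\<Pi>\<^sub>M i\<in>{..<d}. (lborel :: real measure))"
  by (intro sets_PiM_I_finite) auto

lemma space_box: "space (box_lebesgue d t) = (\<Pi>\<^sub>E i\<in>{..<d}. {0..t i})"
  unfolding box_lebesgue_def space_restrict_space by (auto simp: space_PiM PiE_def)

interpretation lborel_product: product_sigma_finite "\<lambda>i::nat. lborel :: real measure"
  by standard

lemma finite_measure_box:
  assumes "\<And>i. i < d \<Longrightarrow> 0 \<le> t i"
  shows "finite_measure (box_lebesgue d t)"
proof
  have "emeasure (box_lebesgue d t) (space (box_lebesgue d t)) = (\<Prod>i<d. ennreal (t i))"
    unfolding space_box using box_sets[of d t] assms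
    by (simp add: box_lebesgue_def emeasure_restrict_space lborel_product.emeasure_PiM)
  then show "emeasure (box_lebesgue d t) (space (box_lebesgue d t)) \<noteq> \<infinity>"
    by (simp add: ennreal_prod_eq_top)
qed

lemma box_component_measurable: "k < d \<Longrightarrow> (\<lambda>l. l k) \<in> borel_measurable (box_lebesgue d t)"
  unfolding box_lebesgue_def by (intro measurable_restrict_space1) auto

text \<open>By Fubini the factor \<open>t\<^sub>k\<close> of the volume is replaced by the integral \<open>t\<^sub>k\<^sup>2 / 2\<close> of the identity on
\<open>{0..t\<^sub>k}\<close>.\<close>

lemma box_coordinate_integral:
  assumes t: "\<And>i. i < d \<Longrightarrow> 0 \<le> t i" and k: "k < d"
  shows "integrable (box_lebesgue d t) (\<lambda>l. l k)" and "(\<integral>l. l k \<partial>box_lebesgue d t) = (\<Prod>i<d. t i) / 2 * t k"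
proof -
  define g where "g i x = indicat_real {0..t i} x * (if i = k then x else 1)" for i x
  have gi: "integrable lborel (g i)" if "i < d" for i
  proof (cases "i = k")
    case True
    have "integrable lborel (\<lambda>x. indicat_real {0..t i} x *\<^sub>R x)"
      by (rule borel_integrable_compact) (auto intro: continuous_intros)
    then show ?thesis using True by (simp add: g_def[abs_def])
  next
    case False
    have "integrable lborel (indicat_real {0..t i})" by (intro integrable_real_indicator) (auto simp: emeasure_lborel_Icc_eq)
    then show ?thesis using False by (simp add: g_def[abs_def])
  qed
  have gint: "(\<integral>x. g i x \<partial>lborel) = (if i = k then t i * t i / 2 else t i)" if "i < d" for i
  proof (cases "i = k")
    case True
    have "(\<integral>x. x * indicat_real {0..t i} x \<partial>lborel) = (t i)\<^sup>2 / 2 - 0\<^sup>2 / 2"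
      using t[OF that] by (intro integral_FTC_Icc_real[where F = "\<lambda>x. x\<^sup>2 / 2"]) (auto intro!: derivative_eq_intros)
    then show ?thesis using True by (simp add: g_def[abs_def] mult.commute power2_eq_square)
  next
    case False
    then show ?thesis using t[OF that] by (simp add: g_def[abs_def])
  qed
  have eq: "indicat_real (\<Pi>\<^sub>E i\<in>{..<d}. {0..t i}) l *\<^sub>R l k = (\<Prod>i<d. g i (l i))"
    if "l \<in> space (\<Pi>\<^sub>M i\<in>{..<d}. (lborel :: real measure))" for l
  proof -
    have "(\<Prod>i<d. g i (l i)) = (\<Prod>i<d. indicat_real {0..t i} (l i)) * (\<Prod>i<d. if i = k then l i else 1)"
      by (simp add: g_def prod.distrib)
    also have "(\<Prod>i<d. if i = k then l i else 1) = l k" using k by (simp add: prod.delta)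
    also have "(\<Prod>i<d. indicat_real {0..t i} (l i)) = indicat_real (\<Pi>\<^sub>E i\<in>{..<d}. {0..t i}) l"
      using that by (auto simp: indicator_def space_PiM PiE_def Pi_iff)
    finally show ?thesis by simp
  qed
  have pi: "integrable (\<Pi>\<^sub>M i\<in>{..<d}. lborel) (\<lambda>l. \<Prod>i<d. g i (l i))"
    by (rule lborel_product.product_integrable_prod) (auto intro: gi)
  have sets: "(\<Pi>\<^sub>E i\<in>{..<d}. {0..t i}) \<inter> space (\<Pi>\<^sub>M i\<in>{..<d}. (lborel :: real measure)) \<in> sets (\<Pi>\<^sub>M i\<in>{..<d}. lborel)"
    using box_sets by (intro sets.Int) auto
  show "integrable (box_lebesgue d t) (\<lambda>l. l k)"
    unfolding box_lebesgue_def integrable_restrict_space[OF sets]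
    by (subst Bochner_Integration.integrable_cong[OF refl eq]) (auto intro: pi)
  have "(\<integral>l. l k \<partial>box_lebesgue d t) = (\<integral>l. indicat_real (\<Pi>\<^sub>E i\<in>{..<d}. {0..t i}) l *\<^sub>R l k \<partial>(\<Pi>\<^sub>M i\<in>{..<d}. lborel))"
    unfolding box_lebesgue_def by (rule integral_restrict_space[OF sets])
  also have "\<dots> = (\<integral>l. (\<Prod>i<d. g i (l i)) \<partial>(\<Pi>\<^sub>M i\<in>{..<d}. lborel))"
    by (rule Bochner_Integration.integral_cong[OF refl eq])
  also have "\<dots> = (\<Prod>i<d. \<integral>x. g i x \<partial>lborel)"
    by (rule lborel_product.product_integral_prod) (auto intro: gi)
  also have "\<dots> = (\<Prod>i<d. if i = k then t i * t i / 2 else t i)"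
    by (intro prod.cong) (auto simp: gint)
  also have "\<dots> = (\<Prod>i<d. t i * (if i = k then t i / 2 else 1))"
    by (intro prod.cong) auto
  also have "\<dots> = (\<Prod>i<d. t i) * (t k / 2)"
    using k by (simp add: prod.distrib prod.delta)
  finally show "(\<integral>l. l k \<partial>box_lebesgue d t) = (\<Prod>i<d. t i) / 2 * t k" by simp
qed

text \<open>Rounding down to a grid takes finitely many values on a bounded box; this provides the
simple functions approximating the representation.\<close>

lemma simple_function_box_floor:
  fixes c :: real
  assumes c: "c > 0"
  shows "simple_function (box_lebesgue d t) (\<lambda>l. \<lambda>i\<in>{..<d}. \<lfloor>c * l i\<rfloor>)"
  unfolding simple_function_def
proof (intro conjI ballI)
  let ?r = "\<lambda>l. \<lambda>i\<in>{..<d}. \<lfloor>c * l i\<rfloor>"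
  have "?r ` space (box_lebesgue d t) \<subseteq> (\<Pi>\<^sub>E i\<in>{..<d}. {0..\<lfloor>c * t i\<rfloor>})"
  proof (intro image_subsetI PiE_I)
    fix l i assume l: "l \<in> space (box_lebesgue d t)" and i: "i \<in> {..<d}"
    have "l i \<in> {0..t i}" using PiE_mem[OF l[unfolded space_box] i] .
    then have "0 \<le> l i" "l i \<le> t i" by simp_all
    then have "0 \<le> c * l i" "c * l i \<le> c * t i" using c by auto
    then show "?r l i \<in> {0..\<lfloor>c * t i\<rfloor>}" using i floor_mono[of "c * l i" "c * t i"] by simp
  qed simp
  then show "finite (?r ` space (box_lebesgue d t))"
    by (rule finite_subset) (auto intro: finite_PiE)
  fix y assume "y \<in> ?r ` space (box_lebesgue d t)"
  then have y: "y \<in> extensional {..<d}" by (elim imageE) simp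
  have m: "(\<lambda>l. \<lfloor>c * l i\<rfloor>) \<in> measurable (box_lebesgue d t) (count_space UNIV)" if "i < d" for i
    using box_component_measurable[OF that, of t] by measurable
  have "?r -` {y} \<inter> space (box_lebesgue d t) = {l \<in> space (box_lebesgue d t). \<forall>i\<in>{..<d}. \<lfloor>c * l i\<rfloor> = y i}"
  proof (intro equalityI subsetI)
    fix l assume l: "l \<in> {l \<in> space (box_lebesgue d t). \<forall>i\<in>{..<d}. \<lfloor>c * l i\<rfloor> = y i}"
    have "?r l = y" by (rule extensionalityI[OF _ y]) (use l in auto)
    then show "l \<in> ?r -` {y} \<inter> space (box_lebesgue d t)" using l by simp
  qed auto
  also have "\<dots> \<in> sets (box_lebesgue d t)"
  proof (rule sets.sets_Collect_finite_All)
    fix i assume "i \<in> {..<d}"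
    then have "(\<lambda>l. \<lfloor>c * l i\<rfloor>) -` {y i} \<inter> space (box_lebesgue d t) \<in> sets (box_lebesgue d t)"
      by (intro measurable_sets[OF m]) auto
    moreover have "(\<lambda>l. \<lfloor>c * l i\<rfloor>) -` {y i} \<inter> space (box_lebesgue d t) = {l \<in> space (box_lebesgue d t). \<lfloor>c * l i\<rfloor> = y i}"
      by auto
    ultimately show "{l \<in> space (box_lebesgue d t). \<lfloor>c * l i\<rfloor> = y i} \<in> sets (box_lebesgue d t)" by simp
  qed auto
  finally show "?r -` {y} \<inter> space (box_lebesgue d t) \<in> sets (box_lebesgue d t)" .
qed

lemma box_measure_eq:
  "box_measure A as t = embed_measure (box_lebesgue (length as) t) (\<lambda>l. \<Oplus>\<^bsub>A\<^esub> i \<in> {..<length as}. complex_of_real (l i) \<odot>\<^bsub>A\<^esub> (as ! i))"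
  by (simp add: box_measure_def box_lebesgue_def)

text \<open>In the coordinates of the box the entries of the representation are linear forms, hence integrable
and uniformly approximated by their values at grid points.\<close>

lemma (in based_module) integral_profile_eq:
  assumes t: "\<And>i. i < length as \<Longrightarrow> 0 \<le> t i"
    and ij: "i < length bs" "j < length bs"
  shows "integral_profile A as M bs t $$ (i, j) =
    complex_of_real ((\<Prod>k<length as. t k) / 2) * (\<Sum>k<length as. complex_of_real (t k) * action_matrix (as ! k) $$ (i, j))"
proof -
  define d where "d = length as"
  define h where "h l = (\<Oplus>\<^bsub>A\<^esub> i \<in> {..<d}. complex_of_real (l i) \<odot>\<^bsub>A\<^esub> (as ! i))" for l :: "nat \<Rightarrow> real"
  define \<mu> where "\<mu> = embed_measure (box_lebesgue d t) h"
  have hA: "h l \<in> carrier A" for l unfolding h_def d_def by simp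
  have coord_h: "alg.alg.coord k (h l) = complex_of_real (l k)" if "k < d" for k l
    using that unfolding h_def d_def by (rule alg.alg.coord_lc)
  have inj: "inj_on h (space (box_lebesgue d t))"
  proof (rule inj_onI)
    fix l l' assume l: "l \<in> space (box_lebesgue d t)" "l' \<in> space (box_lebesgue d t)" and "h l = h l'"
    show "l = l'"
    proof (rule PiE_ext[OF l[unfolded space_box]])
      fix k assume "k \<in> {..<d}"
      then show "l k = l' k" using coord_h[of k l] coord_h[of k l'] \<open>h l = h l'\<close> by simp
    qed
  qed
  have space: "space \<mu> = h ` space (box_lebesgue d t)" unfolding \<mu>_def by (rule space_embed_measure)
  interpret box_lebesgue: finite_measure "box_lebesgue d t" using t by (intro finite_measure_box) (simp add: d_def)
  have distr: "\<mu> = distr (box_lebesgue d t) \<mu> h" unfolding \<mu>_def by (rule embed_measure_eq_distr'[OF inj])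
  have hm: "h \<in> measurable (box_lebesgue d t) \<mu>" unfolding \<mu>_def by (rule measurable_embed_measure2'[OF inj])
  have fm: "finite_measure \<mu>" by (subst distr) (rule box_lebesgue.finite_measure_distr[OF hm])
  let ?\<rho> = "representation M"
  have rho: "?\<rho> a \<in> carrier V.E" if "a \<in> carrier A" for a
    using V.restrict_linear[OF act_linear[OF that]] by (simp add: representation_def)
  have entry_rho: "V.entry i j (?\<rho> a) = action_matrix a $$ (i, j)" for i j a
    by (simp add: V.entry_def action_matrix_representation)
  have entry_h: "V.entry i j (?\<rho> (h l)) = (\<Sum>k<d. complex_of_real (l k) * action_matrix (as ! k) $$ (i, j))"
    if "i < length bs" "j < length bs" for i j l
    unfolding entry_rho h_def using that by (intro action_matrix_lc) (auto simp: d_def)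
  have int_box: "integrable (box_lebesgue d t) (\<lambda>l. \<Sum>k<d. complex_of_real (l k) * action_matrix (as ! k) $$ (i, j))" for i j
    using box_coordinate_integral(1)[of d t] t
    by (intro Bochner_Integration.integrable_sum integrable_mult_left integrable_of_real) (auto simp: d_def)
  have meas_entry: "(\<lambda>x. V.entry i j (?\<rho> x)) \<in> borel_measurable \<mu>" if "i < length bs" "j < length bs" for i j
    unfolding \<mu>_def
  proof (rule measurable_embed_measure1)
    show "(\<lambda>l. V.entry i j (?\<rho> (h l))) \<in> borel_measurable (box_lebesgue d t)"
      unfolding entry_h[OF that] using int_box by (rule borel_measurable_integrable)
  qed
  have int: "integrable \<mu> (\<lambda>x. V.entry i j (?\<rho> x))" if "i < length bs" "j < length bs" for i j
    by (subst distr, subst integrable_distr_eq[OF hm])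
      (use meas_entry[OF that] int_box entry_h[OF that] in simp_all)
  \<comment> \<open>Round to the grid of mesh \<open>1 / (k + 1)\<close>; \<open>Re\<close> recovers the real box coordinates from a point of the algebra.\<close>
  define r where "r k l = (\<lambda>i\<in>{..<d}. \<lfloor>real (Suc k) * l i\<rfloor>)" for k and l :: "nat \<Rightarrow> real"
  define G where "G k y = ?\<rho> (h (\<lambda>i. real_of_int (y i) / real (Suc k)))" for k and y :: "nat \<Rightarrow> int"
  define s where "s k x = G k (r k (\<lambda>i. Re (alg.alg.coord i x)))" for k x
  have r_h: "r k (\<lambda>i. Re (alg.alg.coord i (h l))) = r k l" for k l
    unfolding r_def by (rule restrict_ext) (simp add: coord_h)
  have s_h: "s k (h l) = G k (r k l)" for k l unfolding s_def r_h ..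
  have s_closed: "s k \<in> space \<mu> \<rightarrow> carrier V.E" for k
    unfolding s_def G_def by (intro funcsetI rho hA)
  have s_simple: "simple_function \<mu> (s k)" for k
    unfolding simple_function_def
  proof (intro conjI ballI)
    have sf: "simple_function (box_lebesgue d t) (\<lambda>l. G k (r k l))"
      using simple_function_compose[OF simple_function_box_floor[of "real (Suc k)" d t], of "G k"]
      by (simp add: r_def comp_def)
    have img: "s k ` space \<mu> = (\<lambda>l. G k (r k l)) ` space (box_lebesgue d t)"
      unfolding space image_image s_h ..
    show "finite (s k ` space \<mu>)" unfolding img using sf by (rule simple_functionD(1))
    fix y
    have "s k -` {y} \<inter> space \<mu> = h ` ((\<lambda>l. G k (r k l)) -` {y} \<inter> space (box_lebesgue d t))"
      unfolding space using s_h by auto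
    also have "\<dots> \<in> sets \<mu>"
      unfolding \<mu>_def by (rule in_sets_embed_measure) (rule simple_functionD(2)[OF sf])
    finally show "s k -` {y} \<inter> space \<mu> \<in> sets \<mu>" .
  qed
  define C where "C = (\<Sum>i<length bs. \<Sum>j<length bs. \<Sum>k<d. norm (action_matrix (as ! k) $$ (i, j)))"
  have approx: "norm (V.entry i j (?\<rho> x) - V.entry i j (s k x)) \<le> C / real (Suc k)"
    if ij: "i < length bs" "j < length bs" and x: "x \<in> space \<mu>" for i j k x
  proof -
    obtain l where l: "x = h l" using x space by blast
    have "V.entry i j (s k x) = (\<Sum>q<d. complex_of_real (real_of_int (r k l q) / real (Suc k)) * action_matrix (as ! q) $$ (i, j))"
      unfolding l s_h G_def by (rule entry_h[OF ij])
    then have "V.entry i j (?\<rho> x) - V.entry i j (s k x) =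
        (\<Sum>q<d. complex_of_real (l q - real_of_int (r k l q) / real (Suc k)) * action_matrix (as ! q) $$ (i, j))"
      unfolding l entry_h[OF ij] by (simp add: sum_subtractf[symmetric] left_diff_distrib)
    also have "norm \<dots> \<le> (\<Sum>q<d. 1 / real (Suc k) * norm (action_matrix (as ! q) $$ (i, j)))"
    proof (rule sum_norm_le)
      fix q assume q: "q \<in> {..<d}"
      have "\<bar>real (Suc k) * l q - real_of_int \<lfloor>real (Suc k) * l q\<rfloor>\<bar> \<le> 1" by linarith
      then have "\<bar>(real (Suc k) * l q - real_of_int \<lfloor>real (Suc k) * l q\<rfloor>) / real (Suc k)\<bar> \<le> 1 / real (Suc k)"
        unfolding abs_divide by (intro frac_le) auto
      also have "(real (Suc k) * l q - real_of_int \<lfloor>real (Suc k) * l q\<rfloor>) / real (Suc k) =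
          l q - real_of_int (r k l q) / real (Suc k)"
        using q by (simp add: r_def diff_divide_distrib del: of_nat_Suc)
      finally have "norm (complex_of_real (l q - real_of_int (r k l q) / real (Suc k))) \<le> 1 / real (Suc k)"
        by (simp only: norm_of_real)
      then show "norm (complex_of_real (l q - real_of_int (r k l q) / real (Suc k)) * action_matrix (as ! q) $$ (i, j))
          \<le> 1 / real (Suc k) * norm (action_matrix (as ! q) $$ (i, j))"
        unfolding norm_mult by (rule mult_right_mono) simp
    qed
    also have "\<dots> = (\<Sum>q<d. norm (action_matrix (as ! q) $$ (i, j))) / real (Suc k)"
      by (simp add: sum_divide_distrib)
    also have "\<dots> \<le> C / real (Suc k)"
    proof (rule divide_right_mono)
      have "(\<Sum>q<d. norm (action_matrix (as ! q) $$ (i, j))) \<le> (\<Sum>j<length bs. \<Sum>q<d. norm (action_matrix (as ! q) $$ (i, j)))"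
        using ij by (intro member_le_sum[of j "{..<length bs}" "\<lambda>j. \<Sum>q<d. norm (action_matrix (as ! q) $$ (i, j))"])
          (auto intro!: sum_nonneg)
      also have "\<dots> \<le> C" unfolding C_def using ij
        by (intro member_le_sum[of i "{..<length bs}" "\<lambda>i. \<Sum>j<length bs. \<Sum>q<d. norm (action_matrix (as ! q) $$ (i, j))"])
          (auto intro!: sum_nonneg)
      finally show "(\<Sum>q<d. norm (action_matrix (as ! q) $$ (i, j))) \<le> C" .
    qed simp
    finally show ?thesis .
  qed
  have f: "?\<rho> \<in> space \<mu> \<rightarrow> carrier V.E" unfolding space using rho hA by auto
  have "integral_profile A as M bs t $$ (i, j) = (\<integral>x. V.entry i j (?\<rho> x) \<partial>\<mu>)"
    unfolding integral_profile_def Let_def box_measure_eq d_def[symmetric] h_def[symmetric, abs_def] \<mu>_def[symmetric]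
    by (rule V.bochner_integral_entry[OF fm f int s_closed s_simple approx ij])
  also have "\<dots> = (\<integral>l. V.entry i j (?\<rho> (h l)) \<partial>box_lebesgue d t)"
    by (subst distr, rule integral_distr[OF hm meas_entry[OF ij]])
  also have "\<dots> = (\<integral>l. (\<Sum>k<d. complex_of_real (l k) * action_matrix (as ! k) $$ (i, j)) \<partial>box_lebesgue d t)"
    unfolding entry_h[OF ij] ..
  also have "\<dots> = (\<Sum>k<d. (\<integral>l. complex_of_real (l k) \<partial>box_lebesgue d t) * action_matrix (as ! k) $$ (i, j))"
    using box_coordinate_integral(1)[of d t] t
    by (subst Bochner_Integration.integral_sum) (auto simp: d_def intro!: integrable_mult_left)
  also have "\<dots> = (\<Sum>k<d. complex_of_real ((\<Prod>i<d. t i) / 2 * t k) * action_matrix (as ! k) $$ (i, j))"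
  proof (intro sum.cong refl)
    fix k assume k: "k \<in> {..<d}"
    have "(\<integral>l. complex_of_real (l k) \<partial>box_lebesgue d t) = complex_of_real (\<integral>l. l k \<partial>box_lebesgue d t)"
      by (rule integral_complex_of_real)
    moreover have "(\<integral>l. l k \<partial>box_lebesgue d t) = (\<Prod>i<d. t i) / 2 * t k"
      by (rule box_coordinate_integral(2)) (use t k in \<open>simp_all add: d_def\<close>)
    ultimately show "(\<integral>l. complex_of_real (l k) \<partial>box_lebesgue d t) * action_matrix (as ! k) $$ (i, j) =
        complex_of_real ((\<Prod>i<d. t i) / 2 * t k) * action_matrix (as ! k) $$ (i, j)"
      by (simp only:)
  qed
  finally show ?thesis by (simp add: d_def sum_distrib_left mult.assoc)
qed

section \<open>Splitting data, linear combinations and block sums of matrices\<close>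

definition mat_lc :: "nat \<Rightarrow> nat \<Rightarrow> (nat \<Rightarrow> complex) \<Rightarrow> (nat \<Rightarrow> complex mat) \<Rightarrow> complex mat" where
  "mat_lc n d c F = Matrix.mat n n (\<lambda>(i, j). \<Sum>k<d. c k * F k $$ (i, j))"

lemma mat_lc_carrier [simp]: "mat_lc n d c F \<in> carrier_mat n n"
  by (simp add: mat_lc_def)

lemma mat_lc_index: "i < n \<Longrightarrow> j < n \<Longrightarrow> mat_lc n d c F $$ (i, j) = (\<Sum>k<d. c k * F k $$ (i, j))"
  by (simp add: mat_lc_def)

lemma mat_lc_cong: "(\<And>k. k < d \<Longrightarrow> c k = c' k) \<Longrightarrow> (\<And>k. k < d \<Longrightarrow> F k = F' k) \<Longrightarrow> mat_lc n d c F = mat_lc n d c' F'"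
  by (auto simp: mat_lc_def intro!: eq_matI sum.cong)

lemma mat_mult_index:
  assumes "X \<in> carrier_mat n m" "Y \<in> carrier_mat m p" "i < n" "j < p"
  shows "(X * Y) $$ (i, j) = (\<Sum>q<m. X $$ (i, q) * Y $$ (q, j))"
  using assms by (auto simp: scalar_prod_def atLeast0LessThan intro!: sum.cong)

lemma mult_mat_lc_left:
  assumes H: "H \<in> carrier_mat n n" and F: "\<And>k. k < d \<Longrightarrow> F k \<in> carrier_mat n n"
  shows "H * mat_lc n d c F = mat_lc n d c (\<lambda>k. H * F k)"
proof (rule eq_matI)
  fix i j assume "i < dim_row (mat_lc n d c (\<lambda>k. H * F k))" "j < dim_col (mat_lc n d c (\<lambda>k. H * F k))"
  then have ij: "i < n" "j < n" by (auto simp: mat_lc_def)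
  have "(H * mat_lc n d c F) $$ (i, j) = (\<Sum>q<n. \<Sum>k<d. H $$ (i, q) * (c k * F k $$ (q, j)))"
    using ij by (subst mat_mult_index[OF H mat_lc_carrier]) (auto simp: mat_lc_index sum_distrib_left)
  also have "\<dots> = (\<Sum>k<d. c k * (\<Sum>q<n. H $$ (i, q) * F k $$ (q, j)))"
    by (subst sum.swap) (simp add: sum_distrib_left mult_ac)
  also have "\<dots> = mat_lc n d c (\<lambda>k. H * F k) $$ (i, j)"
    using ij mat_mult_index[OF H F ij] by (auto simp: mat_lc_index intro!: sum.cong)
  finally show "(H * mat_lc n d c F) $$ (i, j) = mat_lc n d c (\<lambda>k. H * F k) $$ (i, j)" .
qed (use H in \<open>auto simp: mat_lc_def\<close>)

lemma mat_lc_transpose: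
  assumes "\<And>k. k < d \<Longrightarrow> F k \<in> carrier_mat n n"
  shows "(mat_lc n d c F)\<^sup>T = mat_lc n d c (\<lambda>k. (F k)\<^sup>T)"
proof (rule eq_matI)
  fix i j assume "i < dim_row (mat_lc n d c (\<lambda>k. (F k)\<^sup>T))" "j < dim_col (mat_lc n d c (\<lambda>k. (F k)\<^sup>T))"
  then have ij: "i < n" "j < n" by (auto simp: mat_lc_def)
  have "(F k)\<^sup>T $$ (i, j) = F k $$ (j, i)" if "k < d" for k using assms[OF that] ij by auto
  then show "(mat_lc n d c F)\<^sup>T $$ (i, j) = mat_lc n d c (\<lambda>k. (F k)\<^sup>T) $$ (i, j)"
    using ij by (simp add: mat_lc_def)
qed (auto simp: mat_lc_def)

lemma mult_mat_lc_right:
  assumes H: "H \<in> carrier_mat n n" and F: "\<And>k. k < d \<Longrightarrow> F k \<in> carrier_mat n n"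
  shows "mat_lc n d c F * H = mat_lc n d c (\<lambda>k. F k * H)"
proof (rule eq_matI)
  fix i j assume "i < dim_row (mat_lc n d c (\<lambda>k. F k * H))" "j < dim_col (mat_lc n d c (\<lambda>k. F k * H))"
  then have ij: "i < n" "j < n" by (auto simp: mat_lc_def)
  have "(mat_lc n d c F * H) $$ (i, j) = (\<Sum>q<n. \<Sum>k<d. c k * F k $$ (i, q) * H $$ (q, j))"
    using ij by (subst mat_mult_index[OF mat_lc_carrier H]) (auto simp: mat_lc_index sum_distrib_right)
  also have "\<dots> = (\<Sum>k<d. c k * (\<Sum>q<n. F k $$ (i, q) * H $$ (q, j)))"
    by (subst sum.swap) (simp add: sum_distrib_left mult_ac)
  also have "\<dots> = mat_lc n d c (\<lambda>k. F k * H) $$ (i, j)"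
    using ij mat_mult_index[OF F H ij] by (auto simp: mat_lc_index intro!: sum.cong)
  finally show "(mat_lc n d c F * H) $$ (i, j) = mat_lc n d c (\<lambda>k. F k * H) $$ (i, j)" .
qed (use H in \<open>auto simp: mat_lc_def\<close>)

lemma matrix_combination_eq:
  assumes "\<And>k. k < d \<Longrightarrow> F k \<in> carrier_mat n n"
  shows "matrix_combination n F d t = mat_lc n d (\<lambda>k. complex_of_real (t k)) F"
proof -
  let ?W = "module_mat TYPE(complex) n n"
  interpret W: abelian_group ?W
  proof (rule abelian_groupI)
    fix X assume "X \<in> carrier ?W"
    then show "\<exists>Y\<in>carrier ?W. Y \<oplus>\<^bsub>?W\<^esub> X = \<zero>\<^bsub>?W\<^esub>"
      by (intro bexI[of _ "- X"]) (simp_all add: module_mat_simps)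
  qed (auto simp: module_mat_simps assoc_add_mat[of _ n n] intro: comm_add_mat[of _ n n])
  have c: "(\<lambda>k. complex_of_real (t k) \<cdot>\<^sub>m F k) \<in> {..<d} \<rightarrow> carrier ?W"
    using assms by (auto simp: module_mat_def)
  have in_c: "finsum ?W (\<lambda>k. complex_of_real (t k) \<cdot>\<^sub>m F k) {..<d} \<in> carrier_mat n n"
    using W.finsum_closed[OF c] by (simp add: module_mat_def)
  show ?thesis
  proof (rule eq_matI)
    fix i j assume "i < dim_row (mat_lc n d (\<lambda>k. complex_of_real (t k)) F)" "j < dim_col (mat_lc n d (\<lambda>k. complex_of_real (t k)) F)"
    then have ij: "i < n" "j < n" by (auto simp: mat_lc_def)
    have "finsum ?W (\<lambda>k. complex_of_real (t k) \<cdot>\<^sub>m F k) {..<d} $$ (i, j) =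
        (\<Sum>k<d. (complex_of_real (t k) \<cdot>\<^sub>m F k) $$ (i, j))"
      by (rule additive_finsum_sum[OF W.abelian_monoid_axioms _ _ c, where h = "\<lambda>X. X $$ (i, j)"])
        (use ij in \<open>auto simp: module_mat_def\<close>)
    also have "\<dots> = (\<Sum>k<d. complex_of_real (t k) * F k $$ (i, j))"
    proof (intro sum.cong refl)
      fix k assume "k \<in> {..<d}"
      then have "F k \<in> carrier_mat n n" using assms by simp
      then show "(complex_of_real (t k) \<cdot>\<^sub>m F k) $$ (i, j) = complex_of_real (t k) * F k $$ (i, j)" using ij by simp
    qed
    finally show "matrix_combination n F d t $$ (i, j) = mat_lc n d (\<lambda>k. complex_of_real (t k)) F $$ (i, j)"
      using ij by (simp add: matrix_combination_def mat_lc_index)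
  qed (use in_c in \<open>auto simp: matrix_combination_def mat_lc_def\<close>)
qed

text \<open>The matrices \<open>S\<^sub>k\<close> describe a section \<open>x \<mapsto> \<Sum> a\<^sub>k \<otimes> S\<^sub>k x\<close> of the action map \<open>A \<otimes>\<^sub>\<complex> M \<rightarrow> M\<close>: the first
equation says that it is a section, the second that it commutes with the action of \<open>a\<^sub>l\<close>, where
\<open>c l k j\<close> is the \<open>j\<close>-th coordinate of \<open>a\<^sub>l a\<^sub>k\<close>.\<close>

definition splits :: "nat \<Rightarrow> (nat \<Rightarrow> nat \<Rightarrow> nat \<Rightarrow> complex) \<Rightarrow> nat \<Rightarrow> (nat \<Rightarrow> complex mat) \<Rightarrow> bool" where
  "splits d c n B \<longleftrightarrow> (\<exists>S. (\<forall>k<d. S k \<in> carrier_mat n n) \<and>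
     mat_lc n d (\<lambda>_. 1) (\<lambda>k. B k * S k) = 1\<^sub>m n \<and>
     (\<forall>j<d. \<forall>l<d. S j * B l = mat_lc n d (\<lambda>k. c l k j) S))"

lemma splits_similar:
  assumes H: "H \<in> carrier_mat n n" and G: "G \<in> carrier_mat n n" and HG: "H * G = 1\<^sub>m n" and GH: "G * H = 1\<^sub>m n"
    and B: "\<And>k. k < d \<Longrightarrow> B k \<in> carrier_mat n n" and D: "\<And>k. k < d \<Longrightarrow> D k \<in> carrier_mat n n"
    and BH: "\<And>k. k < d \<Longrightarrow> B k * H = H * D k" and "splits d c n D"
  shows "splits d c n B"
proof -
  obtain S where S: "\<And>k. k < d \<Longrightarrow> S k \<in> carrier_mat n n"
    and S1: "mat_lc n d (\<lambda>_. 1) (\<lambda>k. D k * S k) = 1\<^sub>m n"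
    and S2: "\<And>j l. j < d \<Longrightarrow> l < d \<Longrightarrow> S j * D l = mat_lc n d (\<lambda>k. c l k j) S"
    using assms(8) unfolding splits_def by auto
  have GB: "G * B k = D k * G" if k: "k < d" for k
  proof -
    have "G * B k = G * B k * (H * G)" using HG G B[OF k] by simp
    also have "\<dots> = G * (B k * H) * G"
      using G B[OF k] H by (simp add: assoc_mult_mat[of _ n n _ n _ n])
    also have "\<dots> = G * H * D k * G" unfolding BH[OF k]
      using G D[OF k] H by (simp add: assoc_mult_mat[of _ n n _ n _ n])
    finally show ?thesis using GH D[OF k] by simp
  qed
  have "mat_lc n d (\<lambda>_. 1) (\<lambda>k. B k * (H * (S k * G))) = mat_lc n d (\<lambda>_. 1) (\<lambda>k. H * (D k * S k * G))"
  proof (rule mat_lc_cong[OF refl])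
    fix k assume k: "k < d"
    have "B k * (H * (S k * G)) = B k * H * (S k * G)"
      using B[OF k] H S[OF k] G by (simp add: assoc_mult_mat[of _ n n _ n _ n])
    also have "\<dots> = H * (D k * S k * G)" unfolding BH[OF k]
      using D[OF k] H S[OF k] G by (simp add: assoc_mult_mat[of _ n n _ n _ n])
    finally show "B k * (H * (S k * G)) = H * (D k * S k * G)" .
  qed
  also have "\<dots> = H * mat_lc n d (\<lambda>_. 1) (\<lambda>k. D k * S k * G)"
    by (rule mult_mat_lc_left[OF H, symmetric]) (use D S G in \<open>auto intro!: mult_carrier_mat[of _ n n]\<close>)
  also have "mat_lc n d (\<lambda>_. 1) (\<lambda>k. D k * S k * G) = mat_lc n d (\<lambda>_. 1) (\<lambda>k. D k * S k) * G"
    by (rule mult_mat_lc_right[OF G, symmetric]) (use D S in \<open>auto intro!: mult_carrier_mat[of _ n n]\<close>)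
  finally have 1: "mat_lc n d (\<lambda>_. 1) (\<lambda>k. B k * (H * (S k * G))) = 1\<^sub>m n"
    unfolding S1 using HG G by simp
  have 2: "(H * (S j * G)) * B l = mat_lc n d (\<lambda>k. c l k j) (\<lambda>k. H * (S k * G))" if j: "j < d" and l: "l < d" for j l
  proof -
    have "(H * (S j * G)) * B l = H * (S j * (G * B l))"
      using H S[OF j] G B[OF l] by (simp add: assoc_mult_mat[of _ n n _ n _ n])
    also have "\<dots> = H * (S j * D l * G)" unfolding GB[OF l]
      using S[OF j] G D[OF l] by (simp add: assoc_mult_mat[of _ n n _ n _ n])
    also have "\<dots> = H * mat_lc n d (\<lambda>k. c l k j) (\<lambda>k. S k * G)"
      unfolding S2[OF j l] using S by (subst mult_mat_lc_right[OF G]) auto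
    also have "\<dots> = mat_lc n d (\<lambda>k. c l k j) (\<lambda>k. H * (S k * G))"
      by (rule mult_mat_lc_left[OF H]) (use S G in \<open>auto intro!: mult_carrier_mat[of _ n n]\<close>)
    finally show ?thesis .
  qed
  show ?thesis unfolding splits_def
  proof (intro exI[of _ "\<lambda>k. H * (S k * G)"] conjI allI impI 1 2)
    show "H * (S k * G) \<in> carrier_mat n n" if "k < d" for k using H S[OF that] G by auto
  qed
qed

definition block2 :: "complex mat \<Rightarrow> complex mat \<Rightarrow> complex mat" where
  "block2 X Y = four_block_mat X (0\<^sub>m (dim_row X) (dim_col Y)) (0\<^sub>m (dim_row Y) (dim_col X)) Y"

lemma block2_carrier: "X \<in> carrier_mat p p \<Longrightarrow> Y \<in> carrier_mat q q \<Longrightarrow> block2 X Y \<in> carrier_mat (p + q) (p + q)"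
  by (auto simp: block2_def)

lemma block2_mult:
  assumes "X \<in> carrier_mat p p" "Y \<in> carrier_mat q q" "X' \<in> carrier_mat p p" "Y' \<in> carrier_mat q q"
  shows "block2 X Y * block2 X' Y' = block2 (X * X') (Y * Y')"
  using assms unfolding block2_def
  by (subst mult_four_block_mat[of _ p p _ q _ q _ _ p _ q]) auto

lemma block2_mat_lc:
  assumes "\<And>k. k < d \<Longrightarrow> X k \<in> carrier_mat p p" "\<And>k. k < d \<Longrightarrow> Y k \<in> carrier_mat q q"
  shows "mat_lc (p + q) d c (\<lambda>k. block2 (X k) (Y k)) = block2 (mat_lc p d c X) (mat_lc q d c Y)"
proof (rule eq_matI)
  fix i j assume "i < dim_row (block2 (mat_lc p d c X) (mat_lc q d c Y))" "j < dim_col (block2 (mat_lc p d c X) (mat_lc q d c Y))"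
  then have ij: "i < p + q" "j < p + q" by (auto simp: block2_def mat_lc_def)
  have e: "block2 (X k) (Y k) $$ (i, j) = (if i < p then if j < p then X k $$ (i, j) else 0
      else if j < p then 0 else Y k $$ (i - p, j - p))" if "k < d" for k
    using assms(1)[OF that] assms(2)[OF that] ij by (auto simp: block2_def)
  have "mat_lc (p + q) d c (\<lambda>k. block2 (X k) (Y k)) $$ (i, j) = (\<Sum>k<d. c k * (if i < p then if j < p then X k $$ (i, j) else 0
      else if j < p then 0 else Y k $$ (i - p, j - p)))"
    using ij e by (simp add: mat_lc_index)
  then show "mat_lc (p + q) d c (\<lambda>k. block2 (X k) (Y k)) $$ (i, j) = block2 (mat_lc p d c X) (mat_lc q d c Y) $$ (i, j)"
    using ij by (auto simp: block2_def mat_lc_def)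
qed (auto simp: block2_def mat_lc_def)

lemma block2_one: "block2 (1\<^sub>m p) (1\<^sub>m q) = 1\<^sub>m (p + q)"
  unfolding block2_def by simp

lemma splits_block2:
  assumes X: "\<And>k. k < d \<Longrightarrow> X k \<in> carrier_mat p p" and Y: "\<And>k. k < d \<Longrightarrow> Y k \<in> carrier_mat q q"
    and "splits d c p X" "splits d c q Y"
  shows "splits d c (p + q) (\<lambda>k. block2 (X k) (Y k))"
proof -
  obtain S where S: "\<And>k. k < d \<Longrightarrow> S k \<in> carrier_mat p p"
    and S1: "mat_lc p d (\<lambda>_. 1) (\<lambda>k. X k * S k) = 1\<^sub>m p"
    and S2: "\<And>j l. j < d \<Longrightarrow> l < d \<Longrightarrow> S j * X l = mat_lc p d (\<lambda>k. c l k j) S"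
    using assms(3) unfolding splits_def by auto
  obtain T where T: "\<And>k. k < d \<Longrightarrow> T k \<in> carrier_mat q q"
    and T1: "mat_lc q d (\<lambda>_. 1) (\<lambda>k. Y k * T k) = 1\<^sub>m q"
    and T2: "\<And>j l. j < d \<Longrightarrow> l < d \<Longrightarrow> T j * Y l = mat_lc q d (\<lambda>k. c l k j) T"
    using assms(4) unfolding splits_def by auto
  show ?thesis unfolding splits_def
  proof (intro exI[of _ "\<lambda>k. block2 (S k) (T k)"] conjI allI impI)
    show "block2 (S k) (T k) \<in> carrier_mat (p + q) (p + q)" if "k < d" for k
      using S[OF that] T[OF that] by (rule block2_carrier)
    have "mat_lc (p + q) d (\<lambda>_. 1) (\<lambda>k. block2 (X k) (Y k) * block2 (S k) (T k)) =
        mat_lc (p + q) d (\<lambda>_. 1) (\<lambda>k. block2 (X k * S k) (Y k * T k))"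
      by (rule mat_lc_cong[OF refl]) (rule block2_mult[OF X Y S T])
    also have "\<dots> = 1\<^sub>m (p + q)"
      using X Y S T S1 T1 by (subst block2_mat_lc[where p = p and q = q])
        (auto simp: block2_one intro!: mult_carrier_mat[of _ p p] mult_carrier_mat[of _ q q])
    finally show "mat_lc (p + q) d (\<lambda>_. 1) (\<lambda>k. block2 (X k) (Y k) * block2 (S k) (T k)) = 1\<^sub>m (p + q)" .
    fix j l assume j: "j < d" and l: "l < d"
    show "block2 (S j) (T j) * block2 (X l) (Y l) = mat_lc (p + q) d (\<lambda>k. c l k j) (\<lambda>k. block2 (S k) (T k))"
      using block2_mult[OF S[OF j] T[OF j] X[OF l] Y[OF l]] block2_mat_lc[of d S p T q, OF S T] S2[OF j l] T2[OF j l]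
      by simp
  qed
qed

lemma diag_block_mat_Cons: "diag_block_mat (X # Xs) = block2 X (diag_block_mat Xs)"
  by (simp add: block2_def Let_def)

lemma diag_block_carrier:
  fixes L :: "'v \<Rightarrow> complex mat"
  assumes "\<And>v. v \<in> set ws \<Longrightarrow> L v \<in> carrier_mat (n v) (n v)"
  shows "diag_block_mat (map L ws) \<in> carrier_mat (sum_list (map n ws)) (sum_list (map n ws))"
  using assms
proof (induction ws)
  case (Cons v ws)
  show ?case unfolding list.map diag_block_mat_Cons sum_list.Cons
    by (intro block2_carrier Cons.IH) (use Cons.prems in auto)
qed simp

lemma splits_diag_block:
  assumes "\<And>v k. v \<in> set ws \<Longrightarrow> k < d \<Longrightarrow> L v k \<in> carrier_mat (n v) (n v)"
    and "\<And>v. v \<in> set ws \<Longrightarrow> splits d c (n v) (L v)"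
  shows "splits d c (sum_list (map n ws)) (\<lambda>k. diag_block_mat (map (\<lambda>v. L v k) ws))"
  using assms
proof (induction ws)
  case Nil
  then show ?case by (auto simp: splits_def mat_lc_def intro!: exI[of _ "\<lambda>_. 0\<^sub>m 0 0"] eq_matI)
next
  case (Cons v ws)
  show ?case unfolding list.map diag_block_mat_Cons sum_list.Cons
    by (intro splits_block2 diag_block_carrier Cons.IH) (use Cons.prems in auto)
qed

lemma mat_lc_diag_block:
  assumes "\<And>v k. v \<in> set ws \<Longrightarrow> k < d \<Longrightarrow> L v k \<in> carrier_mat (n v) (n v)"
  shows "mat_lc (sum_list (map n ws)) d c (\<lambda>k. diag_block_mat (map (\<lambda>v. L v k) ws)) =
    diag_block_mat (map (\<lambda>v. mat_lc (n v) d c (L v)) ws)"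
  using assms
proof (induction ws)
  case Nil
  then show ?case by (auto simp: mat_lc_def intro!: eq_matI)
next
  case (Cons v ws)
  have "mat_lc (n v + sum_list (map n ws)) d c (\<lambda>k. block2 (L v k) (diag_block_mat (map (\<lambda>v. L v k) ws))) =
    block2 (mat_lc (n v) d c (L v)) (mat_lc (sum_list (map n ws)) d c (\<lambda>k. diag_block_mat (map (\<lambda>v. L v k) ws)))"
    by (intro block2_mat_lc diag_block_carrier) (use Cons.prems in auto)
  then show ?case unfolding list.map diag_block_mat_Cons sum_list.Cons using Cons by simp
qed

fun hcat :: "nat \<Rightarrow> complex mat list \<Rightarrow> complex mat" where
  "hcat n [] = 0\<^sub>m n 0"
| "hcat n (H # Hs) = four_block_mat H (hcat n Hs) (0\<^sub>m 0 (dim_col H)) (0\<^sub>m 0 (dim_col (hcat n Hs)))"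

lemma hcat_carrier:
  assumes "\<And>p. p \<in> set ps \<Longrightarrow> H p \<in> carrier_mat n (m p)"
  shows "hcat n (map H ps) \<in> carrier_mat n (sum_list (map m ps))"
  using assms
proof (induction ps)
  case (Cons p ps)
  then have "H p \<in> carrier_mat n (m p)" "hcat n (map H ps) \<in> carrier_mat n (sum_list (map m ps))" by auto
  then show ?case by auto
qed simp

lemma hcat_intertwines:
  assumes B: "B \<in> carrier_mat n n"
    and "\<And>p. p \<in> set ps \<Longrightarrow> H p \<in> carrier_mat n (m p)" "\<And>p. p \<in> set ps \<Longrightarrow> L p \<in> carrier_mat (m p) (m p)"
    and "\<And>p. p \<in> set ps \<Longrightarrow> B * H p = H p * L p"
  shows "B * hcat n (map H ps) = hcat n (map H ps) * diag_block_mat (map L ps)"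
  using assms(2-)
proof (induction ps)
  case Nil
  then show ?case using B by (auto intro!: eq_matI)
next
  case (Cons p ps)
  let ?R = "hcat n (map H ps)" and ?D = "diag_block_mat (map L ps)" and ?q = "sum_list (map m ps)"
  have H: "H p \<in> carrier_mat n (m p)" and L: "L p \<in> carrier_mat (m p) (m p)" using Cons.prems by auto
  have R: "?R \<in> carrier_mat n ?q" by (rule hcat_carrier) (use Cons.prems in auto)
  have D: "?D \<in> carrier_mat ?q ?q" by (rule diag_block_carrier) (use Cons.prems in auto)
  have IH: "B * ?R = ?R * ?D" using Cons by auto
  have B4: "B = four_block_mat B (0\<^sub>m n 0) (0\<^sub>m 0 n) (0\<^sub>m 0 0)" using B by (auto intro!: eq_matI)
  have "B * hcat n (map H (p # ps)) =
      four_block_mat B (0\<^sub>m n 0) (0\<^sub>m 0 n) (0\<^sub>m 0 0) * four_block_mat (H p) ?R (0\<^sub>m 0 (m p)) (0\<^sub>m 0 ?q)"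
    using H R B4 by auto
  also have "\<dots> = four_block_mat (B * H p) (B * ?R) (0\<^sub>m 0 (m p)) (0\<^sub>m 0 ?q)"
    using B H R by (subst mult_four_block_mat[of _ n n _ 0 _ 0 _ _ "m p" _ ?q]) auto
  also have "\<dots> = four_block_mat (H p * L p) (?R * ?D) (0\<^sub>m 0 (m p)) (0\<^sub>m 0 ?q)"
    using IH Cons.prems(3)[of p] by simp
  also have "\<dots> = four_block_mat (H p) ?R (0\<^sub>m 0 (m p)) (0\<^sub>m 0 ?q) * block2 (L p) ?D"
    unfolding block2_def using H R L D
    by (subst mult_four_block_mat[of _ n "m p" _ ?q _ 0 _ _ "m p" _ ?q]) auto
  also have "\<dots> = hcat n (map H (p # ps)) * diag_block_mat (map L (p # ps))"
    using H R by (simp add: diag_block_mat_Cons del: diag_block_mat.simps)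
  finally show ?case .
qed

fun vcat :: "complex vec list \<Rightarrow> complex vec" where
  "vcat [] = 0\<^sub>v 0"
| "vcat (z # zs) = z @\<^sub>v vcat zs"

lemma vcat_carrier:
  assumes "\<And>p. p \<in> set ps \<Longrightarrow> z p \<in> carrier_vec (m p)"
  shows "vcat (map z ps) \<in> carrier_vec (sum_list (map m ps))"
  using assms by (induction ps) auto

lemma vcat_cases:
  assumes "y \<in> carrier_vec (sum_list (map m ps))" and "distinct ps"
  shows "\<exists>z. (\<forall>p\<in>set ps. z p \<in> carrier_vec (m p)) \<and> y = vcat (map z ps)"
  using assms
proof (induction ps arbitrary: y)
  case Nil
  then show ?case by auto
next
  case (Cons p ps)
  then obtain a b where ab: "a \<in> carrier_vec (m p)" "b \<in> carrier_vec (sum_list (map m ps))" "y = a @\<^sub>v b"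
    using vec_first_last_append[of y "m p" "sum_list (map m ps)"] vec_first_carrier vec_last_carrier
    by (metis list.simps(9) sum_list.Cons)
  then obtain z where z: "\<forall>q\<in>set ps. z q \<in> carrier_vec (m q)" "b = vcat (map z ps)" using Cons by auto
  have "map (z(p := a)) ps = map z ps" using Cons.prems by auto
  then have "vcat (map (z(p := a)) (p # ps)) = a @\<^sub>v vcat (map z ps)"
    by (simp only: list.map vcat.simps fun_upd_same)
  then have "y = vcat (map (z(p := a)) (p # ps))" by (simp only: ab(3) z(2))
  moreover have "\<forall>q\<in>set (p # ps). (z(p := a)) q \<in> carrier_vec (m q)" using ab z by simp
  ultimately show ?case by blast
qed

lemma hcat_mult_vcat:
  assumes "\<And>p. p \<in> set ps \<Longrightarrow> H p \<in> carrier_mat n (m p)" "\<And>p. p \<in> set ps \<Longrightarrow> z p \<in> carrier_vec (m p)"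
    and "i < n"
  shows "(hcat n (map H ps) *\<^sub>v vcat (map z ps)) $ i = (\<Sum>p\<leftarrow>ps. (H p *\<^sub>v z p) $ i)"
  using assms
proof (induction ps)
  case (Cons p ps)
  let ?R = "hcat n (map H ps)" and ?y = "vcat (map z ps)" and ?q = "sum_list (map m ps)"
  have H: "H p \<in> carrier_mat n (m p)" and z: "z p \<in> carrier_vec (m p)" using Cons.prems by auto
  have R: "?R \<in> carrier_mat n ?q" by (rule hcat_carrier) (use Cons.prems in auto)
  have y: "?y \<in> carrier_vec ?q" by (rule vcat_carrier) (use Cons.prems in auto)
  have "hcat n (map H (p # ps)) *\<^sub>v vcat (map z (p # ps)) =
      (H p *\<^sub>v z p + ?R *\<^sub>v ?y) @\<^sub>v (0\<^sub>m 0 (m p) *\<^sub>v z p + 0\<^sub>m 0 ?q *\<^sub>v ?y)"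
    using H R z y by (simp add: four_block_mat_mult_vec[of _ n "m p" _ ?q _ 0])
  moreover have "(?R *\<^sub>v ?y) $ i = (\<Sum>p\<leftarrow>ps. (H p *\<^sub>v z p) $ i)" using Cons by auto
  ultimately show ?case using H R z y \<open>i < n\<close> by auto
qed simp

text \<open>Surjectivity gives a right inverse, which injectivity makes two-sided; the traces of \<open>H G\<close> and
\<open>G H\<close> then force the size to be square.\<close>

lemma bijective_matrix:
  fixes H :: "complex mat"
  assumes H: "H \<in> carrier_mat n m"
    and surj: "\<And>y. y \<in> carrier_vec n \<Longrightarrow> \<exists>z\<in>carrier_vec m. H *\<^sub>v z = y"
    and inj: "\<And>z. z \<in> carrier_vec m \<Longrightarrow> H *\<^sub>v z = 0\<^sub>v n \<Longrightarrow> z = 0\<^sub>v m"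
  shows "n = m" and "\<exists>G\<in>carrier_mat m n. H * G = 1\<^sub>m n \<and> G * H = 1\<^sub>m m"
proof -
  have "\<forall>j. \<exists>z. z \<in> carrier_vec m \<and> H *\<^sub>v z = unit_vec n j" using surj unit_vec_carrier by blast
  then obtain z where "\<forall>j. z j \<in> carrier_vec m \<and> H *\<^sub>v z j = unit_vec n j" by (rule choice[THEN exE])
  then have z: "\<And>j. j < n \<Longrightarrow> z j \<in> carrier_vec m" "\<And>j. j < n \<Longrightarrow> H *\<^sub>v z j = unit_vec n j" by auto
  define G where "G = mat_of_cols m (map z [0..<n])"
  have G: "G \<in> carrier_mat m n" unfolding G_def using mat_of_cols_carrier(1)[of m "map z [0..<n]"] by simp
  have colG: "col G j = z j" if "j < n" for j
    unfolding G_def using that z by (subst col_mat_of_cols) auto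
  have HG: "H * G = 1\<^sub>m n"
  proof (rule mat_col_eqI)
    fix j assume "j < dim_col (1\<^sub>m n)"
    then show "col (H * G) j = col (1\<^sub>m n) j" using col_mult2[OF H G] colG z by simp
  qed (use H G in auto)
  have GH: "G * H = 1\<^sub>m m"
  proof (rule mat_col_eqI)
    fix j assume "j < dim_col (1\<^sub>m m)"
    then have j: "j < m" by simp
    let ?u = "col H j"
    have u: "?u \<in> carrier_vec n" using H by auto
    have ej: "H *\<^sub>v unit_vec m j = ?u" using H j by (intro eq_vecI) auto
    have "H *\<^sub>v (G *\<^sub>v ?u - unit_vec m j) = H *\<^sub>v (G *\<^sub>v ?u) - H *\<^sub>v unit_vec m j"
      using H G u by (intro mult_minus_distrib_mat_vec) auto
    also have "H *\<^sub>v (G *\<^sub>v ?u) = ?u" using HG H G u by (simp add: assoc_mult_mat_vec[symmetric])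
    finally have "H *\<^sub>v (G *\<^sub>v ?u - unit_vec m j) = 0\<^sub>v n" using u by (simp add: ej)
    then have "G *\<^sub>v ?u - unit_vec m j = 0\<^sub>v m" using G u by (intro inj) auto
    then have "G *\<^sub>v ?u = unit_vec m j" using G u
    proof (intro eq_vecI)
      fix i assume "i < dim_vec (unit_vec m j :: complex vec)"
      then show "(G *\<^sub>v ?u) $ i = unit_vec m j $ i"
        using G u arg_cong[OF \<open>G *\<^sub>v ?u - unit_vec m j = 0\<^sub>v m\<close>, of "\<lambda>v. v $ i"] by simp
    qed auto
    then show "col (G * H) j = col (1\<^sub>m m) j" using col_mult2[OF G H j] j by simp
  qed (use H G in auto)
  have "complex_of_nat n = (\<Sum>i<n. (H * G) $$ (i, i))" unfolding HG by simp
  also have "\<dots> = (\<Sum>i<n. \<Sum>q<m. H $$ (i, q) * G $$ (q, i))"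
    by (intro sum.cong refl mat_mult_index[OF H G]) auto
  also have "\<dots> = (\<Sum>q<m. \<Sum>i<n. G $$ (q, i) * H $$ (i, q))"
    by (subst sum.swap) (simp add: mult.commute)
  also have "\<dots> = (\<Sum>q<m. (G * H) $$ (q, q))"
    by (intro sum.cong refl mat_mult_index[OF G H, symmetric]) auto
  also have "\<dots> = complex_of_nat m" unfolding GH by simp
  finally show "n = m" by simp
  show "\<exists>G\<in>carrier_mat m n. H * G = 1\<^sub>m n \<and> G * H = 1\<^sub>m m" using G HG GH by blast
qed

lemma (in abelian_monoid) finsum_swap:
  assumes "finite I" "finite K" "\<And>i k. i \<in> I \<Longrightarrow> k \<in> K \<Longrightarrow> f i k \<in> carrier G"
  shows "(\<Oplus>i\<in>I. \<Oplus>k\<in>K. f i k) = (\<Oplus>k\<in>K. \<Oplus>i\<in>I. f i k)"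
  using assms
proof (induction I rule: finite_induct)
  case (insert j I)
  have c: "(\<lambda>k. f j k) \<in> K \<rightarrow> carrier G" "(\<lambda>k. \<Oplus>i\<in>I. f i k) \<in> K \<rightarrow> carrier G"
    "(\<lambda>i. \<Oplus>k\<in>K. f i k) \<in> I \<rightarrow> carrier G" "(\<Oplus>k\<in>K. f j k) \<in> carrier G"
    using insert.prems by (auto intro!: finsum_closed)
  have "(\<Oplus>i\<in>insert j I. \<Oplus>k\<in>K. f i k) = (\<Oplus>k\<in>K. f j k) \<oplus> (\<Oplus>i\<in>I. \<Oplus>k\<in>K. f i k)"
    using insert.hyps c by (intro finsum_insert) auto
  also have "(\<Oplus>i\<in>I. \<Oplus>k\<in>K. f i k) = (\<Oplus>k\<in>K. \<Oplus>i\<in>I. f i k)"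
    using insert by auto
  also have "(\<Oplus>k\<in>K. f j k) \<oplus> (\<Oplus>k\<in>K. \<Oplus>i\<in>I. f i k) = (\<Oplus>k\<in>K. f j k \<oplus> (\<Oplus>i\<in>I. f i k))"
    by (rule finsum_addf[symmetric]) (use c in auto)
  also have "\<dots> = (\<Oplus>k\<in>K. \<Oplus>i\<in>insert j I. f i k)"
    by (rule finsum_cong') (use insert.hyps insert.prems in \<open>auto intro!: finsum_insert[symmetric] finsum_closed\<close>)
  finally show ?case .
qed (simp add: finsum_zero)

lemma module_homD:
  assumes "f \<in> module_hom R X Y"
  shows "x \<in> carrier X \<Longrightarrow> f x \<in> carrier Y"
    and "x \<in> carrier X \<Longrightarrow> y \<in> carrier X \<Longrightarrow> f (x \<oplus>\<^bsub>X\<^esub> y) = f x \<oplus>\<^bsub>Y\<^esub> f y"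
    and "c \<in> carrier R \<Longrightarrow> x \<in> carrier X \<Longrightarrow> f (c \<odot>\<^bsub>X\<^esub> x) = c \<odot>\<^bsub>Y\<^esub> f x"
  using assms by (auto simp: module_hom_def)

lemma module_homI:
  assumes "\<And>x. x \<in> carrier X \<Longrightarrow> f x \<in> carrier Y"
    and "\<And>x y. x \<in> carrier X \<Longrightarrow> y \<in> carrier X \<Longrightarrow> f (x \<oplus>\<^bsub>X\<^esub> y) = f x \<oplus>\<^bsub>Y\<^esub> f y"
    and "\<And>c x. c \<in> carrier R \<Longrightarrow> x \<in> carrier X \<Longrightarrow> f (c \<odot>\<^bsub>X\<^esub> x) = c \<odot>\<^bsub>Y\<^esub> f x"
  shows "f \<in> module_hom R X Y"
  using assms by (auto simp: module_hom_def)

lemma linear_zero: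
  assumes "module class_ring X" "module class_ring Y" "f \<in> module_hom class_ring X Y"
  shows "f \<zero>\<^bsub>X\<^esub> = \<zero>\<^bsub>Y\<^esub>"
proof -
  interpret X: module class_ring X by fact
  interpret Y: module class_ring Y by fact
  interpret mod_hom class_ring X Y f by unfold_locales fact
  show ?thesis by simp
qed

lemma linear_finsum:
  assumes "module class_ring X" "module class_ring Y" "f \<in> module_hom class_ring X Y" "g \<in> S \<rightarrow> carrier X"
  shows "f (finsum X g S) = (\<Oplus>\<^bsub>Y\<^esub>s\<in>S. f (g s))"
proof -
  interpret X: module class_ring X by fact
  interpret Y: module class_ring Y by fact
  show ?thesis
    by (rule additive_finsum[OF X.M.abelian_monoid_axioms Y.M.abelian_monoid_axioms])
      (use assms(4) linear_zero[OF assms(1-3)] module_homD[OF assms(3)] in auto)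
qed

text \<open>A maximal subspace among those that meet \<open>U\<close> only in zero is a complement. Zorn's lemma is used because
test modules may be infinite-dimensional.\<close>

lemma linear_complement:
  fixes Y :: "(complex, 'v, 'z) module_scheme"
  assumes Y: "module class_ring Y" and U0: "\<zero>\<^bsub>Y\<^esub> \<in> U" and UY: "U \<subseteq> carrier Y"
    and Uadd: "\<And>x y. x \<in> U \<Longrightarrow> y \<in> U \<Longrightarrow> x \<oplus>\<^bsub>Y\<^esub> y \<in> U"
    and Usm: "\<And>c x. x \<in> U \<Longrightarrow> c \<odot>\<^bsub>Y\<^esub> x \<in> U"
  obtains K where "\<zero>\<^bsub>Y\<^esub> \<in> K" "K \<subseteq> carrier Y"
    "\<And>x y. x \<in> K \<Longrightarrow> y \<in> K \<Longrightarrow> x \<oplus>\<^bsub>Y\<^esub> y \<in> K" "\<And>c x. x \<in> K \<Longrightarrow> c \<odot>\<^bsub>Y\<^esub> x \<in> K"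
    "K \<inter> U = {\<zero>\<^bsub>Y\<^esub>}" "\<And>y. y \<in> carrier Y \<Longrightarrow> \<exists>k\<in>K. \<exists>u\<in>U. y = k \<oplus>\<^bsub>Y\<^esub> u"
proof -
  interpret Y: module class_ring Y by fact
  note ops = complex_module_ops[OF Y]
  define sub where "sub K \<longleftrightarrow> \<zero>\<^bsub>Y\<^esub> \<in> K \<and> K \<subseteq> carrier Y \<and> (\<forall>x\<in>K. \<forall>y\<in>K. x \<oplus>\<^bsub>Y\<^esub> y \<in> K) \<and>
    (\<forall>c. \<forall>x\<in>K. c \<odot>\<^bsub>Y\<^esub> x \<in> K) \<and> K \<inter> U = {\<zero>\<^bsub>Y\<^esub>}" for K
  have "\<exists>K\<in>Collect sub. \<forall>X\<in>Collect sub. K \<subseteq> X \<longrightarrow> X = K"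
  proof (rule subset_Zorn_nonempty)
    have "sub {\<zero>\<^bsub>Y\<^esub>}" using U0 ops(7) by (simp add: sub_def)
    then show "Collect sub \<noteq> {}" by blast
  next
    fix C assume C: "C \<noteq> {}" "subset.chain (Collect sub) C"
    then have subC: "sub K" if "K \<in> C" for K using that by (auto simp: subset.chain_def)
    have tot: "K \<subseteq> L \<or> L \<subseteq> K" if "K \<in> C" "L \<in> C" for K L
      using C(2) that by (auto simp: subset.chain_def)
    have "sub (\<Union>C)" unfolding sub_def
    proof (intro conjI ballI allI)
      show "\<zero>\<^bsub>Y\<^esub> \<in> \<Union>C" using C(1) subC by (auto simp: sub_def)
      show "\<Union>C \<subseteq> carrier Y" using subC unfolding sub_def by blast
      show "\<Union>C \<inter> U = {\<zero>\<^bsub>Y\<^esub>}" using C(1) subC by (auto simp: sub_def)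
      fix x assume "x \<in> \<Union>C"
      then obtain K where K: "K \<in> C" "x \<in> K" by blast
      show "c \<odot>\<^bsub>Y\<^esub> x \<in> \<Union>C" for c using K subC[OF K(1)] unfolding sub_def by blast
      fix y assume "y \<in> \<Union>C"
      then obtain L where L: "L \<in> C" "y \<in> L" by blast
      obtain N where "N \<in> C" "x \<in> N" "y \<in> N" using tot[OF K(1) L(1)] K L by blast
      then show "x \<oplus>\<^bsub>Y\<^esub> y \<in> \<Union>C" using subC[of N] unfolding sub_def by blast
    qed
    then show "\<Union>C \<in> Collect sub" by simp
  qed
  then obtain K where K: "sub K" and max: "\<And>X. sub X \<Longrightarrow> K \<subseteq> X \<Longrightarrow> X = K" by blast
  have K0: "\<zero>\<^bsub>Y\<^esub> \<in> K" and KY: "K \<subseteq> carrier Y" and Kadd: "\<And>x y. x \<in> K \<Longrightarrow> y \<in> K \<Longrightarrow> x \<oplus>\<^bsub>Y\<^esub> y \<in> K"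
    and Ksm: "\<And>c x. x \<in> K \<Longrightarrow> c \<odot>\<^bsub>Y\<^esub> x \<in> K" and KU: "K \<inter> U = {\<zero>\<^bsub>Y\<^esub>}"
    using K by (auto simp: sub_def)
  have neg: "\<ominus>\<^bsub>Y\<^esub> z = (-1) \<odot>\<^bsub>Y\<^esub> z" if "z \<in> carrier Y" for z
  proof (rule Y.M.minus_equality)
    show "(-1) \<odot>\<^bsub>Y\<^esub> z \<oplus>\<^bsub>Y\<^esub> z = \<zero>\<^bsub>Y\<^esub>"
      using ops(3)[OF that, of "-1" 1] ops(5)[OF that] ops(6)[OF that] by simp
  qed (use that ops(1) in simp_all)
  have "\<exists>k\<in>K. \<exists>u\<in>U. y = k \<oplus>\<^bsub>Y\<^esub> u" if y: "y \<in> carrier Y" for y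
  proof (rule ccontr)
    assume contra: "\<not> (\<exists>k\<in>K. \<exists>u\<in>U. y = k \<oplus>\<^bsub>Y\<^esub> u)"
    define X where "X = {k \<oplus>\<^bsub>Y\<^esub> c \<odot>\<^bsub>Y\<^esub> y | k c. k \<in> K}"
    have cy: "c \<odot>\<^bsub>Y\<^esub> y \<in> carrier Y" for c using ops(1)[OF y] .
    have KX: "K \<subseteq> X"
    proof
      fix k assume "k \<in> K"
      then have "k = k \<oplus>\<^bsub>Y\<^esub> 0 \<odot>\<^bsub>Y\<^esub> y" using KY ops(6)[OF y] by auto
      then show "k \<in> X" unfolding X_def using \<open>k \<in> K\<close> by blast
    qed
    have "sub X" unfolding sub_def
    proof (intro conjI ballI allI)
      show "\<zero>\<^bsub>Y\<^esub> \<in> X" using KX K0 by blast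
      show "X \<subseteq> carrier Y" unfolding X_def using KY cy by auto
      fix x assume "x \<in> X"
      then obtain k c where x: "k \<in> K" "x = k \<oplus>\<^bsub>Y\<^esub> c \<odot>\<^bsub>Y\<^esub> y" unfolding X_def by blast
      have kY: "k \<in> carrier Y" using x KY by blast
      show "b \<odot>\<^bsub>Y\<^esub> x \<in> X" for b
      proof -
        have "b \<odot>\<^bsub>Y\<^esub> x = b \<odot>\<^bsub>Y\<^esub> k \<oplus>\<^bsub>Y\<^esub> (b * c) \<odot>\<^bsub>Y\<^esub> y"
          unfolding x(2) ops(2)[OF y] by (rule ops(4)[OF kY cy])
        then show ?thesis unfolding X_def using Ksm[OF x(1)] by blast
      qed
      fix x' assume "x' \<in> X"
      then obtain k' c' where x': "k' \<in> K" "x' = k' \<oplus>\<^bsub>Y\<^esub> c' \<odot>\<^bsub>Y\<^esub> y" unfolding X_def by blast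
      have kY': "k' \<in> carrier Y" using x' KY by blast
      have "x \<oplus>\<^bsub>Y\<^esub> x' = (k \<oplus>\<^bsub>Y\<^esub> k') \<oplus>\<^bsub>Y\<^esub> (c \<odot>\<^bsub>Y\<^esub> y \<oplus>\<^bsub>Y\<^esub> c' \<odot>\<^bsub>Y\<^esub> y)"
        unfolding x(2) x'(2) using kY kY' cy by (simp add: Y.M.a_ac)
      also have "\<dots> = (k \<oplus>\<^bsub>Y\<^esub> k') \<oplus>\<^bsub>Y\<^esub> (c + c') \<odot>\<^bsub>Y\<^esub> y" unfolding ops(3)[OF y] ..
      finally show "x \<oplus>\<^bsub>Y\<^esub> x' \<in> X" unfolding X_def using Kadd[OF x(1) x'(1)] by blast
    next
      show "X \<inter> U = {\<zero>\<^bsub>Y\<^esub>}"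
      proof (intro equalityI subsetI)
        fix x assume "x \<in> X \<inter> U"
        then obtain k c where x: "k \<in> K" "x = k \<oplus>\<^bsub>Y\<^esub> c \<odot>\<^bsub>Y\<^esub> y" and xU: "x \<in> U" unfolding X_def by blast
        have kY: "k \<in> carrier Y" and xY: "x \<in> carrier Y" using x xU KY UY by blast+
        have "c = 0"
        proof (rule ccontr)
          assume c: "c \<noteq> 0"
          have "c \<odot>\<^bsub>Y\<^esub> y = \<ominus>\<^bsub>Y\<^esub> k \<oplus>\<^bsub>Y\<^esub> x"
            unfolding x(2) using kY cy Y.M.r_neg1[OF kY cy] by simp
          then have "(1 / c) \<odot>\<^bsub>Y\<^esub> (c \<odot>\<^bsub>Y\<^esub> y) = (1 / c) \<odot>\<^bsub>Y\<^esub> ((-1) \<odot>\<^bsub>Y\<^esub> k \<oplus>\<^bsub>Y\<^esub> x)"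
            unfolding neg[OF kY] by simp
          also have "\<dots> = (1 / c) \<odot>\<^bsub>Y\<^esub> ((-1) \<odot>\<^bsub>Y\<^esub> k) \<oplus>\<^bsub>Y\<^esub> (1 / c) \<odot>\<^bsub>Y\<^esub> x"
            by (rule ops(4)[OF ops(1)[OF kY] xY])
          also have "(1 / c) \<odot>\<^bsub>Y\<^esub> (c \<odot>\<^bsub>Y\<^esub> y) = y"
            using c ops(2)[OF y, of "1 / c" c] ops(5)[OF y] by simp
          finally show False using contra Ksm[OF Ksm[OF x(1)]] Usm[OF xU] by blast
        qed
        then have "x = k" using x(2) ops(6)[OF y] kY by simp
        then show "x \<in> {\<zero>\<^bsub>Y\<^esub>}" using x(1) xU KU by blast
      qed (use KX K0 U0 in blast)
    qed
    then have "X = K" using KX by (rule max)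
    moreover have "y = \<zero>\<^bsub>Y\<^esub> \<oplus>\<^bsub>Y\<^esub> 1 \<odot>\<^bsub>Y\<^esub> y" using y ops(5)[OF y] by simp
    then have "y \<in> X" unfolding X_def using K0 by blast
    moreover have "y = y \<oplus>\<^bsub>Y\<^esub> \<zero>\<^bsub>Y\<^esub>" using y by simp
    ultimately show False using contra U0 by blast
  qed
  then show ?thesis using that[OF K0 KY Kadd Ksm KU] by blast
qed

text \<open>Project along a complement of the image of \<open>j\<close> and apply \<open>g\<close>.\<close>

lemma linear_extension:
  fixes X :: "(complex, 'v, 'z) module_scheme" and Y :: "(complex, 'w, 'y) module_scheme"
    and W :: "(complex, 'u, 'x) module_scheme"
  assumes X: "module class_ring X" and Y: "module class_ring Y" and W: "module class_ring W"
    and j: "j \<in> module_hom class_ring X Y" "inj_on j (carrier X)" and g: "g \<in> module_hom class_ring X W"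
  obtains \<phi> where "\<phi> \<in> module_hom class_ring Y W" "\<And>x. x \<in> carrier X \<Longrightarrow> \<phi> (j x) = g x"
proof -
  interpret X: module class_ring X by fact
  interpret Y: module class_ring Y by fact
  interpret W: module class_ring W by fact
  note opsX = complex_module_ops[OF X] and opsY = complex_module_ops[OF Y] and opsW = complex_module_ops[OF W]
  have jc: "x \<in> carrier X \<Longrightarrow> j x \<in> carrier Y" for x by (rule module_homD(1)[OF j(1)])
  have ja: "x \<in> carrier X \<Longrightarrow> y \<in> carrier X \<Longrightarrow> j (x \<oplus>\<^bsub>X\<^esub> y) = j x \<oplus>\<^bsub>Y\<^esub> j y" for x y by (rule module_homD(2)[OF j(1)])
  have js: "x \<in> carrier X \<Longrightarrow> j (c \<odot>\<^bsub>X\<^esub> x) = c \<odot>\<^bsub>Y\<^esub> j x" for c x by (rule module_homD(3)[OF j(1)]) simp_all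
  have j0: "j \<zero>\<^bsub>X\<^esub> = \<zero>\<^bsub>Y\<^esub>" by (rule linear_zero[OF X Y j(1)])
  define U where "U = j ` carrier X"
  have U: "\<zero>\<^bsub>Y\<^esub> \<in> U" "U \<subseteq> carrier Y" "\<And>x y. x \<in> U \<Longrightarrow> y \<in> U \<Longrightarrow> x \<oplus>\<^bsub>Y\<^esub> y \<in> U"
    "\<And>c x. x \<in> U \<Longrightarrow> c \<odot>\<^bsub>Y\<^esub> x \<in> U"
  proof -
    show "\<zero>\<^bsub>Y\<^esub> \<in> U" unfolding U_def j0[symmetric] by simp
    show "U \<subseteq> carrier Y" unfolding U_def using jc by blast
    show "x \<oplus>\<^bsub>Y\<^esub> y \<in> U" if xy: "x \<in> U" "y \<in> U" for x y
    proof -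
      obtain a b where "a \<in> carrier X" "x = j a" "b \<in> carrier X" "y = j b" using xy unfolding U_def by blast
      then show ?thesis unfolding U_def by (simp add: ja[symmetric])
    qed
    show "c \<odot>\<^bsub>Y\<^esub> x \<in> U" if x: "x \<in> U" for c x
    proof -
      obtain a where "a \<in> carrier X" "x = j a" using x unfolding U_def by blast
      then show ?thesis unfolding U_def using opsX(1) by (simp add: js[symmetric])
    qed
  qed
  obtain K where K: "\<zero>\<^bsub>Y\<^esub> \<in> K" "K \<subseteq> carrier Y"
    "\<And>x y. x \<in> K \<Longrightarrow> y \<in> K \<Longrightarrow> x \<oplus>\<^bsub>Y\<^esub> y \<in> K" "\<And>c x. x \<in> K \<Longrightarrow> c \<odot>\<^bsub>Y\<^esub> x \<in> K"
    "K \<inter> U = {\<zero>\<^bsub>Y\<^esub>}" "\<And>y. y \<in> carrier Y \<Longrightarrow> \<exists>k\<in>K. \<exists>u\<in>U. y = k \<oplus>\<^bsub>Y\<^esub> u"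
    by (rule linear_complement[OF Y U], assumption+, rule that)
  have neg: "\<ominus>\<^bsub>Y\<^esub> z = (-1) \<odot>\<^bsub>Y\<^esub> z" if "z \<in> carrier Y" for z
  proof (rule Y.M.minus_equality)
    show "(-1) \<odot>\<^bsub>Y\<^esub> z \<oplus>\<^bsub>Y\<^esub> z = \<zero>\<^bsub>Y\<^esub>"
      using opsY(3)[OF that, of "-1" 1] opsY(5)[OF that] opsY(6)[OF that] by simp
  qed (use that opsY(1) in simp_all)
  have ex: "\<exists>x. x \<in> carrier X \<and> (\<exists>k\<in>K. y = k \<oplus>\<^bsub>Y\<^esub> j x)" if "y \<in> carrier Y" for y
    using K(6)[OF that] unfolding U_def by blast
  have uniq: "x = x'" if x: "x \<in> carrier X" "x' \<in> carrier X" and k: "k \<in> K" "k' \<in> K"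
    and eq: "k \<oplus>\<^bsub>Y\<^esub> j x = k' \<oplus>\<^bsub>Y\<^esub> j x'" for x x' k k'
  proof -
    have kY: "k \<in> carrier Y" "k' \<in> carrier Y" using k K(2) by blast+
    have "j x \<oplus>\<^bsub>Y\<^esub> \<ominus>\<^bsub>Y\<^esub> j x' = \<ominus>\<^bsub>Y\<^esub> k \<oplus>\<^bsub>Y\<^esub> (k \<oplus>\<^bsub>Y\<^esub> j x) \<oplus>\<^bsub>Y\<^esub> \<ominus>\<^bsub>Y\<^esub> j x'"
      using kY jc x by (simp add: Y.M.r_neg1)
    also have "\<dots> = \<ominus>\<^bsub>Y\<^esub> k \<oplus>\<^bsub>Y\<^esub> k'"
      unfolding eq using kY jc x by (simp add: Y.M.a_assoc Y.M.r_neg)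
    also have "\<dots> \<in> K" unfolding neg[OF kY(1)] by (intro K(3,4) k)
    finally have "j x \<oplus>\<^bsub>Y\<^esub> \<ominus>\<^bsub>Y\<^esub> j x' \<in> K" .
    moreover have "j x \<oplus>\<^bsub>Y\<^esub> \<ominus>\<^bsub>Y\<^esub> j x' \<in> U"
      unfolding neg[OF jc[OF x(2)]] by (intro U(3,4)) (auto simp: U_def x)
    ultimately have "j x \<oplus>\<^bsub>Y\<^esub> \<ominus>\<^bsub>Y\<^esub> j x' = \<zero>\<^bsub>Y\<^esub>" using K(5) by blast
    then have "j x = j x'" using jc x by (metis Y.M.minus_equality Y.M.minus_minus Y.M.a_inv_closed)
    then show ?thesis using j(2) x by (simp add: inj_on_def)
  qed
  define \<xi> where "\<xi> y = (SOME x. x \<in> carrier X \<and> (\<exists>k\<in>K. y = k \<oplus>\<^bsub>Y\<^esub> j x))" for y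
  have \<xi>: "\<xi> y \<in> carrier X" "\<exists>k\<in>K. y = k \<oplus>\<^bsub>Y\<^esub> j (\<xi> y)" if "y \<in> carrier Y" for y
    using someI_ex[OF ex[OF that]] unfolding \<xi>_def by blast+
  have \<xi>_eq: "\<xi> (k \<oplus>\<^bsub>Y\<^esub> j x) = x" if "k \<in> K" "x \<in> carrier X" for k x
  proof -
    have "k \<oplus>\<^bsub>Y\<^esub> j x \<in> carrier Y" using that K(2) jc by blast
    from \<xi>[OF this] obtain k' where "\<xi> (k \<oplus>\<^bsub>Y\<^esub> j x) \<in> carrier X" "k' \<in> K" "k \<oplus>\<^bsub>Y\<^esub> j x = k' \<oplus>\<^bsub>Y\<^esub> j (\<xi> (k \<oplus>\<^bsub>Y\<^esub> j x))"
      by blast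
    then show ?thesis using uniq[of x "\<xi> (k \<oplus>\<^bsub>Y\<^esub> j x)" k k'] that by simp
  qed
  have \<xi>_hom: "\<xi> \<in> module_hom class_ring Y X"
  proof (rule module_homI)
    fix x assume x: "x \<in> carrier Y"
    show "\<xi> x \<in> carrier X" by (rule \<xi>(1)[OF x])
    obtain k where k: "k \<in> K" "x = k \<oplus>\<^bsub>Y\<^esub> j (\<xi> x)" using \<xi>(2)[OF x] by blast
    have kY: "k \<in> carrier Y" using k(1) K(2) by blast
    show "\<xi> (c \<odot>\<^bsub>Y\<^esub> x) = c \<odot>\<^bsub>X\<^esub> \<xi> x" for c
    proof -
      have "c \<odot>\<^bsub>Y\<^esub> x = c \<odot>\<^bsub>Y\<^esub> (k \<oplus>\<^bsub>Y\<^esub> j (\<xi> x))" using k(2) by simp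
      also have "\<dots> = c \<odot>\<^bsub>Y\<^esub> k \<oplus>\<^bsub>Y\<^esub> j (c \<odot>\<^bsub>X\<^esub> \<xi> x)"
        unfolding js[OF \<xi>(1)[OF x]] by (rule opsY(4)[OF kY jc[OF \<xi>(1)[OF x]]])
      finally show ?thesis using \<xi>_eq[OF K(4)[OF k(1)] opsX(1)[OF \<xi>(1)[OF x]], of c c] by simp
    qed
    fix y assume y: "y \<in> carrier Y"
    obtain l where l: "l \<in> K" "y = l \<oplus>\<^bsub>Y\<^esub> j (\<xi> y)" using \<xi>(2)[OF y] by blast
    have lY: "l \<in> carrier Y" using l(1) K(2) by blast
    have "x \<oplus>\<^bsub>Y\<^esub> y = (k \<oplus>\<^bsub>Y\<^esub> j (\<xi> x)) \<oplus>\<^bsub>Y\<^esub> (l \<oplus>\<^bsub>Y\<^esub> j (\<xi> y))" using k(2) l(2) by simp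
    also have "\<dots> = (k \<oplus>\<^bsub>Y\<^esub> l) \<oplus>\<^bsub>Y\<^esub> j (\<xi> x \<oplus>\<^bsub>X\<^esub> \<xi> y)"
      unfolding ja[OF \<xi>(1)[OF x] \<xi>(1)[OF y]] using kY lY jc[OF \<xi>(1)[OF x]] jc[OF \<xi>(1)[OF y]] by (simp add: Y.M.a_ac)
    finally show "\<xi> (x \<oplus>\<^bsub>Y\<^esub> y) = \<xi> x \<oplus>\<^bsub>X\<^esub> \<xi> y"
      using \<xi>_eq[OF K(3)[OF k(1) l(1)], of "\<xi> x \<oplus>\<^bsub>X\<^esub> \<xi> y"] \<xi>(1)[OF x] \<xi>(1)[OF y] by simp
  qed
  show ?thesis
  proof (rule that[of "\<lambda>y. g (\<xi> y)"])
    show "(\<lambda>y. g (\<xi> y)) \<in> module_hom class_ring Y W"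
      using \<xi>_hom g by (intro module_homI) (simp_all add: module_homD)
    fix x assume x: "x \<in> carrier X"
    then show "g (\<xi> (j x)) = g x" using \<xi>_eq[OF K(1) x] jc[OF x] by simp
  qed
qed

section \<open>Projectivity and injectivity in terms of endomorphisms\<close>

lemma (in based_algebra) left_mult_linear: "a \<in> carrier A \<Longrightarrow> (\<lambda>x. a \<otimes> x) \<in> module_hom class_ring A A"
  by (rule module_homI) (simp_all add: r_distr mult_smult[symmetric])

lemma (in based_algebra) right_mult_linear: "a \<in> carrier A \<Longrightarrow> (\<lambda>x. x \<otimes> a) \<in> module_hom class_ring A A"
  by (rule module_homI) (simp_all add: l_distr smult_mult[symmetric])

lemma (in based_algebra) as_closed [simp]: "k < length as \<Longrightarrow> as ! k \<in> carrier A"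
  using alg.bs_closed .

context algebra_module
begin

lemmas sc = V_ops[unfolded complex_space_simps(1-3)]

text \<open>The action is determined by the basis elements; this reduces \<open>A\<close>-linearity to commutation with
finitely many operators.\<close>

lemma act_coord:
  assumes a: "a \<in> carrier A" and x: "x \<in> carrier M"
  shows "a \<odot> x = (\<Oplus>i\<in>{..<length as}. alg.alg.coord i a \<odot>\<^bsub>V\<^esub> ((as ! i) \<odot> x))"
proof -
  have "a \<odot> x = (alg.alg.lc (\<lambda>i. alg.alg.coord i a)) \<odot> x"
    using alg.alg.lc_coord[OF a] by simp
  also have "\<dots> = (\<Oplus>i\<in>{..<length as}. (alg.alg.coord i a \<odot>\<^bsub>A\<^esub> (as ! i)) \<odot> x)"
    by (rule act_finsum) (use x in auto)
  also have "\<dots> = (\<Oplus>i\<in>{..<length as}. alg.alg.coord i a \<odot>\<^bsub>V\<^esub> ((as ! i) \<odot> x))"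
  proof (rule mod.M.finsum_cong')
    show "(\<lambda>i. alg.alg.coord i a \<odot>\<^bsub>V\<^esub> ((as ! i) \<odot> x)) \<in> {..<length as} \<rightarrow> carrier M"
      by (intro funcsetI sc(1) mod.smult_closed x) simp
  qed (use x in \<open>simp_all only: lessThan_iff act_scalar alg.as_closed\<close>)
  finally show ?thesis .
qed

lemma sc_finsum: "f \<in> S \<rightarrow> carrier M \<Longrightarrow> c \<odot>\<^bsub>V\<^esub> (finsum M f S) = (\<Oplus>s\<in>S. c \<odot>\<^bsub>V\<^esub> f s)"
  unfolding complex_space_simps(4) by (rule act_finsum_right) simp_all

lemma sum_sc: "finite S \<Longrightarrow> x \<in> carrier M \<Longrightarrow> (\<Sum>s\<in>S. c s) \<odot>\<^bsub>V\<^esub> x = (\<Oplus>s\<in>S. c s \<odot>\<^bsub>V\<^esub> x)"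
proof (induction S rule: finite_induct)
  case empty
  then show ?case using sc(6)[of x] by (simp only: sum.empty mod.M.finsum_empty)
next
  case (insert s S)
  have m: "(\<lambda>s. c s \<odot>\<^bsub>V\<^esub> x) \<in> S \<rightarrow> carrier M" "c s \<odot>\<^bsub>V\<^esub> x \<in> carrier M"
    by (intro funcsetI sc(1) insert)+
  show ?case
    unfolding sum.insert[OF insert(1,2)] mod.M.finsum_insert[OF insert(1,2) m] sc(3)[OF insert(4)]
    by (simp only: insert.IH[OF insert(4)])
qed

lemma finsum_delta:
  assumes "i \<in> S" "finite S" "\<And>s. s \<in> S \<Longrightarrow> f s \<in> carrier M"
  shows "(\<Oplus>s\<in>S. if i = s then f s else \<zero>) = f i"
  by (rule mod.M.add.finprod_singleton) (use assms in auto)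

lemma delta_finsum:
  assumes "i \<in> S" "finite S" "\<And>s. s \<in> S \<Longrightarrow> f s \<in> carrier M"
  shows "(\<Oplus>s\<in>S. (if i = s then c else 0) \<odot>\<^bsub>V\<^esub> f s) = c \<odot>\<^bsub>V\<^esub> f i"
proof -
  have "(\<Oplus>s\<in>S. (if i = s then c else 0) \<odot>\<^bsub>V\<^esub> f s) = (\<Oplus>s\<in>S. if i = s then c \<odot>\<^bsub>V\<^esub> f s else \<zero>)"
  proof (rule mod.M.finsum_cong')
    show "(\<lambda>s. if i = s then c \<odot>\<^bsub>V\<^esub> f s else \<zero>) \<in> S \<rightarrow> carrier M"
      using sc(1)[OF assms(3)] by (intro funcsetI) (simp del: complex_space_simps(4))
  qed (use sc(6)[OF assms(3)] in \<open>simp_all del: complex_space_simps(4)\<close>)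
  also have "\<dots> = c \<odot>\<^bsub>V\<^esub> f i" by (rule finsum_delta) (use assms sc(1) in blast)+
  finally show ?thesis .
qed

lemma hom_complex_linear: "f \<in> module_hom A M X \<Longrightarrow> f \<in> module_hom class_ring V (complex_space A X)"
  by (rule module_homI) (simp_all add: module_homD)

lemma hom_if_basis_hom:
  assumes X: "algebra_module A as X" and f: "f \<in> module_hom class_ring V (complex_space A X)"
    and fas: "\<And>l x. l < length as \<Longrightarrow> x \<in> carrier M \<Longrightarrow> f ((as ! l) \<odot> x) = (as ! l) \<odot>\<^bsub>X\<^esub> f x"
  shows "f \<in> module_hom A M X"
proof (rule module_homI)
  interpret X: algebra_module A as X by fact
  fix a x assume a: "a \<in> carrier A" and x: "x \<in> carrier M"
  have fx: "f x \<in> carrier X" using module_homD(1)[OF f] x by simp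
  have m: "(\<lambda>i. alg.alg.coord i a \<odot>\<^bsub>V\<^esub> ((as ! i) \<odot> x)) \<in> {..<length as} \<rightarrow> carrier M"
    by (intro funcsetI sc(1) mod.smult_closed x) simp
  have "f (a \<odot> x) = f (finsum V (\<lambda>i. alg.alg.coord i a \<odot>\<^bsub>V\<^esub> ((as ! i) \<odot> x)) {..<length as})"
    unfolding act_coord[OF a x] finsum_V[OF m] ..
  also have "\<dots> = finsum X.V (\<lambda>i. f (alg.alg.coord i a \<odot>\<^bsub>V\<^esub> ((as ! i) \<odot> x))) {..<length as}"
    by (rule linear_finsum[OF V_module X.V_module f]) (use m in simp)
  also have "\<dots> = finsum X (\<lambda>i. f (alg.alg.coord i a \<odot>\<^bsub>V\<^esub> ((as ! i) \<odot> x))) {..<length as}"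
  proof (rule X.finsum_V, rule funcsetI)
    fix i assume "i \<in> {..<length as}"
    then have "alg.alg.coord i a \<odot>\<^bsub>V\<^esub> ((as ! i) \<odot> x) \<in> carrier M" using m by auto
    then show "f (alg.alg.coord i a \<odot>\<^bsub>V\<^esub> ((as ! i) \<odot> x)) \<in> carrier X"
      using module_homD(1)[OF f] by (simp only: complex_space_simps(1))
  qed
  also have "\<dots> = a \<odot>\<^bsub>X\<^esub> f x"
    unfolding X.act_coord[OF a fx]
  proof (rule X.mod.M.finsum_cong')
    show "(\<lambda>i. alg.alg.coord i a \<odot>\<^bsub>X.V\<^esub> ((as ! i) \<odot>\<^bsub>X\<^esub> f x)) \<in> {..<length as} \<rightarrow> carrier X"
      by (intro funcsetI X.sc(1) X.mod.smult_closed fx) simp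
    fix i assume "i \<in> {..<length as}"
    then have i: "i < length as" by simp
    have "(as ! i) \<odot> x \<in> carrier V" using i x by (simp add: mod.smult_closed)
    then have "f (alg.alg.coord i a \<odot>\<^bsub>V\<^esub> ((as ! i) \<odot> x)) = alg.alg.coord i a \<odot>\<^bsub>X.V\<^esub> f ((as ! i) \<odot> x)"
      by (intro module_homD(3)[OF f]) simp_all
    then show "f (alg.alg.coord i a \<odot>\<^bsub>V\<^esub> ((as ! i) \<odot> x)) = alg.alg.coord i a \<odot>\<^bsub>X.V\<^esub> ((as ! i) \<odot>\<^bsub>X\<^esub> f x)"
      by (simp only: fas[OF i x])
  qed simp
  finally show "f (a \<odot> x) = a \<odot>\<^bsub>X\<^esub> f x" .
qed (use module_homD[OF f] in simp_all)

text \<open>Families \<open>F\<close> in \<open>M\<close> indexed by the basis of \<open>A\<close>, on which \<open>a\<close> acts by the matrix \<open>r a\<close>. For the left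
regular representation \<open>F\<close> stands for \<open>\<Sum> a\<^sub>k \<otimes> F\<^sub>k\<close> and this is \<open>A \<otimes>\<^sub>\<complex> M\<close>; if \<open>r a i k\<close> is the \<open>k\<close>-th
coordinate of \<open>a\<^sub>i a\<close>, it is \<open>Hom\<^sub>\<complex>(A, M)\<close>, a map being recorded by its values on the basis.\<close>

definition families :: "('r \<Rightarrow> nat \<Rightarrow> nat \<Rightarrow> complex) \<Rightarrow> ('r, nat \<Rightarrow> 'm) module" where
  "families r = \<lparr> carrier = {..<length as} \<rightarrow>\<^sub>E carrier M, mult = (\<lambda>F G. F), one = (\<lambda>i\<in>{..<length as}. \<zero>),
     zero = (\<lambda>i\<in>{..<length as}. \<zero>), add = (\<lambda>F G. \<lambda>i\<in>{..<length as}. F i \<oplus> G i),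
     smult = (\<lambda>a F. \<lambda>i\<in>{..<length as}. \<Oplus>k\<in>{..<length as}. r a i k \<odot>\<^bsub>V\<^esub> F k) \<rparr>"

lemma families_simps [simp]:
  "carrier (families r) = {..<length as} \<rightarrow>\<^sub>E carrier M" "\<zero>\<^bsub>families r\<^esub> = (\<lambda>i\<in>{..<length as}. \<zero>)"
  "F \<oplus>\<^bsub>families r\<^esub> G = (\<lambda>i\<in>{..<length as}. F i \<oplus> G i)"
  "a \<odot>\<^bsub>families r\<^esub> F = (\<lambda>i\<in>{..<length as}. \<Oplus>k\<in>{..<length as}. r a i k \<odot>\<^bsub>V\<^esub> F k)"
  by (simp_all add: families_def)

lemma families_eqI:
  "F \<in> {..<length as} \<rightarrow>\<^sub>E carrier M \<Longrightarrow> G \<in> {..<length as} \<rightarrow>\<^sub>E carrier M \<Longrightarrow>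
    (\<And>i. i < length as \<Longrightarrow> F i = G i) \<Longrightarrow> F = G"
  by (rule PiE_ext) auto

lemma families_nth: "F \<in> {..<length as} \<rightarrow>\<^sub>E carrier M \<Longrightarrow> i < length as \<Longrightarrow> F i \<in> carrier M"
  by auto

lemma families_abelian_group: "abelian_group (families r)"
proof (rule abelian_groupI; unfold families_simps)
  let ?C = "{..<length as} \<rightarrow>\<^sub>E carrier M"
  have cl: "(\<lambda>i\<in>{..<length as}. f i) \<in> ?C" if "\<And>i. i < length as \<Longrightarrow> f i \<in> carrier M" for f
    using that by (simp add: PiE_iff)
  fix F assume F: "F \<in> ?C"
  note Fi = families_nth[OF F]
  show "\<exists>G\<in>?C. (\<lambda>i\<in>{..<length as}. G i \<oplus> F i) = (\<lambda>i\<in>{..<length as}. \<zero>)"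
  proof (rule bexI[OF _ cl[of "\<lambda>i. \<ominus> F i"]])
    show "(\<lambda>i\<in>{..<length as}. (\<lambda>i\<in>{..<length as}. \<ominus> F i) i \<oplus> F i) = (\<lambda>i\<in>{..<length as}. \<zero>)"
      by (rule restrict_ext) (simp add: Fi mod.M.l_neg)
  qed (simp add: Fi)
  show "(\<lambda>i\<in>{..<length as}. (\<lambda>i\<in>{..<length as}. \<zero>) i \<oplus> F i) = F"
    by (rule families_eqI[OF cl F]) (simp_all add: Fi)
  fix G assume G: "G \<in> ?C"
  note Gi = families_nth[OF G]
  show "(\<lambda>i\<in>{..<length as}. F i \<oplus> G i) \<in> ?C" by (rule cl) (simp add: Fi Gi)
  show "(\<lambda>i\<in>{..<length as}. F i \<oplus> G i) = (\<lambda>i\<in>{..<length as}. G i \<oplus> F i)"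
    by (rule restrict_ext) (simp add: Fi Gi mod.M.a_comm)
  fix H assume H: "H \<in> ?C"
  note Hi = families_nth[OF H]
  show "(\<lambda>i\<in>{..<length as}. (\<lambda>i\<in>{..<length as}. F i \<oplus> G i) i \<oplus> H i) =
      (\<lambda>i\<in>{..<length as}. F i \<oplus> (\<lambda>i\<in>{..<length as}. G i \<oplus> H i) i)"
    by (rule restrict_ext) (simp add: Fi Gi Hi mod.M.a_assoc)
next
  show "(\<lambda>i\<in>{..<length as}. \<zero>) \<in> {..<length as} \<rightarrow>\<^sub>E carrier M" by (simp add: PiE_iff)
qed

lemma families_left_module:
  assumes r_add: "\<And>a b i k. a \<in> carrier A \<Longrightarrow> b \<in> carrier A \<Longrightarrow> i < length as \<Longrightarrow> k < length as \<Longrightarrow>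
      r (a \<oplus>\<^bsub>A\<^esub> b) i k = r a i k + r b i k"
    and r_mult: "\<And>a b i k. a \<in> carrier A \<Longrightarrow> b \<in> carrier A \<Longrightarrow> i < length as \<Longrightarrow> k < length as \<Longrightarrow>
      r (a \<otimes>\<^bsub>A\<^esub> b) i k = (\<Sum>j<length as. r a i j * r b j k)"
    and r_scalar: "\<And>c i k. i < length as \<Longrightarrow> k < length as \<Longrightarrow> r (c \<odot>\<^bsub>A\<^esub> \<one>\<^bsub>A\<^esub>) i k = (if i = k then c else 0)"
  shows "left_module A (families r)"
    and "\<And>c F i. F \<in> carrier (families r) \<Longrightarrow> i < length as \<Longrightarrow> (c \<odot>\<^bsub>complex_space A (families r)\<^esub> F) i = c \<odot>\<^bsub>V\<^esub> F i"
proof -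
  let ?D = "{..<length as}"
  let ?C = "?D \<rightarrow>\<^sub>E carrier M"
  have trm: "(\<lambda>k. c k \<odot>\<^bsub>V\<^esub> F k) \<in> ?D \<rightarrow> carrier M" if "F \<in> ?C" for F c
    by (intro funcsetI sc(1)) (use families_nth[OF that] in simp)
  have tot: "(\<Oplus>k\<in>?D. c k \<odot>\<^bsub>V\<^esub> F k) \<in> carrier M" if "F \<in> ?C" for F c
    by (rule mod.M.finsum_closed[OF trm[OF that]])
  have scalar: "(\<Oplus>k\<in>?D. r (c \<odot>\<^bsub>A\<^esub> \<one>\<^bsub>A\<^esub>) i k \<odot>\<^bsub>V\<^esub> F k) = c \<odot>\<^bsub>V\<^esub> F i" if F: "F \<in> ?C" and i: "i < length as" for F c i
  proof -
    have "(\<Oplus>k\<in>?D. r (c \<odot>\<^bsub>A\<^esub> \<one>\<^bsub>A\<^esub>) i k \<odot>\<^bsub>V\<^esub> F k) = (\<Oplus>k\<in>?D. (if i = k then c else 0) \<odot>\<^bsub>V\<^esub> F k)"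
      by (rule mod.M.finsum_cong'[OF refl trm[OF F]]) (simp only: lessThan_iff r_scalar[OF i])
    also have "\<dots> = c \<odot>\<^bsub>V\<^esub> F i"
      by (rule delta_finsum) (use i families_nth[OF F] in simp_all)
    finally show ?thesis .
  qed
  show "(c \<odot>\<^bsub>complex_space A (families r)\<^esub> F) i = c \<odot>\<^bsub>V\<^esub> F i"
    if "F \<in> carrier (families r)" "i < length as" for c F i
  proof -
    have "c \<odot>\<^bsub>complex_space A (families r)\<^esub> F = (c \<odot>\<^bsub>A\<^esub> \<one>\<^bsub>A\<^esub>) \<odot>\<^bsub>families r\<^esub> F"
      by (rule complex_space_simps(4))
    then show ?thesis
      using that by (simp only: families_simps restrict_apply lessThan_iff if_True scalar)
  qed
  show "left_module A (families r)"
  proof (intro left_module.intro families_abelian_group left_module_axioms.intro alg.ring_axioms; unfold families_simps)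
    fix a F assume a: "a \<in> carrier A" and F: "F \<in> ?C"
    note Fi = families_nth[OF F]
    show "(\<lambda>i\<in>?D. \<Oplus>k\<in>?D. r a i k \<odot>\<^bsub>V\<^esub> F k) \<in> ?C"
      using tot[OF F] by (simp add: PiE_iff del: complex_space_simps(4))
    {
      fix b assume b: "b \<in> carrier A"
      show "(\<lambda>i\<in>?D. \<Oplus>k\<in>?D. r (a \<oplus>\<^bsub>A\<^esub> b) i k \<odot>\<^bsub>V\<^esub> F k) =
          (\<lambda>i\<in>?D. (\<lambda>i\<in>?D. \<Oplus>k\<in>?D. r a i k \<odot>\<^bsub>V\<^esub> F k) i \<oplus> (\<lambda>i\<in>?D. \<Oplus>k\<in>?D. r b i k \<odot>\<^bsub>V\<^esub> F k) i)"
      proof (rule restrict_ext)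
        fix i assume i: "i \<in> ?D"
        have "(\<Oplus>k\<in>?D. r (a \<oplus>\<^bsub>A\<^esub> b) i k \<odot>\<^bsub>V\<^esub> F k) = (\<Oplus>k\<in>?D. r a i k \<odot>\<^bsub>V\<^esub> F k \<oplus> r b i k \<odot>\<^bsub>V\<^esub> F k)"
        proof (rule mod.M.finsum_cong'[OF refl])
          show "(\<lambda>k. r a i k \<odot>\<^bsub>V\<^esub> F k \<oplus> r b i k \<odot>\<^bsub>V\<^esub> F k) \<in> ?D \<rightarrow> carrier M"
            by (intro funcsetI mod.M.a_closed sc(1) Fi) simp_all
          fix k assume "k \<in> ?D"
          then show "r (a \<oplus>\<^bsub>A\<^esub> b) i k \<odot>\<^bsub>V\<^esub> F k = r a i k \<odot>\<^bsub>V\<^esub> F k \<oplus> r b i k \<odot>\<^bsub>V\<^esub> F k"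
            using r_add[OF a b, of i k] i sc(3)[OF Fi, of k] by (simp only: lessThan_iff)
        qed
        also have "\<dots> = (\<Oplus>k\<in>?D. r a i k \<odot>\<^bsub>V\<^esub> F k) \<oplus> (\<Oplus>k\<in>?D. r b i k \<odot>\<^bsub>V\<^esub> F k)"
          by (rule mod.M.finsum_addf[OF trm[OF F] trm[OF F]])
        finally show "(\<Oplus>k\<in>?D. r (a \<oplus>\<^bsub>A\<^esub> b) i k \<odot>\<^bsub>V\<^esub> F k) =
            (\<lambda>i\<in>?D. \<Oplus>k\<in>?D. r a i k \<odot>\<^bsub>V\<^esub> F k) i \<oplus> (\<lambda>i\<in>?D. \<Oplus>k\<in>?D. r b i k \<odot>\<^bsub>V\<^esub> F k) i"
          using i by (simp del: complex_space_simps(4))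
      qed
      show "(\<lambda>i\<in>?D. \<Oplus>k\<in>?D. r (a \<otimes>\<^bsub>A\<^esub> b) i k \<odot>\<^bsub>V\<^esub> F k) =
          (\<lambda>i\<in>?D. \<Oplus>j\<in>?D. r a i j \<odot>\<^bsub>V\<^esub> (\<lambda>j\<in>?D. \<Oplus>k\<in>?D. r b j k \<odot>\<^bsub>V\<^esub> F k) j)"
      proof (rule restrict_ext)
        fix i assume i: "i \<in> ?D"
        have cc: "r a i j \<odot>\<^bsub>V\<^esub> (r b j k \<odot>\<^bsub>V\<^esub> F k) \<in> carrier M" if "k \<in> ?D" for j k
          by (intro sc(1) Fi) (use that in simp)
        have "(\<Oplus>k\<in>?D. r (a \<otimes>\<^bsub>A\<^esub> b) i k \<odot>\<^bsub>V\<^esub> F k) = (\<Oplus>k\<in>?D. \<Oplus>j\<in>?D. r a i j \<odot>\<^bsub>V\<^esub> (r b j k \<odot>\<^bsub>V\<^esub> F k))"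
        proof (rule mod.M.finsum_cong'[OF refl])
          show "(\<lambda>k. \<Oplus>j\<in>?D. r a i j \<odot>\<^bsub>V\<^esub> (r b j k \<odot>\<^bsub>V\<^esub> F k)) \<in> ?D \<rightarrow> carrier M"
            by (intro funcsetI mod.M.finsum_closed cc)
          fix k assume k: "k \<in> ?D"
          then have Fk: "F k \<in> carrier M" using Fi by simp
          have "r (a \<otimes>\<^bsub>A\<^esub> b) i k \<odot>\<^bsub>V\<^esub> F k = (\<Sum>j\<in>?D. r a i j * r b j k) \<odot>\<^bsub>V\<^esub> F k"
            using r_mult[OF a b, of i k] i k by (simp only: lessThan_iff)
          also have "\<dots> = (\<Oplus>j\<in>?D. r a i j \<odot>\<^bsub>V\<^esub> (r b j k \<odot>\<^bsub>V\<^esub> F k))"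
            unfolding sum_sc[OF finite_lessThan Fk] sc(2)[OF Fk] ..
          finally show "r (a \<otimes>\<^bsub>A\<^esub> b) i k \<odot>\<^bsub>V\<^esub> F k = (\<Oplus>j\<in>?D. r a i j \<odot>\<^bsub>V\<^esub> (r b j k \<odot>\<^bsub>V\<^esub> F k))" .
        qed
        also have "\<dots> = (\<Oplus>j\<in>?D. \<Oplus>k\<in>?D. r a i j \<odot>\<^bsub>V\<^esub> (r b j k \<odot>\<^bsub>V\<^esub> F k))"
          by (rule mod.M.finsum_swap) (use cc in \<open>simp_all only: finite_lessThan\<close>)
        also have "\<dots> = (\<Oplus>j\<in>?D. r a i j \<odot>\<^bsub>V\<^esub> (\<lambda>j\<in>?D. \<Oplus>k\<in>?D. r b j k \<odot>\<^bsub>V\<^esub> F k) j)"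
        proof (rule mod.M.finsum_cong'[OF refl])
          show "(\<lambda>j. r a i j \<odot>\<^bsub>V\<^esub> (\<lambda>j\<in>?D. \<Oplus>k\<in>?D. r b j k \<odot>\<^bsub>V\<^esub> F k) j) \<in> ?D \<rightarrow> carrier M"
            by (intro funcsetI sc(1)) (simp only: restrict_apply if_True tot[OF F])
          fix j assume "j \<in> ?D"
          then show "(\<Oplus>k\<in>?D. r a i j \<odot>\<^bsub>V\<^esub> (r b j k \<odot>\<^bsub>V\<^esub> F k)) = r a i j \<odot>\<^bsub>V\<^esub> (\<lambda>j\<in>?D. \<Oplus>k\<in>?D. r b j k \<odot>\<^bsub>V\<^esub> F k) j"
            by (simp only: restrict_apply if_True sc_finsum[OF trm[OF F]])
        qed
        finally show "(\<Oplus>k\<in>?D. r (a \<otimes>\<^bsub>A\<^esub> b) i k \<odot>\<^bsub>V\<^esub> F k) =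
            (\<Oplus>j\<in>?D. r a i j \<odot>\<^bsub>V\<^esub> (\<lambda>j\<in>?D. \<Oplus>k\<in>?D. r b j k \<odot>\<^bsub>V\<^esub> F k) j)" .
      qed
    }
    fix G assume G: "G \<in> ?C"
    note Gi = families_nth[OF G]
    show "(\<lambda>i\<in>?D. \<Oplus>k\<in>?D. r a i k \<odot>\<^bsub>V\<^esub> (\<lambda>i\<in>?D. F i \<oplus> G i) k) =
        (\<lambda>i\<in>?D. (\<lambda>i\<in>?D. \<Oplus>k\<in>?D. r a i k \<odot>\<^bsub>V\<^esub> F k) i \<oplus> (\<lambda>i\<in>?D. \<Oplus>k\<in>?D. r a i k \<odot>\<^bsub>V\<^esub> G k) i)"
    proof (rule restrict_ext)
      fix i assume i: "i \<in> ?D"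
      have "(\<Oplus>k\<in>?D. r a i k \<odot>\<^bsub>V\<^esub> (\<lambda>i\<in>?D. F i \<oplus> G i) k) = (\<Oplus>k\<in>?D. r a i k \<odot>\<^bsub>V\<^esub> F k \<oplus> r a i k \<odot>\<^bsub>V\<^esub> G k)"
      proof (rule mod.M.finsum_cong'[OF refl])
        show "(\<lambda>k. r a i k \<odot>\<^bsub>V\<^esub> F k \<oplus> r a i k \<odot>\<^bsub>V\<^esub> G k) \<in> ?D \<rightarrow> carrier M"
          by (intro funcsetI mod.M.a_closed sc(1) Fi Gi) simp_all
        fix k assume "k \<in> ?D"
        then show "r a i k \<odot>\<^bsub>V\<^esub> (\<lambda>i\<in>?D. F i \<oplus> G i) k = r a i k \<odot>\<^bsub>V\<^esub> F k \<oplus> r a i k \<odot>\<^bsub>V\<^esub> G k"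
          using sc(4)[OF Fi Gi, of k k] by (simp only: restrict_apply if_True lessThan_iff)
      qed
      also have "\<dots> = (\<Oplus>k\<in>?D. r a i k \<odot>\<^bsub>V\<^esub> F k) \<oplus> (\<Oplus>k\<in>?D. r a i k \<odot>\<^bsub>V\<^esub> G k)"
        by (rule mod.M.finsum_addf[OF trm[OF F] trm[OF G]])
      finally show "(\<Oplus>k\<in>?D. r a i k \<odot>\<^bsub>V\<^esub> (\<lambda>i\<in>?D. F i \<oplus> G i) k) =
          (\<lambda>i\<in>?D. \<Oplus>k\<in>?D. r a i k \<odot>\<^bsub>V\<^esub> F k) i \<oplus> (\<lambda>i\<in>?D. \<Oplus>k\<in>?D. r a i k \<odot>\<^bsub>V\<^esub> G k) i"
        using i by (simp del: complex_space_simps(4))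
    qed
  next
    fix F assume F: "F \<in> ?C"
    note Fi = families_nth[OF F]
    show "(\<lambda>i\<in>?D. \<Oplus>k\<in>?D. r \<one>\<^bsub>A\<^esub> i k \<odot>\<^bsub>V\<^esub> F k) = F"
    proof (rule families_eqI[OF _ F])
      show "(\<lambda>i\<in>?D. \<Oplus>k\<in>?D. r \<one>\<^bsub>A\<^esub> i k \<odot>\<^bsub>V\<^esub> F k) \<in> ?C"
        using tot[OF F] by (simp add: PiE_iff del: complex_space_simps(4))
      fix i assume i: "i < length as"
      have "1 \<odot>\<^bsub>A\<^esub> \<one>\<^bsub>A\<^esub> = \<one>\<^bsub>A\<^esub>" using alg.alg.complex_module(5)[of "\<one>\<^bsub>A\<^esub>"] by simp
      then show "(\<lambda>i\<in>?D. \<Oplus>k\<in>?D. r \<one>\<^bsub>A\<^esub> i k \<odot>\<^bsub>V\<^esub> F k) i = F i"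
        using scalar[OF F i, of 1] sc(5)[OF Fi[OF i]] i by (simp only: restrict_apply lessThan_iff if_True)
    qed
  qed
qed

end

text \<open>The module structure on the image of an injection, used to bring concrete modules into the type over
which test modules range.\<close>

definition transport :: "('v \<Rightarrow> 'u) \<Rightarrow> ('r, 'v, 'z) module_scheme \<Rightarrow> ('r, 'u) module" where
  "transport f X = \<lparr> carrier = f ` carrier X, mult = (\<lambda>u v. u), one = f \<zero>\<^bsub>X\<^esub>, zero = f \<zero>\<^bsub>X\<^esub>,
     add = (\<lambda>u v. f (inv_into (carrier X) f u \<oplus>\<^bsub>X\<^esub> inv_into (carrier X) f v)),
     smult = (\<lambda>a u. f (a \<odot>\<^bsub>X\<^esub> inv_into (carrier X) f u)) \<rparr>"

lemma transport_module:
  assumes "left_module R X" and inj: "inj_on f (carrier X)"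
  shows "left_module R (transport f X)" and "f \<in> module_hom R X (transport f X)"
    and "inv_into (carrier X) f \<in> module_hom R (transport f X) X"
proof -
  interpret left_module R X by fact
  note gf [simp] = inv_into_f_f[OF inj]
  have ops: "carrier (transport f X) = f ` carrier X" "\<zero>\<^bsub>transport f X\<^esub> = f \<zero>\<^bsub>X\<^esub>"
    "\<And>x y. x \<in> carrier X \<Longrightarrow> y \<in> carrier X \<Longrightarrow> f x \<oplus>\<^bsub>transport f X\<^esub> f y = f (x \<oplus>\<^bsub>X\<^esub> y)"
    "\<And>a x. x \<in> carrier X \<Longrightarrow> a \<odot>\<^bsub>transport f X\<^esub> f x = f (a \<odot>\<^bsub>X\<^esub> x)"
    by (simp_all add: transport_def)
  have "abelian_group (transport f X)"
  proof (rule abelian_groupI)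
    fix x assume "x \<in> carrier (transport f X)"
    then obtain x' where x: "x' \<in> carrier X" "x = f x'" unfolding ops(1) by (rule imageE)
    show "\<exists>y\<in>carrier (transport f X). y \<oplus>\<^bsub>transport f X\<^esub> x = \<zero>\<^bsub>transport f X\<^esub>"
      by (rule bexI[of _ "f (\<ominus>\<^bsub>X\<^esub> x')"]) (simp_all add: x ops M.l_neg)
  qed (auto simp: ops M.a_ac elim!: imageE)
  then show "left_module R (transport f X)"
    by (intro left_module.intro left_module_axioms.intro ring_axioms)
      (auto simp: ops smult_closed smult_l_distr smult_r_distr smult_assoc1 smult_one elim!: imageE)
  show "f \<in> module_hom R X (transport f X)"
    by (rule module_homI) (simp_all add: ops)
  show "inv_into (carrier X) f \<in> module_hom R (transport f X) X"
    by (rule module_homI) (auto simp: ops smult_closed elim!: imageE)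
qed

text \<open>Lift the identity of \<open>M\<close>, after moving both modules into the type of test modules.\<close>

lemma projective_section:
  fixes fX :: "'x \<Rightarrow> 'u" and fM :: "'m \<Rightarrow> 'u"
  assumes proj: "projective_module TYPE('u) R M" and X: "left_module R X"
    and p: "p \<in> module_hom R X M" "p ` carrier X = carrier M"
    and inj: "inj_on fX (carrier X)" "inj_on fM (carrier M)"
  obtains h where "h \<in> module_hom R M X" "\<And>x. x \<in> carrier M \<Longrightarrow> p (h x) = x"
proof -
  have M: "left_module R M" using proj by (simp add: projective_module_def)
  note tX = transport_module[OF X inj(1)] and tM = transport_module[OF M inj(2)]
  let ?g = "inv_into (carrier X) fX"
  have img: "?g ` carrier (transport fX X) = carrier X"
  proof -
    have "?g ` fX ` carrier X = carrier X" using inv_into_f_f[OF inj(1)] by (force simp: image_image)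
    then show ?thesis by (simp add: transport_def)
  qed
  have p': "(\<lambda>u. fM (p (?g u))) \<in> module_hom R (transport fX X) (transport fM M)"
    by (rule module_homI) (simp_all add: module_homD[OF tX(3)] module_homD[OF p(1)] module_homD[OF tM(2)])
  have "(\<lambda>u. fM (p (?g u))) ` carrier (transport fX X) = fM ` p ` ?g ` carrier (transport fX X)"
    by (simp only: image_image)
  also have "\<dots> = carrier (transport fM M)" unfolding img p(2) by (simp add: transport_def)
  finally obtain h where h: "h \<in> module_hom R M (transport fX X)" "\<And>x. x \<in> carrier M \<Longrightarrow> fM (p (?g (h x))) = fM x"
    using proj tX(1) tM(1) p' tM(2) unfolding projective_module_def by blast
  show ?thesis
  proof (rule that[of "\<lambda>x. ?g (h x)"])
    show "(\<lambda>x. ?g (h x)) \<in> module_hom R M X"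
      by (rule module_homI) (simp_all add: module_homD[OF tX(3)] module_homD[OF h(1)])
    fix x assume x: "x \<in> carrier M"
    have "p (?g (h x)) \<in> carrier M"
      by (intro module_homD(1)[OF p(1)] module_homD(1)[OF tX(3)] module_homD(1)[OF h(1)] x)
    then show "p (?g (h x)) = x" using h(2)[OF x] inj(2) x by (simp add: inj_on_def)
  qed
qed

text \<open>Extend the identity of \<open>M\<close> along \<open>j\<close>, after moving both modules into the type of test modules.\<close>

lemma injective_retraction:
  fixes fY :: "'y \<Rightarrow> 'u" and fM :: "'m \<Rightarrow> 'u"
  assumes inje: "injective_module TYPE('u) R M" and Y: "left_module R Y"
    and j: "j \<in> module_hom R M Y" "inj_on j (carrier M)"
    and inj: "inj_on fY (carrier Y)" "inj_on fM (carrier M)"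
  obtains h where "h \<in> module_hom R Y M" "\<And>x. x \<in> carrier M \<Longrightarrow> h (j x) = x"
proof -
  have M: "left_module R M" using inje by (simp add: injective_module_def)
  note tY = transport_module[OF Y inj(1)] and tM = transport_module[OF M inj(2)]
  let ?g = "inv_into (carrier M) fM"
  have cM: "carrier (transport fM M) = fM ` carrier M" by (simp add: transport_def)
  have gf: "?g (fM x) = x" if "x \<in> carrier M" for x by (rule inv_into_f_f[OF inj(2) that])
  have j': "(\<lambda>u. fY (j (?g u))) \<in> module_hom R (transport fM M) (transport fY Y)"
    by (rule module_homI) (simp_all add: module_homD[OF tM(3)] module_homD[OF j(1)] module_homD[OF tY(2)])
  have "inj_on (\<lambda>u. fY (j (?g u))) (carrier (transport fM M))"
  proof (rule inj_onI)
    fix u v assume "u \<in> carrier (transport fM M)" "v \<in> carrier (transport fM M)" and eq: "fY (j (?g u)) = fY (j (?g v))"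
    then obtain x y where x: "x \<in> carrier M" "u = fM x" and y: "y \<in> carrier M" "v = fM y" unfolding cM by blast
    have "fY (j x) = fY (j y)" using eq x y by (simp add: gf)
    then have "j x = j y" by (rule inj_onD[OF inj(1)]) (use module_homD(1)[OF j(1)] x y in auto)
    then show "u = v" using inj_onD[OF j(2)] x y by blast
  qed
  then obtain h where h: "h \<in> module_hom R (transport fY Y) M"
      "\<And>u. u \<in> carrier (transport fM M) \<Longrightarrow> h (fY (j (?g u))) = ?g u"
    using inje tY(1) tM(1) j' tM(3) unfolding injective_module_def by blast
  show ?thesis
  proof (rule that[of "\<lambda>y. h (fY y)"])
    show "(\<lambda>y. h (fY y)) \<in> module_hom R Y M"
      by (rule module_homI) (simp_all add: module_homD[OF tY(2)] module_homD[OF h(1)])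
    fix x assume x: "x \<in> carrier M"
    then show "h (fY (j x)) = x" using h(2)[of "fM x"] by (simp add: cM gf)
  qed
qed

lemma (in based_algebra) coord_mult_left:
  "a \<in> carrier A \<Longrightarrow> y \<in> carrier A \<Longrightarrow> i < length as \<Longrightarrow>
    alg.coord i (a \<otimes> y) = (\<Sum>j<length as. alg.coord i (a \<otimes> (as ! j)) * alg.coord j y)"
  by (rule alg.coord_linear[OF left_mult_linear])

lemma (in based_algebra) coord_mult_right:
  "a \<in> carrier A \<Longrightarrow> y \<in> carrier A \<Longrightarrow> i < length as \<Longrightarrow>
    alg.coord i (y \<otimes> a) = (\<Sum>j<length as. alg.coord i ((as ! j) \<otimes> a) * alg.coord j y)"
  by (rule alg.coord_linear[OF right_mult_linear])

context based_module
begin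

definition encode :: "'m \<Rightarrow> nat \<Rightarrow> complex" where
  "encode x = (\<lambda>k. if k < length bs then V.coord k x else 0)"

lemma inj_encode: "inj_on encode (carrier M)"
proof (rule inj_onI)
  fix x y assume xy: "x \<in> carrier M" "y \<in> carrier M" "encode x = encode y"
  show "x = y"
  proof (rule V.coord_eqI)
    fix i assume "i < length bs"
    then show "V.coord i x = V.coord i y" using fun_cong[OF xy(3), of i] by (simp add: encode_def)
  qed (use xy in simp_all)
qed

text \<open>All coordinates of all members, arranged in one sequence by the pairing function.\<close>

definition encode_family :: "(nat \<Rightarrow> 'm) \<Rightarrow> nat \<Rightarrow> complex" where
  "encode_family F = (\<lambda>k. encode (F (fst (prod_decode k))) (snd (prod_decode k)))"

lemma inj_encode_family: "inj_on encode_family ({..<length as} \<rightarrow>\<^sub>E carrier M)"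
proof (rule inj_onI)
  fix F G assume F: "F \<in> {..<length as} \<rightarrow>\<^sub>E carrier M" and G: "G \<in> {..<length as} \<rightarrow>\<^sub>E carrier M"
    and eq: "encode_family F = encode_family G"
  show "F = G"
  proof (rule families_eqI[OF F G])
    fix i assume i: "i < length as"
    have "encode (F i) = encode (G i)"
    proof
      fix k show "encode (F i) k = encode (G i) k"
        using fun_cong[OF eq, of "prod_encode (i, k)"] by (simp add: encode_family_def)
    qed
    then show "F i = G i" using inj_onD[OF inj_encode] families_nth[OF F i] families_nth[OF G i] by blast
  qed
qed

text \<open>The coordinate-free form of \<open>splits\<close>; \<open>cosplitting_endos\<close> is its dual, describing a retraction of
\<open>M \<rightarrow> Hom\<^sub>\<complex>(A, M)\<close>.\<close>

abbreviation "splitting_endos T \<equiv> (\<forall>k<length as. T k \<in> module_hom class_ring V V) \<and>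
  (\<forall>x\<in>carrier M. (\<Oplus>k\<in>{..<length as}. (as ! k) \<odot> T k x) = x) \<and>
  (\<forall>j<length as. \<forall>l<length as. \<forall>x\<in>carrier M.
     T j ((as ! l) \<odot> x) = (\<Oplus>k\<in>{..<length as}. alg.str l k j \<odot>\<^bsub>V\<^esub> T k x))"

abbreviation "cosplitting_endos T \<equiv> (\<forall>k<length as. T k \<in> module_hom class_ring V V) \<and>
  (\<forall>x\<in>carrier M. (\<Oplus>k\<in>{..<length as}. T k ((as ! k) \<odot> x)) = x) \<and>
  (\<forall>j<length as. \<forall>l<length as. \<forall>x\<in>carrier M.
     (as ! l) \<odot> T j x = (\<Oplus>k\<in>{..<length as}. alg.str k l j \<odot>\<^bsub>V\<^esub> T k x))"

text \<open>The action map \<open>A \<otimes>\<^sub>\<complex> M \<rightarrow> M\<close> is surjective, and the components of a section of it are the required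
endomorphisms.\<close>

lemma endos_if_projective:
  fixes universe :: "(nat \<Rightarrow> complex) \<Rightarrow> 'u"
  assumes inj: "inj universe" and proj: "projective_module TYPE('u) A M"
  shows "\<exists>T. splitting_endos T"
proof -
  let ?D = "{..<length as}"
  define r where "r a i k = alg.alg.coord i (a \<otimes>\<^bsub>A\<^esub> (as ! k))" for a i k
  let ?X = "families r"
  have r: "a \<in> carrier A \<Longrightarrow> b \<in> carrier A \<Longrightarrow> i < length as \<Longrightarrow> k < length as \<Longrightarrow> r (a \<oplus>\<^bsub>A\<^esub> b) i k = r a i k + r b i k"
    "a \<in> carrier A \<Longrightarrow> b \<in> carrier A \<Longrightarrow> i < length as \<Longrightarrow> k < length as \<Longrightarrow>
      r (a \<otimes>\<^bsub>A\<^esub> b) i k = (\<Sum>j<length as. r a i j * r b j k)"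
    "i < length as \<Longrightarrow> k < length as \<Longrightarrow> r (c \<odot>\<^bsub>A\<^esub> \<one>\<^bsub>A\<^esub>) i k = (if i = k then c else 0)" for a b c i k
    unfolding r_def using alg.coord_mult_left[of a "b \<otimes>\<^bsub>A\<^esub> (as ! k)" i]
    by (simp_all add: alg.l_distr alg.m_assoc alg.scalar_mult alg.alg.coord_add alg.alg.coord_smult alg.alg.coord_bs)
  have X: "left_module A ?X"
    by (rule families_left_module(1)) (rule r; assumption)+
  have scalar: "\<And>c F i. F \<in> carrier ?X \<Longrightarrow> i < length as \<Longrightarrow> (c \<odot>\<^bsub>complex_space A ?X\<^esub> F) i = c \<odot>\<^bsub>V\<^esub> F i"
    by (rule families_left_module(2)) (rule r; assumption | assumption)+
  define p where "p F = (\<Oplus>k\<in>?D. (as ! k) \<odot> F k)" for F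
  have trm: "(\<lambda>k. (as ! k) \<odot> F k) \<in> ?D \<rightarrow> carrier M" if "F \<in> carrier ?X" for F
    using that by (intro funcsetI mod.smult_closed) auto
  have p: "p \<in> module_hom A ?X M"
  proof (rule module_homI)
    fix F assume F: "F \<in> carrier ?X"
    then have Fi: "i < length as \<Longrightarrow> F i \<in> carrier M" for i by auto
    show "p F \<in> carrier M" unfolding p_def by (rule mod.M.finsum_closed[OF trm[OF F]])
    {
      fix G assume G: "G \<in> carrier ?X"
      then have Gi: "i < length as \<Longrightarrow> G i \<in> carrier M" for i by auto
      show "p (F \<oplus>\<^bsub>?X\<^esub> G) = p F \<oplus> p G"
        unfolding p_def mod.M.finsum_addf[OF trm[OF F] trm[OF G], symmetric]
      proof (rule mod.M.finsum_cong'[OF refl])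
        show "(\<lambda>k. (as ! k) \<odot> F k \<oplus> (as ! k) \<odot> G k) \<in> ?D \<rightarrow> carrier M"
          by (intro funcsetI mod.M.a_closed mod.smult_closed) (simp_all add: Fi Gi)
      qed (simp add: Fi Gi mod.smult_r_distr)
    }
    fix a assume a: "a \<in> carrier A"
    have cc: "r a i k \<odot>\<^bsub>V\<^esub> ((as ! i) \<odot> F k) \<in> carrier M" if "i \<in> ?D" "k \<in> ?D" for i k
      by (intro sc(1) mod.smult_closed Fi) (use that in simp_all)
    have "p (a \<odot>\<^bsub>?X\<^esub> F) = (\<Oplus>i\<in>?D. \<Oplus>k\<in>?D. r a i k \<odot>\<^bsub>V\<^esub> ((as ! i) \<odot> F k))"
      unfolding p_def
    proof (rule mod.M.finsum_cong'[OF refl])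
      show "(\<lambda>i. \<Oplus>k\<in>?D. r a i k \<odot>\<^bsub>V\<^esub> ((as ! i) \<odot> F k)) \<in> ?D \<rightarrow> carrier M"
        by (intro funcsetI mod.M.finsum_closed cc)
      fix i assume i: "i \<in> ?D"
      have "(as ! i) \<odot> (a \<odot>\<^bsub>?X\<^esub> F) i = (as ! i) \<odot> (\<Oplus>k\<in>?D. r a i k \<odot>\<^bsub>V\<^esub> F k)"
        using i by (simp only: families_simps restrict_apply if_True)
      also have "\<dots> = (\<Oplus>k\<in>?D. (as ! i) \<odot> (r a i k \<odot>\<^bsub>V\<^esub> F k))"
        by (intro act_finsum_right funcsetI sc(1) Fi) (use i in simp_all)
      also have "\<dots> = (\<Oplus>k\<in>?D. r a i k \<odot>\<^bsub>V\<^esub> ((as ! i) \<odot> F k))"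
      proof (rule mod.M.finsum_cong'[OF refl])
        fix k assume "k \<in> ?D"
        then show "(as ! i) \<odot> (r a i k \<odot>\<^bsub>V\<^esub> F k) = r a i k \<odot>\<^bsub>V\<^esub> ((as ! i) \<odot> F k)"
          by (intro act_scalar(2) Fi) (use i in simp_all)
      qed (use i cc in blast)
      finally show "(as ! i) \<odot> (a \<odot>\<^bsub>?X\<^esub> F) i = (\<Oplus>k\<in>?D. r a i k \<odot>\<^bsub>V\<^esub> ((as ! i) \<odot> F k))" .
    qed
    also have "\<dots> = (\<Oplus>k\<in>?D. \<Oplus>i\<in>?D. r a i k \<odot>\<^bsub>V\<^esub> ((as ! i) \<odot> F k))"
      by (rule mod.M.finsum_swap) (use cc in \<open>simp_all only: finite_lessThan\<close>)
    also have "\<dots> = (\<Oplus>k\<in>?D. a \<odot> ((as ! k) \<odot> F k))"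
    proof (rule mod.M.finsum_cong'[OF refl])
      show "(\<lambda>k. a \<odot> ((as ! k) \<odot> F k)) \<in> ?D \<rightarrow> carrier M"
        by (intro funcsetI mod.smult_closed a Fi) simp_all
      fix k assume "k \<in> ?D"
      then have k: "as ! k \<in> carrier A" "F k \<in> carrier M" using Fi by simp_all
      show "(\<Oplus>i\<in>?D. r a i k \<odot>\<^bsub>V\<^esub> ((as ! i) \<odot> F k)) = a \<odot> ((as ! k) \<odot> F k)"
        unfolding r_def mod.smult_assoc1[OF a k, symmetric] by (rule act_coord[symmetric]) (use a k in simp_all)
    qed
    also have "\<dots> = a \<odot> p F"
      unfolding p_def by (rule act_finsum_right[symmetric, OF trm[OF F] a])
    finally show "p (a \<odot>\<^bsub>?X\<^esub> F) = a \<odot> p F" .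
  qed
  have "p ` carrier ?X = carrier M"
  proof
    show "p ` carrier ?X \<subseteq> carrier M" using module_homD(1)[OF p] by blast
    show "carrier M \<subseteq> p ` carrier ?X"
    proof
      fix x assume x: "x \<in> carrier M"
      \<comment> \<open>The preimage \<open>1 \<otimes> x\<close>.\<close>
      let ?F = "\<lambda>i\<in>?D. alg.alg.coord i \<one>\<^bsub>A\<^esub> \<odot>\<^bsub>V\<^esub> x"
      have "?F \<in> carrier ?X" unfolding families_simps PiE_iff using sc(1)[OF x] by (simp del: complex_space_simps(4))
      moreover have "p ?F = x"
      proof -
        have "p ?F = (\<Oplus>k\<in>?D. alg.alg.coord k \<one>\<^bsub>A\<^esub> \<odot>\<^bsub>V\<^esub> ((as ! k) \<odot> x))"
          unfolding p_def
        proof (rule mod.M.finsum_cong'[OF refl])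
          show "(\<lambda>k. alg.alg.coord k \<one>\<^bsub>A\<^esub> \<odot>\<^bsub>V\<^esub> ((as ! k) \<odot> x)) \<in> ?D \<rightarrow> carrier M"
            by (intro funcsetI sc(1) mod.smult_closed x) simp
          fix k assume k: "k \<in> ?D"
          have "(as ! k) \<odot> (alg.alg.coord k \<one>\<^bsub>A\<^esub> \<odot>\<^bsub>V\<^esub> x) = alg.alg.coord k \<one>\<^bsub>A\<^esub> \<odot>\<^bsub>V\<^esub> ((as ! k) \<odot> x)"
            by (rule act_scalar(2)) (use k x in simp_all)
          then show "(as ! k) \<odot> ?F k = alg.alg.coord k \<one>\<^bsub>A\<^esub> \<odot>\<^bsub>V\<^esub> ((as ! k) \<odot> x)"
            using k by (simp only: restrict_apply if_True)
        qed
        also have "\<dots> = x" using act_coord[OF alg.one_closed x] mod.smult_one[OF x] by (simp only:)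
        finally show ?thesis .
      qed
      ultimately show "x \<in> p ` carrier ?X" by (metis imageI)
    qed
  qed
  note surj = this
  have "inj_on (universe \<circ> encode_family) (carrier ?X)" "inj_on (universe \<circ> encode) (carrier M)"
    by (rule comp_inj_on, simp add: inj_encode_family inj_encode, rule inj_on_subset[OF inj], simp)+
  then obtain h where h: "h \<in> module_hom A M ?X" and ph: "\<And>x. x \<in> carrier M \<Longrightarrow> p (h x) = x"
    by (rule projective_section[OF proj X p surj]) (rule that)
  have hx: "h x k \<in> carrier M" if "x \<in> carrier M" "k < length as" for x k
    using module_homD(1)[OF h that(1)] families_nth[of "h x" k] that(2) by (simp only: families_simps)
  have hC: "h \<in> module_hom class_ring V (complex_space A ?X)" by (rule hom_complex_linear[OF h])
  show ?thesis
  proof (intro exI[of _ "\<lambda>k x. h x k"] conjI allI impI ballI)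
    fix k assume k: "k < length as"
    show "(\<lambda>x. h x k) \<in> module_hom class_ring V V"
    proof (rule module_homI)
      fix x assume x: "x \<in> carrier V"
      then have xM: "x \<in> carrier M" by simp
      show "h x k \<in> carrier V" using hx[OF xM k] by simp
      show "h (x \<oplus>\<^bsub>V\<^esub> y) k = h x k \<oplus>\<^bsub>V\<^esub> h y k" if "y \<in> carrier V" for y
        using module_homD(2)[OF h xM, of y] that k by simp
      show "h (c \<odot>\<^bsub>V\<^esub> x) k = c \<odot>\<^bsub>V\<^esub> h x k" for c
        using module_homD(3)[OF hC _ x, of c] scalar[OF module_homD(1)[OF h xM] k, of c]
        by (simp del: complex_space_simps(4))
    qed
  next
    fix x assume x: "x \<in> carrier M"
    show "(\<Oplus>k\<in>?D. (as ! k) \<odot> h x k) = x" using ph[OF x] unfolding p_def .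
  next
    fix j l x assume jl: "j < length as" "l < length as" and x: "x \<in> carrier M"
    have "h ((as ! l) \<odot> x) = (as ! l) \<odot>\<^bsub>?X\<^esub> h x"
      by (rule module_homD(3)[OF h]) (use jl x in simp_all)
    then show "h ((as ! l) \<odot> x) j = (\<Oplus>k\<in>?D. alg.str l k j \<odot>\<^bsub>V\<^esub> h x k)"
      using jl unfolding r_def alg.str_def by (simp only: families_simps restrict_apply lessThan_iff if_True)
  qed
qed

text \<open>A \<open>\<complex>\<close>-linear lift \<open>h\<^sub>0\<close> of \<open>g\<close> exists because \<open>M\<close> has a basis; \<open>x \<mapsto> \<Sum> a\<^sub>k h\<^sub>0 (T\<^sub>k x)\<close> is an \<open>A\<close>-linear one.\<close>

lemma projective_if_endos:
  assumes "splitting_endos T"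
  shows "projective_module TYPE('u) A M"
  unfolding projective_module_def
proof (intro conjI allI impI mod.left_module_axioms; elim conjE)
  fix X Y :: "('r, 'u) module" and p g
  assume X: "left_module A X" and Y: "left_module A Y" and p: "p \<in> module_hom A X Y" and surj: "p ` carrier X = carrier Y"
    and g: "g \<in> module_hom A M Y"
  let ?D = "{..<length as}"
  interpret X: algebra_module A as X using X by (intro algebra_module.intro alg.based_algebra_axioms)
  interpret Y: algebra_module A as Y using Y by (intro algebra_module.intro alg.based_algebra_axioms)
  have T: "k < length as \<Longrightarrow> T k \<in> module_hom class_ring V V"
    and T1: "x \<in> carrier M \<Longrightarrow> (\<Oplus>k\<in>?D. (as ! k) \<odot> T k x) = x"
    and T2: "j < length as \<Longrightarrow> l < length as \<Longrightarrow> x \<in> carrier M \<Longrightarrow>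
      T j ((as ! l) \<odot> x) = (\<Oplus>k\<in>?D. alg.str l k j \<odot>\<^bsub>V\<^esub> T k x)" for k j l x
    using assms by blast+
  have Tc: "T k x \<in> carrier M" if "k < length as" "x \<in> carrier M" for k x
    using module_homD(1)[OF T[OF that(1)]] that(2) by simp
  have "\<forall>i. \<exists>y. i < length bs \<longrightarrow> y \<in> carrier X \<and> p y = g (bs ! i)"
  proof (intro allI)
    fix i
    show "\<exists>y. i < length bs \<longrightarrow> y \<in> carrier X \<and> p y = g (bs ! i)"
      using module_homD(1)[OF g, of "bs ! i"] surj by (metis bs_in_M imageE)
  qed
  then obtain w where w: "\<And>i. i < length bs \<Longrightarrow> w i \<in> carrier X" "\<And>i. i < length bs \<Longrightarrow> p (w i) = g (bs ! i)"
    by metis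
  define h0 where "h0 x = (\<Oplus>\<^bsub>X.V\<^esub>i\<in>{..<length bs}. V.coord i x \<odot>\<^bsub>X.V\<^esub> w i)" for x
  have h0: "h0 \<in> module_hom class_ring V X.V" "\<And>i. i < length bs \<Longrightarrow> h0 (bs ! i) = w i"
    unfolding h0_def using V.linear_extend[OF X.V_module, of w] w(1) by simp_all
  have h0c: "x \<in> carrier M \<Longrightarrow> h0 x \<in> carrier X" for x using module_homD(1)[OF h0(1), of x] by simp
  have pC: "p \<in> module_hom class_ring X.V Y.V" by (rule X.hom_complex_linear[OF p])
  have gC: "g \<in> module_hom class_ring V Y.V" by (rule hom_complex_linear[OF g])
  have ph0: "p (h0 x) = g x" if "x \<in> carrier M" for x
  proof (rule V.linear_eqI[of "\<lambda>x. p (h0 x)" Y.V g])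
    show "(\<lambda>x. p (h0 x)) \<in> module_hom class_ring V Y.V"
      by (rule module_homI) (simp_all only: module_homD[OF h0(1)] module_homD[OF pC])
  qed (use that gC Y.V_module w h0 in simp_all)
  define h where "h x = (\<Oplus>\<^bsub>X\<^esub>k\<in>?D. (as ! k) \<odot>\<^bsub>X\<^esub> h0 (T k x))" for x
  have trm: "(\<lambda>k. (as ! k) \<odot>\<^bsub>X\<^esub> h0 (T k x)) \<in> ?D \<rightarrow> carrier X" if "x \<in> carrier M" for x
    by (intro funcsetI X.mod.smult_closed h0c Tc that) simp_all
  have hhom: "h \<in> module_hom A M X"
  proof (rule hom_if_basis_hom)
    show "algebra_module A as X" by (rule X.algebra_module_axioms)
    show "h \<in> module_hom class_ring V X.V"
    proof (rule module_homI)
      fix x assume x: "x \<in> carrier V"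
      then have xM: "x \<in> carrier M" by simp
      show "h x \<in> carrier X.V" unfolding h_def complex_space_simps(1) by (rule X.mod.M.finsum_closed[OF trm[OF xM]])
      show "h (x \<oplus>\<^bsub>V\<^esub> y) = h x \<oplus>\<^bsub>X.V\<^esub> h y" if y: "y \<in> carrier V" for y
      proof -
        have yM: "y \<in> carrier M" using y by simp
        show ?thesis
          unfolding h_def complex_space_simps(2)[of A X] X.mod.M.finsum_addf[OF trm[OF xM] trm[OF yM], symmetric]
        proof (rule X.mod.M.finsum_cong'[OF refl])
          show "(\<lambda>k. (as ! k) \<odot>\<^bsub>X\<^esub> h0 (T k x) \<oplus>\<^bsub>X\<^esub> (as ! k) \<odot>\<^bsub>X\<^esub> h0 (T k y)) \<in> ?D \<rightarrow> carrier X"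
            by (intro funcsetI X.mod.M.a_closed X.mod.smult_closed h0c Tc xM yM) simp_all
          fix k assume "k \<in> ?D"
          then have k: "k < length as" by simp
          have "h0 (T k (x \<oplus>\<^bsub>V\<^esub> y)) = h0 (T k x) \<oplus>\<^bsub>X.V\<^esub> h0 (T k y)"
            using module_homD(2)[OF T[OF k] x y] module_homD(2)[OF h0(1), of "T k x" "T k y"]
              Tc[OF k xM] Tc[OF k yM] by simp
          then show "(as ! k) \<odot>\<^bsub>X\<^esub> h0 (T k (x \<oplus>\<^bsub>V\<^esub> y)) = (as ! k) \<odot>\<^bsub>X\<^esub> h0 (T k x) \<oplus>\<^bsub>X\<^esub> (as ! k) \<odot>\<^bsub>X\<^esub> h0 (T k y)"
            using X.mod.smult_r_distr[of "as ! k" "h0 (T k x)" "h0 (T k y)"] h0c[OF Tc[OF k xM]] h0c[OF Tc[OF k yM]] k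
            by simp
        qed
      qed
      show "h (c \<odot>\<^bsub>V\<^esub> x) = c \<odot>\<^bsub>X.V\<^esub> h x" for c
        unfolding h_def X.sc_finsum[OF trm[OF xM]]
      proof (rule X.mod.M.finsum_cong'[OF refl])
        show "(\<lambda>k. c \<odot>\<^bsub>X.V\<^esub> ((as ! k) \<odot>\<^bsub>X\<^esub> h0 (T k x))) \<in> ?D \<rightarrow> carrier X"
          by (intro funcsetI X.sc(1) X.mod.smult_closed h0c Tc xM) simp_all
        fix k assume "k \<in> ?D"
        then have k: "k < length as" by simp
        have "T k x \<in> carrier V" using Tc[OF k xM] by simp
        then have "h0 (T k (c \<odot>\<^bsub>V\<^esub> x)) = c \<odot>\<^bsub>X.V\<^esub> h0 (T k x)"
          using module_homD(3)[OF T[OF k] _ x, of c] module_homD(3)[OF h0(1), of c "T k x"]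
          by (simp del: complex_space_simps(4))
        then show "(as ! k) \<odot>\<^bsub>X\<^esub> h0 (T k (c \<odot>\<^bsub>V\<^esub> x)) = c \<odot>\<^bsub>X.V\<^esub> ((as ! k) \<odot>\<^bsub>X\<^esub> h0 (T k x))"
          using X.act_scalar(2)[of "as ! k" "h0 (T k x)" c] h0c[OF Tc[OF k xM]] k
          by (simp only: alg.as_closed)
      qed
    qed
    fix l x assume l: "l < length as" and x: "x \<in> carrier M"
    have cc: "alg.str l k j \<odot>\<^bsub>X.V\<^esub> ((as ! j) \<odot>\<^bsub>X\<^esub> h0 (T k x)) \<in> carrier X" if "k \<in> ?D" "j \<in> ?D" for j k
      by (intro X.sc(1) X.mod.smult_closed h0c Tc x) (use that in simp_all)
    have "h ((as ! l) \<odot> x) = (\<Oplus>\<^bsub>X\<^esub>j\<in>?D. \<Oplus>\<^bsub>X\<^esub>k\<in>?D. alg.str l k j \<odot>\<^bsub>X.V\<^esub> ((as ! j) \<odot>\<^bsub>X\<^esub> h0 (T k x)))"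
      unfolding h_def
    proof (rule X.mod.M.finsum_cong'[OF refl])
      show "(\<lambda>j. \<Oplus>\<^bsub>X\<^esub>k\<in>?D. alg.str l k j \<odot>\<^bsub>X.V\<^esub> ((as ! j) \<odot>\<^bsub>X\<^esub> h0 (T k x))) \<in> ?D \<rightarrow> carrier X"
        by (intro funcsetI X.mod.M.finsum_closed cc)
      fix j assume jD: "j \<in> ?D"
      then have j: "j < length as" by simp
      have mT: "(\<lambda>k. alg.str l k j \<odot>\<^bsub>V\<^esub> T k x) \<in> ?D \<rightarrow> carrier M"
        by (intro funcsetI sc(1) Tc x) simp
      have "h0 (T j ((as ! l) \<odot> x)) = (\<Oplus>\<^bsub>X.V\<^esub>k\<in>?D. h0 (alg.str l k j \<odot>\<^bsub>V\<^esub> T k x))"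
        unfolding T2[OF j l x] finsum_V[OF mT, symmetric]
        by (rule linear_finsum[OF V_module X.V_module h0(1)]) (use mT in simp)
      also have "\<dots> = (\<Oplus>\<^bsub>X\<^esub>k\<in>?D. h0 (alg.str l k j \<odot>\<^bsub>V\<^esub> T k x))"
        by (intro X.finsum_V funcsetI h0c sc(1) Tc x) simp
      also have "\<dots> = (\<Oplus>\<^bsub>X\<^esub>k\<in>?D. alg.str l k j \<odot>\<^bsub>X.V\<^esub> h0 (T k x))"
      proof (rule X.mod.M.finsum_cong'[OF refl])
        show "(\<lambda>k. alg.str l k j \<odot>\<^bsub>X.V\<^esub> h0 (T k x)) \<in> ?D \<rightarrow> carrier X"
          by (intro funcsetI X.sc(1) h0c Tc x) simp
        fix k assume "k \<in> ?D"
        then have "T k x \<in> carrier V" using Tc[OF _ x] by simp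
        then show "h0 (alg.str l k j \<odot>\<^bsub>V\<^esub> T k x) = alg.str l k j \<odot>\<^bsub>X.V\<^esub> h0 (T k x)"
          by (intro module_homD(3)[OF h0(1)]) simp_all
      qed
      finally have "(as ! j) \<odot>\<^bsub>X\<^esub> h0 (T j ((as ! l) \<odot> x)) =
          (as ! j) \<odot>\<^bsub>X\<^esub> (\<Oplus>\<^bsub>X\<^esub>k\<in>?D. alg.str l k j \<odot>\<^bsub>X.V\<^esub> h0 (T k x))" by (rule arg_cong)
      also have "\<dots> = (\<Oplus>\<^bsub>X\<^esub>k\<in>?D. (as ! j) \<odot>\<^bsub>X\<^esub> (alg.str l k j \<odot>\<^bsub>X.V\<^esub> h0 (T k x)))"
        by (intro X.act_finsum_right funcsetI X.sc(1) h0c Tc x) (use j in simp_all)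
      also have "\<dots> = (\<Oplus>\<^bsub>X\<^esub>k\<in>?D. alg.str l k j \<odot>\<^bsub>X.V\<^esub> ((as ! j) \<odot>\<^bsub>X\<^esub> h0 (T k x)))"
      proof (rule X.mod.M.finsum_cong'[OF refl])
        fix k assume "k \<in> ?D"
        then show "(as ! j) \<odot>\<^bsub>X\<^esub> (alg.str l k j \<odot>\<^bsub>X.V\<^esub> h0 (T k x)) = alg.str l k j \<odot>\<^bsub>X.V\<^esub> ((as ! j) \<odot>\<^bsub>X\<^esub> h0 (T k x))"
          by (intro X.act_scalar(2) h0c Tc x) (use j in simp_all)
      qed (use cc jD in blast)
      finally show "(as ! j) \<odot>\<^bsub>X\<^esub> h0 (T j ((as ! l) \<odot> x)) =
          (\<Oplus>\<^bsub>X\<^esub>k\<in>?D. alg.str l k j \<odot>\<^bsub>X.V\<^esub> ((as ! j) \<odot>\<^bsub>X\<^esub> h0 (T k x)))" .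
    qed
    also have "\<dots> = (\<Oplus>\<^bsub>X\<^esub>k\<in>?D. \<Oplus>\<^bsub>X\<^esub>j\<in>?D. alg.str l k j \<odot>\<^bsub>X.V\<^esub> ((as ! j) \<odot>\<^bsub>X\<^esub> h0 (T k x)))"
      by (rule X.mod.M.finsum_swap) (use cc in \<open>simp_all only: finite_lessThan\<close>)
    also have "\<dots> = (\<Oplus>\<^bsub>X\<^esub>k\<in>?D. (as ! l) \<odot>\<^bsub>X\<^esub> ((as ! k) \<odot>\<^bsub>X\<^esub> h0 (T k x)))"
    proof (rule X.mod.M.finsum_cong'[OF refl])
      show "(\<lambda>k. (as ! l) \<odot>\<^bsub>X\<^esub> ((as ! k) \<odot>\<^bsub>X\<^esub> h0 (T k x))) \<in> ?D \<rightarrow> carrier X"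
        by (intro funcsetI X.mod.smult_closed h0c Tc x) (use l in simp_all)
      fix k assume "k \<in> ?D"
      then have k: "as ! k \<in> carrier A" "h0 (T k x) \<in> carrier X" using h0c Tc x by simp_all
      have al: "as ! l \<in> carrier A" using l by simp
      show "(\<Oplus>\<^bsub>X\<^esub>j\<in>?D. alg.str l k j \<odot>\<^bsub>X.V\<^esub> ((as ! j) \<odot>\<^bsub>X\<^esub> h0 (T k x))) = (as ! l) \<odot>\<^bsub>X\<^esub> ((as ! k) \<odot>\<^bsub>X\<^esub> h0 (T k x))"
        unfolding X.mod.smult_assoc1[OF al k, symmetric] alg.str_def
        by (rule X.act_coord[symmetric]) (use al k in simp_all)
    qed
    also have "\<dots> = (as ! l) \<odot>\<^bsub>X\<^esub> h x"
      unfolding h_def by (rule X.act_finsum_right[symmetric, OF trm[OF x]]) (use l in simp)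
    finally show "h ((as ! l) \<odot> x) = (as ! l) \<odot>\<^bsub>X\<^esub> h x" .
  qed
  moreover have "p (h x) = g x" if x: "x \<in> carrier M" for x
  proof -
    have mM: "(\<lambda>k. (as ! k) \<odot> T k x) \<in> ?D \<rightarrow> carrier M"
      by (intro funcsetI mod.smult_closed Tc x) simp_all
    have p0: "p \<zero>\<^bsub>X\<^esub> = \<zero>\<^bsub>Y\<^esub>" using linear_zero[OF X.V_module Y.V_module pC] by simp
    have g0: "g \<zero> = \<zero>\<^bsub>Y\<^esub>" using linear_zero[OF V_module Y.V_module gC] by simp
    have "p (h x) = (\<Oplus>\<^bsub>Y\<^esub>k\<in>?D. p ((as ! k) \<odot>\<^bsub>X\<^esub> h0 (T k x)))"
      unfolding h_def
      by (rule additive_finsum[OF X.mod.M.abelian_monoid_axioms Y.mod.M.abelian_monoid_axioms module_homD(1)[OF p] p0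
            module_homD(2)[OF p] trm[OF x]])
    also have "\<dots> = (\<Oplus>\<^bsub>Y\<^esub>k\<in>?D. g ((as ! k) \<odot> T k x))"
    proof (rule Y.mod.M.finsum_cong'[OF refl])
      show "(\<lambda>k. g ((as ! k) \<odot> T k x)) \<in> ?D \<rightarrow> carrier Y"
        using mM module_homD(1)[OF g] by auto
      fix k assume "k \<in> ?D"
      then have k: "as ! k \<in> carrier A" "T k x \<in> carrier M" using Tc x by simp_all
      show "p ((as ! k) \<odot>\<^bsub>X\<^esub> h0 (T k x)) = g ((as ! k) \<odot> T k x)"
        using module_homD(3)[OF p k(1) h0c[OF k(2)]] module_homD(3)[OF g k] ph0[OF k(2)] by simp
    qed
    also have "\<dots> = g (\<Oplus>k\<in>?D. (as ! k) \<odot> T k x)"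
      by (rule additive_finsum[symmetric, OF mod.M.abelian_monoid_axioms Y.mod.M.abelian_monoid_axioms module_homD(1)[OF g] g0
            module_homD(2)[OF g] mM])
    finally show ?thesis unfolding T1[OF x] .
  qed
  ultimately show "\<exists>h\<in>module_hom A M X. \<forall>x\<in>carrier M. p (h x) = g x" by blast
qed

end

context based_module
begin

text \<open>\<open>M\<close> embeds into \<open>Hom\<^sub>\<complex>(A, M)\<close> by \<open>x \<mapsto> (b \<mapsto> b x)\<close>. A retraction of this embedding, applied to
the maps supported on a single basis element of \<open>A\<close>, gives the required endomorphisms.\<close>

lemma endos_if_injective:
  fixes universe :: "(nat \<Rightarrow> complex) \<Rightarrow> 'u"
  assumes inj: "inj universe" and inje: "injective_module TYPE('u) A M"
  shows "\<exists>T. cosplitting_endos T"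
proof -
  let ?D = "{..<length as}"
  define r where "r a i k = alg.alg.coord k ((as ! i) \<otimes>\<^bsub>A\<^esub> a)" for a i k
  let ?Y = "families r"
  have r: "a \<in> carrier A \<Longrightarrow> b \<in> carrier A \<Longrightarrow> i < length as \<Longrightarrow> k < length as \<Longrightarrow> r (a \<oplus>\<^bsub>A\<^esub> b) i k = r a i k + r b i k"
    "a \<in> carrier A \<Longrightarrow> b \<in> carrier A \<Longrightarrow> i < length as \<Longrightarrow> k < length as \<Longrightarrow>
      r (a \<otimes>\<^bsub>A\<^esub> b) i k = (\<Sum>j<length as. r a i j * r b j k)"
    "i < length as \<Longrightarrow> k < length as \<Longrightarrow> r (c \<odot>\<^bsub>A\<^esub> \<one>\<^bsub>A\<^esub>) i k = (if i = k then c else 0)" for a b c i k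
    unfolding r_def using alg.coord_mult_right[of b "(as ! i) \<otimes>\<^bsub>A\<^esub> a" k]
    by (simp_all add: alg.r_distr alg.m_assoc alg.mult_scalar alg.alg.coord_add alg.alg.coord_smult alg.alg.coord_bs
        mult.commute)
  have Y: "left_module A ?Y"
    by (rule families_left_module(1)) (rule r; assumption)+
  have scalar: "\<And>c F i. F \<in> carrier ?Y \<Longrightarrow> i < length as \<Longrightarrow> (c \<odot>\<^bsub>complex_space A ?Y\<^esub> F) i = c \<odot>\<^bsub>V\<^esub> F i"
    by (rule families_left_module(2)) (rule r; assumption | assumption)+
  interpret Y: algebra_module A as ?Y using Y by (intro algebra_module.intro alg.based_algebra_axioms)
  have family: "(\<lambda>i\<in>?D. f i) \<in> carrier ?Y" if "\<And>i. i < length as \<Longrightarrow> f i \<in> carrier M" for f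
    using that by (simp add: PiE_iff)
  define j where "j x = (\<lambda>i\<in>?D. (as ! i) \<odot> x)" for x
  have jc: "j x \<in> carrier ?Y" if "x \<in> carrier M" for x
    unfolding j_def by (intro family mod.smult_closed that) simp
  have j: "j \<in> module_hom A M ?Y"
  proof (rule module_homI)
    fix x y assume x: "x \<in> carrier M" and y: "y \<in> carrier M"
    show "j (x \<oplus> y) = j x \<oplus>\<^bsub>?Y\<^esub> j y"
      unfolding j_def families_simps by (rule restrict_ext) (simp add: x y mod.smult_r_distr)
  next
    fix a x assume a: "a \<in> carrier A" and x: "x \<in> carrier M"
    have ax: "a \<odot> x \<in> carrier M" using a x by (rule mod.smult_closed)
    show "j (a \<odot> x) = a \<odot>\<^bsub>?Y\<^esub> j x"
      unfolding j_def families_simps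
    proof (rule restrict_ext)
      fix i assume "i \<in> ?D"
      then have i: "as ! i \<in> carrier A" by simp
      have "(as ! i) \<odot> (a \<odot> x) = (\<Oplus>k\<in>?D. r a i k \<odot>\<^bsub>V\<^esub> ((as ! k) \<odot> x))"
        unfolding r_def mod.smult_assoc1[OF i a x, symmetric] by (rule act_coord) (use i a x in simp_all)
      also have "\<dots> = (\<Oplus>k\<in>?D. r a i k \<odot>\<^bsub>V\<^esub> (\<lambda>i\<in>?D. (as ! i) \<odot> x) k)"
      proof (rule mod.M.finsum_cong'[OF refl])
        show "(\<lambda>k. r a i k \<odot>\<^bsub>V\<^esub> (\<lambda>i\<in>?D. (as ! i) \<odot> x) k) \<in> ?D \<rightarrow> carrier M"
        proof (intro funcsetI sc(1))
          fix k assume "k \<in> ?D" then show "(\<lambda>i\<in>?D. (as ! i) \<odot> x) k \<in> carrier M"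
            using mod.smult_closed[of "as ! k" x] x by simp
        qed
      qed (simp only: restrict_apply if_True)
      finally show "(as ! i) \<odot> (a \<odot> x) = (\<Oplus>k\<in>?D. r a i k \<odot>\<^bsub>V\<^esub> (\<lambda>i\<in>?D. (as ! i) \<odot> x) k)" .
    qed
  qed (rule jc)
  have j_inj: "inj_on j (carrier M)"
  proof (rule inj_onI)
    fix x y assume x: "x \<in> carrier M" and y: "y \<in> carrier M" and eq: "j x = j y"
    have eq': "(as ! i) \<odot> x = (as ! i) \<odot> y" if "i \<in> ?D" for i
      using fun_cong[OF eq, of i] that unfolding j_def by (simp only: restrict_apply if_True)
    have "x = \<one>\<^bsub>A\<^esub> \<odot> x" by (rule mod.smult_one[OF x, symmetric])
    also have "\<dots> = \<one>\<^bsub>A\<^esub> \<odot> y"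
      unfolding act_coord[OF alg.one_closed x] act_coord[OF alg.one_closed y]
    proof (rule mod.M.finsum_cong'[OF refl])
      show "(\<lambda>i. alg.alg.coord i \<one>\<^bsub>A\<^esub> \<odot>\<^bsub>V\<^esub> ((as ! i) \<odot> y)) \<in> ?D \<rightarrow> carrier M"
        by (intro funcsetI sc(1) mod.smult_closed y) simp
    qed (simp only: eq')
    finally show "x = y" using mod.smult_one[OF y] by simp
  qed
  have "inj_on (universe \<circ> encode_family) (carrier ?Y)" "inj_on (universe \<circ> encode) (carrier M)"
    by (rule comp_inj_on, simp add: inj_encode_family inj_encode, rule inj_on_subset[OF inj], simp)+
  then obtain h where h: "h \<in> module_hom A ?Y M" and hj: "\<And>x. x \<in> carrier M \<Longrightarrow> h (j x) = x"
    by (rule injective_retraction[OF inje Y j j_inj]) (rule that)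
  have hC: "h \<in> module_hom class_ring Y.V V" by (rule Y.hom_complex_linear[OF h])
  \<comment> \<open>The linear map that sends the \<open>k\<close>-th basis element to \<open>x\<close> and the others to zero.\<close>
  define \<delta> where "\<delta> k x = (\<lambda>i\<in>?D. if i = k then x else \<zero>)" for k x
  have \<delta>c: "\<delta> k x \<in> carrier ?Y" if "x \<in> carrier M" for k x
    unfolding \<delta>_def by (rule family) (use that in simp)
  have h_sum: "(\<Oplus>k\<in>?D. h (\<delta> k (f k))) = h (\<lambda>i\<in>?D. f i)" if f: "\<And>k. k < length as \<Longrightarrow> f k \<in> carrier M" for f
  proof -
    have m: "(\<lambda>k. \<delta> k (f k)) \<in> ?D \<rightarrow> carrier ?Y" by (intro funcsetI \<delta>c f) simp
    have h0: "h \<zero>\<^bsub>?Y\<^esub> = \<zero>" using linear_zero[OF Y.V_module V_module hC] by (simp only: complex_space_simps)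
    have "(\<Oplus>k\<in>?D. h (\<delta> k (f k))) = h (finsum ?Y (\<lambda>k. \<delta> k (f k)) ?D)"
      by (rule additive_finsum[symmetric, OF Y.mod.M.abelian_monoid_axioms mod.M.abelian_monoid_axioms module_homD(1)[OF h] h0
            module_homD(2)[OF h] m])
    also have "finsum ?Y (\<lambda>k. \<delta> k (f k)) ?D = (\<lambda>i\<in>?D. f i)"
    proof (rule families_eqI)
      show "finsum ?Y (\<lambda>k. \<delta> k (f k)) ?D \<in> ?D \<rightarrow>\<^sub>E carrier M"
        using Y.mod.M.finsum_closed[OF m] by (simp only: families_simps)
      show "(\<lambda>i\<in>?D. f i) \<in> ?D \<rightarrow>\<^sub>E carrier M" using family[of f] f by (simp only: families_simps)
      fix i assume i: "i < length as"
      have "finsum ?Y (\<lambda>k. \<delta> k (f k)) ?D i = (\<Oplus>k\<in>?D. \<delta> k (f k) i)"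
        by (rule additive_finsum[OF Y.mod.M.abelian_monoid_axioms mod.M.abelian_monoid_axioms, of "\<lambda>F. F i"])
          (use i m in \<open>auto simp: families_nth\<close>)
      also have "\<dots> = (\<Oplus>k\<in>?D. if i = k then f k else \<zero>)"
        by (rule mod.M.finsum_cong'[OF refl]) (use i f in \<open>simp_all add: \<delta>_def\<close>)
      also have "\<dots> = f i" by (rule finsum_delta) (use i f in simp_all)
      finally show "finsum ?Y (\<lambda>k. \<delta> k (f k)) ?D i = (\<lambda>i\<in>?D. f i) i" using i by simp
    qed
    finally show ?thesis .
  qed
  have \<delta>_add: "\<delta> k (x \<oplus> y) = \<delta> k x \<oplus>\<^bsub>?Y\<^esub> \<delta> k y" if "x \<in> carrier M" "y \<in> carrier M" for k x y
    unfolding \<delta>_def families_simps by (rule restrict_ext) (simp add: that)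
  have \<delta>_sc: "\<delta> k (c \<odot>\<^bsub>V\<^esub> x) = c \<odot>\<^bsub>Y.V\<^esub> \<delta> k x" if x: "x \<in> carrier M" for k c x
  proof (rule families_eqI)
    show "\<delta> k (c \<odot>\<^bsub>V\<^esub> x) \<in> ?D \<rightarrow>\<^sub>E carrier M" using \<delta>c[OF sc(1)[OF x]] by (simp only: families_simps)
    show "c \<odot>\<^bsub>Y.V\<^esub> \<delta> k x \<in> ?D \<rightarrow>\<^sub>E carrier M" using Y.sc(1)[OF \<delta>c[OF x]] by (simp only: families_simps)
    fix i assume i: "i < length as"
    show "\<delta> k (c \<odot>\<^bsub>V\<^esub> x) i = (c \<odot>\<^bsub>Y.V\<^esub> \<delta> k x) i"
      unfolding scalar[OF \<delta>c[OF x] i] unfolding \<delta>_def using i sc(7)[OF x, of c]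
      by (simp only: restrict_apply lessThan_iff if_True split: if_split) simp
  qed
  show ?thesis
  proof (intro exI[of _ "\<lambda>k x. h (\<delta> k x)"] conjI allI impI ballI)
    fix k assume k: "k < length as"
    show "(\<lambda>x. h (\<delta> k x)) \<in> module_hom class_ring V V"
    proof (rule module_homI)
      fix x assume "x \<in> carrier V"
      then have x: "x \<in> carrier M" by simp
      show "h (\<delta> k x) \<in> carrier V" using module_homD(1)[OF h \<delta>c[OF x]] by simp
      show "h (\<delta> k (x \<oplus>\<^bsub>V\<^esub> y)) = h (\<delta> k x) \<oplus>\<^bsub>V\<^esub> h (\<delta> k y)" if "y \<in> carrier V" for y
      proof -
        have y: "y \<in> carrier M" using that by simp
        show ?thesis unfolding complex_space_simps(2) \<delta>_add[OF x y] by (rule module_homD(2)[OF h \<delta>c[OF x] \<delta>c[OF y]])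
      qed
      show "h (\<delta> k (c \<odot>\<^bsub>V\<^esub> x)) = c \<odot>\<^bsub>V\<^esub> h (\<delta> k x)" for c
        unfolding \<delta>_sc[OF x] by (rule module_homD(3)[OF hC]) (use \<delta>c[OF x] in \<open>simp_all only: complex_space_simps class_ring_simps UNIV_I\<close>)
    qed
  next
    fix x assume x: "x \<in> carrier M"
    have "(\<Oplus>k\<in>?D. h (\<delta> k ((as ! k) \<odot> x))) = h (j x)"
      unfolding j_def by (rule h_sum) (simp add: mod.smult_closed x)
    then show "(\<Oplus>k\<in>?D. h (\<delta> k ((as ! k) \<odot> x))) = x" using hj[OF x] by simp
  next
    fix q l x assume q: "q < length as" and l: "l < length as" and x: "x \<in> carrier M"
    have "(as ! l) \<odot> h (\<delta> q x) = h ((as ! l) \<odot>\<^bsub>?Y\<^esub> \<delta> q x)"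
      by (rule module_homD(3)[OF h _ \<delta>c[OF x], symmetric]) (use l in simp)
    also have "(as ! l) \<odot>\<^bsub>?Y\<^esub> \<delta> q x = (\<lambda>i\<in>?D. alg.str i l q \<odot>\<^bsub>V\<^esub> x)"
      unfolding families_simps
    proof (rule restrict_ext)
      fix i assume i: "i \<in> ?D"
      have "(\<Oplus>k\<in>?D. r (as ! l) i k \<odot>\<^bsub>V\<^esub> \<delta> q x k) = (\<Oplus>k\<in>?D. if q = k then r (as ! l) i k \<odot>\<^bsub>V\<^esub> x else \<zero>)"
      proof (rule mod.M.finsum_cong'[OF refl])
        show "(\<lambda>k. if q = k then r (as ! l) i k \<odot>\<^bsub>V\<^esub> x else \<zero>) \<in> ?D \<rightarrow> carrier M"
          using sc(1)[OF x] by (intro funcsetI) (simp del: complex_space_simps(4))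
        fix k assume "k \<in> ?D"
        then show "r (as ! l) i k \<odot>\<^bsub>V\<^esub> \<delta> q x k = (if q = k then r (as ! l) i k \<odot>\<^bsub>V\<^esub> x else \<zero>)"
          using sc(7)[OF x] by (simp add: \<delta>_def del: complex_space_simps(4))
      qed
      also have "\<dots> = r (as ! l) i q \<odot>\<^bsub>V\<^esub> x" by (rule finsum_delta) (use q sc(1)[OF x] in \<open>simp_all del: complex_space_simps(4)\<close>)
      finally show "(\<Oplus>k\<in>?D. r (as ! l) i k \<odot>\<^bsub>V\<^esub> \<delta> q x k) = alg.str i l q \<odot>\<^bsub>V\<^esub> x"
        unfolding r_def alg.str_def .
    qed
    also have "h (\<lambda>i\<in>?D. alg.str i l q \<odot>\<^bsub>V\<^esub> x) = (\<Oplus>k\<in>?D. h (\<delta> k (alg.str k l q \<odot>\<^bsub>V\<^esub> x)))"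
      by (rule h_sum[symmetric]) (rule sc(1)[OF x])
    also have "\<dots> = (\<Oplus>k\<in>?D. alg.str k l q \<odot>\<^bsub>V\<^esub> h (\<delta> k x))"
    proof (rule mod.M.finsum_cong'[OF refl])
      show "(\<lambda>k. alg.str k l q \<odot>\<^bsub>V\<^esub> h (\<delta> k x)) \<in> ?D \<rightarrow> carrier M"
        by (intro funcsetI sc(1) module_homD(1)[OF h] \<delta>c x)
      show "h (\<delta> k (alg.str k l q \<odot>\<^bsub>V\<^esub> x)) = alg.str k l q \<odot>\<^bsub>V\<^esub> h (\<delta> k x)" for k
        unfolding \<delta>_sc[OF x] by (rule module_homD(3)[OF hC]) (use \<delta>c[OF x] in \<open>simp_all only: complex_space_simps class_ring_simps UNIV_I\<close>)
    qed
    finally show "(as ! l) \<odot> h (\<delta> q x) = (\<Oplus>k\<in>?D. alg.str k l q \<odot>\<^bsub>V\<^esub> h (\<delta> k x))" .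
  qed
qed

text \<open>A \<open>\<complex>\<close>-linear extension \<open>\<phi>\<close> of \<open>g\<close> along \<open>i\<close> is corrected to the \<open>A\<close>-linear map
\<open>y \<mapsto> \<Sum> T\<^sub>k (\<phi> (a\<^sub>k y))\<close>.\<close>

lemma injective_if_endos:
  assumes "cosplitting_endos T"
  shows "injective_module TYPE('u) A M"
  unfolding injective_module_def
proof (intro conjI allI impI mod.left_module_axioms; elim conjE)
  fix X Y :: "('r, 'u) module" and i g
  assume X: "left_module A X" and Y: "left_module A Y" and i: "i \<in> module_hom A X Y" and inj: "inj_on i (carrier X)"
    and g: "g \<in> module_hom A X M"
  let ?D = "{..<length as}"
  interpret X: algebra_module A as X using X by (intro algebra_module.intro alg.based_algebra_axioms)
  interpret Y: algebra_module A as Y using Y by (intro algebra_module.intro alg.based_algebra_axioms)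
  have T: "k < length as \<Longrightarrow> T k \<in> module_hom class_ring V V"
    and T1: "x \<in> carrier M \<Longrightarrow> (\<Oplus>k\<in>?D. T k ((as ! k) \<odot> x)) = x"
    and T2: "j < length as \<Longrightarrow> l < length as \<Longrightarrow> x \<in> carrier M \<Longrightarrow>
      (as ! l) \<odot> T j x = (\<Oplus>k\<in>?D. alg.str k l j \<odot>\<^bsub>V\<^esub> T k x)" for k j l x
    using assms by blast+
  have Tc: "T k x \<in> carrier M" if "k < length as" "x \<in> carrier M" for k x
    using module_homD(1)[OF T[OF that(1)]] that(2) by simp
  have injC: "inj_on i (carrier X.V)" using inj by simp
  obtain \<phi> where \<phi>: "\<phi> \<in> module_hom class_ring Y.V V" and \<phi>i': "\<And>x. x \<in> carrier X.V \<Longrightarrow> \<phi> (i x) = g x"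
    by (rule linear_extension[OF X.V_module Y.V_module V_module X.hom_complex_linear[OF i] injC X.hom_complex_linear[OF g]])
      (rule that)
  have \<phi>i: "x \<in> carrier X \<Longrightarrow> \<phi> (i x) = g x" for x using \<phi>i'[of x] by simp
  have \<phi>c: "y \<in> carrier Y \<Longrightarrow> \<phi> y \<in> carrier M" for y using module_homD(1)[OF \<phi>, of y] by simp
  define h where "h y = (\<Oplus>k\<in>?D. T k (\<phi> ((as ! k) \<odot>\<^bsub>Y\<^esub> y)))" for y
  have ac: "(as ! k) \<odot>\<^bsub>Y\<^esub> y \<in> carrier Y" if "k < length as" "y \<in> carrier Y" for k y
    using that by (simp add: Y.mod.smult_closed)
  have trm: "(\<lambda>k. T k (\<phi> ((as ! k) \<odot>\<^bsub>Y\<^esub> y))) \<in> ?D \<rightarrow> carrier M" if "y \<in> carrier Y" for y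
    by (intro funcsetI Tc \<phi>c ac that) simp_all
  have hhom: "h \<in> module_hom A Y M"
  proof (rule Y.hom_if_basis_hom)
    show "algebra_module A as M" by (rule algebra_module_axioms)
    show "h \<in> module_hom class_ring Y.V V"
    proof (rule module_homI)
      fix x assume x: "x \<in> carrier Y.V"
      then have xY: "x \<in> carrier Y" by simp
      show "h x \<in> carrier V" unfolding h_def complex_space_simps(1) by (rule mod.M.finsum_closed[OF trm[OF xY]])
      show "h (x \<oplus>\<^bsub>Y.V\<^esub> y) = h x \<oplus>\<^bsub>V\<^esub> h y" if y: "y \<in> carrier Y.V" for y
      proof -
        have yY: "y \<in> carrier Y" using y by simp
        show ?thesis
          unfolding h_def complex_space_simps(2)[of A M] mod.M.finsum_addf[OF trm[OF xY] trm[OF yY], symmetric]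
        proof (rule mod.M.finsum_cong'[OF refl])
          show "(\<lambda>k. T k (\<phi> ((as ! k) \<odot>\<^bsub>Y\<^esub> x)) \<oplus> T k (\<phi> ((as ! k) \<odot>\<^bsub>Y\<^esub> y))) \<in> ?D \<rightarrow> carrier M"
            by (intro funcsetI mod.M.a_closed Tc \<phi>c ac xY yY) simp_all
          fix k assume "k \<in> ?D"
          then have k: "k < length as" by simp
          have "\<phi> ((as ! k) \<odot>\<^bsub>Y\<^esub> (x \<oplus>\<^bsub>Y.V\<^esub> y)) = \<phi> ((as ! k) \<odot>\<^bsub>Y\<^esub> x) \<oplus> \<phi> ((as ! k) \<odot>\<^bsub>Y\<^esub> y)"
            using Y.mod.smult_r_distr[of "as ! k" x y] module_homD(2)[OF \<phi>, of "(as ! k) \<odot>\<^bsub>Y\<^esub> x" "(as ! k) \<odot>\<^bsub>Y\<^esub> y"]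
              ac[OF k xY] ac[OF k yY] k xY yY by simp
          then show "T k (\<phi> ((as ! k) \<odot>\<^bsub>Y\<^esub> (x \<oplus>\<^bsub>Y.V\<^esub> y))) = T k (\<phi> ((as ! k) \<odot>\<^bsub>Y\<^esub> x)) \<oplus> T k (\<phi> ((as ! k) \<odot>\<^bsub>Y\<^esub> y))"
            using module_homD(2)[OF T[OF k], of "\<phi> ((as ! k) \<odot>\<^bsub>Y\<^esub> x)" "\<phi> ((as ! k) \<odot>\<^bsub>Y\<^esub> y)"]
              \<phi>c[OF ac[OF k xY]] \<phi>c[OF ac[OF k yY]] by simp
        qed
      qed
      show "h (c \<odot>\<^bsub>Y.V\<^esub> x) = c \<odot>\<^bsub>V\<^esub> h x" for c
        unfolding h_def sc_finsum[OF trm[OF xY]]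
      proof (rule mod.M.finsum_cong'[OF refl])
        show "(\<lambda>k. c \<odot>\<^bsub>V\<^esub> T k (\<phi> ((as ! k) \<odot>\<^bsub>Y\<^esub> x))) \<in> ?D \<rightarrow> carrier M"
          by (intro funcsetI sc(1) Tc \<phi>c ac xY) simp_all
        fix k assume "k \<in> ?D"
        then have k: "k < length as" by simp
        have "(as ! k) \<odot>\<^bsub>Y\<^esub> (c \<odot>\<^bsub>Y.V\<^esub> x) = c \<odot>\<^bsub>Y.V\<^esub> ((as ! k) \<odot>\<^bsub>Y\<^esub> x)"
          by (rule Y.act_scalar(2)) (use k xY in simp_all)
        moreover have "\<phi> (c \<odot>\<^bsub>Y.V\<^esub> ((as ! k) \<odot>\<^bsub>Y\<^esub> x)) = c \<odot>\<^bsub>V\<^esub> \<phi> ((as ! k) \<odot>\<^bsub>Y\<^esub> x)"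
          by (rule module_homD(3)[OF \<phi>]) (use ac[OF k xY] in simp_all)
        moreover have "T k (c \<odot>\<^bsub>V\<^esub> \<phi> ((as ! k) \<odot>\<^bsub>Y\<^esub> x)) = c \<odot>\<^bsub>V\<^esub> T k (\<phi> ((as ! k) \<odot>\<^bsub>Y\<^esub> x))"
          by (rule module_homD(3)[OF T[OF k]]) (use \<phi>c[OF ac[OF k xY]] in simp_all)
        ultimately show "T k (\<phi> ((as ! k) \<odot>\<^bsub>Y\<^esub> (c \<odot>\<^bsub>Y.V\<^esub> x))) = c \<odot>\<^bsub>V\<^esub> T k (\<phi> ((as ! k) \<odot>\<^bsub>Y\<^esub> x))"
          by (simp only:)
      qed
    qed
    fix l x assume l: "l < length as" and x: "x \<in> carrier Y"
    have al: "as ! l \<in> carrier A" using l by simp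
    have cc: "alg.str k l j \<odot>\<^bsub>V\<^esub> T k (\<phi> ((as ! j) \<odot>\<^bsub>Y\<^esub> x)) \<in> carrier M" if "k \<in> ?D" "j \<in> ?D" for j k
      by (intro sc(1) Tc \<phi>c ac x) (use that in simp_all)
    have "h ((as ! l) \<odot>\<^bsub>Y\<^esub> x) = (\<Oplus>k\<in>?D. \<Oplus>j\<in>?D. alg.str k l j \<odot>\<^bsub>V\<^esub> T k (\<phi> ((as ! j) \<odot>\<^bsub>Y\<^esub> x)))"
      unfolding h_def
    proof (rule mod.M.finsum_cong'[OF refl])
      show "(\<lambda>k. \<Oplus>j\<in>?D. alg.str k l j \<odot>\<^bsub>V\<^esub> T k (\<phi> ((as ! j) \<odot>\<^bsub>Y\<^esub> x))) \<in> ?D \<rightarrow> carrier M"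
        by (intro funcsetI mod.M.finsum_closed cc)
      fix k assume kD: "k \<in> ?D"
      then have k: "k < length as" and ak: "as ! k \<in> carrier A" by simp_all
      define S where "S y = T k (\<phi> y)" for y
      have S: "S \<in> module_hom class_ring Y.V V"
        unfolding S_def by (rule module_homI) (simp_all only: module_homD[OF T[OF k]] module_homD[OF \<phi>])
      have mY: "(\<lambda>j. alg.str k l j \<odot>\<^bsub>Y.V\<^esub> ((as ! j) \<odot>\<^bsub>Y\<^esub> x)) \<in> ?D \<rightarrow> carrier Y"
        by (intro funcsetI Y.sc(1) ac x) simp
      have "S ((as ! k) \<odot>\<^bsub>Y\<^esub> ((as ! l) \<odot>\<^bsub>Y\<^esub> x)) = S (finsum Y (\<lambda>j. alg.str k l j \<odot>\<^bsub>Y.V\<^esub> ((as ! j) \<odot>\<^bsub>Y\<^esub> x)) ?D)"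
        unfolding Y.mod.smult_assoc1[OF ak al x, symmetric] alg.str_def
        by (rule arg_cong[of _ _ S], rule Y.act_coord) (use ak al x in simp_all)
      also have "\<dots> = finsum V (\<lambda>j. S (alg.str k l j \<odot>\<^bsub>Y.V\<^esub> ((as ! j) \<odot>\<^bsub>Y\<^esub> x))) ?D"
        unfolding Y.finsum_V[OF mY, symmetric]
        by (rule linear_finsum[OF Y.V_module V_module S]) (use mY in \<open>simp only: complex_space_simps(1)\<close>)
      also have "\<dots> = finsum M (\<lambda>j. S (alg.str k l j \<odot>\<^bsub>Y.V\<^esub> ((as ! j) \<odot>\<^bsub>Y\<^esub> x))) ?D"
        unfolding S_def by (intro finsum_V funcsetI Tc \<phi>c Y.sc(1) ac x k) simp
      also have "\<dots> = (\<Oplus>j\<in>?D. alg.str k l j \<odot>\<^bsub>V\<^esub> T k (\<phi> ((as ! j) \<odot>\<^bsub>Y\<^esub> x)))"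
      proof (rule mod.M.finsum_cong'[OF refl])
        fix j assume "j \<in> ?D"
        then have "(as ! j) \<odot>\<^bsub>Y\<^esub> x \<in> carrier Y.V" using ac[OF _ x] by simp
        then show "S (alg.str k l j \<odot>\<^bsub>Y.V\<^esub> ((as ! j) \<odot>\<^bsub>Y\<^esub> x)) = alg.str k l j \<odot>\<^bsub>V\<^esub> T k (\<phi> ((as ! j) \<odot>\<^bsub>Y\<^esub> x))"
          using module_homD(3)[OF S, of "alg.str k l j" "(as ! j) \<odot>\<^bsub>Y\<^esub> x"]
          unfolding S_def by (simp only: class_ring_simps UNIV_I)
      qed (use cc kD in blast)
      finally show "T k (\<phi> ((as ! k) \<odot>\<^bsub>Y\<^esub> ((as ! l) \<odot>\<^bsub>Y\<^esub> x))) =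
          (\<Oplus>j\<in>?D. alg.str k l j \<odot>\<^bsub>V\<^esub> T k (\<phi> ((as ! j) \<odot>\<^bsub>Y\<^esub> x)))" unfolding S_def .
    qed
    also have "\<dots> = (\<Oplus>j\<in>?D. \<Oplus>k\<in>?D. alg.str k l j \<odot>\<^bsub>V\<^esub> T k (\<phi> ((as ! j) \<odot>\<^bsub>Y\<^esub> x)))"
      by (rule mod.M.finsum_swap) (use cc in \<open>simp_all only: finite_lessThan\<close>)
    also have "\<dots> = (\<Oplus>j\<in>?D. (as ! l) \<odot> T j (\<phi> ((as ! j) \<odot>\<^bsub>Y\<^esub> x)))"
    proof (rule mod.M.finsum_cong'[OF refl])
      show "(\<lambda>j. (as ! l) \<odot> T j (\<phi> ((as ! j) \<odot>\<^bsub>Y\<^esub> x))) \<in> ?D \<rightarrow> carrier M"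
        by (intro funcsetI mod.smult_closed al Tc \<phi>c ac x) simp_all
      fix j assume "j \<in> ?D"
      then have j: "j < length as" by simp
      show "(\<Oplus>k\<in>?D. alg.str k l j \<odot>\<^bsub>V\<^esub> T k (\<phi> ((as ! j) \<odot>\<^bsub>Y\<^esub> x))) = (as ! l) \<odot> T j (\<phi> ((as ! j) \<odot>\<^bsub>Y\<^esub> x))"
        by (rule T2[OF j l \<phi>c[OF ac[OF j x]], symmetric])
    qed
    also have "\<dots> = (as ! l) \<odot> h x"
      unfolding h_def by (rule act_finsum_right[symmetric, OF trm[OF x] al])
    finally show "h ((as ! l) \<odot>\<^bsub>Y\<^esub> x) = (as ! l) \<odot> h x" .
  qed
  moreover have "h (i x) = g x" if x: "x \<in> carrier X" for x
  proof -
    have gx: "g x \<in> carrier M" by (rule module_homD(1)[OF g x])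
    have "h (i x) = (\<Oplus>k\<in>?D. T k ((as ! k) \<odot> g x))"
      unfolding h_def
    proof (rule mod.M.finsum_cong'[OF refl])
      show "(\<lambda>k. T k ((as ! k) \<odot> g x)) \<in> ?D \<rightarrow> carrier M"
        by (intro funcsetI Tc mod.smult_closed gx) simp_all
      fix k assume "k \<in> ?D"
      then have k: "as ! k \<in> carrier A" by simp
      have "(as ! k) \<odot>\<^bsub>Y\<^esub> i x = i ((as ! k) \<odot>\<^bsub>X\<^esub> x)" by (rule module_homD(3)[OF i k x, symmetric])
      then show "T k (\<phi> ((as ! k) \<odot>\<^bsub>Y\<^esub> i x)) = T k ((as ! k) \<odot> g x)"
        using \<phi>i[OF X.mod.smult_closed[OF k x]] module_homD(3)[OF g k x] by simp
    qed
    then show ?thesis unfolding T1[OF gx] .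
  qed
  ultimately show "\<exists>h\<in>module_hom A Y M. \<forall>x\<in>carrier X. h (i x) = g x" by blast
qed

end

context based_module
begin

lemma matrix_lc_iff:
  assumes f: "\<And>k. k < d \<Longrightarrow> f k \<in> module_hom class_ring V V" and g: "g \<in> module_hom class_ring V V"
  shows "(\<forall>x\<in>carrier M. (\<Oplus>k\<in>{..<d}. c k \<odot>\<^bsub>V\<^esub> f k x) = g x) \<longleftrightarrow>
    mat_lc (length bs) d c (\<lambda>k. matrix_of V bs (f k)) = matrix_of V bs g"
proof -
  define L where "L x = (\<Oplus>k\<in>{..<d}. c k \<odot>\<^bsub>V\<^esub> f k x)" for x
  have fc: "f k x \<in> carrier M" if "k < d" "x \<in> carrier M" for k x
    using module_homD(1)[OF f[OF that(1)]] that(2) by simp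
  have trm: "(\<lambda>k. c k \<odot>\<^bsub>V\<^esub> f k x) \<in> {..<d} \<rightarrow> carrier M" if "x \<in> carrier M" for x
    by (intro funcsetI sc(1) fc that) simp
  have L: "L \<in> module_hom class_ring V V"
  proof (rule module_homI)
    fix x assume "x \<in> carrier V"
    then have x: "x \<in> carrier M" and xV: "x \<in> carrier V" by simp_all
    show "L x \<in> carrier V" unfolding L_def complex_space_simps(1) by (rule mod.M.finsum_closed[OF trm[OF x]])
    show "L (x \<oplus>\<^bsub>V\<^esub> y) = L x \<oplus>\<^bsub>V\<^esub> L y" if yV: "y \<in> carrier V" for y
    proof -
      have y: "y \<in> carrier M" using yV by simp
      show ?thesis
        unfolding L_def complex_space_simps(2) mod.M.finsum_addf[OF trm[OF x] trm[OF y], symmetric]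
      proof (rule mod.M.finsum_cong'[OF refl])
        show "(\<lambda>k. c k \<odot>\<^bsub>V\<^esub> f k x \<oplus> c k \<odot>\<^bsub>V\<^esub> f k y) \<in> {..<d} \<rightarrow> carrier M"
          by (intro funcsetI mod.M.a_closed sc(1) fc x y) simp_all
        fix k assume "k \<in> {..<d}"
        then have k: "k < d" by simp
        show "c k \<odot>\<^bsub>V\<^esub> f k (x \<oplus> y) = c k \<odot>\<^bsub>V\<^esub> f k x \<oplus> c k \<odot>\<^bsub>V\<^esub> f k y"
          using module_homD(2)[OF f[OF k] xV yV] sc(4)[OF fc[OF k x] fc[OF k y]] by (simp only: complex_space_simps(2))
      qed
    qed
    show "L (b \<odot>\<^bsub>V\<^esub> x) = b \<odot>\<^bsub>V\<^esub> L x" for b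
      unfolding L_def sc_finsum[OF trm[OF x]]
    proof (rule mod.M.finsum_cong'[OF refl])
      show "(\<lambda>k. b \<odot>\<^bsub>V\<^esub> (c k \<odot>\<^bsub>V\<^esub> f k x)) \<in> {..<d} \<rightarrow> carrier M"
        by (intro funcsetI sc(1) fc x) simp
      fix k assume "k \<in> {..<d}"
      then have k: "k < d" by simp
      have "f k (b \<odot>\<^bsub>V\<^esub> x) = b \<odot>\<^bsub>V\<^esub> f k x" by (rule module_homD(3)[OF f[OF k] _ xV]) simp
      then show "c k \<odot>\<^bsub>V\<^esub> f k (b \<odot>\<^bsub>V\<^esub> x) = b \<odot>\<^bsub>V\<^esub> (c k \<odot>\<^bsub>V\<^esub> f k x)"
        using sc(2)[OF fc[OF k x], of "c k" b] sc(2)[OF fc[OF k x], of b "c k"] by (simp only: mult.commute)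
    qed
  qed
  have mL: "mat_lc (length bs) d c (\<lambda>k. matrix_of V bs (f k)) = matrix_of V bs L"
  proof (rule eq_matI)
    fix i j assume "i < dim_row (matrix_of V bs L)" "j < dim_col (matrix_of V bs L)"
    then have ij: "i < length bs" "j < length bs" by (auto simp: matrix_of_def)
    have "V.coord i (L (bs ! j)) = (\<Sum>k<d. V.coord i (c k \<odot>\<^bsub>V\<^esub> f k (bs ! j)))"
      unfolding L_def by (rule coord_finsum_M[OF ij(1) trm]) (use ij in simp)
    also have "\<dots> = (\<Sum>k<d. c k * V.coord i (f k (bs ! j)))"
      by (intro sum.cong refl V.coord_smult ij(1)) (use fc ij in simp)
    finally show "mat_lc (length bs) d c (\<lambda>k. matrix_of V bs (f k)) $$ (i, j) = matrix_of V bs L $$ (i, j)"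
      using ij by (simp add: mat_lc_index V.matrix_of_index)
  qed (simp_all add: mat_lc_def matrix_of_def)
  show ?thesis unfolding mL
  proof
    assume "\<forall>x\<in>carrier M. (\<Oplus>k\<in>{..<d}. c k \<odot>\<^bsub>V\<^esub> f k x) = g x"
    then show "matrix_of V bs L = matrix_of V bs g"
      by (intro V.matrix_of_cong) (simp add: L_def)
  next
    assume eq: "matrix_of V bs L = matrix_of V bs g"
    show "\<forall>x\<in>carrier M. (\<Oplus>k\<in>{..<d}. c k \<odot>\<^bsub>V\<^esub> f k x) = g x"
      using V.matrix_of_eqD[OF eq L g] by (simp add: L_def)
  qed
qed

lemma matrix_sum_iff:
  assumes f: "\<And>k. k < d \<Longrightarrow> f k \<in> module_hom class_ring V V" and g: "g \<in> module_hom class_ring V V"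
  shows "(\<forall>x\<in>carrier M. (\<Oplus>k\<in>{..<d}. f k x) = g x) \<longleftrightarrow>
    mat_lc (length bs) d (\<lambda>_. 1) (\<lambda>k. matrix_of V bs (f k)) = matrix_of V bs g"
proof -
  have "(\<Oplus>k\<in>{..<d}. 1 \<odot>\<^bsub>V\<^esub> f k x) = (\<Oplus>k\<in>{..<d}. f k x)" if "x \<in> carrier M" for x
  proof (rule mod.M.finsum_cong'[OF refl])
    have fc: "f k x \<in> carrier M" if "k \<in> {..<d}" for k
      using module_homD(1)[OF f, of k x] \<open>x \<in> carrier M\<close> that by simp
    then show "(\<lambda>k. f k x) \<in> {..<d} \<rightarrow> carrier M" by blast
    show "1 \<odot>\<^bsub>V\<^esub> f k x = f k x" if "k \<in> {..<d}" for k by (rule sc(5)[OF fc[OF that]])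
  qed
  then have "(\<forall>x\<in>carrier M. (\<Oplus>k\<in>{..<d}. f k x) = g x) \<longleftrightarrow>
      (\<forall>x\<in>carrier M. (\<Oplus>k\<in>{..<d}. 1 \<odot>\<^bsub>V\<^esub> f k x) = g x)"
    by (intro ball_cong refl) (simp only:)
  also have "\<dots> \<longleftrightarrow> mat_lc (length bs) d (\<lambda>_. 1) (\<lambda>k. matrix_of V bs (f k)) = matrix_of V bs g"
    by (rule matrix_lc_iff) (rule f, assumption, rule g)
  finally show ?thesis .
qed

lemma matrix_lc_iff':
  assumes f: "\<And>k. k < d \<Longrightarrow> f k \<in> module_hom class_ring V V" and g: "g \<in> module_hom class_ring V V"
  shows "(\<forall>x\<in>carrier M. g x = (\<Oplus>k\<in>{..<d}. c k \<odot>\<^bsub>V\<^esub> f k x)) \<longleftrightarrow>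
    matrix_of V bs g = mat_lc (length bs) d c (\<lambda>k. matrix_of V bs (f k))"
  unfolding eq_commute[of "g _"] eq_commute[of "matrix_of V bs g"]
  by (rule matrix_lc_iff) (rule f, assumption, rule g)

lemma hom_comp: "f \<in> module_hom class_ring V V \<Longrightarrow> g \<in> module_hom class_ring V V \<Longrightarrow>
    (\<lambda>x. f (g x)) \<in> module_hom class_ring V V"
  by (rule module_homI) (simp_all only: module_homD[of f] module_homD[of g])

lemma matrix_hom_comp: "f \<in> module_hom class_ring V V \<Longrightarrow> g \<in> module_hom class_ring V V \<Longrightarrow>
    matrix_of V bs (\<lambda>x. f (g x)) = matrix_of V bs f * matrix_of V bs g"
  by (rule V.matrix_of_comp) (simp_all only: module_homD[of g] V.bs_closed)

lemma splitting_endos_matrix: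
  assumes T': "\<forall>k<length as. T k \<in> module_hom class_ring V V"
  shows "splitting_endos T \<longleftrightarrow>
    mat_lc (length bs) (length as) (\<lambda>_. 1) (\<lambda>k. action_matrix (as ! k) * matrix_of V bs (T k)) = 1\<^sub>m (length bs) \<and>
    (\<forall>j<length as. \<forall>l<length as. matrix_of V bs (T j) * action_matrix (as ! l) =
      mat_lc (length bs) (length as) (\<lambda>k. alg.str l k j) (\<lambda>k. matrix_of V bs (T k)))"
  and "cosplitting_endos T \<longleftrightarrow>
    mat_lc (length bs) (length as) (\<lambda>_. 1) (\<lambda>k. matrix_of V bs (T k) * action_matrix (as ! k)) = 1\<^sub>m (length bs) \<and>
    (\<forall>j<length as. \<forall>l<length as. action_matrix (as ! l) * matrix_of V bs (T j) =
      mat_lc (length bs) (length as) (\<lambda>k. alg.str k l j) (\<lambda>k. matrix_of V bs (T k)))"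
proof -
  let ?D = "{..<length as}"
  note T = T'[rule_format]
  have act: "(\<lambda>x. (as ! k) \<odot> x) \<in> module_hom class_ring V V" if "k < length as" for k
    by (rule act_linear) (use that in simp)
  have sum1: "(\<forall>x\<in>carrier M. (\<Oplus>k\<in>?D. (as ! k) \<odot> T k x) = x) \<longleftrightarrow>
      mat_lc (length bs) (length as) (\<lambda>_. 1) (\<lambda>k. action_matrix (as ! k) * matrix_of V bs (T k)) = 1\<^sub>m (length bs)"
  proof -
    have "mat_lc (length bs) (length as) (\<lambda>_. 1) (\<lambda>k. action_matrix (as ! k) * matrix_of V bs (T k)) =
        mat_lc (length bs) (length as) (\<lambda>_. 1) (\<lambda>k. matrix_of V bs (\<lambda>x. (as ! k) \<odot> T k x))"
      by (rule mat_lc_cong[OF refl]) (simp only: action_matrix_def matrix_hom_comp[OF act T])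
    then show ?thesis unfolding V.matrix_of_id[symmetric]
      by (simp only:) (rule matrix_sum_iff; (rule V.linear_id | rule hom_comp[OF act T]; assumption))
  qed
  have sum2: "(\<forall>x\<in>carrier M. (\<Oplus>k\<in>?D. T k ((as ! k) \<odot> x)) = x) \<longleftrightarrow>
      mat_lc (length bs) (length as) (\<lambda>_. 1) (\<lambda>k. matrix_of V bs (T k) * action_matrix (as ! k)) = 1\<^sub>m (length bs)"
  proof -
    have "mat_lc (length bs) (length as) (\<lambda>_. 1) (\<lambda>k. matrix_of V bs (T k) * action_matrix (as ! k)) =
        mat_lc (length bs) (length as) (\<lambda>_. 1) (\<lambda>k. matrix_of V bs (\<lambda>x. T k ((as ! k) \<odot> x)))"
      by (rule mat_lc_cong[OF refl]) (simp only: action_matrix_def matrix_hom_comp[OF T act])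
    then show ?thesis unfolding V.matrix_of_id[symmetric]
      by (simp only:) (rule matrix_sum_iff; (rule V.linear_id | rule hom_comp[OF T act]; assumption))
  qed
  have lc1: "(\<forall>x\<in>carrier M. T j ((as ! l) \<odot> x) = (\<Oplus>k\<in>?D. c k \<odot>\<^bsub>V\<^esub> T k x)) \<longleftrightarrow>
      matrix_of V bs (T j) * action_matrix (as ! l) = mat_lc (length bs) (length as) c (\<lambda>k. matrix_of V bs (T k))"
    if "j < length as" "l < length as" for j l c
    unfolding action_matrix_def matrix_hom_comp[OF T[OF that(1)] act[OF that(2)], symmetric]
    by (rule matrix_lc_iff') (rule T, assumption, rule hom_comp[OF T[OF that(1)] act[OF that(2)]])
  have lc2: "(\<forall>x\<in>carrier M. (as ! l) \<odot> T j x = (\<Oplus>k\<in>?D. c k \<odot>\<^bsub>V\<^esub> T k x)) \<longleftrightarrow>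
      action_matrix (as ! l) * matrix_of V bs (T j) = mat_lc (length bs) (length as) c (\<lambda>k. matrix_of V bs (T k))"
    if "j < length as" "l < length as" for j l c
    unfolding action_matrix_def matrix_hom_comp[OF act[OF that(2)] T[OF that(1)], symmetric]
    by (rule matrix_lc_iff') (rule T, assumption, rule hom_comp[OF act[OF that(2)] T[OF that(1)]])
  have C1: "(\<forall>j<length as. \<forall>l<length as. \<forall>x\<in>carrier M.
      T j ((as ! l) \<odot> x) = (\<Oplus>k\<in>?D. alg.str l k j \<odot>\<^bsub>V\<^esub> T k x)) \<longleftrightarrow>
    (\<forall>j<length as. \<forall>l<length as. matrix_of V bs (T j) * action_matrix (as ! l) =
      mat_lc (length bs) (length as) (\<lambda>k. alg.str l k j) (\<lambda>k. matrix_of V bs (T k)))"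
    by (intro all_cong lc1)
  have C2: "(\<forall>j<length as. \<forall>l<length as. \<forall>x\<in>carrier M.
      (as ! l) \<odot> T j x = (\<Oplus>k\<in>?D. alg.str k l j \<odot>\<^bsub>V\<^esub> T k x)) \<longleftrightarrow>
    (\<forall>j<length as. \<forall>l<length as. action_matrix (as ! l) * matrix_of V bs (T j) =
      mat_lc (length bs) (length as) (\<lambda>k. alg.str k l j) (\<lambda>k. matrix_of V bs (T k)))"
    by (intro all_cong lc2)
  show "splitting_endos T \<longleftrightarrow>
    mat_lc (length bs) (length as) (\<lambda>_. 1) (\<lambda>k. action_matrix (as ! k) * matrix_of V bs (T k)) = 1\<^sub>m (length bs) \<and>
    (\<forall>j<length as. \<forall>l<length as. matrix_of V bs (T j) * action_matrix (as ! l) =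
      mat_lc (length bs) (length as) (\<lambda>k. alg.str l k j) (\<lambda>k. matrix_of V bs (T k)))"
    by (simp only: eqTrueI[OF T'] sum1 C1 simp_thms)
  show "cosplitting_endos T \<longleftrightarrow>
    mat_lc (length bs) (length as) (\<lambda>_. 1) (\<lambda>k. matrix_of V bs (T k) * action_matrix (as ! k)) = 1\<^sub>m (length bs) \<and>
    (\<forall>j<length as. \<forall>l<length as. action_matrix (as ! l) * matrix_of V bs (T j) =
      mat_lc (length bs) (length as) (\<lambda>k. alg.str k l j) (\<lambda>k. matrix_of V bs (T k)))"
    by (simp only: eqTrueI[OF T'] sum2 C2 simp_thms)
qed

lemma splits_iff_endos: "splits (length as) alg.str (length bs) (\<lambda>k. action_matrix (as ! k)) \<longleftrightarrow> (\<exists>T. splitting_endos T)"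
proof
  assume "\<exists>T. splitting_endos T"
  then obtain T where T: "splitting_endos T" ..
  then have "\<forall>k<length as. T k \<in> module_hom class_ring V V" by (rule conjunct1)
  from iffD1[OF splitting_endos_matrix(1)[OF this] T] show "splits (length as) alg.str (length bs) (\<lambda>k. action_matrix (as ! k))"
    unfolding splits_def by (intro exI[of _ "\<lambda>k. matrix_of V bs (T k)"]) simp
next
  assume "splits (length as) alg.str (length bs) (\<lambda>k. action_matrix (as ! k))"
  then obtain S where S: "\<And>k. k < length as \<Longrightarrow> S k \<in> carrier_mat (length bs) (length bs)"
    and S1: "mat_lc (length bs) (length as) (\<lambda>_. 1) (\<lambda>k. action_matrix (as ! k) * S k) = 1\<^sub>m (length bs)"
    and S2: "\<And>j l. j < length as \<Longrightarrow> l < length as \<Longrightarrow>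
      S j * action_matrix (as ! l) = mat_lc (length bs) (length as) (\<lambda>k. alg.str l k j) S"
    unfolding splits_def by blast
  have mS: "matrix_of V bs (V.endo_of (S k)) = S k" if "k < length as" for k
    by (rule V.matrix_of_endo_of[OF S[OF that]])
  have endo: "\<forall>k<length as. V.endo_of (S k) \<in> module_hom class_ring V V"
    by (intro allI impI V.endo_of_linear)
  have "splitting_endos (\<lambda>k. V.endo_of (S k))"
    by (rule iffD2[OF splitting_endos_matrix(1)[OF endo]])
      (use S1 S2 in \<open>simp add: mS cong: mat_lc_cong\<close>)
  then show "\<exists>T. splitting_endos T" by (rule exI[of _ "\<lambda>k. V.endo_of (S k)"])
qed

lemma splits_if_endos:
  assumes "\<And>k. k < length as \<Longrightarrow> T k \<in> module_hom class_ring V V"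
    and "\<And>x. x \<in> carrier M \<Longrightarrow> (\<Oplus>k\<in>{..<length as}. (as ! k) \<odot> T k x) = x"
    and "\<And>j l x. j < length as \<Longrightarrow> l < length as \<Longrightarrow> x \<in> carrier M \<Longrightarrow>
      T j ((as ! l) \<odot> x) = (\<Oplus>k\<in>{..<length as}. alg.str l k j \<odot>\<^bsub>V\<^esub> T k x)"
  shows "splits (length as) alg.str (length bs) (\<lambda>k. action_matrix (as ! k))"
  unfolding splits_iff_endos by (rule exI[of _ T]) (intro conjI allI impI ballI assms)

lemma endos_if_splits:
  assumes "splits (length as) alg.str (length bs) (\<lambda>k. action_matrix (as ! k))"
  obtains T where "\<And>k. k < length as \<Longrightarrow> T k \<in> module_hom class_ring V V"
    and "\<And>x. x \<in> carrier M \<Longrightarrow> (\<Oplus>k\<in>{..<length as}. (as ! k) \<odot> T k x) = x"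
    and "\<And>j l x. j < length as \<Longrightarrow> l < length as \<Longrightarrow> x \<in> carrier M \<Longrightarrow>
      T j ((as ! l) \<odot> x) = (\<Oplus>k\<in>{..<length as}. alg.str l k j \<odot>\<^bsub>V\<^esub> T k x)"
proof -
  obtain T where T: "splitting_endos T" using assms unfolding splits_iff_endos ..
  show ?thesis
    by (rule that[OF conjunct1[OF T, rule_format] conjunct1[OF conjunct2[OF T], rule_format]
          conjunct2[OF conjunct2[OF T], rule_format]])
qed

text \<open>Transposition reverses products, which exchanges the roles of the two sides in \<open>splitting_endos\<close>
and leads to the structure constants of the opposite algebra.\<close>

lemma splits_transpose_iff_endos:
  "splits (length as) (\<lambda>k l j. alg.str l k j) (length bs) (\<lambda>k. transpose_mat (action_matrix (as ! k))) \<longleftrightarrow> (\<exists>T. cosplitting_endos T)"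
proof
  assume "\<exists>T. cosplitting_endos T"
  then obtain T where T: "cosplitting_endos T" ..
  then have "\<forall>k<length as. T k \<in> module_hom class_ring V V" by (rule conjunct1)
  note * = iffD1[OF splitting_endos_matrix(2)[OF this] T]
  show "splits (length as) (\<lambda>k l j. alg.str l k j) (length bs) (\<lambda>k. transpose_mat (action_matrix (as ! k)))"
    unfolding splits_def
  proof (intro exI[of _ "\<lambda>k. transpose_mat (matrix_of V bs (T k))"] conjI allI impI)
    have tt: "transpose_mat (action_matrix (as ! k)) * transpose_mat (matrix_of V bs (T k)) = transpose_mat (matrix_of V bs (T k) * action_matrix (as ! k))" for k
      by (rule transpose_mult[symmetric, of _ "length bs" "length bs" _ "length bs"]) simp_all
    have "mat_lc (length bs) (length as) (\<lambda>_. 1) (\<lambda>k. transpose_mat (action_matrix (as ! k)) * transpose_mat (matrix_of V bs (T k))) =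
        transpose_mat (mat_lc (length bs) (length as) (\<lambda>_. 1) (\<lambda>k. matrix_of V bs (T k) * action_matrix (as ! k)))"
      unfolding tt by (rule mat_lc_transpose[symmetric], rule mult_carrier_mat[of _ "length bs" "length bs"]) simp_all
    then show "mat_lc (length bs) (length as) (\<lambda>_. 1) (\<lambda>k. transpose_mat (action_matrix (as ! k)) * transpose_mat (matrix_of V bs (T k))) = 1\<^sub>m (length bs)"
      unfolding conjunct1[OF *] by simp
    fix j l assume jl: "j < length as" "l < length as"
    have "transpose_mat (matrix_of V bs (T j)) * transpose_mat (action_matrix (as ! l)) = transpose_mat (action_matrix (as ! l) * matrix_of V bs (T j))"
      by (rule transpose_mult[symmetric, of _ "length bs" "length bs" _ "length bs"]) simp_all
    also have "\<dots> = mat_lc (length bs) (length as) (\<lambda>k. alg.str k l j) (\<lambda>k. transpose_mat (matrix_of V bs (T k)))"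
      unfolding conjunct2[OF *, rule_format, OF jl] by (rule mat_lc_transpose) simp
    finally show "transpose_mat (matrix_of V bs (T j)) * transpose_mat (action_matrix (as ! l)) =
        mat_lc (length bs) (length as) (\<lambda>k. alg.str k l j) (\<lambda>k. transpose_mat (matrix_of V bs (T k)))" .
  qed simp
next
  assume "splits (length as) (\<lambda>k l j. alg.str l k j) (length bs) (\<lambda>k. transpose_mat (action_matrix (as ! k)))"
  then obtain S where S0: "(\<forall>k<length as. S k \<in> carrier_mat (length bs) (length bs)) \<and>
      mat_lc (length bs) (length as) (\<lambda>_. 1) (\<lambda>k. transpose_mat (action_matrix (as ! k)) * S k) = 1\<^sub>m (length bs) \<and>
      (\<forall>j<length as. \<forall>l<length as. S j * transpose_mat (action_matrix (as ! l)) =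
        mat_lc (length bs) (length as) (\<lambda>k. alg.str k l j) S)"
    unfolding splits_def ..
  note S = conjunct1[OF S0, rule_format] and S1 = conjunct1[OF conjunct2[OF S0]]
    and S2 = conjunct2[OF conjunct2[OF S0], rule_format]
  have St: "transpose_mat (S k) \<in> carrier_mat (length bs) (length bs)" if "k < length as" for k
    using S[OF that] by simp
  have mS: "matrix_of V bs (V.endo_of (transpose_mat (S k))) = transpose_mat (S k)" if "k < length as" for k
    by (rule V.matrix_of_endo_of[OF St[OF that]])
  have t1: "transpose_mat (S k) * action_matrix (as ! k) = transpose_mat (transpose_mat (action_matrix (as ! k)) * S k)" if "k < length as" for k
    using transpose_mult[of "transpose_mat (action_matrix (as ! k))" "length bs" "length bs" "S k" "length bs"] S[OF that]
    by (simp only: transpose_transpose transpose_carrier_mat action_matrix_carrier simp_thms)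
  have t2: "action_matrix (as ! l) * transpose_mat (S j) = transpose_mat (S j * transpose_mat (action_matrix (as ! l)))" if "j < length as" for j l
    using transpose_mult[of "S j" "length bs" "length bs" "transpose_mat (action_matrix (as ! l))" "length bs"] S[OF that]
    by (simp only: transpose_transpose transpose_carrier_mat action_matrix_carrier simp_thms)
  have endo: "\<forall>k<length as. V.endo_of (transpose_mat (S k)) \<in> module_hom class_ring V V"
    by (intro allI impI V.endo_of_linear)
  have "cosplitting_endos (\<lambda>k. V.endo_of (transpose_mat (S k)))"
  proof (rule iffD2[OF splitting_endos_matrix(2)[OF endo]], intro conjI allI impI)
    have "mat_lc (length bs) (length as) (\<lambda>_. 1) (\<lambda>k. matrix_of V bs (V.endo_of (transpose_mat (S k))) * action_matrix (as ! k)) =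
        mat_lc (length bs) (length as) (\<lambda>_. 1) (\<lambda>k. transpose_mat (transpose_mat (action_matrix (as ! k)) * S k))"
      by (rule mat_lc_cong) (simp_all add: mS t1)
    also have "\<dots> = transpose_mat (mat_lc (length bs) (length as) (\<lambda>_. 1) (\<lambda>k. transpose_mat (action_matrix (as ! k)) * S k))"
      by (rule mat_lc_transpose[symmetric]) (rule mult_carrier_mat[OF _ S], simp only: transpose_carrier_mat action_matrix_carrier)
    finally show "mat_lc (length bs) (length as) (\<lambda>_. 1) (\<lambda>k. matrix_of V bs (V.endo_of (transpose_mat (S k))) * action_matrix (as ! k)) = 1\<^sub>m (length bs)"
      unfolding S1 by simp
    fix j l assume jl: "j < length as" "l < length as"
    have "action_matrix (as ! l) * matrix_of V bs (V.endo_of (transpose_mat (S j))) = transpose_mat (mat_lc (length bs) (length as) (\<lambda>k. alg.str k l j) S)"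
      unfolding mS[OF jl(1)] t2[OF jl(1)] S2[OF jl] ..
    also have "\<dots> = mat_lc (length bs) (length as) (\<lambda>k. alg.str k l j) (\<lambda>k. transpose_mat (S k))"
      by (rule mat_lc_transpose) (rule S)
    also have "\<dots> = mat_lc (length bs) (length as) (\<lambda>k. alg.str k l j) (\<lambda>k. matrix_of V bs (V.endo_of (transpose_mat (S k))))"
      by (rule mat_lc_cong) (simp_all add: mS)
    finally show "action_matrix (as ! l) * matrix_of V bs (V.endo_of (transpose_mat (S j))) =
        mat_lc (length bs) (length as) (\<lambda>k. alg.str k l j) (\<lambda>k. matrix_of V bs (V.endo_of (transpose_mat (S k))))" .
  qed
  then show "\<exists>T. cosplitting_endos T" by (rule exI[of _ "\<lambda>k. V.endo_of (transpose_mat (S k))"])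
qed

theorem projective_iff_splits:
  assumes "inj (universe :: (nat \<Rightarrow> complex) \<Rightarrow> 'u)"
  shows "projective_module TYPE('u) A M \<longleftrightarrow> splits (length as) alg.str (length bs) (\<lambda>k. action_matrix (as ! k))"
  unfolding splits_iff_endos
proof
  show "\<exists>T. splitting_endos T" if "projective_module TYPE('u) A M" by (rule endos_if_projective[OF assms that])
  show "projective_module TYPE('u) A M" if "\<exists>T. splitting_endos T" using that by (rule exE) (rule projective_if_endos)
qed

theorem injective_iff_splits:
  assumes "inj (universe :: (nat \<Rightarrow> complex) \<Rightarrow> 'u)"
  shows "injective_module TYPE('u) A M \<longleftrightarrow>
    splits (length as) (\<lambda>k l j. alg.str l k j) (length bs) (\<lambda>k. transpose_mat (action_matrix (as ! k)))"
  unfolding splits_transpose_iff_endos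
proof
  show "\<exists>T. cosplitting_endos T" if "injective_module TYPE('u) A M" by (rule endos_if_injective[OF assms that])
  show "injective_module TYPE('u) A M" if "\<exists>T. cosplitting_endos T" using that by (rule exE) (rule injective_if_endos)
qed

end

section \<open>Decomposition into indecomposable projectives\<close>

text \<open>What the decomposition needs of a bound quiver algebra: the idempotents at the vertices \<open>V0\<close>, and the
powers \<open>F k\<close> of the radical. The last assumption says that \<open>A e\<^sub>v\<close> is spanned by \<open>e\<^sub>v\<close> modulo the
radical.\<close>

locale filtered_algebra = based_algebra A as
  for A :: "(complex, 'r, 'y) module_scheme" (structure) and as :: "'r list" +
  fixes V0 :: "'i set" and e :: "'i \<Rightarrow> 'r" and F :: "nat \<Rightarrow> 'r set"
  assumes finite_V0: "finite V0"
    and e_closed [simp]: "v \<in> V0 \<Longrightarrow> e v \<in> carrier A"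
    and e_idem: "v \<in> V0 \<Longrightarrow> e v \<otimes> e v = e v"
    and one_sum: "\<one> = (\<Oplus>v\<in>V0. e v)"
    and F_0: "F 0 = carrier A" and F_closed: "F k \<subseteq> carrier A"
    and F_zero: "\<zero> \<in> F k"
    and F_add: "x \<in> F k \<Longrightarrow> y \<in> F k \<Longrightarrow> x \<oplus> y \<in> F k"
    and F_smult: "x \<in> F k \<Longrightarrow> c \<odot> x \<in> F k"
    and F_mult: "x \<in> F k \<Longrightarrow> y \<in> F 1 \<Longrightarrow> x \<otimes> y \<in> F (Suc k)"
    and F_nilpotent: "\<exists>m. F m = {\<zero>}"
    and e_split: "x \<in> carrier A \<Longrightarrow> v \<in> V0 \<Longrightarrow> \<exists>c. \<exists>y\<in>F 1. x \<otimes> e v = c \<odot> e v \<oplus> y"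
begin

lemma F_in [simp]: "x \<in> F k \<Longrightarrow> x \<in> carrier A"
  using F_closed by auto

lemma minus_eq_smult: "x \<in> carrier A \<Longrightarrow> \<ominus> x = (-1) \<odot> x"
proof -
  assume x: "x \<in> carrier A"
  have "(-1) \<odot> x \<oplus> x = (-1 + 1) \<odot> x"
    using alg.complex_module(3)[OF x, of "-1" 1] alg.complex_module(5)[OF x] by simp
  also have "\<dots> = \<zero>" using alg.complex_module(6)[OF x] by simp
  finally show ?thesis using x by (intro minus_equality) auto
qed

lemma F_minus: "x \<in> F k \<Longrightarrow> \<ominus> x \<in> F k"
  by (simp add: minus_eq_smult F_smult)

lemma F_finsum: "(\<And>s. s \<in> S \<Longrightarrow> f s \<in> F k) \<Longrightarrow> finsum A f S \<in> F k"
proof (induction S rule: infinite_finite_induct)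
  case (insert s S)
  then have "finsum A f (insert s S) = f s \<oplus> finsum A f S" by (intro finsum_insert) (auto intro: F_in[of _ k])
  then show ?case using insert by (auto intro: F_add)
qed (auto simp: F_zero)

text \<open>The carrier of \<open>P(v)\<close>, characterised by fixed points so that membership is an equation.\<close>

definition Pe :: "'i \<Rightarrow> 'r set" where "Pe v = {y \<in> carrier A. y \<otimes> e v = y}"

lemma Pe_image: "v \<in> V0 \<Longrightarrow> Pe v = (\<lambda>x. x \<otimes> e v) ` carrier A"
  by (auto simp: Pe_def m_assoc e_idem image_iff) metis

lemma Pe_in: "y \<in> Pe v \<Longrightarrow> y \<in> carrier A" and Pe_mult_e: "y \<in> Pe v \<Longrightarrow> y \<otimes> e v = y"
  by (auto simp: Pe_def)

lemma Pe_zero: "v \<in> V0 \<Longrightarrow> \<zero> \<in> Pe v" by (simp add: Pe_def)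
lemma Pe_e: "v \<in> V0 \<Longrightarrow> e v \<in> Pe v" by (simp add: Pe_def e_idem)
lemma Pe_add: "v \<in> V0 \<Longrightarrow> x \<in> Pe v \<Longrightarrow> y \<in> Pe v \<Longrightarrow> x \<oplus> y \<in> Pe v" by (simp add: Pe_def l_distr)
lemma Pe_mult: "v \<in> V0 \<Longrightarrow> x \<in> carrier A \<Longrightarrow> y \<in> Pe v \<Longrightarrow> x \<otimes> y \<in> Pe v" by (simp add: Pe_def m_assoc)
lemma Pe_smult: "v \<in> V0 \<Longrightarrow> y \<in> Pe v \<Longrightarrow> c \<odot> y \<in> Pe v" by (simp add: Pe_def smult_mult[symmetric])
lemma Pe_minus: "v \<in> V0 \<Longrightarrow> y \<in> Pe v \<Longrightarrow> \<ominus> y \<in> Pe v" by (simp add: minus_eq_smult Pe_in Pe_smult)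

lemma Pe_finsum: "v \<in> V0 \<Longrightarrow> (\<And>s. s \<in> S \<Longrightarrow> f s \<in> Pe v) \<Longrightarrow> finsum A f S \<in> Pe v"
proof (induction S rule: infinite_finite_induct)
  case (insert s S)
  then have "finsum A f (insert s S) = f s \<oplus> finsum A f S" by (intro finsum_insert) (auto intro: Pe_in[of _ v])
  then show ?case using insert by (auto intro: Pe_add)
qed (auto simp: Pe_zero)

end

locale decomposition = based_module A as M bs + flt: filtered_algebra A as V0 e F
  for A :: "(complex, 'r, 'y) module_scheme" and as :: "'r list"
    and M :: "('r, 'm, 'z) module_scheme" (structure) and bs :: "'m list"
    and V0 :: "'i set" and e :: "'i \<Rightarrow> 'r" and F :: "nat \<Rightarrow> 'r set"
begin

text \<open>A generating family is a set \<open>T\<close> of pairs of a vertex \<open>v\<close> and an element \<open>x\<close> of \<open>M\<close>; the pair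
stands for the submodule \<open>(A e\<^sub>v) x\<close>, and admissible coefficients of \<open>x\<close> lie in \<open>A e\<^sub>v\<close>. The same \<open>x\<close> may occur
at several vertices.\<close>

definition combination :: "('i \<times> 'm) set \<Rightarrow> ('i \<times> 'm \<Rightarrow> 'r) \<Rightarrow> 'm" where
  "combination T a = (\<Oplus>t\<in>T. a t \<odot> snd t)"

definition coefficients :: "('i \<times> 'm) set \<Rightarrow> ('i \<times> 'm \<Rightarrow> 'r) \<Rightarrow> bool" where
  "coefficients T a \<longleftrightarrow> (\<forall>t\<in>T. a t \<in> flt.Pe (fst t))"

definition family :: "('i \<times> 'm) set \<Rightarrow> bool" where
  "family T \<longleftrightarrow> finite T \<and> T \<subseteq> V0 \<times> carrier M"

definition spanned :: "('i \<times> 'm) set \<Rightarrow> 'm set" where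
  "spanned T = {combination T a | a. coefficients T a}"

lemma familyD: "family T \<Longrightarrow> finite T" "family T \<Longrightarrow> t \<in> T \<Longrightarrow> fst t \<in> V0" "family T \<Longrightarrow> t \<in> T \<Longrightarrow> snd t \<in> carrier M"
  by (auto simp: family_def)

lemma coefficientsD: "coefficients T a \<Longrightarrow> t \<in> T \<Longrightarrow> a t \<in> carrier A" "coefficients T a \<Longrightarrow> t \<in> T \<Longrightarrow> a t \<in> flt.Pe (fst t)"
  by (auto simp: coefficients_def flt.Pe_in)

lemma combination_terms: "family T \<Longrightarrow> coefficients T a \<Longrightarrow> (\<lambda>t. a t \<odot> snd t) \<in> T \<rightarrow> carrier M"
  by (intro funcsetI mod.smult_closed coefficientsD(1) familyD(3))

lemma combination_closed: "family T \<Longrightarrow> coefficients T a \<Longrightarrow> combination T a \<in> carrier M"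
  unfolding combination_def by (intro mod.M.finsum_closed combination_terms)

lemma combination_add:
  assumes "family T" "coefficients T a" "coefficients T b"
  shows "combination T a \<oplus> combination T b = combination T (\<lambda>t. a t \<oplus>\<^bsub>A\<^esub> b t)"
    and "coefficients T (\<lambda>t. a t \<oplus>\<^bsub>A\<^esub> b t)"
proof -
  show c: "coefficients T (\<lambda>t. a t \<oplus>\<^bsub>A\<^esub> b t)"
    using assms by (auto simp: coefficients_def familyD flt.Pe_add)
  have "combination T (\<lambda>t. a t \<oplus>\<^bsub>A\<^esub> b t) = (\<Oplus>t\<in>T. a t \<odot> snd t \<oplus> b t \<odot> snd t)"
    unfolding combination_def using combination_terms[OF assms(1,2)] combination_terms[OF assms(1,3)] assms
    by (intro mod.M.finsum_cong') (auto simp: mod.smult_l_distr coefficientsD familyD Pi_iff)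
  then show "combination T a \<oplus> combination T b = combination T (\<lambda>t. a t \<oplus>\<^bsub>A\<^esub> b t)"
    unfolding combination_def using mod.M.finsum_addf[OF combination_terms[OF assms(1,2)] combination_terms[OF assms(1,3)]] by simp
qed

lemma combination_act:
  assumes "family T" "coefficients T a" "b \<in> carrier A"
  shows "b \<odot> combination T a = combination T (\<lambda>t. b \<otimes>\<^bsub>A\<^esub> a t)" and "coefficients T (\<lambda>t. b \<otimes>\<^bsub>A\<^esub> a t)"
proof -
  show "coefficients T (\<lambda>t. b \<otimes>\<^bsub>A\<^esub> a t)" using assms by (auto simp: coefficients_def familyD flt.Pe_mult)
  have "b \<odot> combination T a = (\<Oplus>t\<in>T. b \<odot> (a t \<odot> snd t))"
    unfolding combination_def by (rule act_finsum_right[OF combination_terms[OF assms(1,2)] assms(3)])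
  also have "\<dots> = combination T (\<lambda>t. b \<otimes>\<^bsub>A\<^esub> a t)"
    unfolding combination_def using assms
    by (intro mod.M.finsum_cong' refl funcsetI mod.smult_assoc1[symmetric] mod.smult_closed alg.m_closed
        coefficientsD(1)[where a = a and T = T] familyD(3)[where T = T])
  finally show "b \<odot> combination T a = combination T (\<lambda>t. b \<otimes>\<^bsub>A\<^esub> a t)" .
qed

lemma combination_remove:
  assumes "family T" "coefficients T a" "t \<in> T"
  shows "combination T a = a t \<odot> snd t \<oplus> combination (T - {t}) a"
proof -
  have "T = insert t (T - {t})" using assms by auto
  then have "combination T a = (\<Oplus>t\<in>insert t (T - {t}). a t \<odot> snd t)" unfolding combination_def by simp
  also have "\<dots> = a t \<odot> snd t \<oplus> combination (T - {t}) a"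
    unfolding combination_def using combination_terms[OF assms(1,2)] assms
    by (intro mod.M.finsum_insert) (auto simp: familyD Pi_iff)
  finally show ?thesis .
qed

lemma combination_zero: "family T \<Longrightarrow> (\<And>t. t \<in> T \<Longrightarrow> a t = \<zero>\<^bsub>A\<^esub>) \<Longrightarrow> combination T a = \<zero>"
  unfolding combination_def by (rule mod.M.add.finprod_one_eqI) (auto simp: act_zero familyD)

lemma combination_single:
  assumes "family T" "t \<in> T" "y \<in> flt.Pe (fst t)"
  shows "combination T (\<lambda>s. if s = t then y else \<zero>\<^bsub>A\<^esub>) = y \<odot> snd t"
    and "coefficients T (\<lambda>s. if s = t then y else \<zero>\<^bsub>A\<^esub>)"
proof -
  show c: "coefficients T (\<lambda>s. if s = t then y else \<zero>\<^bsub>A\<^esub>)"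
    using assms by (auto simp: coefficients_def familyD flt.Pe_zero)
  have "family (T - {t})" using assms by (auto simp: family_def)
  then show "combination T (\<lambda>s. if s = t then y else \<zero>\<^bsub>A\<^esub>) = y \<odot> snd t"
    using combination_remove[OF assms(1) c assms(2)] combination_zero[of "T - {t}"] assms
    by (simp add: mod.smult_closed familyD flt.Pe_in)
qed

lemma spanned_closed: "family T \<Longrightarrow> spanned T \<subseteq> carrier M"
  by (auto simp: spanned_def combination_closed)

lemma spanned_add: "family T \<Longrightarrow> x \<in> spanned T \<Longrightarrow> y \<in> spanned T \<Longrightarrow> x \<oplus> y \<in> spanned T"
  unfolding spanned_def using combination_add by blast

lemma spanned_act: "family T \<Longrightarrow> x \<in> spanned T \<Longrightarrow> b \<in> carrier A \<Longrightarrow> b \<odot> x \<in> spanned T"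
  unfolding spanned_def using combination_act by blast

lemma spanned_mem: "family T \<Longrightarrow> t \<in> T \<Longrightarrow> y \<in> flt.Pe (fst t) \<Longrightarrow> y \<odot> snd t \<in> spanned T"
  unfolding spanned_def using combination_single[of T t y] by (intro CollectI exI[of _ "\<lambda>s. if s = t then y else \<zero>\<^bsub>A\<^esub>"]) simp

lemma spanned_zero: "family T \<Longrightarrow> \<zero> \<in> spanned T"
  unfolding spanned_def using combination_zero[of T "\<lambda>_. \<zero>\<^bsub>A\<^esub>"]
  by (intro CollectI exI[of _ "\<lambda>_. \<zero>\<^bsub>A\<^esub>"]) (auto simp: coefficients_def familyD flt.Pe_zero)

lemma spanned_finsum: "family T \<Longrightarrow> (\<And>s. s \<in> S \<Longrightarrow> f s \<in> spanned T) \<Longrightarrow> finsum M f S \<in> spanned T"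
proof (induction S rule: infinite_finite_induct)
  case (insert s S)
  then have "finsum M f (insert s S) = f s \<oplus> finsum M f S"
    using spanned_closed by (intro mod.M.finsum_insert) auto
  then show ?case using insert by (auto intro: spanned_add)
qed (auto simp: spanned_zero)

lemma spanned_subset:
  assumes "family T" "family S" "\<And>t y. t \<in> T \<Longrightarrow> y \<in> flt.Pe (fst t) \<Longrightarrow> y \<odot> snd t \<in> spanned S"
  shows "spanned T \<subseteq> spanned S"
proof
  fix x assume "x \<in> spanned T"
  then obtain a where a: "coefficients T a" "x = combination T a" by (auto simp: spanned_def)
  show "x \<in> spanned S" unfolding a(2) combination_def by (rule spanned_finsum[OF assms(2)]) (rule assms(3)[OF _ coefficientsD(2)[OF a(1)]])
qed

lemma spanned_lc: "family T \<Longrightarrow> (\<And>i. i < length bs \<Longrightarrow> bs ! i \<in> spanned T) \<Longrightarrow> spanned T = carrier M"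
proof (intro equalityI subsetI)
  fix x assume T: "family T" and b: "\<And>i. i < length bs \<Longrightarrow> bs ! i \<in> spanned T" and x: "x \<in> carrier M"
  have m: "(\<lambda>i. V.coord i x \<odot>\<^bsub>V\<^esub> bs ! i) \<in> {..<length bs} \<rightarrow> carrier M"
    using V.smult_c by (auto simp del: complex_space_simps(4))
  have "x = (\<Oplus>i\<in>{..<length bs}. V.coord i x \<odot>\<^bsub>V\<^esub> bs ! i)"
    using V.lc_coord[of x] x finsum_V[OF m] by simp
  also have "\<dots> \<in> spanned T" using T b by (intro spanned_finsum) (auto intro!: spanned_act)
  finally show "x \<in> spanned T" .
qed (use spanned_closed in auto)

lemma generating_family_exists: "\<exists>T. family T \<and> spanned T = carrier M"
proof (intro exI conjI)
  let ?T = "V0 \<times> set bs"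
  show T: "family ?T" using flt.finite_V0 V.bs_subset by (auto simp: family_def)
  show "spanned ?T = carrier M"
  proof (rule spanned_lc[OF T])
    fix i assume i: "i < length bs"
    have "bs ! i = \<one>\<^bsub>A\<^esub> \<odot> bs ! i" using i by (simp add: mod.smult_one)
    also have "\<dots> = (\<Oplus>v\<in>V0. e v \<odot> bs ! i)"
      unfolding flt.one_sum using i by (intro act_finsum) auto
    also have "\<dots> \<in> spanned ?T"
      using i spanned_mem[OF T, of "(_, bs ! i)"] by (intro spanned_finsum[OF T]) (auto simp: flt.Pe_e)
    finally show "bs ! i \<in> spanned ?T" .
  qed
qed

definition minimal :: "('i \<times> 'm) set \<Rightarrow> bool" where
  "minimal T \<longleftrightarrow> family T \<and> spanned T = carrier M \<and> (\<forall>S. family S \<and> spanned S = carrier M \<longrightarrow> card T \<le> card S)"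

lemma minimal_exists: "\<exists>T. minimal T"
proof -
  obtain T where "family T \<and> spanned T = carrier M" "\<forall>S. family S \<and> spanned S = carrier M \<longrightarrow> card T \<le> card S"
    using ex_has_least_nat[of "\<lambda>T. family T \<and> spanned T = carrier M" _ card] generating_family_exists by blast
  then show ?thesis unfolding minimal_def by blast
qed

text \<open>A coefficient outside the radical would be \<open>c e\<^sub>v + y\<close> with \<open>c \<noteq> 0\<close> and \<open>y\<close> in the radical. The relation
then expresses \<open>x' = e\<^sub>v x\<close> as \<open>n x' + w\<close> with \<open>n\<close> in the radical and \<open>w\<close> spanned by the other members;
iterating this until the power of \<open>n\<close> vanishes shows that \<open>x\<close> is redundant.\<close>

lemma minimal_relation:
  assumes T: "minimal T" and a: "coefficients T a" and rel: "combination T a = \<zero>" and t: "t \<in> T"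
  shows "a t \<in> F 1"
proof (rule ccontr)
  assume notF: "a t \<notin> F 1"
  let ?v = "fst t" and ?x = "snd t" and ?S = "T - {t}"
  have fT: "family T" using T by (simp add: minimal_def)
  then have fS: "family ?S" by (auto simp: family_def)
  have v: "?v \<in> V0" and x: "?x \<in> carrier M" using familyD[OF fT] t by auto
  have at: "a t \<in> carrier A" "a t \<otimes>\<^bsub>A\<^esub> e ?v = a t" using coefficientsD[OF a t] flt.Pe_mult_e by auto
  obtain c y where y: "y \<in> F 1" and aty: "a t = c \<odot>\<^bsub>A\<^esub> e ?v \<oplus>\<^bsub>A\<^esub> y"
    using flt.e_split[OF at(1) v] at(2) by auto
  have c: "c \<noteq> 0"
  proof
    assume "c = 0"
    then have "a t = y" using aty y v by (simp add: alg.alg.complex_module(6))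
    then show False using y notF by simp
  qed
  define x' where "x' = e ?v \<odot> ?x"
  have x': "x' \<in> carrier M" unfolding x'_def using v x by (simp add: mod.smult_closed)
  define w where "w = combination ?S a"
  have aS: "coefficients ?S a" using a by (auto simp: coefficients_def)
  have w: "w \<in> spanned ?S" unfolding w_def spanned_def using aS by blast
  then have wM: "w \<in> carrier M" using spanned_closed[OF fS] by auto
  have "a t \<odot> ?x = (a t \<otimes>\<^bsub>A\<^esub> e ?v) \<odot> ?x" using at by simp
  also have "\<dots> = a t \<odot> x'" unfolding x'_def using mod.smult_assoc1[OF at(1) _ x, of "e ?v"] v by simp
  also have "\<dots> = (c \<odot>\<^bsub>A\<^esub> e ?v) \<odot> x' \<oplus> y \<odot> x'"
    unfolding aty using y v x' by (simp add: mod.smult_l_distr)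
  also have "(c \<odot>\<^bsub>A\<^esub> e ?v) \<odot> x' = c \<odot>\<^bsub>V\<^esub> (e ?v \<odot> x')" using v x' by (intro act_scalar) auto
  also have "e ?v \<odot> x' = x'" unfolding x'_def using v x by (simp add: mod.smult_assoc1[symmetric] flt.e_idem)
  finally have "c \<odot>\<^bsub>V\<^esub> x' \<oplus> y \<odot> x' \<oplus> w = \<zero>"
    using combination_remove[OF fT a t] rel by (simp add: w_def)
  moreover have cx: "c \<odot>\<^bsub>V\<^esub> x' \<in> carrier M" using x' V.smult_c[of x' c] by simp
  moreover have yx: "y \<odot> x' \<in> carrier M" using x' y by (simp add: mod.smult_closed)
  ultimately have "c \<odot>\<^bsub>V\<^esub> x' = \<ominus> (y \<odot> x' \<oplus> w)"
    using wM by (intro mod.M.minus_equality[symmetric]) (auto simp: mod.M.a_assoc simp del: complex_space_simps(4))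
  moreover have "\<ominus> z = (-1) \<odot>\<^bsub>V\<^esub> z" if "z \<in> carrier M" for z
  proof -
    have z1: "(-1) \<odot>\<^bsub>V\<^esub> z \<in> carrier M" using that V.smult_c[of z "-1"] by simp
    have "(-1) \<odot>\<^bsub>V\<^esub> z \<oplus> z = (-1 + 1) \<odot>\<^bsub>V\<^esub> z"
      using V.complex_module(3)[of z "-1" 1] V.complex_module(5)[of z] that by simp
    also have "\<dots> = \<zero>" using V.complex_module(6)[of z] that by simp
    finally show ?thesis using that z1 by (intro mod.M.minus_equality)
  qed
  ultimately have "c \<odot>\<^bsub>V\<^esub> x' = (-1) \<odot>\<^bsub>V\<^esub> (y \<odot> x' \<oplus> w)"
    using yx wM by (simp del: complex_space_simps(4))
  then have "(1 / c) \<odot>\<^bsub>V\<^esub> (c \<odot>\<^bsub>V\<^esub> x') = (1 / c) \<odot>\<^bsub>V\<^esub> ((-1) \<odot>\<^bsub>V\<^esub> (y \<odot> x' \<oplus> w))" by simp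
  then have "x' = (- 1 / c) \<odot>\<^bsub>V\<^esub> (y \<odot> x' \<oplus> w)"
    using c x' yx wM V.complex_module(2)[of x' "1 / c" c] V.complex_module(5)[of x']
      V.complex_module(2)[of "y \<odot> x' \<oplus> w" "1 / c" "-1"] by (simp del: complex_space_simps(4))
  also have "\<dots> = (- 1 / c) \<odot>\<^bsub>V\<^esub> (y \<odot> x') \<oplus> (- 1 / c) \<odot>\<^bsub>V\<^esub> w"
    using V.complex_module(4)[of "y \<odot> x'" w "- 1 / c"] yx wM by (simp del: complex_space_simps(4))
  also have "(- 1 / c) \<odot>\<^bsub>V\<^esub> (y \<odot> x') = ((- 1 / c) \<odot>\<^bsub>A\<^esub> y) \<odot> x'"
    using y x' by (intro act_scalar(1)[symmetric]) auto
  finally have fix_eq: "x' = ((- 1 / c) \<odot>\<^bsub>A\<^esub> y) \<odot> x' \<oplus> (- 1 / c) \<odot>\<^bsub>V\<^esub> w" .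
  define z where "z = (- 1 / c) \<odot>\<^bsub>A\<^esub> y"
  define u where "u = (- 1 / c) \<odot>\<^bsub>V\<^esub> w"
  have z: "z \<in> F 1" unfolding z_def using y by (rule flt.F_smult)
  have u: "u \<in> spanned ?S" unfolding u_def using spanned_act[OF fS w] by simp
  have uM: "u \<in> carrier M" using u spanned_closed[OF fS] by auto
  have fix_eq: "x' = z \<odot> x' \<oplus> u" unfolding z_def u_def by (rule fix_eq)
  have iter: "\<exists>n\<in>F k. \<exists>w\<in>spanned ?S. x' = n \<odot> x' \<oplus> w" for k
  proof (induction k)
    case 0
    show ?case
      by (intro bexI[of _ "\<one>\<^bsub>A\<^esub>"] bexI[of _ "\<zero>"]) (auto simp: flt.F_0 x' mod.smult_one spanned_zero[OF fS])
  next
    case (Suc k)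
    then obtain n w where n: "n \<in> F k" and w: "w \<in> spanned ?S" and eq: "x' = n \<odot> x' \<oplus> w" by blast
    have wM: "w \<in> carrier M" using w spanned_closed[OF fS] by auto
    have "n \<odot> x' = n \<odot> (z \<odot> x' \<oplus> u)" using fix_eq by simp
    also have "\<dots> = (n \<otimes>\<^bsub>A\<^esub> z) \<odot> x' \<oplus> n \<odot> u"
      using n z x' uM by (simp add: mod.smult_r_distr mod.smult_assoc1 mod.smult_closed)
    finally have "x' = (n \<otimes>\<^bsub>A\<^esub> z) \<odot> x' \<oplus> (n \<odot> u \<oplus> w)"
      using eq n z x' uM wM by (simp add: mod.M.a_assoc mod.smult_closed)
    moreover have "n \<otimes>\<^bsub>A\<^esub> z \<in> F (Suc k)" using n z by (rule flt.F_mult)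
    moreover have "n \<odot> u \<oplus> w \<in> spanned ?S" using n u w by (intro spanned_add[OF fS] spanned_act[OF fS]) auto
    ultimately show ?case by blast
  qed
  obtain m where "F m = {\<zero>\<^bsub>A\<^esub>}" using flt.F_nilpotent by blast
  then obtain w where "w \<in> spanned ?S" "x' = \<zero>\<^bsub>A\<^esub> \<odot> x' \<oplus> w" using iter[of m] by auto
  then have x'S: "x' \<in> spanned ?S" using x' spanned_closed[OF fS] by (auto simp: act_zero)
  have "spanned T \<subseteq> spanned ?S"
  proof (rule spanned_subset[OF fT fS])
    fix s b assume s: "s \<in> T" and b: "b \<in> flt.Pe (fst s)"
    show "b \<odot> snd s \<in> spanned ?S"
    proof (cases "s = t")
      case True
      have "b \<odot> snd s = b \<odot> x'"
        using b v x flt.Pe_mult_e[OF b] True by (simp add: x'_def mod.smult_assoc1[symmetric] flt.Pe_in)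
      then show ?thesis using x'S b by (simp add: spanned_act[OF fS] flt.Pe_in)
    next
      case False
      then show ?thesis using s b by (intro spanned_mem[OF fS]) auto
    qed
  qed
  then have "spanned ?S = carrier M" using T spanned_closed[OF fS] by (auto simp: minimal_def)
  then have "card T \<le> card ?S" using T fS by (simp add: minimal_def)
  then show False using t familyD(1)[OF fT] by (simp add: card_Diff_singleton_if card_gt_0_iff) (metis Suc_pred card_gt_0_iff empty_iff not_less_eq_eq order_refl)
qed

end

context based_algebra
begin

lemma coord_mult_lc:
  assumes "l < length as" "j < length as"
  shows "alg.coord j ((as ! l) \<otimes> alg.lc c) = (\<Sum>k<length as. c k * str l k j)"
proof -
  have "(as ! l) \<otimes> alg.lc c = (\<Oplus>k\<in>{..<length as}. (as ! l) \<otimes> (c k \<odot> (as ! k)))"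
    using assms by (intro finsum_rdistr) auto
  also have "alg.coord j \<dots> = (\<Sum>k<length as. alg.coord j ((as ! l) \<otimes> (c k \<odot> (as ! k))))"
    using assms by (intro alg.coord_finsum) auto
  also have "\<dots> = (\<Sum>k<length as. c k * str l k j)"
    unfolding str_def using assms
    by (intro sum.cong refl) (simp add: mult_smult[symmetric] alg.coord_smult)
  finally show ?thesis .
qed

end

context decomposition
begin

text \<open>The maps \<open>h\<^sub>p x = \<Sum>\<^sub>k (S\<^sub>k x)\<^sub>p a\<^sub>k\<close> built from the splitting endomorphisms are \<open>A\<close>-linear and satisfy
\<open>x = \<Sum>\<^sub>p h\<^sub>p(x) b\<^sub>p\<close> for the basis \<open>b\<close> of \<open>M\<close>; expanding each \<open>b\<^sub>p\<close> in the generating family yields the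
functionals belonging to the family.\<close>

lemma dual_family:
  assumes "splits (length as) alg.str (length bs) (\<lambda>k. action_matrix (as ! k))"
    and fT: "family T" and gen: "spanned T = carrier M"
  obtains f where "\<And>t x. t \<in> T \<Longrightarrow> x \<in> carrier M \<Longrightarrow> f t x \<in> flt.Pe (fst t)"
    and "\<And>t x y. t \<in> T \<Longrightarrow> x \<in> carrier M \<Longrightarrow> y \<in> carrier M \<Longrightarrow> f t (x \<oplus> y) = f t x \<oplus>\<^bsub>A\<^esub> f t y"
    and "\<And>t x a. t \<in> T \<Longrightarrow> x \<in> carrier M \<Longrightarrow> a \<in> carrier A \<Longrightarrow> f t (a \<odot> x) = a \<otimes>\<^bsub>A\<^esub> f t x"
    and "\<And>x. x \<in> carrier M \<Longrightarrow> combination T (\<lambda>t. f t x) = x"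
proof -
  let ?d = "length as" and ?n = "length bs"
  obtain S where S: "\<And>k. k < ?d \<Longrightarrow> S k \<in> module_hom class_ring V V"
    and S1: "\<And>x. x \<in> carrier M \<Longrightarrow> (\<Oplus>k\<in>{..<?d}. (as ! k) \<odot> S k x) = x"
    and S2: "\<And>j l x. j < ?d \<Longrightarrow> l < ?d \<Longrightarrow> x \<in> carrier M \<Longrightarrow>
      S j ((as ! l) \<odot> x) = (\<Oplus>k\<in>{..<?d}. alg.str l k j \<odot>\<^bsub>V\<^esub> S k x)"
    by (rule endos_if_splits[OF assms(1)]) (rule that)
  have Sc: "S k x \<in> carrier M" if "k < ?d" "x \<in> carrier M" for k x
    using S[OF that(1)] that(2) by (auto simp: module_hom_def)
  have Sadd: "S k (x \<oplus> y) = S k x \<oplus> S k y" if "k < ?d" "x \<in> carrier M" "y \<in> carrier M" for k x y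
    using S[OF that(1)] that(2,3) by (auto simp: module_hom_def)
  have Ssm: "S k (c \<odot>\<^bsub>V\<^esub> x) = c \<odot>\<^bsub>V\<^esub> S k x" if "k < ?d" "x \<in> carrier M" for k x c
    using S[OF that(1)] that(2) by (auto simp: module_hom_def)
  \<comment> \<open>The \<open>p\<close>-th row of the section, read as an element of the algebra.\<close>
  define h where "h p x = alg.alg.lc (\<lambda>k. V.coord p (S k x))" for p x
  have hA: "h p x \<in> carrier A" for p x unfolding h_def by simp
  have coord_h: "alg.alg.coord k (h p x) = V.coord p (S k x)" if "k < ?d" for k p x
    unfolding h_def using that by (rule alg.alg.coord_lc)
  have h_add: "h p (x \<oplus> y) = h p x \<oplus>\<^bsub>A\<^esub> h p y" if "p < ?n" "x \<in> carrier M" "y \<in> carrier M" for p x y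
  proof (rule alg.alg.coord_eqI)
    show "alg.alg.coord k (h p (x \<oplus> y)) = alg.alg.coord k (h p x \<oplus>\<^bsub>A\<^esub> h p y)" if k: "k < ?d" for k
      using that \<open>p < ?n\<close> \<open>x \<in> carrier M\<close> \<open>y \<in> carrier M\<close> V.coord_add[of p "S k x" "S k y"] Sc
      by (simp add: alg.alg.coord_add hA coord_h Sadd)
  qed (auto simp: hA)
  have h_smult: "h p (c \<odot>\<^bsub>V\<^esub> x) = c \<odot>\<^bsub>A\<^esub> h p x" if "p < ?n" "x \<in> carrier M" for p x c
  proof (rule alg.alg.coord_eqI)
    show "alg.alg.coord k (h p (c \<odot>\<^bsub>V\<^esub> x)) = alg.alg.coord k (c \<odot>\<^bsub>A\<^esub> h p x)" if k: "k < ?d" for k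
      using that \<open>p < ?n\<close> \<open>x \<in> carrier M\<close> V.coord_smult[of p "S k x" c] Sc
      by (simp add: alg.alg.coord_smult hA coord_h Ssm del: complex_space_simps(4))
  qed (auto simp: hA)
  have h_zero: "h p \<zero> = \<zero>\<^bsub>A\<^esub>" if "p < ?n" for p
    using h_smult[OF that, of "\<zero>" 0] V.complex_module(6)[of "\<zero>"] alg.alg.complex_module(6)[OF hA] by simp
  have h_basis: "h p ((as ! l) \<odot> x) = (as ! l) \<otimes>\<^bsub>A\<^esub> h p x" if p: "p < ?n" and l: "l < ?d" and x: "x \<in> carrier M" for p l x
  proof (rule alg.alg.coord_eqI)
    fix j assume j: "j < ?d"
    have m: "(\<lambda>k. alg.str l k j \<odot>\<^bsub>V\<^esub> S k x) \<in> {..<?d} \<rightarrow> carrier M"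
      using V.smult_c Sc x by (intro funcsetI) (simp del: complex_space_simps(4))
    have "alg.alg.coord j (h p ((as ! l) \<odot> x)) = V.coord p (\<Oplus>k\<in>{..<?d}. alg.str l k j \<odot>\<^bsub>V\<^esub> S k x)"
      by (simp only: coord_h[OF j] S2[OF j l x])
    also have "\<dots> = (\<Sum>k<?d. V.coord p (alg.str l k j \<odot>\<^bsub>V\<^esub> S k x))" by (rule coord_finsum_M[OF p m])
    also have "\<dots> = (\<Sum>k<?d. V.coord p (S k x) * alg.str l k j)"
      using Sc x V.coord_smult[OF p] by (intro sum.cong refl) (simp add: mult.commute del: complex_space_simps(4))
    also have "\<dots> = alg.alg.coord j ((as ! l) \<otimes>\<^bsub>A\<^esub> h p x)"
      unfolding h_def by (rule alg.coord_mult_lc[OF l j, symmetric])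
    finally show "alg.alg.coord j (h p ((as ! l) \<odot> x)) = alg.alg.coord j ((as ! l) \<otimes>\<^bsub>A\<^esub> h p x)" .
  qed (use l hA in auto)
  have h_act: "h p (a \<odot> x) = a \<otimes>\<^bsub>A\<^esub> h p x" if p: "p < ?n" and a: "a \<in> carrier A" and x: "x \<in> carrier M" for p a x
  proof -
    let ?c = "\<lambda>l. alg.alg.coord l a"
    have m: "(\<lambda>l. (?c l \<odot>\<^bsub>A\<^esub> as ! l) \<odot> x) \<in> {..<?d} \<rightarrow> carrier M"
      using x by (auto intro!: mod.smult_closed)
    have aeq: "a = alg.alg.lc ?c" using alg.alg.lc_coord[OF a] by simp
    have "h p (a \<odot> x) = h p (\<Oplus>l\<in>{..<?d}. (?c l \<odot>\<^bsub>A\<^esub> as ! l) \<odot> x)"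
      by (subst aeq, subst act_finsum) (use x in auto)
    also have "\<dots> = (\<Oplus>\<^bsub>A\<^esub>l\<in>{..<?d}. h p ((?c l \<odot>\<^bsub>A\<^esub> as ! l) \<odot> x))"
      by (rule additive_finsum[OF mod.M.abelian_monoid_axioms alg.abelian_monoid_axioms])
        (use hA h_zero[OF p] h_add[OF p] m in auto)
    also have "\<dots> = (\<Oplus>\<^bsub>A\<^esub>l\<in>{..<?d}. (?c l \<odot>\<^bsub>A\<^esub> as ! l) \<otimes>\<^bsub>A\<^esub> h p x)"
    proof (rule alg.finsum_cong'[OF refl])
      fix l assume "l \<in> {..<?d}"
      then have l: "l < ?d" by simp
      have "h p ((?c l \<odot>\<^bsub>A\<^esub> as ! l) \<odot> x) = h p (?c l \<odot>\<^bsub>V\<^esub> ((as ! l) \<odot> x))"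
        using act_scalar(1)[of "as ! l" x "?c l"] l x by simp
      also have "\<dots> = ?c l \<odot>\<^bsub>A\<^esub> ((as ! l) \<otimes>\<^bsub>A\<^esub> h p x)"
        using h_smult[OF p, of "(as ! l) \<odot> x" "?c l"] h_basis[OF p l x] l x
        by (simp add: mod.smult_closed del: complex_space_simps(4))
      also have "\<dots> = (?c l \<odot>\<^bsub>A\<^esub> as ! l) \<otimes>\<^bsub>A\<^esub> h p x" using l hA by (intro alg.smult_mult) auto
      finally show "h p ((?c l \<odot>\<^bsub>A\<^esub> as ! l) \<odot> x) = (?c l \<odot>\<^bsub>A\<^esub> as ! l) \<otimes>\<^bsub>A\<^esub> h p x" .
    qed (use hA in auto)
    also have "\<dots> = alg.alg.lc ?c \<otimes>\<^bsub>A\<^esub> h p x"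
      by (rule alg.finsum_ldistr[symmetric]) (use hA in auto)
    finally show ?thesis using aeq by simp
  qed
  have h_sum: "(\<Oplus>p\<in>{..<?n}. h p x \<odot> bs ! p) = x" if x: "x \<in> carrier M" for x
  proof (rule V.coord_eqI)
    have m: "(\<lambda>p. h p x \<odot> bs ! p) \<in> {..<?n} \<rightarrow> carrier M" using hA by (auto intro!: mod.smult_closed)
    show "(\<Oplus>p\<in>{..<?n}. h p x \<odot> bs ! p) \<in> carrier V" using mod.M.finsum_closed[OF m] by simp
    show "x \<in> carrier V" using x by simp
    fix i assume i: "i < ?n"
    have "V.coord i (\<Oplus>p\<in>{..<?n}. h p x \<odot> bs ! p) = (\<Sum>p<?n. V.coord i (h p x \<odot> bs ! p))"
      by (rule coord_finsum_M[OF i m])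
    also have "\<dots> = (\<Sum>p<?n. \<Sum>k<?d. V.coord p (S k x) * action_matrix (as ! k) $$ (i, p))"
    proof (intro sum.cong refl)
      fix p assume "p \<in> {..<?n}"
      then have p: "p < ?n" by simp
      show "V.coord i (h p x \<odot> bs ! p) = (\<Sum>k<?d. V.coord p (S k x) * action_matrix (as ! k) $$ (i, p))"
        unfolding action_matrix_index[OF i p, symmetric] h_def by (rule action_matrix_lc[OF i p]) auto
    qed
    also have "\<dots> = (\<Sum>k<?d. V.coord i ((as ! k) \<odot> S k x))"
    proof (subst sum.swap, intro sum.cong refl)
      fix k assume "k \<in> {..<?d}"
      then have k: "k < ?d" by simp
      have "V.coord i ((as ! k) \<odot> S k x) = (action_matrix (as ! k) *\<^sub>v coords V bs (S k x)) $ i"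
        unfolding V.coord_def using coords_act[of "as ! k" "S k x"] k Sc x by simp
      also have "\<dots> = (\<Sum>p<?n. action_matrix (as ! k) $$ (i, p) * V.coord p (S k x))"
        using i V.dim_coords[of "S k x"] Sc[OF k x] carrier_matD[OF action_matrix_carrier[of "as ! k"]]
        by (auto simp: scalar_prod_def V.coord_def atLeast0LessThan intro!: sum.cong)
      finally show "(\<Sum>p<?n. V.coord p (S k x) * action_matrix (as ! k) $$ (i, p)) = V.coord i ((as ! k) \<odot> S k x)"
        by (simp add: mult.commute)
    qed
    also have "\<dots> = V.coord i (\<Oplus>k\<in>{..<?d}. (as ! k) \<odot> S k x)"
      using Sc x by (intro coord_finsum_M[OF i, symmetric]) (auto intro!: mod.smult_closed)
    finally show "V.coord i (\<Oplus>p\<in>{..<?n}. h p x \<odot> bs ! p) = V.coord i x" unfolding S1[OF x] .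
  qed
  have "\<forall>p. \<exists>a. p < ?n \<longrightarrow> coefficients T a \<and> bs ! p = combination T a"
    using gen bs_in_M unfolding spanned_def by blast
  then obtain g where g: "\<And>p. p < ?n \<Longrightarrow> coefficients T (g p)" "\<And>p. p < ?n \<Longrightarrow> bs ! p = combination T (g p)" by metis
  have gA: "g p t \<in> carrier A" "g p t \<in> flt.Pe (fst t)" if "p < ?n" "t \<in> T" for p t
    using coefficientsD[OF g(1)[OF that(1)] that(2)] by auto
  define f where "f t x = (\<Oplus>\<^bsub>A\<^esub>p\<in>{..<?n}. h p x \<otimes>\<^bsub>A\<^esub> g p t)" for t x
  show ?thesis
  proof (rule that[of f])
    fix t x assume t: "t \<in> T" and x: "x \<in> carrier M"
    show "f t x \<in> flt.Pe (fst t)" unfolding f_def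
      using t familyD[OF fT] gA hA by (intro flt.Pe_finsum flt.Pe_mult) auto
    fix y assume y: "y \<in> carrier M"
    have "f t (x \<oplus> y) = (\<Oplus>\<^bsub>A\<^esub>p\<in>{..<?n}. h p x \<otimes>\<^bsub>A\<^esub> g p t \<oplus>\<^bsub>A\<^esub> h p y \<otimes>\<^bsub>A\<^esub> g p t)"
      unfolding f_def using t x y hA gA by (intro alg.finsum_cong') (auto simp: h_add alg.l_distr)
    then show "f t (x \<oplus> y) = f t x \<oplus>\<^bsub>A\<^esub> f t y"
      unfolding f_def using t hA gA by (subst (asm) alg.finsum_addf) auto
  next
    fix t x a assume t: "t \<in> T" and x: "x \<in> carrier M" and a: "a \<in> carrier A"
    have "f t (a \<odot> x) = (\<Oplus>\<^bsub>A\<^esub>p\<in>{..<?n}. a \<otimes>\<^bsub>A\<^esub> (h p x \<otimes>\<^bsub>A\<^esub> g p t))"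
      unfolding f_def using t x a hA gA by (intro alg.finsum_cong') (auto simp: h_act alg.m_assoc)
    then show "f t (a \<odot> x) = a \<otimes>\<^bsub>A\<^esub> f t x"
      unfolding f_def using t a hA gA by (subst alg.finsum_rdistr) auto
  next
    fix x assume x: "x \<in> carrier M"
    have xt: "snd t \<in> carrier M" if "t \<in> T" for t using familyD[OF fT] that by auto
    have "combination T (\<lambda>t. f t x) = (\<Oplus>t\<in>T. \<Oplus>p\<in>{..<?n}. h p x \<odot> (g p t \<odot> snd t))"
      unfolding combination_def
    proof (rule mod.M.finsum_cong'[OF refl])
      fix t assume t: "t \<in> T"
      have "f t x \<odot> snd t = (\<Oplus>p\<in>{..<?n}. (h p x \<otimes>\<^bsub>A\<^esub> g p t) \<odot> snd t)"
        unfolding f_def using t hA gA xt by (intro act_finsum) auto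
      also have "\<dots> = (\<Oplus>p\<in>{..<?n}. h p x \<odot> (g p t \<odot> snd t))"
        using t hA gA(1) xt by (intro mod.M.finsum_cong' refl funcsetI) (simp_all add: mod.smult_assoc1 mod.smult_closed)
      finally show "f t x \<odot> snd t = (\<Oplus>p\<in>{..<?n}. h p x \<odot> (g p t \<odot> snd t))" .
    qed (use hA gA xt in \<open>auto intro!: mod.M.finsum_closed mod.smult_closed\<close>)
    also have "\<dots> = (\<Oplus>p\<in>{..<?n}. \<Oplus>t\<in>T. h p x \<odot> (g p t \<odot> snd t))"
      using familyD(1)[OF fT] hA gA xt by (intro mod.M.finsum_swap) (auto intro!: mod.smult_closed)
    also have "\<dots> = (\<Oplus>p\<in>{..<?n}. h p x \<odot> bs ! p)"
    proof (rule mod.M.finsum_cong'[OF refl])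
      fix p assume "p \<in> {..<?n}"
      then have p: "p < ?n" by simp
      show "(\<Oplus>t\<in>T. h p x \<odot> (g p t \<odot> snd t)) = h p x \<odot> bs ! p"
        unfolding g(2)[OF p] combination_def
        by (rule act_finsum_right[symmetric]) (use combination_terms[OF fT g(1)[OF p]] hA in auto)
    qed (use hA in \<open>auto intro!: mod.smult_closed\<close>)
    finally show "combination T (\<lambda>t. f t x) = x" using h_sum[OF x] by simp
  qed
qed

text \<open>For each \<open>s\<close> the coefficients \<open>f\<^sub>t(e\<^sub>s x\<^sub>s) - \<delta>\<^sub>s\<^sub>t e\<^sub>s\<close> form a relation, so they lie in the radical. Applying
\<open>f\<^sub>t\<close> to the given relation expresses \<open>a\<^sub>t\<close> as a combination of the \<open>a\<^sub>s\<close> with these coefficients, hence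
all \<open>a\<^sub>t\<close> lie in every power of the radical.\<close>

lemma minimal_family_free:
  assumes spl: "splits (length as) alg.str (length bs) (\<lambda>k. action_matrix (as ! k))"
    and T: "minimal T" and a: "coefficients T a" and rel: "combination T a = \<zero>" and t: "t \<in> T"
  shows "a t = \<zero>\<^bsub>A\<^esub>"
proof -
  have fT: "family T" and gen: "spanned T = carrier M" using T by (auto simp: minimal_def)
  obtain f where f1: "\<And>t x. t \<in> T \<Longrightarrow> x \<in> carrier M \<Longrightarrow> f t x \<in> flt.Pe (fst t)"
    and f2: "\<And>t x y. t \<in> T \<Longrightarrow> x \<in> carrier M \<Longrightarrow> y \<in> carrier M \<Longrightarrow> f t (x \<oplus> y) = f t x \<oplus>\<^bsub>A\<^esub> f t y"
    and f3: "\<And>t x a. t \<in> T \<Longrightarrow> x \<in> carrier M \<Longrightarrow> a \<in> carrier A \<Longrightarrow> f t (a \<odot> x) = a \<otimes>\<^bsub>A\<^esub> f t x"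
    and f4: "\<And>x. x \<in> carrier M \<Longrightarrow> combination T (\<lambda>t. f t x) = x"
    by (rule dual_family[OF spl fT gen]) (rule that)
  have xs: "snd s \<in> carrier M" and es: "e (fst s) \<in> carrier A" and vs: "fst s \<in> V0" if "s \<in> T" for s
    using familyD[OF fT] that by auto
  have fA: "f t x \<in> carrier A" if "t \<in> T" "x \<in> carrier M" for t x using f1[OF that] by (rule flt.Pe_in)
  \<comment> \<open>This makes \<open>f t (e s x s) + \<delta> s t\<close> the relation that expresses \<open>e s x s\<close> by itself.\<close>
  define \<delta> where "\<delta> s t = (if t = s then \<ominus>\<^bsub>A\<^esub> e (fst s) else \<zero>\<^bsub>A\<^esub>)" for s t :: "'i \<times> 'm"
  define n where "n s t = e (fst s) \<otimes>\<^bsub>A\<^esub> f t (snd s) \<oplus>\<^bsub>A\<^esub> \<delta> s t" for s t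
  have dA: "\<delta> s t \<in> carrier A" if "s \<in> T" for s t unfolding \<delta>_def using es[OF that] by simp
  have nF: "n s t \<in> F 1" if s: "s \<in> T" and t: "t \<in> T" for s t
  proof (rule minimal_relation[OF T _ _ t])
    have c1: "coefficients T (\<lambda>t. f t (snd s))" unfolding coefficients_def using f1 xs[OF s] by simp
    note act = combination_act[OF fT c1 es[OF s]]
    have mem: "\<ominus>\<^bsub>A\<^esub> e (fst s) \<in> flt.Pe (fst s)" using vs[OF s] by (intro flt.Pe_minus flt.Pe_e)
    note single = combination_single[OF fT s mem, folded \<delta>_def]
    note add = combination_add[OF fT act(2) single(2), folded n_def]
    show "coefficients T (n s)" by (rule add(2))
    have "combination T (n s) = e (fst s) \<odot> snd s \<oplus> (\<ominus>\<^bsub>A\<^esub> e (fst s)) \<odot> snd s"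
      using add(1) act(1) single(1) f4[OF xs[OF s]] by simp
    also have "\<dots> = (e (fst s) \<oplus>\<^bsub>A\<^esub> \<ominus>\<^bsub>A\<^esub> e (fst s)) \<odot> snd s"
      using es[OF s] xs[OF s] by (simp add: mod.smult_l_distr)
    finally show "combination T (n s) = \<zero>" using es[OF s] xs[OF s] by (simp add: alg.r_neg act_zero)
  qed
  have key: "a t = \<ominus>\<^bsub>A\<^esub> (\<Oplus>\<^bsub>A\<^esub>s\<in>T. a s \<otimes>\<^bsub>A\<^esub> n s t)" if t: "t \<in> T" for t
  proof -
    have aA: "a s \<in> carrier A" "a s \<otimes>\<^bsub>A\<^esub> e (fst s) = a s" if "s \<in> T" for s
      using coefficientsD[OF a that] flt.Pe_mult_e by auto
    have f0: "f t \<zero> = \<zero>\<^bsub>A\<^esub>"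
      using f3[OF t, of "\<zero>" "\<zero>\<^bsub>A\<^esub>"] fA[OF t, of "\<zero>"] act_zero[of "\<zero>"] by simp
    have "(\<Oplus>\<^bsub>A\<^esub>s\<in>T. a s \<otimes>\<^bsub>A\<^esub> n s t) = (\<Oplus>\<^bsub>A\<^esub>s\<in>T. f t (a s \<odot> snd s) \<oplus>\<^bsub>A\<^esub> (if t = s then \<ominus>\<^bsub>A\<^esub> a s else \<zero>\<^bsub>A\<^esub>))"
    proof (rule alg.finsum_cong'[OF refl])
      fix s assume s: "s \<in> T"
      have "a s \<otimes>\<^bsub>A\<^esub> n s t = (a s \<otimes>\<^bsub>A\<^esub> e (fst s)) \<otimes>\<^bsub>A\<^esub> f t (snd s) \<oplus>\<^bsub>A\<^esub> a s \<otimes>\<^bsub>A\<^esub> \<delta> s t"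
        unfolding n_def using aA(1)[OF s] es[OF s] fA[OF t xs[OF s]] dA[OF s]
        by (simp add: alg.r_distr alg.m_assoc)
      also have "a s \<otimes>\<^bsub>A\<^esub> \<delta> s t = (if t = s then \<ominus>\<^bsub>A\<^esub> a s else \<zero>\<^bsub>A\<^esub>)"
        unfolding \<delta>_def using aA[OF s] es[OF s] by (simp add: alg.r_minus)
      finally show "a s \<otimes>\<^bsub>A\<^esub> n s t = f t (a s \<odot> snd s) \<oplus>\<^bsub>A\<^esub> (if t = s then \<ominus>\<^bsub>A\<^esub> a s else \<zero>\<^bsub>A\<^esub>)"
        using f3[OF t xs[OF s] aA(1)[OF s]] aA(2)[OF s] by simp
    qed (rule funcsetI, use aA fA[OF t] xs t in \<open>simp add: mod.smult_closed\<close>)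
    also have "\<dots> = (\<Oplus>\<^bsub>A\<^esub>s\<in>T. f t (a s \<odot> snd s)) \<oplus>\<^bsub>A\<^esub> (\<Oplus>\<^bsub>A\<^esub>s\<in>T. if t = s then \<ominus>\<^bsub>A\<^esub> a s else \<zero>\<^bsub>A\<^esub>)"
      by (rule alg.finsum_addf; rule funcsetI) (use aA fA[OF t] xs in \<open>simp_all add: mod.smult_closed\<close>)
    also have "(\<Oplus>\<^bsub>A\<^esub>s\<in>T. if t = s then \<ominus>\<^bsub>A\<^esub> a s else \<zero>\<^bsub>A\<^esub>) = \<ominus>\<^bsub>A\<^esub> a t"
      using t familyD(1)[OF fT] aA by (intro alg.finsum_singleton) auto
    also have "(\<Oplus>\<^bsub>A\<^esub>s\<in>T. f t (a s \<odot> snd s)) = f t (combination T a)"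
      unfolding combination_def
      by (rule additive_finsum[symmetric, OF mod.M.abelian_monoid_axioms alg.abelian_monoid_axioms])
        (use fA[OF t] f0 f2[OF t] combination_terms[OF fT a] in auto)
    finally show ?thesis using aA(1)[OF t] by (simp add: rel f0)
  qed
  have "\<forall>t\<in>T. a t \<in> F k" for k
  proof (induction k)
    case 0
    then show ?case using coefficientsD[OF a] by (simp add: flt.F_0)
  next
    case (Suc k)
    show ?case
    proof
      fix t assume t: "t \<in> T"
      have "\<ominus>\<^bsub>A\<^esub> (\<Oplus>\<^bsub>A\<^esub>s\<in>T. a s \<otimes>\<^bsub>A\<^esub> n s t) \<in> F (Suc k)"
        using Suc nF t by (intro flt.F_minus flt.F_finsum flt.F_mult) auto
      then show "a t \<in> F (Suc k)" using key[OF t] by simp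
    qed
  qed
  then show ?thesis using flt.F_nilpotent t by blast
qed

end

lemma projective_at_simps [simp]:
  "carrier (projective_at A e) = (\<lambda>x. x \<otimes>\<^bsub>A\<^esub> e) ` carrier A" "zero (projective_at A e) = zero A"
  "add (projective_at A e) = add A" "smult (projective_at A e) = mult A"
  by (simp_all add: projective_at_def)

context filtered_algebra
begin

lemma projective_carrier: "v \<in> V0 \<Longrightarrow> carrier (projective_at A (e v)) = Pe v"
  by (simp add: Pe_image)

lemma left_module_projective:
  assumes v: "v \<in> V0"
  shows "left_module A (projective_at A (e v))"
proof -
  have "abelian_group (projective_at A (e v))"
  proof (rule abelian_groupI)
    fix x assume "x \<in> carrier (projective_at A (e v))"
    then have x: "x \<in> Pe v" using projective_carrier[OF v] by simp
    then show "\<exists>y\<in>carrier (projective_at A (e v)). y \<oplus>\<^bsub>projective_at A (e v)\<^esub> x = \<zero>\<^bsub>projective_at A (e v)\<^esub>"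
      unfolding projective_carrier[OF v] by (intro bexI[of _ "\<ominus> x"]) (auto simp: Pe_in l_neg Pe_minus v)
  qed (use v in \<open>unfold projective_carrier[OF v], auto simp: Pe_in a_ac Pe_add Pe_zero\<close>)
  then show ?thesis
    by (intro left_module.intro left_module_axioms.intro ring_axioms)
      (use v in \<open>unfold projective_carrier[OF v], auto simp: Pe_in Pe_mult l_distr r_distr m_assoc\<close>)
qed

lemma based_module_projective:
  assumes v: "v \<in> V0" and "based_space (complex_space A (projective_at A (e v))) ps"
  shows "based_module A as (projective_at A (e v)) ps"
  by (intro based_module.intro algebra_module.intro left_module_projective[OF v] assms(2)) (rule based_algebra_axioms)

text \<open>For \<open>A e\<^sub>v\<close> the section of the action map is \<open>x \<mapsto> x \<otimes> e\<^sub>v\<close>, that is, \<open>T\<^sub>k x\<close> is the \<open>k\<close>-th coordinate of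
\<open>x\<close> times \<open>e\<^sub>v\<close>.\<close>

lemma projective_splits:
  assumes v: "v \<in> V0" and "based_space (complex_space A (projective_at A (e v))) ps"
  shows "splits (length as) str (length ps)
    (\<lambda>k. matrix_of (complex_space A (projective_at A (e v))) ps (representation (projective_at A (e v)) (as ! k)))"
proof -
  let ?P = "projective_at A (e v)"
  interpret P: based_module A as ?P ps by (rule based_module_projective[OF assms])
  have sm: "c \<odot>\<^bsub>complex_space A ?P\<^esub> x = c \<odot> x" if "x \<in> carrier A" for c x
    using scalar_mult[OF that] by simp
  show ?thesis unfolding P.action_matrix_representation
  proof (rule P.splits_if_endos[of "\<lambda>k x. alg.coord k x \<odot> e v"])
    fix k assume k: "k < length as"
    show "(\<lambda>x. alg.coord k x \<odot> e v) \<in> module_hom class_ring P.V P.V"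
      unfolding module_hom_def
    proof (intro CollectI conjI allI impI funcsetI; (elim conjE)?)
      fix x y assume x: "x \<in> carrier P.V" and y: "y \<in> carrier P.V"
      then have xy: "x \<in> carrier A" "y \<in> carrier A" using projective_carrier[OF v] by (auto simp: Pe_in)
      show "alg.coord k x \<odot> e v \<in> carrier P.V"
        using Pe_smult[OF v Pe_e[OF v]] projective_carrier[OF v] by simp
      show "alg.coord k (x \<oplus>\<^bsub>P.V\<^esub> y) \<odot> e v = alg.coord k x \<odot> e v \<oplus>\<^bsub>P.V\<^esub> alg.coord k y \<odot> e v"
        using xy v k alg.complex_module(3)[of "e v"] by (simp add: alg.coord_add)
      fix c :: complex
      show "alg.coord k (c \<odot>\<^bsub>P.V\<^esub> x) \<odot> e v = c \<odot>\<^bsub>P.V\<^esub> (alg.coord k x \<odot> e v)"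
        using xy v k alg.complex_module(2)[of "e v"] sm alg.coord_smult
        by (simp del: complex_space_simps(4))
    qed
  next
    fix x assume "x \<in> carrier ?P"
    then have x: "x \<in> carrier A" "x \<otimes> e v = x" using projective_carrier[OF v] by (auto simp: Pe_def)
    have m: "(\<lambda>k. (as ! k) \<otimes> (alg.coord k x \<odot> e v)) \<in> {..<length as} \<rightarrow> carrier ?P"
      unfolding projective_carrier[OF v] using v by (auto intro!: Pe_mult Pe_smult Pe_e)
    have "(\<Oplus>\<^bsub>?P\<^esub>k\<in>{..<length as}. (as ! k) \<odot>\<^bsub>?P\<^esub> (alg.coord k x \<odot> e v)) =
        (\<Oplus>k\<in>{..<length as}. (as ! k) \<otimes> (alg.coord k x \<odot> e v))"
      unfolding projective_at_simps
      by (rule additive_finsum[OF P.mod.M.abelian_monoid_axioms abelian_monoid_axioms, where h = "\<lambda>x. x"])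
        (use m projective_carrier[OF v] in \<open>auto simp: Pe_in\<close>)
    also have "\<dots> = (\<Oplus>k\<in>{..<length as}. (alg.coord k x \<odot> (as ! k)) \<otimes> e v)"
      using v by (intro finsum_cong') (auto simp: mult_smult[symmetric] smult_mult)
    also have "\<dots> = alg.lc (\<lambda>k. alg.coord k x) \<otimes> e v"
      using v by (intro finsum_ldistr[symmetric]) auto
    finally show "(\<Oplus>\<^bsub>?P\<^esub>k\<in>{..<length as}. (as ! k) \<odot>\<^bsub>?P\<^esub> (alg.coord k x \<odot> e v)) = x"
      using x by (simp add: alg.lc_coord)
  next
    fix j l x assume j: "j < length as" and l: "l < length as" and "x \<in> carrier ?P"
    then have x: "x \<in> carrier A" using projective_carrier[OF v] by (auto simp: Pe_def)
    have m: "(\<lambda>k. str l k j \<odot>\<^bsub>P.V\<^esub> (alg.coord k x \<odot> e v)) \<in> {..<length as} \<rightarrow> carrier ?P"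
      unfolding projective_carrier[OF v] using v sm by (auto intro!: Pe_mult Pe_smult Pe_e)
    have "(\<Oplus>\<^bsub>?P\<^esub>k\<in>{..<length as}. str l k j \<odot>\<^bsub>P.V\<^esub> (alg.coord k x \<odot> e v)) =
        (\<Oplus>k\<in>{..<length as}. str l k j \<odot>\<^bsub>P.V\<^esub> (alg.coord k x \<odot> e v))"
      by (rule additive_finsum[OF P.mod.M.abelian_monoid_axioms abelian_monoid_axioms _ _ _ m, where h = "\<lambda>x. x"])
        (use projective_carrier[OF v] in \<open>auto simp: Pe_in\<close>)
    also have "\<dots> = (\<Oplus>k\<in>{..<length as}. (alg.coord k x * str l k j) \<odot> e v)"
      using v sm by (intro finsum_cong') (auto simp: alg.complex_module(2)[of "e v", symmetric] mult.commute simp del: complex_space_simps(4))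
    also have "\<dots> = (\<Sum>k<length as. alg.coord k x * str l k j) \<odot> e v"
      by (rule additive_finsum[symmetric, of class_ring A "\<lambda>c. c \<odot> e v" "\<lambda>k. alg.coord k x * str l k j" "{..<length as}", unfolded class_ring_simps])
        (use v alg.complex_module[of "e v"] abelian_monoid_axioms alg.R.abelian_monoid_axioms in auto)
    also have "(\<Sum>k<length as. alg.coord k x * str l k j) = alg.coord j ((as ! l) \<otimes> x)"
      using coord_mult_lc[OF l j, of "\<lambda>k. alg.coord k x"] alg.lc_coord[OF x] by simp
    finally show "alg.coord j ((as ! l) \<odot>\<^bsub>?P\<^esub> x) \<odot> e v =
        (\<Oplus>\<^bsub>?P\<^esub>k\<in>{..<length as}. str l k j \<odot>\<^bsub>P.V\<^esub> (alg.coord k x \<odot> e v))" by simp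
  qed
qed

end

text \<open>The list of vertices with multiplicities that indexes the diagonal blocks.\<close>

definition multiset_list :: "'i list \<Rightarrow> ('i \<Rightarrow> nat) \<Rightarrow> 'i list" where
  "multiset_list vs m = concat (map (\<lambda>v. replicate (m v) v) vs)"

locale decomposition_bases = decomposition A as M bs V0 e F
  for A :: "(complex, 'r, 'y) module_scheme" and as :: "'r list"
    and M :: "('r, 'm, 'z) module_scheme" (structure) and bs :: "'m list"
    and V0 :: "'i set" and e :: "'i \<Rightarrow> 'r" and F :: "nat \<Rightarrow> 'r set" +
  fixes Pb :: "'i \<Rightarrow> 'r list"
  assumes Pb: "v \<in> V0 \<Longrightarrow> based_space (complex_space A (projective_at A (e v))) (Pb v)"
begin

abbreviation "VP v \<equiv> complex_space A (projective_at A (e v))"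
abbreviation "L v k \<equiv> matrix_of (VP v) (Pb v) (representation (projective_at A (e v)) (as ! k))"

text \<open>The matrix of the module map \<open>P(v) \<rightarrow> M\<close>, \<open>y \<mapsto> y x\<close>, belonging to the generator \<open>t = (v, x)\<close>.\<close>

definition generator_matrix :: "'i \<times> 'm \<Rightarrow> complex mat" where
  "generator_matrix t = Matrix.mat (length bs) (length (Pb (fst t))) (\<lambda>(i, j). V.coord i ((Pb (fst t) ! j) \<odot> snd t))"

lemma generator_matrix_carrier: "generator_matrix t \<in> carrier_mat (length bs) (length (Pb (fst t)))"
  by (simp add: generator_matrix_def)

lemma Pb_Pe: "v \<in> V0 \<Longrightarrow> j < length (Pb v) \<Longrightarrow> Pb v ! j \<in> flt.Pe v"
  using based_space.bs_closed[OF Pb] flt.projective_carrier by simp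

lemma generator_matrix_mult:
  assumes v: "fst t \<in> V0" and x: "snd t \<in> carrier M" and y: "y \<in> flt.Pe (fst t)"
  shows "coords V bs (y \<odot> snd t) = generator_matrix t *\<^sub>v coords (VP (fst t)) (Pb (fst t)) y"
proof (rule eq_vecI)
  let ?v = "fst t"
  interpret P: based_module A as "projective_at A (e ?v)" "Pb ?v"
    by (rule flt.based_module_projective[OF v Pb[OF v]])
  have yP: "y \<in> carrier P.V" using y flt.projective_carrier[OF v] by simp
  have yM: "y \<odot> snd t \<in> carrier V" using y x by (simp add: mod.smult_closed flt.Pe_in)
  have hom: "(\<lambda>y. y \<odot> snd t) \<in> module_hom class_ring P.V V"
    unfolding module_hom_def using x flt.projective_carrier[OF v]
    by (auto simp: mod.smult_closed flt.Pe_in mod.smult_l_distr mod.smult_assoc1)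
  show "dim_vec (coords V bs (y \<odot> snd t)) = dim_vec (generator_matrix t *\<^sub>v coords P.V (Pb ?v) y)"
    using yM by (simp add: generator_matrix_def)
  fix i assume "i < dim_vec (generator_matrix t *\<^sub>v coords P.V (Pb ?v) y)"
  then have i: "i < length bs" by (simp add: generator_matrix_def)
  have bM: "(Pb ?v ! j) \<odot> snd t \<in> carrier V" if "j < length (Pb ?v)" for j
    using Pb_Pe[OF v that] x by (simp add: mod.smult_closed flt.Pe_in)
  have "V.coord i (y \<odot> snd t) = V.coord i (P.V.lc (\<lambda>j. P.V.coord j y) \<odot> snd t)"
    using P.V.lc_coord[OF yP] by simp
  also have "\<dots> = V.coord i (\<Oplus>\<^bsub>V\<^esub>j\<in>{..<length (Pb ?v)}. P.V.coord j y \<odot>\<^bsub>V\<^esub> ((Pb ?v ! j) \<odot> snd t))"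
    by (subst P.V.linear_lc[OF hom V.module_axioms]) (rule refl)
  also have "\<dots> = (\<Sum>j<length (Pb ?v). V.coord i (P.V.coord j y \<odot>\<^bsub>V\<^esub> ((Pb ?v ! j) \<odot> snd t)))"
    using bM V.smult_c by (intro V.coord_finsum[OF i]) blast
  also have "\<dots> = (\<Sum>j<length (Pb ?v). P.V.coord j y * V.coord i ((Pb ?v ! j) \<odot> snd t))"
    by (intro sum.cong refl V.coord_smult[OF i] bM) simp
  finally show "coords V bs (y \<odot> snd t) $ i = (generator_matrix t *\<^sub>v coords P.V (Pb ?v) y) $ i"
    using i yP by (simp add: generator_matrix_def scalar_prod_def V.coord_def P.V.coord_def atLeast0LessThan mult.commute)
qed

lemma generator_matrix_intertwines:
  assumes v: "fst t \<in> V0" and x: "snd t \<in> carrier M" and k: "k < length as"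
  shows "action_matrix (as ! k) * generator_matrix t = generator_matrix t * L (fst t) k"
proof (rule mat_col_eqI)
  let ?v = "fst t"
  interpret P: based_module A as "projective_at A (e ?v)" "Pb ?v"
    by (rule flt.based_module_projective[OF v Pb[OF v]])
  have LP: "L ?v k = P.action_matrix (as ! k)" by (rule P.action_matrix_representation)
  have Lc: "L ?v k \<in> carrier_mat (length (Pb ?v)) (length (Pb ?v))" unfolding LP by simp
  fix j assume "j < dim_col (generator_matrix t * L ?v k)"
  then have j: "j < length (Pb ?v)" using Lc by simp
  have b: "Pb ?v ! j \<in> flt.Pe ?v" by (rule Pb_Pe[OF v j])
  have bP: "Pb ?v ! j \<in> carrier (projective_at A (e ?v))" using b flt.projective_carrier[OF v] by simp
  have ab: "(as ! k) \<otimes>\<^bsub>A\<^esub> (Pb ?v ! j) \<in> flt.Pe ?v" using b k v by (intro flt.Pe_mult) auto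
  have colH: "col (generator_matrix t) j = coords V bs ((Pb ?v ! j) \<odot> snd t)"
    using j x b by (intro eq_vecI) (auto simp: generator_matrix_def V.coord_def mod.smult_closed flt.Pe_in)
  have colL: "col (P.action_matrix (as ! k)) j = coords P.V (Pb ?v) ((as ! k) \<otimes>\<^bsub>A\<^esub> (Pb ?v ! j))"
    using j P.V.dim_coords[of "(as ! k) \<otimes>\<^bsub>A\<^esub> (Pb ?v ! j)"] ab flt.projective_carrier[OF v]
    by (intro eq_vecI) (auto simp: P.action_matrix_def matrix_of_def)
  have "col (action_matrix (as ! k) * generator_matrix t) j = action_matrix (as ! k) *\<^sub>v col (generator_matrix t) j"
    using col_mult2[OF action_matrix_carrier generator_matrix_carrier j] .
  also have "\<dots> = coords V bs ((as ! k) \<odot> ((Pb ?v ! j) \<odot> snd t))"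
    unfolding colH using k x b by (intro coords_act[symmetric]) (auto simp: mod.smult_closed flt.Pe_in)
  also have "\<dots> = coords V bs (((as ! k) \<otimes>\<^bsub>A\<^esub> (Pb ?v ! j)) \<odot> snd t)"
    using k x b by (simp add: mod.smult_assoc1 flt.Pe_in)
  also have "\<dots> = generator_matrix t *\<^sub>v col (L ?v k) j"
    unfolding LP colL by (rule generator_matrix_mult[OF v x ab])
  also have "\<dots> = col (generator_matrix t * L ?v k) j" using col_mult2[OF generator_matrix_carrier Lc j] by simp
  finally show "col (action_matrix (as ! k) * generator_matrix t) j = col (generator_matrix t * L ?v k) j" .
next
  have Lc: "L (fst t) k \<in> carrier_mat (length (Pb (fst t))) (length (Pb (fst t)))"
    by (rule based_space.dim_matrix_of[OF Pb[OF v]])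
  show "dim_row (action_matrix (as ! k) * generator_matrix t) = dim_row (generator_matrix t * L (fst t) k)"
    using carrier_matD(1)[OF action_matrix_carrier] carrier_matD(1)[OF generator_matrix_carrier[of t]] by simp
  show "dim_col (action_matrix (as ! k) * generator_matrix t) = dim_col (generator_matrix t * L (fst t) k)"
    using carrier_matD(2)[OF Lc] carrier_matD(2)[OF generator_matrix_carrier[of t]] by simp
qed

lemma hcat_generators_intertwine:
  assumes t: "\<And>t. t \<in> set ps \<Longrightarrow> fst t \<in> V0" "\<And>t. t \<in> set ps \<Longrightarrow> snd t \<in> carrier M" and k: "k < length as"
  shows "action_matrix (as ! k) * hcat (length bs) (map generator_matrix ps) =
    hcat (length bs) (map generator_matrix ps) * diag_block_mat (map (\<lambda>t. L (fst t) k) ps)"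
proof -
  define l where "l t = length (Pb (fst t))" for t :: "'i \<times> 'm"
  define K where "K t = L (fst t) k" for t :: "'i \<times> 'm"
  have 1: "generator_matrix s \<in> carrier_mat (length bs) (l s)" if "s \<in> set ps" for s unfolding l_def by (rule generator_matrix_carrier)
  have 2: "K s \<in> carrier_mat (l s) (l s)" if "s \<in> set ps" for s
    unfolding l_def K_def by (rule based_space.dim_matrix_of[OF Pb[OF t(1)[OF that]]])
  have 3: "action_matrix (as ! k) * generator_matrix s = generator_matrix s * K s" if "s \<in> set ps" for s
    unfolding K_def by (rule generator_matrix_intertwines[OF t(1)[OF that] t(2)[OF that] k])
  have "action_matrix (as ! k) * hcat (length bs) (map generator_matrix ps) = hcat (length bs) (map generator_matrix ps) * diag_block_mat (map K ps)"
    by (rule hcat_intertwines[OF action_matrix_carrier 1 2 3])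
  then show ?thesis unfolding K_def .
qed

text \<open>The map from the direct sum of the \<open>P(v)\<close> to \<open>M\<close> is surjective because the family generates, and
injective because it is free.\<close>

lemma family_matrix:
  assumes spl: "splits (length as) alg.str (length bs) (\<lambda>k. action_matrix (as ! k))"
    and T: "minimal T" and ps: "distinct ps" "set ps = T"
  defines "H \<equiv> hcat (length bs) (map generator_matrix ps)"
  shows "sum_list (map (\<lambda>t. length (Pb (fst t))) ps) = length bs"
    and "H \<in> carrier_mat (length bs) (length bs)"
    and "\<exists>G\<in>carrier_mat (length bs) (length bs). H * G = 1\<^sub>m (length bs) \<and> G * H = 1\<^sub>m (length bs)"
proof -
  let ?n = "length bs" and ?l = "\<lambda>t :: 'i \<times> 'm. length (Pb (fst t))"
  let ?N = "sum_list (map ?l ps)"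
  have fT: "family T" and gen: "spanned T = carrier M" using T by (auto simp: minimal_def)
  have t: "fst t \<in> V0" "snd t \<in> carrier M" if "t \<in> set ps" for t using familyD[OF fT] that ps by auto
  have HN: "H \<in> carrier_mat ?n ?N" unfolding H_def by (rule hcat_carrier) (rule generator_matrix_carrier)
  define enc where "enc a t = coords (VP (fst t)) (Pb (fst t)) (a t)" for a and t :: "'i \<times> 'm"
  have Pc: "y \<in> carrier (VP (fst t)) \<longleftrightarrow> y \<in> flt.Pe (fst t)" if "t \<in> set ps" for t y
    using flt.projective_carrier[OF t(1)[OF that]] by simp
  have enc_c: "enc a s \<in> carrier_vec (?l s)" if "coefficients T a" "s \<in> set ps" for a s
    unfolding enc_def using based_space.coords_carrier[OF Pb[OF t(1)[OF that(2)]]] Pc[OF that(2)] coefficientsD(2)[OF that(1)] that(2) ps by simp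
  have H_enc: "H *\<^sub>v vcat (map (enc a) ps) = coords V bs (combination T a)" if a: "coefficients T a" for a
  proof (rule eq_vecI)
    have cM: "combination T a \<in> carrier V" using combination_closed[OF fT a] by simp
    show "dim_vec (H *\<^sub>v vcat (map (enc a) ps)) = dim_vec (coords V bs (combination T a))"
      using HN cM by simp
    fix i assume "i < dim_vec (coords V bs (combination T a))"
    then have i: "i < ?n" using cM by simp
    have "(H *\<^sub>v vcat (map (enc a) ps)) $ i = (\<Sum>s\<leftarrow>ps. (generator_matrix s *\<^sub>v enc a s) $ i)"
      unfolding H_def using hcat_mult_vcat[of ps generator_matrix ?n ?l "enc a" i] generator_matrix_carrier enc_c[OF a] i by blast
    also have "\<dots> = (\<Sum>s\<leftarrow>ps. V.coord i (a s \<odot> snd s))"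
    proof (intro arg_cong[of _ _ sum_list] map_cong refl)
      fix s assume s: "s \<in> set ps"
      have "a s \<in> flt.Pe (fst s)" using coefficientsD(2)[OF a] s ps by simp
      then show "(generator_matrix s *\<^sub>v enc a s) $ i = V.coord i (a s \<odot> snd s)"
        unfolding enc_def V.coord_def using generator_matrix_mult[OF t[OF s]] by simp
    qed
    also have "\<dots> = (\<Sum>s\<in>T. V.coord i (a s \<odot> snd s))"
      using ps by (simp add: sum_list_distinct_conv_sum_set)
    also have "\<dots> = V.coord i (combination T a)"
      unfolding combination_def by (rule coord_finsum_M[OF i combination_terms[OF fT a], symmetric])
    finally show "(H *\<^sub>v vcat (map (enc a) ps)) $ i = coords V bs (combination T a) $ i" by (simp add: V.coord_def)
  qed
  have surj: "\<exists>z\<in>carrier_vec ?N. H *\<^sub>v z = y" if y: "y \<in> carrier_vec ?n" for y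
  proof -
    let ?x = "V.lc (\<lambda>i. y $ i)"
    have "?x \<in> carrier M" using V.lc_closed by simp
    then obtain a where a: "coefficients T a" "?x = combination T a" using gen by (auto simp: spanned_def)
    have "coords V bs ?x = y" using V.coords_eqI[OF y refl] .
    then have "H *\<^sub>v vcat (map (enc a) ps) = y" using H_enc[OF a(1)] a(2) by simp
    moreover have "vcat (map (enc a) ps) \<in> carrier_vec ?N" by (rule vcat_carrier) (rule enc_c[OF a(1)])
    ultimately show ?thesis by blast
  qed
  have inj: "z = 0\<^sub>v ?N" if z: "z \<in> carrier_vec ?N" and Hz: "H *\<^sub>v z = 0\<^sub>v ?n" for z
  proof -
    obtain w where w: "\<forall>s\<in>set ps. w s \<in> carrier_vec (?l s)" "z = vcat (map w ps)"
      using vcat_cases[OF z ps(1)] by blast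
    define a where "a s = (\<Oplus>\<^bsub>VP (fst s)\<^esub> j \<in> {..<?l s}. w s $ j \<odot>\<^bsub>VP (fst s)\<^esub> (Pb (fst s) ! j))" for s
    have "a s \<in> carrier (VP (fst s))" if "s \<in> set ps" for s
      unfolding a_def by (rule based_space.lc_closed[OF Pb[OF t(1)[OF that]]])
    then have ca: "coefficients T a" unfolding coefficients_def using Pc ps by blast
    have encw: "enc a s = w s" if "s \<in> set ps" for s
      unfolding enc_def a_def by (rule based_space.coords_eqI[OF Pb[OF t(1)[OF that]]]) (use w that in auto)
    have wenc: "map w ps = map (enc a) ps" using encw by simp
    have "coords V bs (combination T a) = 0\<^sub>v ?n" using H_enc[OF ca] Hz unfolding w(2) wenc by simp
    then have "combination T a = \<zero>" using V.coords_inj[of "combination T a" "\<zero>"] V.coords_zero combination_closed[OF fT ca] by simp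
    then have a0: "a s = \<zero>\<^bsub>A\<^esub>" if "s \<in> set ps" for s
      using minimal_family_free[OF spl T ca] that ps by simp
    have "w s = 0\<^sub>v (?l s)" if s: "s \<in> set ps" for s
      using encw[OF s] based_space.coords_zero[OF Pb[OF t(1)[OF s]]] a0[OF s] by (simp add: enc_def)
    then have "z = vcat (map (\<lambda>s. 0\<^sub>v (?l s)) ps)" using w(2) by (simp cong: map_cong)
    also have "\<dots> = 0\<^sub>v ?N" by (induction ps) auto
    finally show ?thesis .
  qed
  note bij = bijective_matrix[OF HN surj inj]
  show N: "?N = ?n" by (rule bij(1)[symmetric])
  show "H \<in> carrier_mat ?n ?n" using HN unfolding N .
  show "\<exists>G\<in>carrier_mat ?n ?n. H * G = 1\<^sub>m ?n \<and> G * H = 1\<^sub>m ?n" using bij(2) unfolding N .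
qed

text \<open>From left to right, the generators of a minimal family are sorted by their vertices; the
multiplicity of \<open>v\<close> is the number of generators at \<open>v\<close>.\<close>

theorem splits_iff_block_sum:
  assumes vs: "distinct vs" "set vs = V0"
  shows "splits (length as) alg.str (length bs) (\<lambda>k. action_matrix (as ! k)) \<longleftrightarrow>
    (\<exists>m. sum_list (map (\<lambda>v. length (Pb v)) (multiset_list vs m)) = length bs \<and>
      (\<exists>H\<in>carrier_mat (length bs) (length bs). \<exists>G\<in>carrier_mat (length bs) (length bs).
        H * G = 1\<^sub>m (length bs) \<and> G * H = 1\<^sub>m (length bs) \<and>
        (\<forall>k<length as. action_matrix (as ! k) * H = H * diag_block_mat (map (\<lambda>v. L v k) (multiset_list vs m)))))"
    (is "?spl \<longleftrightarrow> ?dec")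
proof
  assume spl: ?spl
  obtain T where T: "minimal T" using minimal_exists by blast
  then have fT: "family T" by (simp add: minimal_def)
  define X where "X v = {x. (v, x) \<in> T}" for v
  have finX: "finite (X v)" for v
    using finite_subset[of "X v" "snd ` T"] familyD(1)[OF fT] by (force simp: X_def)
  have "\<forall>v. \<exists>xs. set xs = X v \<and> distinct xs" using finX finite_distinct_list by blast
  then obtain xl where xl: "\<And>v. set (xl v) = X v" "\<And>v. distinct (xl v)" by metis
  define ps where "ps = concat (map (\<lambda>v. map (\<lambda>x. (v, x)) (xl v)) vs)"
  have setps: "set ps = T"
  proof (intro equalityI subsetI)
    fix t assume "t \<in> set ps"
    then obtain v x where "t = (v, x)" "x \<in> set (xl v)" by (auto simp: ps_def)
    then show "t \<in> T" by (simp add: xl(1) X_def)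
  next
    fix t assume t: "t \<in> T"
    then have "fst t \<in> set vs" using familyD(2)[OF fT] vs(2) by simp
    moreover have "snd t \<in> set (xl (fst t))" using t by (simp add: xl(1) X_def)
    moreover have "t = (fst t, snd t)" by simp
    ultimately have "\<exists>v\<in>set vs. t \<in> (\<lambda>x. (v, x)) ` set (xl v)"
      by (intro bexI[of _ "fst t"] image_eqI[of _ _ "snd t"])
    then show "t \<in> set ps" by (simp add: ps_def)
  qed
  have dist: "distinct ps"
    unfolding ps_def using vs(1)
  proof (induction vs)
    case (Cons v vs)
    have "distinct (map (\<lambda>x. (v, x)) (xl v))" by (simp add: distinct_map xl(2) inj_on_def)
    moreover have "set (map (\<lambda>x. (v, x)) (xl v)) \<inter> set (concat (map (\<lambda>v. map (\<lambda>x. (v, x)) (xl v)) vs)) = {}"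
    proof -
      have "v \<notin> set vs" using Cons.prems by simp
      then show ?thesis by fastforce
    qed
    moreover have "distinct (concat (map (\<lambda>v. map (\<lambda>x. (v, x)) (xl v)) vs))" using Cons by simp
    ultimately show ?case by (simp only: list.map concat.simps distinct_append simp_thms)
  qed simp
  define m where "m v = length (xl v)" for v
  have fst_ps: "map fst ps = multiset_list vs m"
    unfolding ps_def multiset_list_def m_def
  proof (induction vs)
    case (Cons v vs)
    have "map fst (map (\<lambda>x. (v, x)) (xl v)) = replicate (length (xl v)) v"
      by (simp add: comp_def map_replicate_const)
    then show ?case using Cons.IH by (simp only: list.map concat.simps map_append)
  qed simp
  have tps: "fst t \<in> V0" "snd t \<in> carrier M" if "t \<in> set ps" for t
    using familyD[OF fT] that setps by simp_all
  note fm = family_matrix[OF spl T dist setps]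
  have "map (\<lambda>t. length (Pb (fst t))) ps = map (\<lambda>v. length (Pb v)) (multiset_list vs m)"
    unfolding fst_ps[symmetric] by simp
  moreover have "map (\<lambda>t. L (fst t) k) ps = map (\<lambda>v. L v k) (multiset_list vs m)" for k
    unfolding fst_ps[symmetric] by simp
  ultimately have len: "sum_list (map (\<lambda>v. length (Pb v)) (multiset_list vs m)) = length bs"
    and BH: "k < length as \<Longrightarrow> action_matrix (as ! k) * hcat (length bs) (map generator_matrix ps) =
      hcat (length bs) (map generator_matrix ps) * diag_block_mat (map (\<lambda>v. L v k) (multiset_list vs m))" for k
    using fm(1) hcat_generators_intertwine[OF tps, of ps k] by simp_all
  from fm(3) obtain G where G: "G \<in> carrier_mat (length bs) (length bs)"
    "hcat (length bs) (map generator_matrix ps) * G = 1\<^sub>m (length bs) \<and> G * hcat (length bs) (map generator_matrix ps) = 1\<^sub>m (length bs)"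
    by (elim bexE)
  show ?dec
    by (rule exI[of _ m], rule conjI[OF len], rule bexI[OF _ fm(2)], rule bexI[OF _ G(1)])
      (intro conjI allI impI BH G(2)[THEN conjunct1] G(2)[THEN conjunct2])
next
  assume ?dec
  then obtain m H G where len: "sum_list (map (\<lambda>v. length (Pb v)) (multiset_list vs m)) = length bs"
    and H: "H \<in> carrier_mat (length bs) (length bs)" and G: "G \<in> carrier_mat (length bs) (length bs)"
    and HG: "H * G = 1\<^sub>m (length bs)" "G * H = 1\<^sub>m (length bs)"
    and all: "\<forall>k<length as. action_matrix (as ! k) * H = H * diag_block_mat (map (\<lambda>v. L v k) (multiset_list vs m))"
    by (elim exE conjE bexE) (rule that)
  have BH: "action_matrix (as ! k) * H = H * diag_block_mat (map (\<lambda>v. L v k) (multiset_list vs m))" if "k < length as" for k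
    using all that by simp
  let ?ws = "multiset_list vs m"
  have ws: "v \<in> V0" if "v \<in> set ?ws" for v using that vs by (auto simp: multiset_list_def)
  have Lc: "L v k \<in> carrier_mat (length (Pb v)) (length (Pb v))" if "v \<in> set ?ws" for v k
    using based_space.dim_matrix_of[OF Pb[OF ws[OF that]]] .
  have "splits (length as) alg.str (sum_list (map (\<lambda>v. length (Pb v)) ?ws)) (\<lambda>k. diag_block_mat (map (\<lambda>v. L v k) ?ws))"
    by (rule splits_diag_block) (rule Lc, assumption, rule flt.projective_splits, erule ws, rule Pb, erule ws)
  then have spl: "splits (length as) alg.str (length bs) (\<lambda>k. diag_block_mat (map (\<lambda>v. L v k) ?ws))" unfolding len .
  have D: "diag_block_mat (map (\<lambda>v. L v k) ?ws) \<in> carrier_mat (length bs) (length bs)" for k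
    using diag_block_carrier[of ?ws "\<lambda>v. L v k" "\<lambda>v. length (Pb v)", OF Lc] unfolding len .
  show ?spl by (rule splits_similar[OF H G HG action_matrix_carrier D BH spl])
qed

end

section \<open>Duality with the opposite algebra\<close>

definition opposite :: "(complex, 'r, 'y) module_scheme \<Rightarrow> (complex, 'r, 'y) module_scheme" where
  "opposite A = A \<lparr> mult := \<lambda>x y. y \<otimes>\<^bsub>A\<^esub> x \<rparr>"

lemma opposite_simps [simp]:
  "carrier (opposite A) = carrier A" "\<zero>\<^bsub>opposite A\<^esub> = \<zero>\<^bsub>A\<^esub>" "\<one>\<^bsub>opposite A\<^esub> = \<one>\<^bsub>A\<^esub>"
  "x \<oplus>\<^bsub>opposite A\<^esub> y = x \<oplus>\<^bsub>A\<^esub> y" "x \<otimes>\<^bsub>opposite A\<^esub> y = y \<otimes>\<^bsub>A\<^esub> x" "c \<odot>\<^bsub>opposite A\<^esub> x = c \<odot>\<^bsub>A\<^esub> x"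
  by (simp_all add: opposite_def)

context based_algebra
begin

lemma opposite_space: "based_space (opposite A) as" "coords (opposite A) as = coords A as"
  by (rule based_space_transfer[OF alg.based_space_axioms]; simp)+

lemma opposite_algebra: "based_algebra (opposite A) as"
proof (intro based_algebra.intro opposite_space(1) based_algebra_axioms.intro)
  show "ring (opposite A)"
  proof (rule ringI)
    show "abelian_group (opposite A)" by (rule abelian_group_transfer[OF is_abelian_group]) simp_all
    show "Group.monoid (opposite A)" by (rule monoidI) (simp_all add: m_assoc)
  qed (simp_all add: l_distr r_distr)
qed (simp_all add: smult_mult[symmetric] mult_smult[symmetric])

lemma str_opposite: "based_algebra.str (opposite A) as k l j = str l k j"
  unfolding str_def based_algebra.str_def[OF opposite_algebra] based_space.coord_def[OF opposite_space(1)] alg.coord_def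
  by (simp add: opposite_space(2))

end

text \<open>The conditions on a filtered algebra for both sides, so that the opposite algebra is filtered as well.\<close>

locale bifiltered_algebra = filtered_algebra +
  assumes F_mult_left: "x \<in> F 1 \<Longrightarrow> y \<in> F k \<Longrightarrow> x \<otimes> y \<in> F (Suc k)"
    and e_split_left: "x \<in> carrier A \<Longrightarrow> v \<in> V0 \<Longrightarrow> \<exists>c. \<exists>y\<in>F 1. e v \<otimes> x = c \<odot> e v \<oplus> y"
begin

lemma opposite_filtered: "filtered_algebra (opposite A) as V0 e F"
proof (intro filtered_algebra.intro opposite_algebra filtered_algebra_axioms.intro)
  have "finsum (opposite A) e V0 = finsum A e V0"
    using based_algebra.axioms(1)[OF opposite_algebra]
    by (intro finsum_transfer abelian_monoid_axioms) (auto simp: ring_def abelian_group_def)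
  then show "\<one>\<^bsub>opposite A\<^esub> = finsum (opposite A) e V0" using one_sum by simp
qed (simp_all add: finite_V0 e_idem F_0 F_closed F_zero F_add F_smult F_mult_left[simplified] F_nilpotent e_split_left[simplified])

end

definition dual_space :: "(complex, 'v, 'z) module_scheme \<Rightarrow> (complex, 'v \<Rightarrow> complex) module" where
  "dual_space V = \<lparr> carrier = dual_carrier V, mult = (\<lambda>\<phi> \<psi>. \<phi>), one = (\<lambda>x\<in>carrier V. 0), zero = (\<lambda>x\<in>carrier V. 0),
     add = (\<lambda>\<phi> \<psi>. \<lambda>x\<in>carrier V. \<phi> x + \<psi> x), smult = (\<lambda>c \<phi>. \<lambda>x\<in>carrier V. c * \<phi> x) \<rparr>"

lemma dual_space_simps [simp]:
  "carrier (dual_space V) = dual_carrier V" "\<zero>\<^bsub>dual_space V\<^esub> = (\<lambda>x\<in>carrier V. 0)"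
  "\<phi> \<oplus>\<^bsub>dual_space V\<^esub> \<psi> = (\<lambda>x\<in>carrier V. \<phi> x + \<psi> x)" "c \<odot>\<^bsub>dual_space V\<^esub> \<phi> = (\<lambda>x\<in>carrier V. c * \<phi> x)"
  by (simp_all add: dual_space_def)

lemma dual_carrierD:
  assumes "\<phi> \<in> dual_carrier V"
  shows "x \<in> carrier V \<Longrightarrow> y \<in> carrier V \<Longrightarrow> \<phi> (x \<oplus>\<^bsub>V\<^esub> y) = \<phi> x + \<phi> y"
    and "x \<in> carrier V \<Longrightarrow> \<phi> (c \<odot>\<^bsub>V\<^esub> x) = c * \<phi> x" and "\<phi> \<in> extensional (carrier V)"
  using assms by (auto simp: dual_carrier_def)

lemma dual_carrier_eqI:
  "\<phi> \<in> dual_carrier V \<Longrightarrow> \<psi> \<in> dual_carrier V \<Longrightarrow> (\<And>x. x \<in> carrier V \<Longrightarrow> \<phi> x = \<psi> x) \<Longrightarrow> \<phi> = \<psi>"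
  by (rule extensionalityI[of _ "carrier V"]) (auto simp: dual_carrier_def)

context based_space
begin

lemma dual_carrierI:
  assumes "\<And>x y. x \<in> carrier V \<Longrightarrow> y \<in> carrier V \<Longrightarrow> f (x \<oplus> y) = f x + f y"
    and "\<And>c x. x \<in> carrier V \<Longrightarrow> f (c \<odot> x) = c * f x"
  shows "(\<lambda>x\<in>carrier V. f x) \<in> dual_carrier V"
  using assms by (simp add: dual_carrier_def)

lemma dual_space_module: "module class_ring (dual_space V)"
proof (rule moduleI)
  have cl: "(\<lambda>x\<in>carrier V. c * \<phi> x) \<in> dual_carrier V" if "\<phi> \<in> dual_carrier V" for c \<phi>
    by (rule dual_carrierI) (simp_all add: dual_carrierD[OF that] algebra_simps)
  show "abelian_group (dual_space V)"
  proof (rule abelian_groupI; unfold dual_space_simps)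
    fix \<phi> assume f: "\<phi> \<in> dual_carrier V"
    note fD = dual_carrierD[OF f]
    show "\<exists>\<psi>\<in>dual_carrier V. (\<lambda>x\<in>carrier V. \<psi> x + \<phi> x) = (\<lambda>x\<in>carrier V. 0)"
      by (rule bexI[OF _ cl[OF f, of "-1"]]) (rule restrict_ext, simp)
    show "(\<lambda>x\<in>carrier V. (\<lambda>x\<in>carrier V. 0) x + \<phi> x) = \<phi>"
      by (rule extensionalityI[OF restrict_extensional fD(3)]) simp
    fix \<psi> assume g: "\<psi> \<in> dual_carrier V"
    note gD = dual_carrierD[OF g]
    show "(\<lambda>x\<in>carrier V. \<phi> x + \<psi> x) \<in> dual_carrier V"
      by (rule dual_carrierI) (simp_all add: fD gD algebra_simps)
    show "(\<lambda>x\<in>carrier V. \<phi> x + \<psi> x) = (\<lambda>x\<in>carrier V. \<psi> x + \<phi> x)" by (rule restrict_ext) simp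
    fix \<theta>
    show "(\<lambda>x\<in>carrier V. (\<lambda>x\<in>carrier V. \<phi> x + \<psi> x) x + \<theta> x) = (\<lambda>x\<in>carrier V. \<phi> x + (\<lambda>x\<in>carrier V. \<psi> x + \<theta> x) x)"
      by (rule restrict_ext) simp
  next
    show "(\<lambda>x\<in>carrier V. 0) \<in> dual_carrier V" by (rule dual_carrierI) simp_all
  qed
  show "a \<odot>\<^bsub>dual_space V\<^esub> x \<in> carrier (dual_space V)" if "x \<in> carrier (dual_space V)" for a x
    using cl that by simp
  show "\<one>\<^bsub>class_ring\<^esub> \<odot>\<^bsub>dual_space V\<^esub> \<phi> = \<phi>" if "\<phi> \<in> carrier (dual_space V)" for \<phi>
    unfolding dual_space_simps
    by (rule extensionalityI[OF restrict_extensional]) (use that in \<open>simp_all add: dual_carrierD\<close>)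
qed (use class_cring.is_cring in \<open>simp_all add: algebra_simps restrict_def fun_eq_iff\<close>)

lemma dual_finsum:
  assumes f: "f \<in> S \<rightarrow> dual_carrier V" and x: "x \<in> carrier V"
  shows "finsum (dual_space V) f S x = (\<Sum>s\<in>S. f s x)"
proof -
  interpret D: module class_ring "dual_space V" by (rule dual_space_module)
  show ?thesis
    by (rule additive_finsum_sum[OF D.M.abelian_monoid_axioms, of "\<lambda>\<phi>. \<phi> x"]) (use f x in simp_all)
qed

lemma dual_basis_nth: "i < length bs \<Longrightarrow> dual_basis V bs ! i = (\<lambda>x\<in>carrier V. coord i x)"
  by (simp add: dual_basis_def coord_def)

lemma length_dual_basis [simp]: "length (dual_basis V bs) = length bs"
  by (simp add: dual_basis_def)

lemma dual_basis_closed: "i < length bs \<Longrightarrow> dual_basis V bs ! i \<in> dual_carrier V"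
  unfolding dual_basis_nth by (rule dual_carrierI) (simp_all add: coord_add coord_smult)

lemma dual_expand:
  assumes f: "\<phi> \<in> dual_carrier V" and x: "x \<in> carrier V"
  shows "\<phi> x = (\<Sum>i<length bs. \<phi> (bs ! i) * coord i x)"
proof -
  have z: "\<phi> \<zero> = 0" using dual_carrierD(2)[OF f, of \<zero> 0] complex_module(6)[of \<zero>] by simp
  have "\<phi> x = \<phi> (lc (\<lambda>i. coord i x))" using lc_coord[OF x] by simp
  also have "\<dots> = (\<Sum>i<length bs. \<phi> (coord i x \<odot> (bs ! i)))"
    by (rule additive_finsum_sum[OF M.abelian_monoid_axioms z dual_carrierD(1)[OF f]]) simp_all
  also have "\<dots> = (\<Sum>i<length bs. \<phi> (bs ! i) * coord i x)"
    by (intro sum.cong refl) (simp add: dual_carrierD(2)[OF f])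
  finally show ?thesis .
qed

lemma dual_lc:
  assumes x: "x \<in> carrier V"
  shows "(\<Oplus>\<^bsub>dual_space V\<^esub>i\<in>{..<length bs}. c i \<odot>\<^bsub>dual_space V\<^esub> (dual_basis V bs ! i)) x = (\<Sum>i<length bs. c i * coord i x)"
    and "(\<Oplus>\<^bsub>dual_space V\<^esub>i\<in>{..<length bs}. c i \<odot>\<^bsub>dual_space V\<^esub> (dual_basis V bs ! i)) \<in> dual_carrier V"
proof -
  interpret D: module class_ring "dual_space V" by (rule dual_space_module)
  have m: "(\<lambda>i. c i \<odot>\<^bsub>dual_space V\<^esub> (dual_basis V bs ! i)) \<in> {..<length bs} \<rightarrow> carrier (dual_space V)"
    using dual_basis_closed by (intro funcsetI complex_module_ops(1)[OF dual_space_module]) simp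
  show "(\<Oplus>\<^bsub>dual_space V\<^esub>i\<in>{..<length bs}. c i \<odot>\<^bsub>dual_space V\<^esub> (dual_basis V bs ! i)) \<in> dual_carrier V"
    using D.M.finsum_closed[OF m] by (simp only: dual_space_simps(1))
  have "(\<Oplus>\<^bsub>dual_space V\<^esub>i\<in>{..<length bs}. c i \<odot>\<^bsub>dual_space V\<^esub> (dual_basis V bs ! i)) x =
      (\<Sum>i<length bs. (c i \<odot>\<^bsub>dual_space V\<^esub> (dual_basis V bs ! i)) x)"
    using m by (intro dual_finsum x) (simp only: dual_space_simps(1))
  also have "\<dots> = (\<Sum>i<length bs. c i * coord i x)"
    by (intro sum.cong refl) (simp add: dual_basis_nth x)
  finally show "(\<Oplus>\<^bsub>dual_space V\<^esub>i\<in>{..<length bs}. c i \<odot>\<^bsub>dual_space V\<^esub> (dual_basis V bs ! i)) x = (\<Sum>i<length bs. c i * coord i x)" .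
qed

lemma dual_based_space: "based_space (dual_space V) (dual_basis V bs)"
  and coords_dual: "\<phi> \<in> dual_carrier V \<Longrightarrow> coords (dual_space V) (dual_basis V bs) \<phi> = Matrix.vec (length bs) (\<lambda>i. \<phi> (bs ! i))"
proof -
  have char: "\<phi> = (\<Oplus>\<^bsub>dual_space V\<^esub>i\<in>{..<length bs}. vec_index c i \<odot>\<^bsub>dual_space V\<^esub> (dual_basis V bs ! i)) \<longleftrightarrow>
      c = Matrix.vec (length bs) (\<lambda>i. \<phi> (bs ! i))"
    if f: "\<phi> \<in> dual_carrier V" and c: "c \<in> carrier_vec (length bs)" for \<phi> c
  proof
    assume eq: "\<phi> = (\<Oplus>\<^bsub>dual_space V\<^esub>i\<in>{..<length bs}. vec_index c i \<odot>\<^bsub>dual_space V\<^esub> (dual_basis V bs ! i))"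
    show "c = Matrix.vec (length bs) (\<lambda>i. \<phi> (bs ! i))"
    proof (rule eq_vecI)
      fix j assume "j < dim_vec (Matrix.vec (length bs) (\<lambda>i. \<phi> (bs ! i)))"
      then have j: "j < length bs" by simp
      have "\<phi> (bs ! j) = (\<Sum>i<length bs. vec_index c i * coord i (bs ! j))"
        by (subst eq) (rule dual_lc(1)[OF bs_closed[OF j]])
      also have "\<dots> = (\<Sum>i<length bs. if i = j then vec_index c i else 0)"
        by (intro sum.cong refl) (use j in \<open>simp add: coord_bs\<close>)
      also have "\<dots> = vec_index c j" using j by simp
      finally show "vec_index c j = vec_index (Matrix.vec (length bs) (\<lambda>i. \<phi> (bs ! i))) j" using j by simp
    qed (use c in simp)
  next
    assume c: "c = Matrix.vec (length bs) (\<lambda>i. \<phi> (bs ! i))"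
    show "\<phi> = (\<Oplus>\<^bsub>dual_space V\<^esub>i\<in>{..<length bs}. vec_index c i \<odot>\<^bsub>dual_space V\<^esub> (dual_basis V bs ! i))"
    proof (rule dual_carrier_eqI[OF f])
      show "(\<Oplus>\<^bsub>dual_space V\<^esub>i\<in>{..<length bs}. vec_index c i \<odot>\<^bsub>dual_space V\<^esub> (dual_basis V bs ! i)) \<in> dual_carrier V"
        by (rule dual_lc(2)[of \<zero>]) simp
      fix x assume x: "x \<in> carrier V"
      show "\<phi> x = (\<Oplus>\<^bsub>dual_space V\<^esub>i\<in>{..<length bs}. vec_index c i \<odot>\<^bsub>dual_space V\<^esub> (dual_basis V bs ! i)) x"
        unfolding dual_lc(1)[OF x] dual_expand[OF f x] c by (intro sum.cong refl) simp
    qed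
  qed
  show "based_space (dual_space V) (dual_basis V bs)"
  proof (intro based_space.intro dual_space_module based_space_axioms.intro)
    show "set (dual_basis V bs) \<subseteq> carrier (dual_space V)"
      using dual_basis_closed by (auto simp: in_set_conv_nth)
    fix \<phi> assume "\<phi> \<in> carrier (dual_space V)"
    then have f: "\<phi> \<in> dual_carrier V" by simp
    show "\<exists>!c. c \<in> carrier_vec (length (dual_basis V bs)) \<and>
        \<phi> = (\<Oplus>\<^bsub>dual_space V\<^esub>i\<in>{..<length (dual_basis V bs)}. vec_index c i \<odot>\<^bsub>dual_space V\<^esub> (dual_basis V bs ! i))"
      unfolding length_dual_basis
    proof (rule ex1I[of _ "Matrix.vec (length bs) (\<lambda>i. \<phi> (bs ! i))"], goal_cases)
      case 1 show ?case by (rule conjI[OF vec_carrier iffD2[OF char[OF f vec_carrier] refl]])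
    next
      case (2 c) show ?case by (rule iffD1[OF char[OF f conjunct1[OF 2]] conjunct2[OF 2]])
    qed
  qed
  then interpret D: based_space "dual_space V" "dual_basis V bs" .
  show "coords (dual_space V) (dual_basis V bs) \<phi> = Matrix.vec (length bs) (\<lambda>i. \<phi> (bs ! i))" if f: "\<phi> \<in> dual_carrier V" for \<phi>
    using D.coords_props[of \<phi>] f by (intro iffD1[OF char[OF f]]) auto
qed

text \<open>The \<open>i\<close>-th coordinate of a functional is its value at the \<open>i\<close>-th basis vector.\<close>

lemma matrix_of_dual:
  assumes f: "f \<in> module_hom class_ring V V"
    and g: "\<And>\<phi>. \<phi> \<in> dual_carrier V \<Longrightarrow> g \<phi> = (\<lambda>x\<in>carrier V. \<phi> (f x))"
  shows "matrix_of (dual_space V) (dual_basis V bs) g = transpose_mat (matrix_of V bs f)"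
proof (rule eq_matI)
  fix i j assume "i < dim_row (transpose_mat (matrix_of V bs f))" "j < dim_col (transpose_mat (matrix_of V bs f))"
  then have ij: "i < length bs" "j < length bs" by (simp_all add: matrix_of_def)
  have gj: "g (dual_basis V bs ! j) = (\<lambda>x\<in>carrier V. (dual_basis V bs ! j) (f x))"
    by (rule g[OF dual_basis_closed[OF ij(2)]])
  have cl: "(\<lambda>x\<in>carrier V. (dual_basis V bs ! j) (f x)) \<in> dual_carrier V"
    by (rule dual_carrierI) (simp_all only: module_homD[OF f] dual_carrierD[OF dual_basis_closed[OF ij(2)]] class_ring_simps UNIV_I)
  have "matrix_of (dual_space V) (dual_basis V bs) g $$ (i, j) = vec_index (coords (dual_space V) (dual_basis V bs) (g (dual_basis V bs ! j))) i"
    using ij by (simp add: matrix_of_def)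
  also have "\<dots> = (dual_basis V bs ! j) (f (bs ! i))"
    unfolding gj coords_dual[OF cl] using ij by simp
  also have "\<dots> = coord j (f (bs ! i))"
    unfolding dual_basis_nth[OF ij(2)] using module_homD(1)[OF f bs_closed[OF ij(1)]] by simp
  also have "\<dots> = transpose_mat (matrix_of V bs f) $$ (i, j)"
    using ij by (simp add: matrix_of_def coord_def)
  finally show "matrix_of (dual_space V) (dual_basis V bs) g $$ (i, j) = transpose_mat (matrix_of V bs f) $$ (i, j)" .
qed (simp_all add: matrix_of_def)

text \<open>This applies to the vector spaces underlying \<open>dual_module\<close> and \<open>injective_at\<close>, whose scalar
multiplications agree with that of the dual space only on functionals.\<close>

lemma dual_agree:
  assumes "carrier D = dual_carrier V" "\<zero>\<^bsub>D\<^esub> = (\<lambda>x\<in>carrier V. 0)"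
    "\<And>\<phi> \<psi>. \<phi> \<oplus>\<^bsub>D\<^esub> \<psi> = (\<lambda>x\<in>carrier V. \<phi> x + \<psi> x)"
    "\<And>c \<phi>. \<phi> \<in> dual_carrier V \<Longrightarrow> c \<odot>\<^bsub>D\<^esub> \<phi> = (\<lambda>x\<in>carrier V. c * \<phi> x)"
  shows "based_space D (dual_basis V bs)" "matrix_of D (dual_basis V bs) = matrix_of (dual_space V) (dual_basis V bs)"
  by (rule based_space_transfer[OF dual_based_space]; use assms in simp)+

end

text \<open>The right action on the dual of a left module, as a left action of the opposite algebra.\<close>

definition dual_module :: "(complex, 'r, 'y) module_scheme \<Rightarrow> ('r, 'm, 'z) module_scheme \<Rightarrow> ('r, 'm \<Rightarrow> complex) module" where
  "dual_module A M = \<lparr> carrier = dual_carrier (complex_space A M), mult = (\<lambda>\<phi> \<psi>. \<phi>), one = (\<lambda>x\<in>carrier M. 0),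
     zero = (\<lambda>x\<in>carrier M. 0), add = (\<lambda>\<phi> \<psi>. \<lambda>x\<in>carrier M. \<phi> x + \<psi> x),
     smult = (\<lambda>a \<phi>. \<lambda>x\<in>carrier M. \<phi> (a \<odot>\<^bsub>M\<^esub> x)) \<rparr>"

lemma dual_module_simps [simp]:
  "carrier (dual_module A M) = dual_carrier (complex_space A M)" "\<zero>\<^bsub>dual_module A M\<^esub> = (\<lambda>x\<in>carrier M. 0)"
  "\<phi> \<oplus>\<^bsub>dual_module A M\<^esub> \<psi> = (\<lambda>x\<in>carrier M. \<phi> x + \<psi> x)" "a \<odot>\<^bsub>dual_module A M\<^esub> \<phi> = (\<lambda>x\<in>carrier M. \<phi> (a \<odot>\<^bsub>M\<^esub> x))"
  by (simp_all add: dual_module_def)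

context based_module
begin

lemma dual_left_module: "left_module (opposite A) (dual_module A M)"
proof (intro left_module.intro left_module_axioms.intro)
  show "ring (opposite A)" by (rule based_algebra.axioms(1)[OF alg.opposite_algebra])
  interpret D: module class_ring "dual_space V" by (rule V.dual_space_module)
  show "abelian_group (dual_module A M)"
    by (rule abelian_group_transfer[OF D.M.abelian_group_axioms]) simp_all
  fix a \<phi> assume "a \<in> carrier (opposite A)" and f: "\<phi> \<in> carrier (dual_module A M)"
  then have a: "a \<in> carrier A" and fD: "\<phi> \<in> dual_carrier V" by simp_all
  note add = dual_carrierD(1)[OF fD, unfolded complex_space_simps(1,2)]
    and sm = dual_carrierD(2)[OF fD, unfolded complex_space_simps(1)]
  have "(\<lambda>x\<in>carrier V. \<phi> (a \<odot> x)) \<in> dual_carrier V"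
  proof (rule V.dual_carrierI)
    show "\<phi> (a \<odot> (x \<oplus>\<^bsub>V\<^esub> y)) = \<phi> (a \<odot> x) + \<phi> (a \<odot> y)" if "x \<in> carrier V" "y \<in> carrier V" for x y
      using that a by (simp add: mod.smult_r_distr mod.smult_closed add)
    show "\<phi> (a \<odot> (c \<odot>\<^bsub>V\<^esub> x)) = c * \<phi> (a \<odot> x)" if "x \<in> carrier V" for c x
      using that act_scalar(2)[OF a, of x c] sm[OF mod.smult_closed[OF a], of x c] by (simp only: complex_space_simps(1))
  qed
  then show "a \<odot>\<^bsub>dual_module A M\<^esub> \<phi> \<in> carrier (dual_module A M)" by simp
  {
    fix b assume "b \<in> carrier (opposite A)"
    then have b: "b \<in> carrier A" by simp
    show "(a \<oplus>\<^bsub>opposite A\<^esub> b) \<odot>\<^bsub>dual_module A M\<^esub> \<phi> = a \<odot>\<^bsub>dual_module A M\<^esub> \<phi> \<oplus>\<^bsub>dual_module A M\<^esub> b \<odot>\<^bsub>dual_module A M\<^esub> \<phi>"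
      unfolding dual_module_simps opposite_simps
      by (rule restrict_ext) (simp add: a b mod.smult_l_distr mod.smult_closed add)
    show "(a \<otimes>\<^bsub>opposite A\<^esub> b) \<odot>\<^bsub>dual_module A M\<^esub> \<phi> = a \<odot>\<^bsub>dual_module A M\<^esub> (b \<odot>\<^bsub>dual_module A M\<^esub> \<phi>)"
      unfolding dual_module_simps opposite_simps
      by (rule restrict_ext) (simp add: a b mod.smult_assoc1 mod.smult_closed)
  }
  fix \<psi> assume "\<psi> \<in> carrier (dual_module A M)"
  show "a \<odot>\<^bsub>dual_module A M\<^esub> (\<phi> \<oplus>\<^bsub>dual_module A M\<^esub> \<psi>) = a \<odot>\<^bsub>dual_module A M\<^esub> \<phi> \<oplus>\<^bsub>dual_module A M\<^esub> a \<odot>\<^bsub>dual_module A M\<^esub> \<psi>"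
    unfolding dual_module_simps by (rule restrict_ext) (simp add: a mod.smult_closed)
next
  fix \<phi> assume "\<phi> \<in> carrier (dual_module A M)"
  then have "\<phi> \<in> extensional (carrier M)" using dual_carrierD(3)[of \<phi> V] by simp
  then show "\<one>\<^bsub>opposite A\<^esub> \<odot>\<^bsub>dual_module A M\<^esub> \<phi> = \<phi>"
    unfolding dual_module_simps
    by (intro extensionalityI[OF restrict_extensional]) (simp_all add: mod.smult_one)
qed

lemma dual_module_space:
  "based_space (complex_space (opposite A) (dual_module A M)) (dual_basis V bs)"
  "matrix_of (complex_space (opposite A) (dual_module A M)) (dual_basis V bs) = matrix_of (dual_space V) (dual_basis V bs)"
proof -
  have *: "c \<odot>\<^bsub>complex_space (opposite A) (dual_module A M)\<^esub> \<phi> = (\<lambda>x\<in>carrier V. c * \<phi> x)" if "\<phi> \<in> dual_carrier V" for c \<phi>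
    unfolding complex_space_simps(4)[of "opposite A"] opposite_simps dual_module_simps complex_space_simps(1)
    by (rule restrict_ext) (use dual_carrierD(2)[OF that] in simp)
  show "based_space (complex_space (opposite A) (dual_module A M)) (dual_basis V bs)"
    by (rule V.dual_agree(1)) (simp_all only: complex_space_simps(1-3) dual_module_simps(1-3) *)
  show "matrix_of (complex_space (opposite A) (dual_module A M)) (dual_basis V bs) = matrix_of (dual_space V) (dual_basis V bs)"
    by (rule V.dual_agree(2)) (simp_all only: complex_space_simps(1-3) dual_module_simps(1-3) *)
qed

lemma dual_based_module: "based_module (opposite A) as (dual_module A M) (dual_basis V bs)"
  by (intro based_module.intro algebra_module.intro alg.opposite_algebra dual_left_module dual_module_space(1))

lemma action_matrix_dual:
  assumes a: "a \<in> carrier A"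
  shows "based_module.action_matrix (opposite A) (dual_module A M) (dual_basis V bs) a = transpose_mat (action_matrix a)"
  unfolding based_module.action_matrix_def[OF dual_based_module] dual_module_space(2) action_matrix_def
  by (rule V.matrix_of_dual[OF act_linear[OF a]]) simp

end

context bifiltered_algebra
begin

text \<open>Over the opposite algebra the projective at \<open>v\<close> is \<open>e\<^sub>v A\<close> with right multiplication, of which
\<open>I(v)\<close> is the dual.\<close>

lemma injective_at_dual:
  assumes v: "v \<in> V0" and Ib: "based_space (right_space A (e v)) Ib"
  shows "based_space (complex_space (opposite A) (projective_at (opposite A) (e v))) Ib"
    and "based_space (complex_space A (injective_at A (e v))) (dual_basis (right_space A (e v)) Ib)"
    and "k < length as \<Longrightarrow>
      matrix_of (complex_space A (injective_at A (e v))) (dual_basis (right_space A (e v)) Ib)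
        (representation (injective_at A (e v)) (as ! k)) =
      transpose_mat (matrix_of (complex_space (opposite A) (projective_at (opposite A) (e v))) Ib
        (representation (projective_at (opposite A) (e v)) (as ! k)))"
proof -
  let ?R = "right_space A (e v)" and ?P = "projective_at (opposite A) (e v)" and ?I = "injective_at A (e v)"
  interpret R: based_space ?R Ib by (rule Ib)
  have R: "carrier ?R = (\<lambda>x. e v \<otimes> x) ` carrier A" "\<zero>\<^bsub>?R\<^esub> = \<zero>" "\<And>x y. x \<oplus>\<^bsub>?R\<^esub> y = x \<oplus> y" "\<And>c x. c \<odot>\<^bsub>?R\<^esub> x = c \<odot> x"
    by (simp_all add: right_space_def)
  have RA: "x \<in> carrier A" if "x \<in> carrier ?R" for x using that v unfolding R(1) by auto
  have R_mult: "x \<otimes> a \<in> carrier ?R" if "x \<in> carrier ?R" "a \<in> carrier A" for x a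
  proof -
    have "x \<in> (\<lambda>x. e v \<otimes> x) ` carrier A" using that(1) unfolding R(1) .
    then obtain y where y: "x = e v \<otimes> y" "y \<in> carrier A" by (rule imageE)
    show ?thesis unfolding R(1)
      by (rule image_eqI[of _ _ "y \<otimes> a"]) (use y that(2) v in \<open>simp_all add: m_assoc\<close>)
  qed
  have P: "carrier ?P = carrier ?R" "\<zero>\<^bsub>?P\<^esub> = \<zero>\<^bsub>?R\<^esub>" "\<And>x y. x \<oplus>\<^bsub>?P\<^esub> y = x \<oplus>\<^bsub>?R\<^esub> y" "\<And>a x. a \<odot>\<^bsub>?P\<^esub> x = x \<otimes> a"
    unfolding R by (simp_all add: projective_at_def)
  have trP: "based_space (complex_space (opposite A) ?P) Ib" "matrix_of (complex_space (opposite A) ?P) Ib = matrix_of ?R Ib"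
    by (rule based_space_transfer[OF Ib]; simp add: P R RA mult_scalar)+
  show "based_space (complex_space (opposite A) ?P) Ib" by (rule trP(1))
  have I: "carrier ?I = dual_carrier ?R" "\<zero>\<^bsub>?I\<^esub> = (\<lambda>x\<in>carrier ?R. 0)" "\<And>\<phi> \<psi>. \<phi> \<oplus>\<^bsub>?I\<^esub> \<psi> = (\<lambda>x\<in>carrier ?R. \<phi> x + \<psi> x)"
    "\<And>a \<phi>. a \<odot>\<^bsub>?I\<^esub> \<phi> = (\<lambda>x\<in>carrier ?R. \<phi> (x \<otimes> a))"
    by (simp_all add: injective_at_def Let_def)
  have I_sc: "c \<odot>\<^bsub>complex_space A ?I\<^esub> \<phi> = (\<lambda>x\<in>carrier ?R. c * \<phi> x)" if f: "\<phi> \<in> dual_carrier ?R" for c \<phi>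
    unfolding complex_space_simps(4) I
  proof (rule restrict_ext)
    fix x assume x: "x \<in> carrier ?R"
    then have "x \<otimes> (c \<odot> \<one>) = c \<odot>\<^bsub>?R\<^esub> x" by (simp add: R mult_scalar RA)
    then show "\<phi> (x \<otimes> (c \<odot> \<one>)) = c * \<phi> x" using dual_carrierD(2)[OF f x] by simp
  qed
  show "based_space (complex_space A ?I) (dual_basis ?R Ib)"
    by (rule R.dual_agree(1)) (simp_all only: complex_space_simps(1-3) I(1-3) I_sc)
  assume k: "k < length as"
  have lin: "(\<lambda>x. x \<otimes> (as ! k)) \<in> module_hom class_ring ?R ?R"
    by (rule module_homI) (use k R_mult RA in \<open>simp_all add: R(3,4) l_distr smult_mult[symmetric]\<close>)
  have "matrix_of (complex_space A ?I) (dual_basis ?R Ib) (representation ?I (as ! k)) =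
      matrix_of (dual_space ?R) (dual_basis ?R Ib) (representation ?I (as ! k))"
    by (rule fun_cong[OF R.dual_agree(2)]) (simp_all only: complex_space_simps(1-3) I(1-3) I_sc)
  also have "\<dots> = transpose_mat (matrix_of ?R Ib (\<lambda>x. x \<otimes> (as ! k)))"
    by (rule R.matrix_of_dual[OF lin]) (simp add: representation_def I)
  also have "matrix_of ?R Ib (\<lambda>x. x \<otimes> (as ! k)) = matrix_of ?R Ib (representation ?P (as ! k))"
    by (rule R.matrix_of_cong) (simp only: representation_def P(1,4) restrict_apply R.bs_closed if_True)
  finally show "matrix_of (complex_space A ?I) (dual_basis ?R Ib) (representation ?I (as ! k)) =
      transpose_mat (matrix_of (complex_space (opposite A) ?P) Ib (representation ?P (as ! k)))"
    unfolding trP(2) .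
qed

end

section \<open>Similarity of integral profiles\<close>

lemma block2_transpose:
  assumes "X \<in> carrier_mat p p" "Y \<in> carrier_mat q q"
  shows "transpose_mat (block2 X Y) = block2 (transpose_mat X) (transpose_mat Y)"
proof -
  have z: "transpose_mat (0\<^sub>m a b :: complex mat) = 0\<^sub>m b a" for a b by (rule eq_matI) auto
  show ?thesis using assms unfolding block2_def
    by (subst transpose_four_block_mat[of _ p p _ q _ q]) (auto simp: z)
qed

lemma transpose_diag_block:
  assumes "\<And>v. v \<in> set ws \<Longrightarrow> L v \<in> carrier_mat (n v) (n v)"
  shows "transpose_mat (diag_block_mat (map L ws)) = diag_block_mat (map (\<lambda>v. transpose_mat (L v)) ws :: complex mat list)"
  using assms
proof (induction ws)
  case Nil
  show ?case by (rule eq_matI) auto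
next
  case (Cons v ws)
  have "transpose_mat (block2 (L v) (diag_block_mat (map L ws))) = block2 (transpose_mat (L v)) (transpose_mat (diag_block_mat (map L ws)))"
    by (rule block2_transpose[OF _ diag_block_carrier]) (use Cons.prems in auto)
  then show ?case unfolding list.map diag_block_mat_Cons using Cons by simp
qed

definition conjugates :: "nat \<Rightarrow> nat \<Rightarrow> (nat \<Rightarrow> complex mat) \<Rightarrow> (nat \<Rightarrow> complex mat) \<Rightarrow> bool" where
  "conjugates n d X D \<longleftrightarrow> (\<exists>H\<in>carrier_mat n n. \<exists>G\<in>carrier_mat n n.
     H * G = 1\<^sub>m n \<and> G * H = 1\<^sub>m n \<and> (\<forall>k<d. X k * H = H * D k))"

text \<open>If \<open>H\<close> conjugates the families, with inverse \<open>G\<close>, the transpose of \<open>G\<close> conjugates the transposed ones.\<close>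

lemma conjugates_transpose:
  assumes X: "\<And>k. k < d \<Longrightarrow> X k \<in> carrier_mat n n" and D: "\<And>k. k < d \<Longrightarrow> D k \<in> carrier_mat n n"
    and conj: "conjugates n d X D"
  shows "conjugates n d (\<lambda>k. transpose_mat (X k)) (\<lambda>k. transpose_mat (D k))"
proof -
  obtain H G where H: "H \<in> carrier_mat n n" and G: "G \<in> carrier_mat n n" and HG: "H * G = 1\<^sub>m n" and GH: "G * H = 1\<^sub>m n"
    and eq: "\<And>k. k < d \<Longrightarrow> X k * H = H * D k" using conj unfolding conjugates_def by blast
  show ?thesis unfolding conjugates_def
  proof (rule bexI[of _ "transpose_mat G"], rule bexI[of _ "transpose_mat H"], intro conjI allI impI)
    show "transpose_mat G * transpose_mat H = 1\<^sub>m n"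
      unfolding transpose_mult[OF H G, symmetric] HG by simp
    show "transpose_mat H * transpose_mat G = 1\<^sub>m n"
      unfolding transpose_mult[OF G H, symmetric] GH by simp
    fix k assume k: "k < d"
    have "G * X k = G * (X k * H) * G"
    proof -
      have "G * (X k * H) * G = G * ((X k * H) * G)" by (rule assoc_mult_mat[OF G mult_carrier_mat[OF X[OF k] H] G])
      also have "(X k * H) * G = X k * (H * G)" by (rule assoc_mult_mat[OF X[OF k] H G])
      finally show ?thesis unfolding HG using X[OF k] by simp
    qed
    also have "\<dots> = D k * G"
    proof -
      have "G * (H * D k) = (G * H) * D k" by (rule assoc_mult_mat[OF G H D[OF k], symmetric])
      then show ?thesis unfolding eq[OF k] GH using D[OF k] by simp
    qed
    finally show "transpose_mat (X k) * transpose_mat G = transpose_mat G * transpose_mat (D k)"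
      unfolding transpose_mult[OF G X[OF k], symmetric] transpose_mult[OF D[OF k] G, symmetric] by (rule arg_cong)
  qed (use H G in simp_all)
qed

text \<open>The scalar factor cancels at points with positive coordinates. Comparing the all-ones vector with the
one in which the \<open>k\<close>-th coordinate is doubled isolates the \<open>k\<close>-th coefficient matrix.\<close>

lemma similar_on_iff_conjugates:
  assumes B: "\<And>k. k < d \<Longrightarrow> B k \<in> carrier_mat n n" and D: "\<And>k. k < d \<Longrightarrow> D k \<in> carrier_mat n n"
    and X: "\<And>t. \<forall>i<d. 0 \<le> t i \<Longrightarrow>
      X t = complex_of_real ((\<Prod>i<d. t i) / 2) \<cdot>\<^sub>m mat_lc n d (\<lambda>k. complex_of_real (t k)) B"
    and Y: "\<And>t. \<forall>i<d. 0 \<le> t i \<Longrightarrow>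
      Y t = complex_of_real ((\<Prod>i<d. t i) / 2) \<cdot>\<^sub>m mat_lc n d (\<lambda>k. complex_of_real (t k)) D"
  shows "similar_on {t :: nat \<Rightarrow> real. \<forall>i<d. 0 \<le> t i} X Y \<longleftrightarrow> conjugates n d B D"
proof
  let ?lc = "\<lambda>t. mat_lc n d (\<lambda>k. complex_of_real (t k))"
  let ?c = "\<lambda>t :: nat \<Rightarrow> real. complex_of_real ((\<Prod>i<d. t i) / 2)"
  assume "conjugates n d B D"
  then obtain H G where H: "H \<in> carrier_mat n n" and G: "G \<in> carrier_mat n n" and HG: "H * G = 1\<^sub>m n" and GH: "G * H = 1\<^sub>m n"
    and eq: "\<And>k. k < d \<Longrightarrow> B k * H = H * D k" unfolding conjugates_def by blast
  show "similar_on {t. \<forall>i<d. 0 \<le> t i} X Y"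
    unfolding similar_on_def
  proof (intro exI[of _ n] bexI[OF _ H] conjI ballI)
    show "invertible_mat H" using H G HG GH unfolding invertible_mat_def inverts_mat_def by auto
    fix t :: "nat \<Rightarrow> real" assume "t \<in> {t. \<forall>i<d. 0 \<le> t i}"
    then have t: "\<forall>i<d. 0 \<le> t i" by simp
    show "X t \<in> carrier_mat n n" "Y t \<in> carrier_mat n n" unfolding X[OF t] Y[OF t] by simp_all
    have "?lc t B * H = ?lc t (\<lambda>k. B k * H)" by (rule mult_mat_lc_right[OF H B])
    also have "\<dots> = ?lc t (\<lambda>k. H * D k)" by (rule mat_lc_cong[OF refl eq])
    also have "\<dots> = H * ?lc t D" by (rule mult_mat_lc_left[OF H D, symmetric])
    finally show "X t * H = H * Y t"
      unfolding X[OF t] Y[OF t] using mult_smult_assoc_mat[OF mat_lc_carrier H] mult_smult_distrib[OF H mat_lc_carrier] by simp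
  qed
next
  let ?lc = "\<lambda>t. mat_lc n d (\<lambda>k. complex_of_real (t k))"
  assume "similar_on {t. \<forall>i<d. 0 \<le> t i} X Y"
  then obtain n' H where H': "H \<in> carrier_mat n' n'" and inv: "invertible_mat H"
    and sim: "\<And>t. \<forall>i<d. 0 \<le> t i \<Longrightarrow> X t \<in> carrier_mat n' n' \<and> X t * H = H * Y t"
    unfolding similar_on_def by blast
  have "X (\<lambda>_. 0) \<in> carrier_mat n n" by (subst X) simp_all
  then have "n' = n" using sim[of "\<lambda>_. 0"] by auto
  then have H: "H \<in> carrier_mat n n" using H' by simp
  obtain G where G: "inverts_mat H G" "inverts_mat G H" using inv unfolding invertible_mat_def by blast
  then have HG: "H * G = 1\<^sub>m n" and GH0: "G * H = 1\<^sub>m (dim_row G)" using H by (auto simp: inverts_mat_def)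
  have "dim_col G = n" using arg_cong[OF HG, of dim_col] by simp
  moreover have "dim_row G = n" using arg_cong[OF GH0, of dim_col] H by simp
  ultimately have Gc: "G \<in> carrier_mat n n" and GH: "G * H = 1\<^sub>m n" using GH0 by auto
  have lin: "?lc t (\<lambda>k. B k * H) = ?lc t (\<lambda>k. H * D k)" if t: "\<forall>i<d. 0 < t i" for t :: "nat \<Rightarrow> real"
  proof -
    let ?c = "complex_of_real ((\<Prod>i<d. t i) / 2)"
    have t0: "\<forall>i<d. 0 \<le> t i" using t by (auto intro: less_imp_le)
    have "(\<Prod>i<d. t i) > 0" using t by (intro prod_pos) simp
    then have "(\<Prod>i<d. t i) / 2 > 0" by (rule half_gt_zero)
    then have c: "?c \<noteq> 0" unfolding of_real_eq_0_iff by (rule not_sym[OF less_imp_neq])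
    have "?c \<cdot>\<^sub>m (?lc t B * H) = ?c \<cdot>\<^sub>m (H * ?lc t D)"
      using sim[OF t0] unfolding X[OF t0] Y[OF t0]
      using mult_smult_assoc_mat[OF mat_lc_carrier H] mult_smult_distrib[OF H mat_lc_carrier] by simp
    then have "(1 / ?c) \<cdot>\<^sub>m (?c \<cdot>\<^sub>m (?lc t B * H)) = (1 / ?c) \<cdot>\<^sub>m (?c \<cdot>\<^sub>m (H * ?lc t D))" by (rule arg_cong)
    moreover have "(1 / ?c) \<cdot>\<^sub>m (?c \<cdot>\<^sub>m Z) = Z" for Z :: "complex mat"
      by (rule eq_matI) (use c in simp_all)
    ultimately have eq: "?lc t B * H = H * ?lc t D" by (simp only:)
    have "?lc t (\<lambda>k. B k * H) = ?lc t B * H" by (rule mult_mat_lc_right[OF H B, symmetric])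
    also have "\<dots> = ?lc t (\<lambda>k. H * D k)" unfolding eq by (rule mult_mat_lc_left[OF H D])
    finally show ?thesis .
  qed
  have "B k * H = H * D k" if k: "k < d" for k
  proof (rule eq_matI)
    fix i j assume "i < dim_row (H * D k)" "j < dim_col (H * D k)"
    then have ij: "i < n" "j < n" using H D[OF k] by auto
    have s: "(\<Sum>q<d. complex_of_real (t q) * (B q * H) $$ (i, j)) = (\<Sum>q<d. complex_of_real (t q) * (H * D q) $$ (i, j))"
      if "\<forall>i<d. 0 < t i" for t :: "nat \<Rightarrow> real"
      using arg_cong[OF lin[OF that], of "\<lambda>Z. Z $$ (i, j)"] ij by (simp add: mat_lc_index)
    have split: "(\<Sum>q<d. complex_of_real (if q = k then 2 else 1) * u q) = u k + (\<Sum>q<d. complex_of_real 1 * u q)" for u :: "nat \<Rightarrow> complex"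
    proof -
      have "(\<Sum>q<d. complex_of_real (if q = k then 2 else 1) * u q) = (\<Sum>q<d. (if q = k then u q else 0) + complex_of_real 1 * u q)"
        by (intro sum.cong refl) simp
      then show ?thesis using k by (simp add: sum.distrib)
    qed
    show "(B k * H) $$ (i, j) = (H * D k) $$ (i, j)"
      using s[of "\<lambda>q. if q = k then 2 else 1"] s[of "\<lambda>_. 1"] unfolding split by simp
  qed (use H B[OF k] D[OF k] in auto)
  then show "conjugates n d B D"
    unfolding conjugates_def using H Gc HG GH by blast
qed

lemma sum_list_multiset_list:
  "distinct vs \<Longrightarrow> sum_list (map f (multiset_list vs m)) = (\<Sum>v\<in>set vs. m v * f v :: nat)"
proof (induction vs)
  case (Cons v vs)
  have "sum_list (map f (replicate k v)) = k * f v" for k by (induction k) auto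
  then show ?case using Cons by (simp add: multiset_list_def)
qed (simp add: multiset_list_def)

lemma set_multiset_list: "set (multiset_list vs m) \<subseteq> set vs"
  by (auto simp: multiset_list_def)

lemma block_sum_matrix_combination:
  assumes L: "\<And>v k. v \<in> set vs \<Longrightarrow> k < d \<Longrightarrow> L v k \<in> carrier_mat (n v) (n v)"
  shows "block_sum vs m (\<lambda>v. matrix_combination (n v) (L v) d t) =
    mat_lc (sum_list (map n (multiset_list vs m))) d (\<lambda>k. complex_of_real (t k))
      (\<lambda>k. diag_block_mat (map (\<lambda>v. L v k) (multiset_list vs m)))"
proof -
  have ws: "v \<in> set vs" if "v \<in> set (multiset_list vs m)" for v by (rule subsetD[OF set_multiset_list that])
  have "block_sum vs m (\<lambda>v. matrix_combination (n v) (L v) d t) =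
      diag_block_mat (map (\<lambda>v. matrix_combination (n v) (L v) d t) (multiset_list vs m))"
    by (simp add: block_sum_def multiset_list_def map_concat comp_def)
  also have "map (\<lambda>v. matrix_combination (n v) (L v) d t) (multiset_list vs m) =
      map (\<lambda>v. mat_lc (n v) d (\<lambda>k. complex_of_real (t k)) (L v)) (multiset_list vs m)"
    by (intro map_cong refl matrix_combination_eq L ws)
  also have "diag_block_mat \<dots> = mat_lc (sum_list (map n (multiset_list vs m))) d (\<lambda>k. complex_of_real (t k))
      (\<lambda>k. diag_block_mat (map (\<lambda>v. L v k) (multiset_list vs m)))"
    by (rule mat_lc_diag_block[symmetric]) (intro L ws)
  finally show ?thesis .
qed

context based_module
begin

lemma integral_profile_matrix:
  assumes "\<forall>i<length as. 0 \<le> t i"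
  shows "integral_profile A as M bs t =
    complex_of_real ((\<Prod>i<length as. t i) / 2) \<cdot>\<^sub>m
      mat_lc (length bs) (length as) (\<lambda>k. complex_of_real (t k)) (\<lambda>k. action_matrix (as ! k))"
proof (rule eq_matI)
  fix i j assume "i < dim_row (complex_of_real ((\<Prod>i<length as. t i) / 2) \<cdot>\<^sub>m
      mat_lc (length bs) (length as) (\<lambda>k. complex_of_real (t k)) (\<lambda>k. action_matrix (as ! k)))"
    "j < dim_col (complex_of_real ((\<Prod>i<length as. t i) / 2) \<cdot>\<^sub>m
      mat_lc (length bs) (length as) (\<lambda>k. complex_of_real (t k)) (\<lambda>k. action_matrix (as ! k)))"
  then have ij: "i < length bs" "j < length bs" by (simp_all add: mat_lc_def)
  have "integral_profile A as M bs t $$ (i, j) = complex_of_real ((\<Prod>k<length as. t k) / 2) *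
      (\<Sum>k<length as. complex_of_real (t k) * action_matrix (as ! k) $$ (i, j))"
    by (rule integral_profile_eq) (use assms ij in auto)
  then show "integral_profile A as M bs t $$ (i, j) = (complex_of_real ((\<Prod>i<length as. t i) / 2) \<cdot>\<^sub>m
      mat_lc (length bs) (length as) (\<lambda>k. complex_of_real (t k)) (\<lambda>k. action_matrix (as ! k))) $$ (i, j)"
    using ij by (simp add: mat_lc_def)
qed (simp_all add: integral_profile_def Let_def matrix_of_def mat_lc_def)

lemma profile_similar_block_sum:
  assumes L: "\<And>v k. v \<in> set vs \<Longrightarrow> k < length as \<Longrightarrow> L v k \<in> carrier_mat (n v) (n v)"
    and dim: "sum_list (map n (multiset_list vs m)) = length bs"
  shows "similar_on {t. \<forall>i<length as. 0 \<le> t i} (integral_profile A as M bs)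
      (\<lambda>t. complex_of_real ((\<Prod>i<length as. t i) / 2) \<cdot>\<^sub>m
        block_sum vs m (\<lambda>v. matrix_combination (n v) (L v) (length as) t)) \<longleftrightarrow>
    conjugates (length bs) (length as) (\<lambda>k. action_matrix (as ! k)) (\<lambda>k. diag_block_mat (map (\<lambda>v. L v k) (multiset_list vs m)))"
proof (rule similar_on_iff_conjugates)
  have ws: "v \<in> set vs" if "v \<in> set (multiset_list vs m)" for v by (rule subsetD[OF set_multiset_list that])
  show "diag_block_mat (map (\<lambda>v. L v k) (multiset_list vs m)) \<in> carrier_mat (length bs) (length bs)" if "k < length as" for k
    unfolding dim[symmetric] by (rule diag_block_carrier) (intro L ws that)
qed (simp_all only: integral_profile_matrix block_sum_matrix_combination[OF L] dim action_matrix_carrier)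

end

theorem (in bifiltered_algebra) projective_iff_profile:
  fixes universe :: "(nat \<Rightarrow> complex) \<Rightarrow> 'u"
  assumes inj: "inj universe" and M: "based_module A as M bs" and vs: "distinct vs" "set vs = V0"
    and Pb: "\<And>v. v \<in> V0 \<Longrightarrow> based_space (complex_space A (projective_at A (e v))) (Pb v)"
  shows "projective_module TYPE('u) A M \<longleftrightarrow>
    (\<exists>m. (\<Sum>v\<in>V0. m v * length (Pb v)) = length bs \<and>
      similar_on {t. \<forall>i<length as. 0 \<le> t i} (integral_profile A as M bs)
        (\<lambda>t. complex_of_real ((\<Prod>i<length as. t i) / 2) \<cdot>\<^sub>m
          block_sum vs m (\<lambda>v. matrix_combination (length (Pb v))
            (\<lambda>k. matrix_of (complex_space A (projective_at A (e v))) (Pb v)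
              (representation (projective_at A (e v)) (as ! k))) (length as) t)))"
proof -
  interpret M: based_module A as M bs by (rule M)
  interpret M: decomposition_bases A as M bs V0 e F Pb
    by (intro decomposition_bases.intro decomposition.intro decomposition_bases_axioms.intro Pb M filtered_algebra_axioms)
  let ?n = "\<lambda>v. length (Pb v)"
  have L: "M.L v k \<in> carrier_mat (?n v) (?n v)" if "v \<in> set vs" for v k
    by (simp add: matrix_of_def)
  show ?thesis
    unfolding M.projective_iff_splits[OF inj] M.splits_iff_block_sum[OF vs] conjugates_def[symmetric]
      sum_list_multiset_list[OF vs(1)] vs(2)
  proof (intro ex_cong1 conj_cong refl)
    fix m assume "(\<Sum>v\<in>V0. m v * ?n v) = length bs"
    then have dim: "sum_list (map ?n (multiset_list vs m)) = length bs"
      using sum_list_multiset_list[OF vs(1)] vs(2) by simp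
    show "conjugates (length bs) (length as) (\<lambda>k. M.action_matrix (as ! k)) (\<lambda>k. diag_block_mat (map (\<lambda>v. M.L v k) (multiset_list vs m))) \<longleftrightarrow>
      similar_on {t. \<forall>i<length as. 0 \<le> t i} (integral_profile A as M bs)
        (\<lambda>t. complex_of_real ((\<Prod>i<length as. t i) / 2) \<cdot>\<^sub>m
          block_sum vs m (\<lambda>v. matrix_combination (?n v) (M.L v) (length as) t))"
      by (rule M.profile_similar_block_sum[where L = "\<lambda>v k. M.L v k" and n = ?n and vs = vs and m = m, symmetric])
        (rule L, assumption, rule dim)
  qed
qed

text \<open>Apply the decomposition to the dual of \<open>M\<close> over the opposite algebra and transpose the conjugating
matrix.\<close>

theorem (in bifiltered_algebra) injective_iff_profile:
  fixes universe :: "(nat \<Rightarrow> complex) \<Rightarrow> 'u"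
  assumes inj: "inj universe" and M: "based_module A as M bs" and vs: "distinct vs" "set vs = V0"
    and Ib: "\<And>v. v \<in> V0 \<Longrightarrow> based_space (right_space A (e v)) (Ib v)"
  shows "injective_module TYPE('u) A M \<longleftrightarrow>
    (\<exists>m. (\<Sum>v\<in>V0. m v * length (Ib v)) = length bs \<and>
      similar_on {t. \<forall>i<length as. 0 \<le> t i} (integral_profile A as M bs)
        (\<lambda>t. complex_of_real ((\<Prod>i<length as. t i) / 2) \<cdot>\<^sub>m
          block_sum vs m (\<lambda>v. matrix_combination (length (Ib v))
            (\<lambda>k. matrix_of (complex_space A (injective_at A (e v))) (dual_basis (right_space A (e v)) (Ib v))
              (representation (injective_at A (e v)) (as ! k))) (length as) t)))"
proof -
  interpret M: based_module A as M bs by (rule M)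
  interpret D: decomposition_bases "opposite A" as "dual_module A M" "dual_basis M.V bs" V0 e F Ib
    by (intro decomposition_bases.intro decomposition.intro decomposition_bases_axioms.intro
        injective_at_dual(1) Ib M.dual_based_module opposite_filtered)
  let ?n = "\<lambda>v. length (Ib v)"
  let ?R = "\<lambda>v k. matrix_of (complex_space A (injective_at A (e v))) (dual_basis (right_space A (e v)) (Ib v))
    (representation (injective_at A (e v)) (as ! k))"
  have Lc: "D.L v k \<in> carrier_mat (?n v) (?n v)" for v k
    by (simp add: matrix_of_def)
  have R: "?R v k = transpose_mat (D.L v k)" if "v \<in> V0" "k < length as" for v k
    by (rule injective_at_dual(3)[OF that(1) Ib[OF that(1)] that(2)])
  have Rc: "?R v k \<in> carrier_mat (?n v) (?n v)" if "v \<in> set vs" "k < length as" for v k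
    using R[of v k] Lc[of v k] that vs(2) by simp
  have lenD: "length (dual_basis M.V bs) = length bs" by (rule M.V.length_dual_basis)
  have sp: "splits (length as) (\<lambda>k l j. str l k j) (length bs) (\<lambda>k. transpose_mat (M.action_matrix (as ! k))) \<longleftrightarrow>
      splits (length as) D.alg.str (length (dual_basis M.V bs)) (\<lambda>k. D.action_matrix (as ! k))"
  proof -
    have "D.action_matrix (as ! k) = transpose_mat (M.action_matrix (as ! k))" if "k < length as" for k
      by (rule M.action_matrix_dual) (use that in simp)
    then show ?thesis unfolding splits_def lenD by (simp add: str_opposite cong: mat_lc_cong)
  qed
  have conj: "conjugates (length bs) (length as) (\<lambda>k. D.action_matrix (as ! k)) (\<lambda>k. diag_block_mat (map (\<lambda>v. D.L v k) (multiset_list vs m))) \<longleftrightarrow>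
      conjugates (length bs) (length as) (\<lambda>k. M.action_matrix (as ! k)) (\<lambda>k. diag_block_mat (map (\<lambda>v. ?R v k) (multiset_list vs m)))"
    if dim: "sum_list (map ?n (multiset_list vs m)) = length bs" for m
  proof -
    have ws: "v \<in> V0" if "v \<in> set (multiset_list vs m)" for v unfolding vs(2)[symmetric] by (rule subsetD[OF set_multiset_list that])
    have Bt: "D.action_matrix (as ! k) = transpose_mat (M.action_matrix (as ! k))" if "k < length as" for k
      by (rule M.action_matrix_dual) (use that in simp)
    have Dt: "diag_block_mat (map (\<lambda>v. ?R v k) (multiset_list vs m)) = transpose_mat (diag_block_mat (map (\<lambda>v. D.L v k) (multiset_list vs m)))"
      if "k < length as" for k
    proof -
      have "transpose_mat (diag_block_mat (map (\<lambda>v. D.L v k) (multiset_list vs m))) =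
          diag_block_mat (map (\<lambda>v. transpose_mat (D.L v k)) (multiset_list vs m))"
        by (rule transpose_diag_block) (rule Lc)
      also have "map (\<lambda>v. transpose_mat (D.L v k)) (multiset_list vs m) = map (\<lambda>v. ?R v k) (multiset_list vs m)"
        by (intro map_cong refl R[symmetric] ws that)
      finally show ?thesis ..
    qed
    have Dc: "diag_block_mat (map (\<lambda>v. D.L v k) (multiset_list vs m)) \<in> carrier_mat (length bs) (length bs)" for k
      unfolding dim[symmetric] by (rule diag_block_carrier) (rule Lc)
    have cong: "conjugates (length bs) (length as) X Y \<longleftrightarrow> conjugates (length bs) (length as) X' Y'"
      if "\<And>k. k < length as \<Longrightarrow> X k = X' k" "\<And>k. k < length as \<Longrightarrow> Y k = Y' k" for X X' Y Y'
      using that unfolding conjugates_def by simp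
    have "conjugates (length bs) (length as) (\<lambda>k. D.action_matrix (as ! k)) (\<lambda>k. diag_block_mat (map (\<lambda>v. D.L v k) (multiset_list vs m))) \<longleftrightarrow>
        conjugates (length bs) (length as) (\<lambda>k. transpose_mat (M.action_matrix (as ! k))) (\<lambda>k. diag_block_mat (map (\<lambda>v. D.L v k) (multiset_list vs m)))"
      by (rule cong[OF Bt refl])
    also have "\<dots> \<longleftrightarrow> conjugates (length bs) (length as) (\<lambda>k. M.action_matrix (as ! k)) (\<lambda>k. transpose_mat (diag_block_mat (map (\<lambda>v. D.L v k) (multiset_list vs m))))"
    proof
      assume "conjugates (length bs) (length as) (\<lambda>k. transpose_mat (M.action_matrix (as ! k))) (\<lambda>k. diag_block_mat (map (\<lambda>v. D.L v k) (multiset_list vs m)))"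
      then have "conjugates (length bs) (length as) (\<lambda>k. transpose_mat (transpose_mat (M.action_matrix (as ! k))))
          (\<lambda>k. transpose_mat (diag_block_mat (map (\<lambda>v. D.L v k) (multiset_list vs m))))"
        by (rule conjugates_transpose[rotated 2]) (simp_all add: Dc)
      then show "conjugates (length bs) (length as) (\<lambda>k. M.action_matrix (as ! k)) (\<lambda>k. transpose_mat (diag_block_mat (map (\<lambda>v. D.L v k) (multiset_list vs m))))"
        by (simp only: transpose_transpose)
    next
      assume "conjugates (length bs) (length as) (\<lambda>k. M.action_matrix (as ! k)) (\<lambda>k. transpose_mat (diag_block_mat (map (\<lambda>v. D.L v k) (multiset_list vs m))))"
      then have "conjugates (length bs) (length as) (\<lambda>k. transpose_mat (M.action_matrix (as ! k)))
          (\<lambda>k. transpose_mat (transpose_mat (diag_block_mat (map (\<lambda>v. D.L v k) (multiset_list vs m)))))"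
        by (rule conjugates_transpose[rotated 2]) (simp_all add: Dc)
      then show "conjugates (length bs) (length as) (\<lambda>k. transpose_mat (M.action_matrix (as ! k))) (\<lambda>k. diag_block_mat (map (\<lambda>v. D.L v k) (multiset_list vs m)))"
        by (simp only: transpose_transpose)
    qed
    also have "\<dots> \<longleftrightarrow> conjugates (length bs) (length as) (\<lambda>k. M.action_matrix (as ! k)) (\<lambda>k. diag_block_mat (map (\<lambda>v. ?R v k) (multiset_list vs m)))"
      by (rule cong[OF refl Dt[symmetric]])
    finally show ?thesis .
  qed
  show ?thesis
    unfolding M.injective_iff_splits[OF inj] sp[unfolded lenD] D.splits_iff_block_sum[OF vs, unfolded lenD] conjugates_def[symmetric]
      sum_list_multiset_list[OF vs(1)] vs(2)
  proof (intro ex_cong1 conj_cong refl)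
    fix m assume "(\<Sum>v\<in>V0. m v * ?n v) = length bs"
    then have dim: "sum_list (map ?n (multiset_list vs m)) = length bs"
      using sum_list_multiset_list[OF vs(1)] vs(2) by simp
    show "conjugates (length bs) (length as) (\<lambda>k. D.action_matrix (as ! k)) (\<lambda>k. diag_block_mat (map (\<lambda>v. D.L v k) (multiset_list vs m))) \<longleftrightarrow>
      similar_on {t. \<forall>i<length as. 0 \<le> t i} (integral_profile A as M bs)
        (\<lambda>t. complex_of_real ((\<Prod>i<length as. t i) / 2) \<cdot>\<^sub>m
          block_sum vs m (\<lambda>v. matrix_combination (?n v) (?R v) (length as) t))"
      unfolding conj[OF dim]
      by (rule M.profile_similar_block_sum[where L = ?R and n = ?n and vs = vs and m = m, symmetric])
        (rule Rc, assumption, assumption, rule dim)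
  qed
qed

section \<open>Bound quiver algebras\<close>

lemma lookup_scale_map [simp]: "Poly_Mapping.lookup (scale_map c x) k = c * Poly_Mapping.lookup x k"
  by (simp add: scale_map_def Poly_Mapping.map.rep_eq when_def)

lemma scale_map_simps [simp]:
  "scale_map c (Poly_Mapping.single k a) = Poly_Mapping.single k (c * a)"
  "scale_map c 0 = 0" "scale_map 0 x = 0" "scale_map 1 x = x"
  "scale_map c (scale_map b x) = scale_map (c * b) x"
  by (auto intro!: poly_mapping_eqI simp: lookup_single when_def)

lemma scale_map_add: "scale_map c (x + y) = scale_map c x + scale_map c y"
  and scale_map_add_left: "scale_map (b + c) x = scale_map b x + scale_map c x"
  and scale_map_sum: "scale_map c (\<Sum>i\<in>S. f i) = (\<Sum>i\<in>S. scale_map c (f i))"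
  by (auto intro!: poly_mapping_eqI simp: lookup_add lookup_sum algebra_simps sum_distrib_left)

lemma keys_scale_map: "Poly_Mapping.keys (scale_map c x) \<subseteq> Poly_Mapping.keys x"
  by (auto simp: in_keys_iff)

lemma poly_mapping_single_induct:
  assumes "Poly_Mapping.keys x \<subseteq> S" "P 0"
    and "\<And>p a. p \<in> S \<Longrightarrow> P (Poly_Mapping.single p a)"
    and "\<And>x y. P x \<Longrightarrow> P y \<Longrightarrow> P (x + y)"
  shows "P (x :: 'k \<Rightarrow>\<^sub>0 complex)"
proof -
  have "x = (\<Sum>p\<in>Poly_Mapping.keys x. Poly_Mapping.single p (Poly_Mapping.lookup x p))"
    by (intro poly_mapping_eqI) (auto simp: lookup_sum lookup_single when_def in_keys_iff)
  moreover have "P (\<Sum>p\<in>T. Poly_Mapping.single p (Poly_Mapping.lookup x p))" if "finite T" "T \<subseteq> S" for T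
    using that by (induction T) (auto intro: assms)
  ultimately show ?thesis using assms(1) by (metis finite_keys)
qed

definition path_end :: "('a, 'b) pre_digraph \<Rightarrow> 'a \<times> 'b list \<Rightarrow> 'a" where
  "path_end Q p = last (pre_digraph.awalk_verts Q (fst p) (snd p))"

text \<open>The multiplication of the path algebra on all finitely supported functions on pairs, so that its
algebraic laws need no carrier conditions.\<close>

definition path_product :: "('a, 'b) pre_digraph \<Rightarrow> (('a \<times> 'b list) \<Rightarrow>\<^sub>0 complex) \<Rightarrow>
    (('a \<times> 'b list) \<Rightarrow>\<^sub>0 complex) \<Rightarrow> (('a \<times> 'b list) \<Rightarrow>\<^sub>0 complex)" where
  "path_product Q x y = (\<Sum>p\<in>Poly_Mapping.keys x. \<Sum>q\<in>Poly_Mapping.keys y.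
     scale_map (Poly_Mapping.lookup x p * Poly_Mapping.lookup y q) (path_mult Q p q))"

lemma path_product_superset:
  assumes "finite S" "finite T" "Poly_Mapping.keys x \<subseteq> S" "Poly_Mapping.keys y \<subseteq> T"
  shows "path_product Q x y = (\<Sum>p\<in>S. \<Sum>q\<in>T.
     scale_map (Poly_Mapping.lookup x p * Poly_Mapping.lookup y q) (path_mult Q p q))"
proof -
  have "path_product Q x y = (\<Sum>p\<in>S. \<Sum>q\<in>Poly_Mapping.keys y.
     scale_map (Poly_Mapping.lookup x p * Poly_Mapping.lookup y q) (path_mult Q p q))"
    unfolding path_product_def using assms by (intro sum.mono_neutral_left) (auto simp: in_keys_iff)
  also have "\<dots> = (\<Sum>p\<in>S. \<Sum>q\<in>T.
     scale_map (Poly_Mapping.lookup x p * Poly_Mapping.lookup y q) (path_mult Q p q))"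
    using assms by (intro sum.cong sum.mono_neutral_left refl) (auto simp: in_keys_iff)
  finally show ?thesis .
qed

lemma path_product_add_left: "path_product Q (x + y) z = path_product Q x z + path_product Q y z"
proof -
  let ?S = "Poly_Mapping.keys x \<union> Poly_Mapping.keys y"
  have "Poly_Mapping.keys (x + y) \<subseteq> ?S" by (rule Poly_Mapping.keys_add)
  then show ?thesis
    by (subst (1 2 3) path_product_superset[of ?S "Poly_Mapping.keys z"])
      (auto simp: lookup_add distrib_right scale_map_add_left sum.distrib)
qed

lemma path_product_add_right: "path_product Q z (x + y) = path_product Q z x + path_product Q z y"
proof -
  let ?S = "Poly_Mapping.keys x \<union> Poly_Mapping.keys y"
  have "Poly_Mapping.keys (x + y) \<subseteq> ?S" by (rule Poly_Mapping.keys_add)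
  then show ?thesis
    by (subst (1 2 3) path_product_superset[of "Poly_Mapping.keys z" ?S])
      (auto simp: lookup_add distrib_left scale_map_add_left sum.distrib)
qed

lemma path_product_scale_left: "path_product Q (scale_map c x) y = scale_map c (path_product Q x y)"
  by (subst path_product_superset[of "Poly_Mapping.keys x" "Poly_Mapping.keys y"])
    (auto simp: keys_scale_map path_product_def scale_map_sum mult.assoc)

lemma path_product_scale_right: "path_product Q x (scale_map c y) = scale_map c (path_product Q x y)"
  by (subst path_product_superset[of "Poly_Mapping.keys x" "Poly_Mapping.keys y"])
    (auto simp: keys_scale_map path_product_def scale_map_sum mult_ac)

lemma path_product_zero [simp]: "path_product Q 0 y = 0" "path_product Q x 0 = 0"
  by (simp_all add: path_product_def)

lemma path_product_single: "path_product Q (Poly_Mapping.single p a) (Poly_Mapping.single q b) =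
    (if path_end Q p = fst q then Poly_Mapping.single (fst p, snd p @ snd q) (a * b) else 0)"
  by (subst path_product_superset[of "{p}" "{q}"]) (auto simp: path_mult_def path_end_def)

lemma last_awalk_verts_append:
  "last (pre_digraph.awalk_verts Q u (es @ fs)) =
    last (pre_digraph.awalk_verts Q (last (pre_digraph.awalk_verts Q u es)) fs)"
  by (induction es arbitrary: u) (auto simp: pre_digraph.awalk_verts.simps pre_digraph.awalk_verts_non_Nil)

lemma path_end_append: "path_end Q p = fst q \<Longrightarrow> path_end Q (fst p, snd p @ snd q) = path_end Q q"
  by (simp add: path_end_def last_awalk_verts_append)

lemma path_end_Nil [simp]: "path_end Q (v, []) = v"
  by (simp add: path_end_def pre_digraph.awalk_verts.simps)

lemma path_product_assoc: "path_product Q (path_product Q x y) z = path_product Q x (path_product Q y z)"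
proof (rule poly_mapping_single_induct[of x UNIV])
  fix p a
  show "path_product Q (path_product Q (Poly_Mapping.single p a) y) z = path_product Q (Poly_Mapping.single p a) (path_product Q y z)"
  proof (rule poly_mapping_single_induct[of y UNIV])
    fix q b
    show "path_product Q (path_product Q (Poly_Mapping.single p a) (Poly_Mapping.single q b)) z =
        path_product Q (Poly_Mapping.single p a) (path_product Q (Poly_Mapping.single q b) z)"
      by (rule poly_mapping_single_induct[of z UNIV])
        (auto simp: path_product_add_right path_product_single path_end_append mult.assoc)
  qed (auto simp: path_product_add_left path_product_add_right)
qed (auto simp: path_product_add_left)

lemma path_product_sum_left: "path_product Q (\<Sum>i\<in>S. f i) y = (\<Sum>i\<in>S. path_product Q (f i) y)"
  by (induction S rule: infinite_finite_induct) (auto simp: path_product_add_left)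

lemma path_product_sum_right: "path_product Q y (\<Sum>i\<in>S. f i) = (\<Sum>i\<in>S. path_product Q y (f i))"
  by (induction S rule: infinite_finite_induct) (auto simp: path_product_add_right)

lemma path_algebra_simps [simp]:
  "x \<in> carrier (path_algebra Q) \<longleftrightarrow> Poly_Mapping.keys x \<subseteq> quiver_paths Q"
  "x \<otimes>\<^bsub>path_algebra Q\<^esub> y = path_product Q x y"
  "\<one>\<^bsub>path_algebra Q\<^esub> = (\<Sum>v\<in>verts Q. Poly_Mapping.single (v, []) 1)"
  "\<zero>\<^bsub>path_algebra Q\<^esub> = 0"
  "x \<oplus>\<^bsub>path_algebra Q\<^esub> y = x + y"
  "c \<odot>\<^bsub>path_algebra Q\<^esub> x = scale_map c x"
  by (auto simp: path_algebra_def path_product_def)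

lemma cas_awlast: "pre_digraph.cas Q u es v \<Longrightarrow> last (pre_digraph.awalk_verts Q u es) = v"
  by (induction es arbitrary: u)
    (auto simp: pre_digraph.cas.simps pre_digraph.awalk_verts.simps pre_digraph.awalk_verts_non_Nil)

lemma cas_append: "pre_digraph.cas Q u es v \<Longrightarrow> pre_digraph.cas Q v fs w \<Longrightarrow> pre_digraph.cas Q u (es @ fs) w"
  by (induction es arbitrary: u) (auto simp: pre_digraph.cas.simps)

lemma quiver_paths_iff:
  "(u, es) \<in> quiver_paths Q \<longleftrightarrow> u \<in> verts Q \<and> set es \<subseteq> arcs Q \<and> pre_digraph.cas Q u es (path_end Q (u, es))"
  by (auto simp: quiver_paths_def pre_digraph.awalk_def path_end_def dest: cas_awlast)

lemma quiver_paths_append: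
  "p \<in> quiver_paths Q \<Longrightarrow> q \<in> quiver_paths Q \<Longrightarrow> path_end Q p = fst q \<Longrightarrow>
    (fst p, snd p @ snd q) \<in> quiver_paths Q"
  using path_end_append[of Q p q]
  by (cases p; cases q) (auto simp: quiver_paths_iff intro: cas_append)

lemma keys_path_product:
  assumes "k \<in> Poly_Mapping.keys (path_product Q x y)"
  obtains p q where "p \<in> Poly_Mapping.keys x" "q \<in> Poly_Mapping.keys y" "path_end Q p = fst q"
    "k = (fst p, snd p @ snd q)"
proof -
  have "Poly_Mapping.keys (scale_map c (path_mult Q p q)) \<subseteq>
      (if path_end Q p = fst q then {(fst p, snd p @ snd q)} else {})" for c p q
    by (auto simp: path_mult_def path_end_def)
  moreover have "k \<in> (\<Union>p\<in>Poly_Mapping.keys x. Poly_Mapping.keys (\<Sum>q\<in>Poly_Mapping.keys y.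
     scale_map (Poly_Mapping.lookup x p * Poly_Mapping.lookup y q) (path_mult Q p q)))"
    using assms keys_sum unfolding path_product_def by fast
  then have "k \<in> (\<Union>p\<in>Poly_Mapping.keys x. \<Union>q\<in>Poly_Mapping.keys y. Poly_Mapping.keys (
     scale_map (Poly_Mapping.lookup x p * Poly_Mapping.lookup y q) (path_mult Q p q)))"
    using keys_sum by fast
  ultimately show ?thesis using that by (fastforce split: if_splits)
qed

locale quiver_quotient = fin_digraph Q for Q :: "('a, 'b) pre_digraph" +
  fixes J assumes admissible: "admissible_ideal Q J"
begin

abbreviation "PA \<equiv> path_algebra Q"
abbreviation "A \<equiv> bound_quiver_algebra Q J"
abbreviation "cls x \<equiv> J +>\<^bsub>PA\<^esub> x"

lemma PA_closed: "x \<in> carrier PA \<Longrightarrow> y \<in> carrier PA \<Longrightarrow> path_product Q x y \<in> carrier PA"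
  unfolding path_algebra_simps(1)
proof
  fix k assume "Poly_Mapping.keys x \<subseteq> quiver_paths Q" "Poly_Mapping.keys y \<subseteq> quiver_paths Q"
    "k \<in> Poly_Mapping.keys (path_product Q x y)"
  then show "k \<in> quiver_paths Q"
    by (elim keys_path_product) (simp only: quiver_paths_append subsetD)
qed

lemma trivial_paths: "(\<Sum>v\<in>verts Q. Poly_Mapping.single (v, []) (1::complex)) \<in> carrier PA"
  by (auto dest!: keys_sum[THEN subsetD] simp: quiver_paths_iff pre_digraph.cas.simps)

lemma PA_unit:
  assumes "x \<in> carrier PA"
  shows "path_product Q (\<Sum>v\<in>verts Q. Poly_Mapping.single (v, []) 1) x = x"
    and "path_product Q x (\<Sum>v\<in>verts Q. Poly_Mapping.single (v, []) 1) = x"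
proof -
  have keys: "Poly_Mapping.keys x \<subseteq> quiver_paths Q" using assms by simp
  show "path_product Q (\<Sum>v\<in>verts Q. Poly_Mapping.single (v, []) 1) x = x"
  proof (rule poly_mapping_single_induct[OF keys])
    fix p :: "'a \<times> 'b list" and a assume p: "p \<in> quiver_paths Q"
    then have "fst p \<in> verts Q" by (cases p) (simp add: quiver_paths_iff)
    then show "path_product Q (\<Sum>v\<in>verts Q. Poly_Mapping.single (v, []) 1) (Poly_Mapping.single p a) = Poly_Mapping.single p a"
      by (simp add: path_product_sum_left path_product_single)
  qed (auto simp: path_product_add_right)
  show "path_product Q x (\<Sum>v\<in>verts Q. Poly_Mapping.single (v, []) 1) = x"
  proof (rule poly_mapping_single_induct[OF keys])
    fix p :: "'a \<times> 'b list" and a assume p: "p \<in> quiver_paths Q"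
    then have "path_end Q p \<in> verts Q"
    proof (cases p)
      case (Pair u es)
      then have "awalk u es (path_end Q p)" using p by (auto simp: quiver_paths_iff awalk_def)
      then show ?thesis by (rule awalk_last_in_verts)
    qed
    then show "path_product Q (Poly_Mapping.single p a) (\<Sum>v\<in>verts Q. Poly_Mapping.single (v, []) 1) = Poly_Mapping.single p a"
      by (simp add: path_product_sum_right path_product_single sum.delta)
  qed (auto simp: path_product_add_left)
qed

lemma PA_ring: "ring PA"
proof (rule ringI)
  show "abelian_group PA"
  proof (rule abelian_groupI)
    fix x assume "x \<in> carrier PA"
    then show "\<exists>y\<in>carrier PA. y \<oplus>\<^bsub>PA\<^esub> x = \<zero>\<^bsub>PA\<^esub>"
      by (intro bexI[of _ "- x"]) auto
  qed (auto dest!: Poly_Mapping.keys_add[THEN subsetD] simp: add_ac)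
  show "Group.monoid PA"
    using PA_closed trivial_paths PA_unit by (intro monoidI) (auto simp: path_product_assoc)
qed (auto simp: path_product_add_left path_product_add_right)

sublocale PA: ring PA by (rule PA_ring)

sublocale J: ideal J PA using admissible by (simp add: admissible_ideal_def)

lemma J_scale: "x \<in> J \<Longrightarrow> scale_map c x \<in> J"
proof -
  assume x: "x \<in> J"
  then have xc: "x \<in> carrier PA" using J.a_subset by blast
  have "scale_map c \<one>\<^bsub>PA\<^esub> \<in> carrier PA"
    using trivial_paths keys_scale_map by fastforce
  then have "scale_map c \<one>\<^bsub>PA\<^esub> \<otimes>\<^bsub>PA\<^esub> x \<in> J" using x by (intro J.I_l_closed)
  then show ?thesis using PA_unit(1)[OF xc] by (simp add: path_product_scale_left)
qed

lemma A_simps: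
  "carrier A = cls ` carrier PA" "\<zero>\<^bsub>A\<^esub> = cls 0" "\<one>\<^bsub>A\<^esub> = cls \<one>\<^bsub>PA\<^esub>"
  "x \<in> carrier PA \<Longrightarrow> y \<in> carrier PA \<Longrightarrow> cls x \<otimes>\<^bsub>A\<^esub> cls y = cls (path_product Q x y)"
  "x \<in> carrier PA \<Longrightarrow> y \<in> carrier PA \<Longrightarrow> cls x \<oplus>\<^bsub>A\<^esub> cls y = cls (x + y)"
  "x \<in> carrier PA \<Longrightarrow> c \<odot>\<^bsub>A\<^esub> cls x = cls (scale_map c x)"
proof -
  show "carrier A = cls ` carrier PA"
    by (auto simp: bound_quiver_algebra_def ring.defs FactRing_def A_RCOSETS_def')
  have "cls \<zero>\<^bsub>PA\<^esub> = J" by (rule PA.a_coset_add_zero[OF J.a_subset])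
  then show "\<zero>\<^bsub>A\<^esub> = cls 0" by (simp add: bound_quiver_algebra_def ring.defs FactRing_def)
  show "\<one>\<^bsub>A\<^esub> = cls \<one>\<^bsub>PA\<^esub>" by (simp add: bound_quiver_algebra_def ring.defs FactRing_def)
  show "cls x \<otimes>\<^bsub>A\<^esub> cls y = cls (path_product Q x y)" if "x \<in> carrier PA" "y \<in> carrier PA"
    using J.rcoset_mult_add[OF that] by (simp add: bound_quiver_algebra_def ring.defs FactRing_def)
  show "cls x \<oplus>\<^bsub>A\<^esub> cls y = cls (x + y)" if "x \<in> carrier PA" "y \<in> carrier PA"
    using J.a_rcos_sum[OF that] by (simp add: bound_quiver_algebra_def ring.defs FactRing_def)
  show "c \<odot>\<^bsub>A\<^esub> cls x = cls (scale_map c x)" if x: "x \<in> carrier PA"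
  proof -
    have "cls (scale_map c y) = cls (scale_map c x)" if y: "y \<in> cls x" for y
    proof -
      obtain j where j: "j \<in> J" "y = j + x" using y by (auto simp: a_r_coset_def' )
      have "scale_map c y \<in> cls (scale_map c x)"
        using J_scale[OF j(1), of c] j(2) by (auto simp: a_r_coset_def' scale_map_add)
      moreover have "scale_map c x \<in> carrier PA" using x keys_scale_map by fastforce
      ultimately show ?thesis using J.a_repr_independence' by metis
    qed
    moreover have "x \<in> cls x" using x by (rule J.a_rcos_self)
    ultimately have "(\<Union>y\<in>cls x. cls (scale_map c y)) = cls (scale_map c x)" by blast
    then show ?thesis by (simp add: bound_quiver_algebra_def ring.defs module.defs)
  qed
qed

lemma A_cases: "X \<in> carrier A \<Longrightarrow> (\<And>x. x \<in> carrier PA \<Longrightarrow> X = cls x \<Longrightarrow> P) \<Longrightarrow> P"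
  by (auto simp: A_simps(1))

lemma cls_closed: "x \<in> carrier PA \<Longrightarrow> cls x \<in> carrier A"
  by (simp add: A_simps(1))

lemma add_closed_PA: "x \<in> carrier PA \<Longrightarrow> y \<in> carrier PA \<Longrightarrow> x + y \<in> carrier PA"
  using PA.a_closed[of x y] by simp

lemma zero_closed_PA: "0 \<in> carrier PA"
  by simp

lemma scale_closed_PA: "x \<in> carrier PA \<Longrightarrow> scale_map c x \<in> carrier PA"
  using keys_scale_map by fastforce

lemma A_ring: "ring A"
proof (rule ringI)
  show "abelian_group A"
  proof (rule abelian_groupI)
    fix X assume "X \<in> carrier A"
    then obtain x where x: "x \<in> carrier PA" "X = cls x" by (rule A_cases)
    have "- x \<in> carrier PA" using x by simp
    from cls_closed[OF this] A_simps(5)[OF this x(1)] show "\<exists>Y\<in>carrier A. Y \<oplus>\<^bsub>A\<^esub> X = \<zero>\<^bsub>A\<^esub>"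
      by (intro bexI[of _ "cls (- x)"]) (simp_all add: A_simps(2) x(2))
  next
    fix X Y assume "X \<in> carrier A" "Y \<in> carrier A"
    then obtain x y where xy: "x \<in> carrier PA" "X = cls x" "y \<in> carrier PA" "Y = cls y" by (metis A_cases)
    show "X \<oplus>\<^bsub>A\<^esub> Y \<in> carrier A" "X \<oplus>\<^bsub>A\<^esub> Y = Y \<oplus>\<^bsub>A\<^esub> X"
      using xy(1,3) cls_closed[OF add_closed_PA[OF xy(1,3)]] by (simp_all only: xy(2,4) A_simps(5) add.commute)
    fix Z assume "Z \<in> carrier A"
    then obtain z where z: "z \<in> carrier PA" "Z = cls z" by (metis A_cases)
    show "X \<oplus>\<^bsub>A\<^esub> Y \<oplus>\<^bsub>A\<^esub> Z = X \<oplus>\<^bsub>A\<^esub> (Y \<oplus>\<^bsub>A\<^esub> Z)"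
      using xy(1,3) z(1) by (simp only: xy(2,4) z(2) A_simps(5) add_closed_PA add.assoc)
  next
    show "\<zero>\<^bsub>A\<^esub> \<in> carrier A" by (simp only: A_simps(2) cls_closed[OF zero_closed_PA])
    fix X assume "X \<in> carrier A"
    then obtain x where x: "x \<in> carrier PA" "X = cls x" by (rule A_cases)
    then show "\<zero>\<^bsub>A\<^esub> \<oplus>\<^bsub>A\<^esub> X = X"
      using A_simps(5)[OF zero_closed_PA x(1)] by (simp only: A_simps(2) x(2) add_0)
  qed
  show "Group.monoid A"
  proof (rule monoidI)
    fix X Y assume "X \<in> carrier A" "Y \<in> carrier A"
    then obtain x y where xy: "x \<in> carrier PA" "X = cls x" "y \<in> carrier PA" "Y = cls y" by (metis A_cases)
    show "X \<otimes>\<^bsub>A\<^esub> Y \<in> carrier A"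
      using xy(1,3) cls_closed[OF PA_closed[OF xy(1,3)]] by (simp only: xy(2,4) A_simps(4))
    fix Z assume "Z \<in> carrier A"
    then obtain z where z: "z \<in> carrier PA" "Z = cls z" by (metis A_cases)
    show "X \<otimes>\<^bsub>A\<^esub> Y \<otimes>\<^bsub>A\<^esub> Z = X \<otimes>\<^bsub>A\<^esub> (Y \<otimes>\<^bsub>A\<^esub> Z)"
      using xy(1,3) z(1) by (simp only: xy(2,4) z(2) A_simps(4) PA_closed path_product_assoc)
  next
    have one: "\<one>\<^bsub>PA\<^esub> \<in> carrier PA" by (rule PA.one_closed)
    then show "\<one>\<^bsub>A\<^esub> \<in> carrier A" by (simp only: A_simps(3) cls_closed)
    fix X assume "X \<in> carrier A"
    then obtain x where x: "x \<in> carrier PA" "X = cls x" by (rule A_cases)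
    show "\<one>\<^bsub>A\<^esub> \<otimes>\<^bsub>A\<^esub> X = X" "X \<otimes>\<^bsub>A\<^esub> \<one>\<^bsub>A\<^esub> = X"
      using A_simps(4)[OF one x(1)] A_simps(4)[OF x(1) one] PA_unit[OF x(1)]
      by (simp_all only: A_simps(3) x(2) path_algebra_simps(3))
  qed
next
  fix X Y Z assume "X \<in> carrier A" "Y \<in> carrier A" "Z \<in> carrier A"
  then obtain x y z where xyz: "x \<in> carrier PA" "X = cls x" "y \<in> carrier PA" "Y = cls y" "z \<in> carrier PA" "Z = cls z"
    by (metis A_cases)
  show "(X \<oplus>\<^bsub>A\<^esub> Y) \<otimes>\<^bsub>A\<^esub> Z = X \<otimes>\<^bsub>A\<^esub> Z \<oplus>\<^bsub>A\<^esub> Y \<otimes>\<^bsub>A\<^esub> Z"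
    "Z \<otimes>\<^bsub>A\<^esub> (X \<oplus>\<^bsub>A\<^esub> Y) = Z \<otimes>\<^bsub>A\<^esub> X \<oplus>\<^bsub>A\<^esub> Z \<otimes>\<^bsub>A\<^esub> Y"
    using xyz(1,3,5)
    by (simp_all only: xyz(2,4,6) A_simps(4,5) PA_closed add_closed_PA path_product_add_left path_product_add_right)
qed

lemma A_smult_assoc:
  assumes "X \<in> carrier A" "Y \<in> carrier A"
  shows "c \<odot>\<^bsub>A\<^esub> (X \<otimes>\<^bsub>A\<^esub> Y) = (c \<odot>\<^bsub>A\<^esub> X) \<otimes>\<^bsub>A\<^esub> Y"
    and "c \<odot>\<^bsub>A\<^esub> (X \<otimes>\<^bsub>A\<^esub> Y) = X \<otimes>\<^bsub>A\<^esub> (c \<odot>\<^bsub>A\<^esub> Y)"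
  using assms by (auto elim!: A_cases simp: A_simps PA_closed scale_closed_PA path_product_scale_left path_product_scale_right
      simp del: path_algebra_simps)

abbreviation "ev \<equiv> trivial_path Q J"

lemma triv_closed: "v \<in> verts Q \<Longrightarrow> Poly_Mapping.single (v, []) c \<in> carrier PA"
  by (auto simp: quiver_paths_iff pre_digraph.cas.simps)

lemma ev_closed: "v \<in> verts Q \<Longrightarrow> ev v \<in> carrier A"
  unfolding trivial_path_def by (intro cls_closed triv_closed)

lemma ev_idem: "v \<in> verts Q \<Longrightarrow> ev v \<otimes>\<^bsub>A\<^esub> ev v = ev v"
  unfolding trivial_path_def by (simp add: A_simps triv_closed path_product_single del: path_algebra_simps)

lemma one_eq_sum_ev: "\<one>\<^bsub>A\<^esub> = (\<Oplus>\<^bsub>A\<^esub>v\<in>verts Q. ev v)"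
proof -
  interpret A: ring A by (rule A_ring)
  have *: "S \<subseteq> verts Q \<Longrightarrow> (\<Sum>v\<in>S. Poly_Mapping.single (v, []) 1) \<in> carrier PA \<and>
      cls (\<Sum>v\<in>S. Poly_Mapping.single (v, []) 1) = (\<Oplus>\<^bsub>A\<^esub>v\<in>S. ev v)" if "finite S" for S
    using that
  proof (induction S)
    case empty
    show ?case
      by (simp only: sum.empty A.finsum_empty A_simps(2) zero_closed_PA simp_thms)
  next
    case (insert v S)
    have v: "v \<in> verts Q" and S: "S \<subseteq> verts Q" using insert.prems by blast+
    have IH: "(\<Sum>v\<in>S. Poly_Mapping.single (v, []) 1) \<in> carrier PA"
      "cls (\<Sum>v\<in>S. Poly_Mapping.single (v, []) 1) = (\<Oplus>\<^bsub>A\<^esub>v\<in>S. ev v)" using insert.IH[OF S] by blast+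
    have "(\<Oplus>\<^bsub>A\<^esub>v\<in>insert v S. ev v) = ev v \<oplus>\<^bsub>A\<^esub> (\<Oplus>\<^bsub>A\<^esub>v\<in>S. ev v)"
      using insert.hyps v S ev_closed by (intro A.finsum_insert) blast+
    also have "\<dots> = cls (Poly_Mapping.single (v, []) 1 + (\<Sum>v\<in>S. Poly_Mapping.single (v, []) 1))"
      unfolding IH(2)[symmetric] unfolding trivial_path_def
      by (rule A_simps(5)[OF triv_closed[OF v] IH(1)])
    finally show ?case
      using add_closed_PA[OF triv_closed[OF v, of 1] IH(1)] insert.hyps
      by (simp only: sum.insert simp_thms)
  qed
  show ?thesis using *[of "verts Q"] unfolding A_simps(3) path_algebra_simps(3) by (simp only: finite_verts subset_refl simp_thms)
qed

text \<open>The span of the paths of length at least \<open>k\<close>, whose image \<open>rad k\<close> in the quotient is the \<open>k\<close>-th power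
of the radical; working with path lengths makes closure under products immediate.\<close>

definition long_paths :: "nat \<Rightarrow> (('a \<times> 'b list) \<Rightarrow>\<^sub>0 complex) set" where
  "long_paths k = {x \<in> carrier PA. \<forall>p\<in>Poly_Mapping.keys x. k \<le> length (snd p)}"

definition rad :: "nat \<Rightarrow> (('a \<times> 'b list) \<Rightarrow>\<^sub>0 complex) set set" where
  "rad k = cls ` long_paths k"

lemma long_paths_closed: "x \<in> long_paths k \<Longrightarrow> x \<in> carrier PA"
  by (simp add: long_paths_def)

lemma long_paths_zero: "0 \<in> long_paths k"
  by (simp add: long_paths_def)

lemma long_paths_add: "x \<in> long_paths k \<Longrightarrow> y \<in> long_paths k \<Longrightarrow> x + y \<in> long_paths k"
  by (auto simp: long_paths_def dest!: Poly_Mapping.keys_add[THEN subsetD])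

lemma long_paths_scale: "x \<in> long_paths k \<Longrightarrow> scale_map c x \<in> long_paths k"
  using keys_scale_map[of c x] by (auto simp: long_paths_def)

lemma long_paths_mult: "x \<in> long_paths k \<Longrightarrow> y \<in> long_paths l \<Longrightarrow> path_product Q x y \<in> long_paths (k + l)"
  using PA_closed[of x y] unfolding long_paths_def mem_Collect_eq
proof (intro conjI ballI)
  assume x: "x \<in> carrier PA \<and> (\<forall>p\<in>Poly_Mapping.keys x. k \<le> length (snd p))"
    and y: "y \<in> carrier PA \<and> (\<forall>p\<in>Poly_Mapping.keys y. l \<le> length (snd p))"
  fix p assume "p \<in> Poly_Mapping.keys (path_product Q x y)"
  then obtain q r where "q \<in> Poly_Mapping.keys x" "r \<in> Poly_Mapping.keys y" "p = (fst q, snd q @ snd r)"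
    by (rule keys_path_product)
  with x y show "k + l \<le> length (snd p)" by (simp add: add_mono)
qed blast

lemma rad_facts:
  "rad 0 = carrier A" "rad k \<subseteq> carrier A" "\<zero>\<^bsub>A\<^esub> \<in> rad k"
  "X \<in> rad k \<Longrightarrow> Y \<in> rad k \<Longrightarrow> X \<oplus>\<^bsub>A\<^esub> Y \<in> rad k"
  "X \<in> rad k \<Longrightarrow> c \<odot>\<^bsub>A\<^esub> X \<in> rad k"
  "X \<in> rad k \<Longrightarrow> Y \<in> rad l \<Longrightarrow> X \<otimes>\<^bsub>A\<^esub> Y \<in> rad (k + l)"
proof -
  have "long_paths 0 = carrier PA" "long_paths k \<subseteq> carrier PA" by (auto simp: long_paths_def)
  then show "rad 0 = carrier A" "rad k \<subseteq> carrier A" unfolding rad_def A_simps(1) by blast+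
  show "\<zero>\<^bsub>A\<^esub> \<in> rad k" unfolding rad_def A_simps(2) by (intro imageI long_paths_zero)
  show "X \<oplus>\<^bsub>A\<^esub> Y \<in> rad k" if XY: "X \<in> rad k" "Y \<in> rad k"
  proof -
    obtain x y where "x \<in> long_paths k" "X = cls x" "y \<in> long_paths k" "Y = cls y"
      using XY unfolding rad_def by blast
    then show ?thesis using long_paths_add[of x k y] unfolding rad_def
      by (simp only: A_simps(5)[OF long_paths_closed long_paths_closed] imageI)
  qed
  show "c \<odot>\<^bsub>A\<^esub> X \<in> rad k" if XY: "X \<in> rad k"
  proof -
    obtain x where "x \<in> long_paths k" "X = cls x" using XY unfolding rad_def by blast
    then show ?thesis using long_paths_scale[of x k c] unfolding rad_def
      by (simp only: A_simps(6)[OF long_paths_closed] imageI)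
  qed
  show "X \<otimes>\<^bsub>A\<^esub> Y \<in> rad (k + l)" if XY: "X \<in> rad k" "Y \<in> rad l"
  proof -
    obtain x y where "x \<in> long_paths k" "X = cls x" "y \<in> long_paths l" "Y = cls y"
      using XY unfolding rad_def by blast
    then show ?thesis using long_paths_mult[of x k y l] unfolding rad_def
      by (simp only: A_simps(4)[OF long_paths_closed long_paths_closed] imageI)
  qed
qed

lemma arrows_in_PA: "(\<lambda>e. Poly_Mapping.single (tail Q e, [e]) 1) ` arcs Q \<subseteq> carrier PA"
  by (auto simp: quiver_paths_iff pre_digraph.cas.simps path_end_def pre_digraph.awalk_verts.simps)

text \<open>Split the first arrow off a path.\<close>

lemma long_paths_in_power: "long_paths k \<subseteq> ideal_power PA (arrow_ideal Q) k"
proof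
  fix x assume "x \<in> long_paths k"
  then show "x \<in> ideal_power PA (arrow_ideal Q) k"
  proof (induction k arbitrary: x)
    case 0
    then show ?case by (simp add: ideal_power_def long_paths_def)
  next
    case (Suc k)
    have step: "ideal_power PA (arrow_ideal Q) (Suc k) = ideal_prod PA (arrow_ideal Q) (ideal_power PA (arrow_ideal Q) k)"
      by (simp add: ideal_power_def)
    have id: "ideal (arrow_ideal Q) PA" unfolding arrow_ideal_def by (rule PA.genideal_ideal[OF arrows_in_PA])
    then have z: "0 \<in> arrow_ideal Q"
      using additive_subgroup.zero_closed[OF ideal.axioms(1)] by fastforce
    have sub: "Poly_Mapping.keys x \<subseteq> {p \<in> quiver_paths Q. Suc k \<le> length (snd p)}"
      using Suc.prems by (auto simp: long_paths_def)
    show ?case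
    proof (rule poly_mapping_single_induct[OF sub])
      have "0 \<otimes>\<^bsub>PA\<^esub> 0 \<in> ideal_power PA (arrow_ideal Q) (Suc k)"
        unfolding step using z Suc.IH[OF long_paths_zero] by (rule ideal_prod.prod)
      then show "0 \<in> ideal_power PA (arrow_ideal Q) (Suc k)" by simp
    next
      fix x y assume "x \<in> ideal_power PA (arrow_ideal Q) (Suc k)" "y \<in> ideal_power PA (arrow_ideal Q) (Suc k)"
      then show "x + y \<in> ideal_power PA (arrow_ideal Q) (Suc k)"
        unfolding step using ideal_prod.sum[of x PA] by simp
    next
      fix p :: "'a \<times> 'b list" and a assume p: "p \<in> {p \<in> quiver_paths Q. Suc k \<le> length (snd p)}"
      then obtain u e es where pe: "p = (u, e # es)" "k \<le> length es"
        by (cases p) (auto simp: Suc_le_length_iff)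
      have e: "e \<in> arcs Q" "tail Q e = u" and es: "(head Q e, es) \<in> quiver_paths Q"
        using p by (auto simp: pe quiver_paths_iff pre_digraph.cas.simps path_end_def pre_digraph.awalk_verts.simps
            pre_digraph.awalk_verts_non_Nil)
      have "Poly_Mapping.single (tail Q e, [e]) 1 \<in> arrow_ideal Q"
        unfolding arrow_ideal_def using PA.genideal_self[OF arrows_in_PA] e by blast
      moreover have "Poly_Mapping.single (head Q e, es) a \<in> ideal_power PA (arrow_ideal Q) k"
        using es pe by (intro Suc.IH) (auto simp: long_paths_def)
      ultimately have "Poly_Mapping.single (tail Q e, [e]) 1 \<otimes>\<^bsub>PA\<^esub> Poly_Mapping.single (head Q e, es) a
          \<in> ideal_power PA (arrow_ideal Q) (Suc k)"
        unfolding step by (rule ideal_prod.prod)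
      then show "Poly_Mapping.single p a \<in> ideal_power PA (arrow_ideal Q) (Suc k)"
        using e by (simp add: path_product_single path_end_def pre_digraph.awalk_verts.simps pe)
    qed
  qed
qed

lemma rad_nilpotent: "\<exists>m. rad m = {\<zero>\<^bsub>A\<^esub>}"
proof -
  obtain m where "ideal_power PA (arrow_ideal Q) m \<subseteq> J" using admissible by (auto simp: admissible_ideal_def)
  then have sub: "long_paths m \<subseteq> J" using long_paths_in_power by blast
  have "cls x = \<zero>\<^bsub>A\<^esub>" if x: "x \<in> long_paths m" for x
  proof -
    have "cls x = J" using x sub by (intro PA.a_coset_join2 long_paths_closed J.a_subgroup) blast+
    moreover have "cls 0 = J" using PA.a_coset_add_zero[OF J.a_subset] by (simp only: path_algebra_simps(4))
    ultimately show ?thesis by (simp only: A_simps(2))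
  qed
  then have "rad m \<subseteq> {\<zero>\<^bsub>A\<^esub>}" unfolding rad_def by blast
  then show ?thesis using rad_facts(3)[of m] by blast
qed

text \<open>Among the paths that start or end at \<open>v\<close>, only the trivial one has length zero.\<close>

lemma split_ev:
  assumes v: "v \<in> verts Q" and X: "X \<in> carrier A"
  shows "\<exists>c. \<exists>Y\<in>rad 1. X \<otimes>\<^bsub>A\<^esub> ev v = c \<odot>\<^bsub>A\<^esub> ev v \<oplus>\<^bsub>A\<^esub> Y"
    and "\<exists>c. \<exists>Y\<in>rad 1. ev v \<otimes>\<^bsub>A\<^esub> X = c \<odot>\<^bsub>A\<^esub> ev v \<oplus>\<^bsub>A\<^esub> Y"
proof -
  obtain x where x: "x \<in> carrier PA" "X = cls x" using X by (rule A_cases)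
  let ?e = "Poly_Mapping.single (v, []) (1::complex)"
  have keys: "Poly_Mapping.keys x \<subseteq> quiver_paths Q" using x by simp
  have "\<exists>c. \<exists>y\<in>long_paths 1. path_product Q x ?e = scale_map c ?e + y"
  proof (rule poly_mapping_single_induct[OF keys])
    show "\<exists>c. \<exists>y\<in>long_paths 1. path_product Q 0 ?e = scale_map c ?e + y"
      by (intro exI[of _ 0] bexI[of _ 0]) (auto simp: long_paths_zero)
  next
    fix p :: "'a \<times> 'b list" and a assume p: "p \<in> quiver_paths Q"
    show "\<exists>c. \<exists>y\<in>long_paths 1. path_product Q (Poly_Mapping.single p a) ?e = scale_map c ?e + y"
    proof (cases "snd p = [] \<and> fst p = v")
      case True
      then have "p = (v, [])" by (cases p) auto
      then show ?thesis by (intro exI[of _ a] bexI[of _ 0]) (auto simp: path_product_single long_paths_zero)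
    next
      case False
      moreover obtain u es where "p = (u, es)" by (cases p)
      ultimately show ?thesis using p PA_closed[of "Poly_Mapping.single p a" ?e] PA_closed[of ?e "Poly_Mapping.single p a"] triv_closed[OF v, of 1]
        by (intro exI[of _ 0] bexI[of _ "path_product Q (Poly_Mapping.single p a) ?e"])
          (auto simp: path_product_single long_paths_def Suc_le_eq)
    qed
  next
    fix x y assume "\<exists>c. \<exists>z\<in>long_paths 1. path_product Q x ?e = scale_map c ?e + z"
      "\<exists>c. \<exists>z\<in>long_paths 1. path_product Q y ?e = scale_map c ?e + z"
    then obtain c d z w where "z \<in> long_paths 1" "w \<in> long_paths 1"
      "path_product Q x ?e = scale_map c ?e + z" "path_product Q y ?e = scale_map d ?e + w" by blast
    then show "\<exists>c. \<exists>z\<in>long_paths 1. path_product Q (x + y) ?e = scale_map c ?e + z"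
      by (intro exI[of _ "c + d"] bexI[of _ "z + w"])
        (auto simp: path_product_add_left long_paths_add scale_map_add_left single_add algebra_simps)
  qed
  then obtain c y where "y \<in> long_paths 1" "path_product Q x ?e = scale_map c ?e + y" by blast
  then show "\<exists>c. \<exists>Y\<in>rad 1. X \<otimes>\<^bsub>A\<^esub> ev v = c \<odot>\<^bsub>A\<^esub> ev v \<oplus>\<^bsub>A\<^esub> Y"
    using A_simps(4)[OF x(1) triv_closed[OF v, of 1]] A_simps(4)[OF triv_closed[OF v, of 1] x(1)]
      A_simps(5)[OF scale_closed_PA[OF triv_closed[OF v, of 1]] long_paths_closed] A_simps(6)[OF triv_closed[OF v, of 1]]
    by (intro exI[of _ c] bexI[of _ "cls y"]) (simp_all only: rad_def trivial_path_def x(2) imageI)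
  have "\<exists>c. \<exists>y\<in>long_paths 1. path_product Q ?e x = scale_map c ?e + y"
  proof (rule poly_mapping_single_induct[OF keys])
    show "\<exists>c. \<exists>y\<in>long_paths 1. path_product Q ?e 0 = scale_map c ?e + y"
      by (intro exI[of _ 0] bexI[of _ 0]) (auto simp: long_paths_zero)
  next
    fix p :: "'a \<times> 'b list" and a assume p: "p \<in> quiver_paths Q"
    show "\<exists>c. \<exists>y\<in>long_paths 1. path_product Q ?e (Poly_Mapping.single p a) = scale_map c ?e + y"
    proof (cases "snd p = [] \<and> fst p = v")
      case True
      then have "p = (v, [])" by (cases p) auto
      then show ?thesis by (intro exI[of _ a] bexI[of _ 0]) (auto simp: path_product_single long_paths_zero)
    next
      case False
      moreover obtain u es where "p = (u, es)" by (cases p)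
      ultimately show ?thesis using p PA_closed[of "Poly_Mapping.single p a" ?e] PA_closed[of ?e "Poly_Mapping.single p a"] triv_closed[OF v, of 1]
        by (intro exI[of _ 0] bexI[of _ "path_product Q ?e (Poly_Mapping.single p a)"])
          (auto simp: path_product_single long_paths_def Suc_le_eq)
    qed
  next
    fix x y assume "\<exists>c. \<exists>z\<in>long_paths 1. path_product Q ?e x = scale_map c ?e + z"
      "\<exists>c. \<exists>z\<in>long_paths 1. path_product Q ?e y = scale_map c ?e + z"
    then obtain c d z w where "z \<in> long_paths 1" "w \<in> long_paths 1"
      "path_product Q ?e x = scale_map c ?e + z" "path_product Q ?e y = scale_map d ?e + w" by blast
    then show "\<exists>c. \<exists>z\<in>long_paths 1. path_product Q ?e (x + y) = scale_map c ?e + z"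
      by (intro exI[of _ "c + d"] bexI[of _ "z + w"])
        (auto simp: path_product_add_right long_paths_add scale_map_add_left single_add algebra_simps)
  qed
  then obtain c y where "y \<in> long_paths 1" "path_product Q ?e x = scale_map c ?e + y" by blast
  then show "\<exists>c. \<exists>Y\<in>rad 1. ev v \<otimes>\<^bsub>A\<^esub> X = c \<odot>\<^bsub>A\<^esub> ev v \<oplus>\<^bsub>A\<^esub> Y"
    using A_simps(4)[OF x(1) triv_closed[OF v, of 1]] A_simps(4)[OF triv_closed[OF v, of 1] x(1)]
      A_simps(5)[OF scale_closed_PA[OF triv_closed[OF v, of 1]] long_paths_closed] A_simps(6)[OF triv_closed[OF v, of 1]]
    by (intro exI[of _ c] bexI[of _ "cls y"]) (simp_all only: rad_def trivial_path_def x(2) imageI)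
qed

end

lemma (in quiver_quotient) bifiltered:
  assumes "ordered_basis A as"
  shows "bifiltered_algebra A as (verts Q) ev rad"
proof -
  have m1: "X \<in> rad k \<Longrightarrow> Y \<in> rad 1 \<Longrightarrow> X \<otimes>\<^bsub>A\<^esub> Y \<in> rad (Suc k)" for X Y k
    using rad_facts(6)[of X k Y 1] by (simp only: Suc_eq_plus1)
  have m2: "X \<in> rad 1 \<Longrightarrow> Y \<in> rad k \<Longrightarrow> X \<otimes>\<^bsub>A\<^esub> Y \<in> rad (Suc k)" for X Y k
    using rad_facts(6)[of X 1 Y k] by (simp only: Suc_eq_plus1 add.commute)
  show ?thesis
  proof (intro bifiltered_algebra.intro filtered_algebra.intro based_algebra.intro based_algebra_axioms.intro
      filtered_algebra_axioms.intro bifiltered_algebra_axioms.intro A_ring A_smult_assoc ev_closed ev_idem one_eq_sum_ev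
      rad_facts rad_nilpotent split_ev)
    show "based_space A as" using assms unfolding based_space_iff .
    show "finite (verts Q)" by (rule finite_verts)
  qed (assumption | rule m1 m2)+
qed

theorem theorem4:
  fixes Q :: "('a, 'b) pre_digraph"
    and J :: "(('a \<times> 'b list) \<Rightarrow>\<^sub>0 complex) set"
    and A :: "(complex, (('a \<times> 'b list) \<Rightarrow>\<^sub>0 complex) set) module"
    and e :: "'a \<Rightarrow> (('a \<times> 'b list) \<Rightarrow>\<^sub>0 complex) set"
    and as :: "(('a \<times> 'b list) \<Rightarrow>\<^sub>0 complex) set list"
    and M :: "((('a \<times> 'b list) \<Rightarrow>\<^sub>0 complex) set, 'm) module"
    and bs :: "'m list"
    and vs :: "'a list"
    and Pb Ib :: "'a \<Rightarrow> (('a \<times> 'b list) \<Rightarrow>\<^sub>0 complex) set list"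
    and L R :: "'a \<Rightarrow> nat \<Rightarrow> complex mat"
    and d :: nat
    and dimP dimI :: "'a \<Rightarrow> nat"
    and universe :: "(nat \<Rightarrow> complex) \<Rightarrow> 'u"
  assumes "inj universe"
    and "fin_digraph Q" and "admissible_ideal Q J"
    and "A = bound_quiver_algebra Q J"
    and "e = trivial_path Q J"
    and "ordered_basis A as" and "d = vectorspace.dim class_ring A"
    and "left_module A M" and "ordered_basis (complex_space A M) bs"
    and "distinct vs" and "set vs = verts Q"
    and "\<And>v. v \<in> verts Q \<Longrightarrow>
           ordered_basis (complex_space A (projective_at A (e v))) (Pb v)"
    and "\<And>v. v \<in> verts Q \<Longrightarrow> ordered_basis (right_space A (e v)) (Ib v)"
    and "dimP = (\<lambda>v. vectorspace.dim class_ring (complex_space A (projective_at A (e v))))"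
    and "dimI = (\<lambda>v. vectorspace.dim class_ring (complex_space A (injective_at A (e v))))"
    and "L = (\<lambda>v i. matrix_of (complex_space A (projective_at A (e v))) (Pb v)
                      (representation (projective_at A (e v)) (as ! i)))"
    and "R = (\<lambda>v i. matrix_of (complex_space A (injective_at A (e v)))
                      (dual_basis (right_space A (e v)) (Ib v))
                      (representation (injective_at A (e v)) (as ! i)))"
  shows "(projective_module TYPE('u) A M \<longleftrightarrow>
      (\<exists>m :: 'a \<Rightarrow> nat.
         (\<Sum>v\<in>verts Q. m v * dimP v) = vectorspace.dim class_ring (complex_space A M) \<and>
         similar_on {t :: nat \<Rightarrow> real. \<forall>i<d. 0 \<le> t i}
           (integral_profile A as M bs)
           (\<lambda>t. complex_of_real ((\<Prod>i<d. t i) / 2) \<cdot>\<^sub>m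
              block_sum vs m (\<lambda>v. matrix_combination (dimP v) (L v) d t))))
    \<and> (injective_module TYPE('u) A M \<longleftrightarrow>
      (\<exists>n :: 'a \<Rightarrow> nat.
         (\<Sum>v\<in>verts Q. n v * dimI v) = vectorspace.dim class_ring (complex_space A M) \<and>
         similar_on {t :: nat \<Rightarrow> real. \<forall>i<d. 0 \<le> t i}
           (integral_profile A as M bs)
           (\<lambda>t. complex_of_real ((\<Prod>i<d. t i) / 2) \<cdot>\<^sub>m
              block_sum vs n (\<lambda>v. matrix_combination (dimI v) (R v) d t))))"
proof -
  interpret Q: quiver_quotient Q J
    by (intro quiver_quotient.intro quiver_quotient_axioms.intro assms(2,3))
  interpret A: bifiltered_algebra A as "verts Q" e "Q.rad"
    unfolding assms(4,5) by (rule Q.bifiltered) (use assms(4,6) in simp)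
  have d: "d = length as" using based_space_dim[OF A.alg.based_space_axioms] assms(7) by simp
  have M: "based_module A as M bs"
    by (intro based_module.intro algebra_module.intro A.based_algebra_axioms assms(8) iffD1[OF based_space_iff assms(9)])
  have n: "vectorspace.dim class_ring (complex_space A M) = length bs"
    by (rule based_space_dim[OF iffD1[OF based_space_iff assms(9)]])
  have Pb: "based_space (complex_space A (projective_at A (e v))) (Pb v)" if "v \<in> verts Q" for v
    by (rule iffD1[OF based_space_iff assms(12)[OF that]])
  have Ib: "based_space (right_space A (e v)) (Ib v)" if "v \<in> verts Q" for v
    by (rule iffD1[OF based_space_iff assms(13)[OF that]])
  have dimP: "dimP v = length (Pb v)" if "v \<in> verts Q" for v
    unfolding assms(14) by (rule based_space_dim[OF Pb[OF that]])
  have dimI: "dimI v = length (Ib v)" if "v \<in> verts Q" for v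
    unfolding assms(15)
    using based_space_dim[OF A.injective_at_dual(2)[OF that Ib[OF that]]] by (simp add: dual_basis_def)
  have cong: "block_sum vs m (\<lambda>v. matrix_combination (f v) (B v) d t) = block_sum vs m (\<lambda>v. matrix_combination (g v) (B v) d t)"
    if "\<And>v. v \<in> verts Q \<Longrightarrow> f v = g v" for m f g t and B :: "'a \<Rightarrow> nat \<Rightarrow> complex mat"
    unfolding block_sum_def using that assms(11)
    by (intro arg_cong[of _ _ diag_block_mat] arg_cong[of _ _ concat] map_cong refl) simp
  have cP: "block_sum vs m (\<lambda>v. matrix_combination (dimP v) (L v) d t) =
      block_sum vs m (\<lambda>v. matrix_combination (length (Pb v)) (L v) d t)" for m t
    by (rule cong) (rule dimP)
  have cI: "block_sum vs m (\<lambda>v. matrix_combination (dimI v) (R v) d t) =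
      block_sum vs m (\<lambda>v. matrix_combination (length (Ib v)) (R v) d t)" for m t
    by (rule cong) (rule dimI)
  show ?thesis unfolding n
  proof (intro conjI)
    have s: "(\<Sum>v\<in>verts Q. m v * dimP v) = (\<Sum>v\<in>verts Q. m v * length (Pb v))" for m :: "'a \<Rightarrow> nat"
      by (intro sum.cong refl) (simp only: dimP)
    show "projective_module TYPE('u) A M \<longleftrightarrow> (\<exists>m :: 'a \<Rightarrow> nat. (\<Sum>v\<in>verts Q. m v * dimP v) = length bs \<and>
        similar_on {t :: nat \<Rightarrow> real. \<forall>i<d. 0 \<le> t i} (integral_profile A as M bs)
          (\<lambda>t. complex_of_real ((\<Prod>i<d. t i) / 2) \<cdot>\<^sub>m block_sum vs m (\<lambda>v. matrix_combination (dimP v) (L v) d t)))"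
      unfolding s cP unfolding assms(16) d
      by (rule A.projective_iff_profile[OF assms(1) M assms(10,11)]) (rule Pb)
    have s: "(\<Sum>v\<in>verts Q. m v * dimI v) = (\<Sum>v\<in>verts Q. m v * length (Ib v))" for m :: "'a \<Rightarrow> nat"
      by (intro sum.cong refl) (simp only: dimI)
    show "injective_module TYPE('u) A M \<longleftrightarrow> (\<exists>m :: 'a \<Rightarrow> nat. (\<Sum>v\<in>verts Q. m v * dimI v) = length bs \<and>
        similar_on {t :: nat \<Rightarrow> real. \<forall>i<d. 0 \<le> t i} (integral_profile A as M bs)
          (\<lambda>t. complex_of_real ((\<Prod>i<d. t i) / 2) \<cdot>\<^sub>m block_sum vs m (\<lambda>v. matrix_combination (dimI v) (R v) d t)))"
      unfolding s cI unfolding assms(17) d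
      by (rule A.injective_iff_profile[OF assms(1) M assms(10,11)]) (rule Ib)
  qed
qed

end
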